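(* Let $\mathcal{U}$ be a good collection of open subsets of $[0,\infty)^m$ and let $(\mathcal{F}(U,\mathbb{R}))_{U\in\mathcal{U}}$ be a family of locally convex spaces suitable for global analysis. Let $M$ be an $m$-dimensional compact smooth manifold with corners, and let $N_1$ and $N_2$ be finite-dimensional smooth manifolds which admit local additions. If $f:N_1\to N_2$ is a smooth map, then the map $$\mathcal{F}(M,f):\mathcal{F}(M,N_1)\to\mathcal{F}(M,N_2),\quad \gamma\mapsto f\circ\gamma$$ is smooth.
   Context: **Conventions.** Smoothness ($C^\infty$) of maps between open subsets of locally convex spaces is in the sense of Bastiani (Keller's $C^\infty_c$-calculus), and smooth manifolds may be modeled on locally convex spaces; maps on open subsets of $[0,\infty)^m$ are smooth in the usual sense for domains with corners. "Relatively compact in $U$" means having compact closure contained in $U$. A locally convex space is integral complete if every continuous path from $[0,1]$ to it has a weak integral in it. Fix $m\in\mathbb{N}$. **Good collection.** A set $\mathcal{U}$ of open subsets of $[0,\infty)^m$ is a good collection of open subsets if: (a) $\mathcal{U}$ is a basis for the topology of $[0,\infty)^m$; (b) if $U\in\mathcal{U}$ and $K\subseteq U$ is compact and non-empty, there is $V\in\mathcal{U}$ with compact closure $\overline V$ in $[0,\infty)^m$ such that $K\subseteq V$ and $\overline V\subseteq U$; (c) if $U\subseteq[0,\infty)^m$ is open and $W\in\mathcal{U}$ is relatively compact in $U$, there is $V\in\mathcal{U}$ relatively compact in $U$ with $\overline W\subseteq V$; (d) if $\phi:U\to V$ is a $C^\infty$-diffeomorphism between open subsets of $[0,\infty)^m$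 and $W\in\mathcal{U}$ is relatively compact in $U$, then $\phi(W)\in\mathcal{U}$. **Suitable family.** For each $U\in\mathcal{U}$ let $\mathcal{F}(U,\mathbb{R})$ be a vector subspace of the space $BC(U,\mathbb{R})$ of bounded continuous functions (with supremum norm), endowed with an integral complete locally convex topology making the inclusion $\mathcal{F}(U,\mathbb{R})\to BC(U,\mathbb{R})$ continuous. For a finite-dimensional real vector space $E$ with basis $b_1,\dots,b_n$ put $\mathcal{F}(U,E)=\sum_i\mathcal{F}(U,\mathbb{R})b_i$ with the topology making $\mathcal{F}(U,\mathbb{R})^n\to\mathcal{F}(U,E)$, $(f_i)_i\mapsto\sum_i f_ib_i$ an isomorphism of topological vector spaces. The family is suitable for global analysis if for all finite-dimensional real vector spaces $E,F$: (PF) for all $U,V\in\mathcal{U}$ with $V$ relatively compact in $U$ and each smooth $f:U\times E\to F$, one has $f_*(\gamma):=f\circ(\mathrm{id}_V,\gamma|_V)\in\mathcal{F}(V,F)$ for all $\gamma\in\mathcal{F}(U,E)$, and $f_*:\mathcal{F}(U,E)\to\mathcal{F}(V,F)$ is continuous; (PB) if $U\subseteq[0,\infty)^m$ is open, $V,W\in\mathcal{U}$, $W$ is relatively compact in $U$ and $\Theta:U\to V$ is a smooth diffeomorphism, then $\gamma\circ\Theta|_W\in\mathcal{F}(W,E)$ for all $\gamma\in\mathcal{F}(V,E)$ and $\mathcal{F}(V,E)\to\mathcal{F}(W,E)$, $\gamma\mapsto\gamma\circ\Theta|_W$ is continuous; (GL) if $U,V\in\mathcal{U}$, $V\subseteq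 U$ and $\gamma\in\mathcal{F}(V,E)$ has compact support, then its extension by $0$ to $\tilde\gamma:U\to E$ lies in $\mathcal{F}(U,E)$, and for each compact $K\subseteq V$ the map $\mathcal{F}_K(V,E)\to\mathcal{F}(U,E)$, $\gamma\mapsto\tilde\gamma$ is continuous, where $\mathcal{F}_K(V,E)=\{\gamma\in\mathcal{F}(V,E):\mathrm{supp}(\gamma)\subseteq K\}$ has the induced topology; (MU) if $U\in\mathcal{U}$ and $h\in C_c^\infty(U,\mathbb{R})$, then $h\gamma\in\mathcal{F}(U,E)$ for all $\gamma\in\mathcal{F}(U,E)$ and $\gamma\mapsto h\gamma$ is a continuous self-map of $\mathcal{F}(U,E)$. **Manifolds and mapping spaces.** An $m$-dimensional smooth manifold with corners is a paracompact Hausdorff space with a maximal atlas of smoothly compatible charts onto open subsets of $[0,\infty)^m$; "smooth manifold" means without boundary. For $M$ an $m$-dimensional compact smooth manifold with corners and $N$ an $n$-dimensional smooth manifold, $\mathcal{F}(M,N)$ is the set of all functions $\gamma:M\to N$ such that for each $p\in M$ there are charts $\phi_M:U_M\to V_M$ of $M$ with $p\in U_M$, $V_M\in\mathcal{U}$, and $\phi_N:U_N\to V_N$ of $N$ with $\gamma(U_M)\subseteq U_N$ and $\phi_N\circ\gamma\circ\phi_M^{-1}\in\mathcal{F}(V_M,\mathbb{R}^n)$. Let $\pi_N:TN\to N$ be the tangent bundle. For $\gamma\in\mathcal{F}(M,N)$ let $\Gamma_{\mathcal{F}}(\gamma)=\{\sigma\in\mathcal{F}(M,TN):\pi_N\circ\sigma=\gamma\}$,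 a vector space under pointwise operations, with the initial locally convex topology with respect to the maps $\Gamma_{\mathcal{F}}(\gamma)\to\mathcal{F}(W,\mathbb{R}^n)$, $\sigma\mapsto d\phi\circ\sigma\circ\varphi^{-1}|_W$, where $\varphi:U_\varphi\to V_\varphi$ is a chart of $M$, $W\in\mathcal{U}$ is relatively compact in $V_\varphi$, and $\phi:U_\phi\to V_\phi$ is a chart of $N$ with $\gamma(U_\varphi)\subseteq U_\phi$; here $d\phi:TU_\phi\to\mathbb{R}^n$ is the second component of $T\phi:TU_\phi\to V_\phi\times\mathbb{R}^n$. **Local addition and manifold structure.** A local addition on $N$ is a smooth map $\Sigma:\Omega\to N$ on an open neighborhood $\Omega\subseteq TN$ of the zero-section $\{0_p\in T_pN:p\in N\}$ with $\Sigma(0_p)=p$ for all $p\in N$, such that $\Omega':=(\pi_N,\Sigma)(\Omega)$ is open in $N\times N$ and $\theta_N:=(\pi_N,\Sigma):\Omega\to\Omega'$ is a $C^\infty$-diffeomorphism. Put $\mathcal{V}_\gamma=\{\sigma\in\Gamma_{\mathcal{F}}(\gamma):\sigma(M)\subseteq\Omega\}$ (open in $\Gamma_{\mathcal{F}}(\gamma)$) and $\mathcal{U}_\gamma=\{\xi\in\mathcal{F}(M,N):(\gamma,\xi)(M)\subseteq\Omega'\}$. The map $\Psi_\gamma:\mathcal{V}_\gamma\to\mathcal{U}_\gamma$, $\sigma\mapsto\Sigma\circ\sigma$ is a bijection with inverse $\xi\mapsto\theta_N^{-1}\circ(\gamma,\xi)$. $\mathcal{F}(M,N)$ carries the smooth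 manifold structure with atlas $\{\Psi_\gamma^{-1}:\mathcal{U}_\gamma\to\mathcal{V}_\gamma\mid\gamma\in\mathcal{F}(M,N)\}$ (it exists); each of $\mathcal{F}(M,N_1)$, $\mathcal{F}(M,N_2)$ is given this structure using a chosen local addition on the respective target. Compositions $f\circ\gamma$ with smooth $f:N_1\to N_2$ do lie in $\mathcal{F}(M,N_2)$ for $\gamma\in\mathcal{F}(M,N_1)$. *)

theory Defs
  imports "HOL-Analysis.Analysis" "HOL-Analysis.Finite_Function_Topology"
begin

section \<open>Locally convex spaces and Bastiani smoothness\<close>

text \<open>A real topological vector space on an explicit carrier, namely \<open>topspace (lcs_top E)\<close>.
  Carriers are needed because the model spaces of a manifold of mappings vary from chart to chart,
  and because finite-dimensional spaces of every dimension (including 0) occur inside one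
  statement.\<close>

record 'v lcs =
  lcs_top :: "'v topology"
  lcs_add :: "'v \<Rightarrow> 'v \<Rightarrow> 'v"
  lcs_zero :: 'v
  lcs_scale :: "real \<Rightarrow> 'v \<Rightarrow> 'v"

definition vector_space_lcs :: "'v lcs \<Rightarrow> bool" where
  "vector_space_lcs E \<longleftrightarrow> (let V = topspace (lcs_top E) in
     lcs_zero E \<in> V \<and>
     (\<forall>x\<in>V. \<forall>y\<in>V. lcs_add E x y \<in> V \<and> lcs_add E x y = lcs_add E y x) \<and>
     (\<forall>x\<in>V. \<forall>y\<in>V. \<forall>z\<in>V. lcs_add E (lcs_add E x y) z = lcs_add E x (lcs_add E y z)) \<and>
     (\<forall>x\<in>V. lcs_add E x (lcs_zero E) = x \<and> lcs_add E x (lcs_scale E (- 1) x) = lcs_zero E) \<and>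
     (\<forall>r. \<forall>x\<in>V. lcs_scale E r x \<in> V) \<and>
     (\<forall>r. \<forall>x\<in>V. \<forall>y\<in>V.
        lcs_scale E r (lcs_add E x y) = lcs_add E (lcs_scale E r x) (lcs_scale E r y)) \<and>
     (\<forall>r s. \<forall>x\<in>V. lcs_scale E (r + s) x = lcs_add E (lcs_scale E r x) (lcs_scale E s x)) \<and>
     (\<forall>r s. \<forall>x\<in>V. lcs_scale E (r * s) x = lcs_scale E r (lcs_scale E s x)) \<and>
     (\<forall>x\<in>V. lcs_scale E 1 x = x))"

definition locally_convex_space :: "'v lcs \<Rightarrow> bool" where
  "locally_convex_space E \<longleftrightarrow>
     vector_space_lcs E \<and>
     continuous_map (prod_topology (lcs_top E) (lcs_top E)) (lcs_top E) (\<lambda>(x, y). lcs_add E x y) \<and>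
     continuous_map (prod_topology euclideanreal (lcs_top E)) (lcs_top E) (\<lambda>(r, x). lcs_scale E r x) \<and>
     Hausdorff_space (lcs_top E) \<and>
     (\<forall>W. openin (lcs_top E) W \<and> lcs_zero E \<in> W \<longrightarrow>
        (\<exists>C. openin (lcs_top E) C \<and> lcs_zero E \<in> C \<and> C \<subseteq> W \<and>
             (\<forall>x\<in>C. \<forall>y\<in>C. \<forall>t\<in>{0..1}.
                lcs_add E (lcs_scale E (1 - t) x) (lcs_scale E t y) \<in> C)))"

definition continuous_functional :: "'v lcs \<Rightarrow> ('v \<Rightarrow> real) \<Rightarrow> bool" where
  "continuous_functional E l \<longleftrightarrow>
     continuous_map (lcs_top E) euclideanreal l \<and>
     (\<forall>x\<in>topspace (lcs_top E). \<forall>y\<in>topspace (lcs_top E). l (lcs_add E x y) = l x + l y) \<and>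
     (\<forall>r. \<forall>x\<in>topspace (lcs_top E). l (lcs_scale E r x) = r * l x)"

definition integral_complete :: "'v lcs \<Rightarrow> bool" where
  "integral_complete E \<longleftrightarrow>
     (\<forall>p. continuous_map (top_of_set {0..1::real}) (lcs_top E) p \<longrightarrow>
        (\<exists>w\<in>topspace (lcs_top E). \<forall>l. continuous_functional E l \<longrightarrow>
           ((\<lambda>t. l (p t)) has_integral l w) {0..1}))"

definition sub_lcs :: "'v::real_normed_vector set \<Rightarrow> 'v lcs" where
  "sub_lcs S = \<lparr>lcs_top = top_of_set S, lcs_add = (+), lcs_zero = 0, lcs_scale = (*\<^sub>R)\<rparr>"

definition prod_lcs :: "'v lcs \<Rightarrow> 'w lcs \<Rightarrow> ('v \<times> 'w) lcs" where
  "prod_lcs E F =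
     \<lparr>lcs_top = prod_topology (lcs_top E) (lcs_top F),
      lcs_add = (\<lambda>(x, y) (x', y'). (lcs_add E x x', lcs_add F y y')),
      lcs_zero = (lcs_zero E, lcs_zero F),
      lcs_scale = (\<lambda>r (x, y). (lcs_scale E r x, lcs_scale F r y))\<rparr>"

text \<open>\<open>l\<close> is the directional derivative \<open>df(x, y) = lim\<^sub>t\<^sub>\<rightarrow>\<^sub>0 (f(x + ty) - f(x)) / t\<close>.\<close>

definition has_dir_deriv ::
    "'v lcs \<Rightarrow> 'w lcs \<Rightarrow> ('v \<Rightarrow> 'w) \<Rightarrow> 'v \<Rightarrow> 'v \<Rightarrow> 'w \<Rightarrow> bool" where
  "has_dir_deriv E F f x y l \<longleftrightarrow>
     limitin (lcs_top F)
       (\<lambda>t. lcs_scale F (1 / t)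
              (lcs_add F (f (lcs_add E x (lcs_scale E t y))) (lcs_scale F (- 1) (f x))))
       l (at (0::real))"

text \<open>Bastiani smoothness on a set \<open>U\<close> with dense interior (in \<open>E\<close>): \<open>d j\<close> is the iterated
  directional derivative \<open>d\<^sup>(\<^sup>j\<^sup>)f(x, y\<^sub>0, \<dots>, y\<^sub>j\<^sub>-\<^sub>1) = (D\<^bsub>y(j-1)\<^esub> \<dots> D\<^bsub>y(0)\<^esub> f)(x)\<close> for \<open>x\<close> in the interior
  of \<open>U\<close>, and is required to be continuous on all of \<open>U \<times> E\<^sup>j\<close>. If \<open>U\<close> is open, this is Keller's
  \<open>C\<^sup>\<infinity>\<^sub>c\<close>; for relatively open subsets of \<open>[0,\<infinity>)\<^sup>m\<close> (possibly times a vector space) it is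
  smoothness on a domain with corners: the iterated derivatives on the interior extend
  continuously. Tuples in \<open>E\<^sup>j\<close> are extensional functions on \<open>{..<j}\<close>; the empty tuple is
  \<open>\<lambda>_. undefined\<close>.\<close>

definition smooth_between :: "'v lcs \<Rightarrow> 'w lcs \<Rightarrow> 'v set \<Rightarrow> ('v \<Rightarrow> 'w) \<Rightarrow> bool" where
  "smooth_between E F U f \<longleftrightarrow>
     (\<exists>d :: nat \<Rightarrow> 'v \<Rightarrow> (nat \<Rightarrow> 'v) \<Rightarrow> 'w.
        (\<forall>x\<in>U. d 0 x (\<lambda>_. undefined) = f x) \<and>
        (\<forall>j. continuous_map
               (prod_topology (subtopology (lcs_top E) U)
                              (product_topology (\<lambda>_. lcs_top E) {..<j}))
               (lcs_top F) (\<lambda>(x, y). d j x y)) \<and>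
        (\<forall>j. \<forall>x \<in> lcs_top E interior_of U. \<forall>y \<in> {..<Suc j} \<rightarrow>\<^sub>E topspace (lcs_top E).
           has_dir_deriv E F (\<lambda>z. d j z (restrict y {..<j})) x (y j) (d (Suc j) x y)))"

definition diffeo_between :: "'v lcs \<Rightarrow> 'w lcs \<Rightarrow> 'v set \<Rightarrow> 'w set \<Rightarrow> ('v \<Rightarrow> 'w) \<Rightarrow> bool" where
  "diffeo_between E F U V f \<longleftrightarrow>
     bij_betw f U V \<and> smooth_between E F U f \<and> smooth_between F E V (the_inv_into U f)"


section \<open>Euclidean spaces and corners\<close>

text \<open>All \<open>\<real>\<^sup>n\<close> are realised inside one normed space of finitely supported sequences; on the
  finite-dimensional subspaces its topology is the Euclidean one. Every finite-dimensional real
  vector space is isomorphic to a subspace of \<open>vec\<close>.\<close>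

type_synonym vec = "nat \<Rightarrow>\<^sub>0 real"

definition std_basis :: "nat \<Rightarrow> vec set" where
  "std_basis n = (\<lambda>i. Poly_Mapping.single i 1) ` {..<n}"

definition Rn :: "nat \<Rightarrow> vec set" where
  "Rn n = span (std_basis n)"

definition orthant :: "nat \<Rightarrow> vec set" where
  "orthant m = {x \<in> Rn m. \<forall>i. 0 \<le> Poly_Mapping.lookup x i}"

text \<open>The identification \<open>\<real>\<^sup>n \<times> \<real>\<^sup>n = \<real>\<^sup>2\<^sup>n\<close>.\<close>

definition vconcat :: "nat \<Rightarrow> vec \<Rightarrow> vec \<Rightarrow> vec" where
  "vconcat n x y = x + (\<Sum>i<n. Poly_Mapping.single (n + i) (Poly_Mapping.lookup y i))"

lemma Rn_iff: "x \<in> Rn n \<longleftrightarrow> Poly_Mapping.keys x \<subseteq> {..<n}"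
proof
  have scale: "Poly_Mapping.lookup (r *\<^sub>R x) i = r * Poly_Mapping.lookup x i" for r i and x :: vec
  proof -
    have "finite {i. r * Poly_Mapping.lookup x i \<noteq> 0}"
      by (rule finite_subset[OF _ finite_keys[of x]]) (auto simp: in_keys_iff)
    then show ?thesis
      by (simp add: scaleR_poly_mapping_def)
  qed
  assume "x \<in> Rn n"
  then show "Poly_Mapping.keys x \<subseteq> {..<n}"
    unfolding Rn_def std_basis_def
  proof (induction rule: span_induct_alt)
    case (step c v y)
    then show ?case
      by (auto simp: in_keys_iff lookup_add scale lookup_single when_def split: if_splits)
  qed simp
next
  have scale: "r *\<^sub>R Poly_Mapping.single i 1 = Poly_Mapping.single i r" for r i
    by (rule poly_mapping_eqI)
      (simp add: scaleR_poly_mapping_def lookup_single when_def)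
  assume keys: "Poly_Mapping.keys x \<subseteq> {..<n}"
  have "x = (\<Sum>i\<in>Poly_Mapping.keys x. Poly_Mapping.single i (Poly_Mapping.lookup x i))"
    by (rule poly_mapping_eqI) (auto simp: lookup_sum lookup_single when_def in_keys_iff)
  also have "\<dots> = (\<Sum>i\<in>Poly_Mapping.keys x. Poly_Mapping.lookup x i *\<^sub>R Poly_Mapping.single i 1)"
    by (simp add: scale)
  also have "\<dots> \<in> Rn n"
    unfolding Rn_def std_basis_def using keys
    by (intro span_sum span_scale span_base) auto
  finally show "x \<in> Rn n" .
qed

definition open_in_orthant :: "nat \<Rightarrow> vec set \<Rightarrow> bool" where
  "open_in_orthant m U \<longleftrightarrow> openin (top_of_set (orthant m)) U"

definition relatively_compact_in :: "nat \<Rightarrow> vec set \<Rightarrow> vec set \<Rightarrow> bool" where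
  "relatively_compact_in m V U \<longleftrightarrow>
     compact (top_of_set (orthant m) closure_of V) \<and> top_of_set (orthant m) closure_of V \<subseteq> U"

definition good_collection :: "nat \<Rightarrow> vec set set \<Rightarrow> bool" where
  "good_collection m \<U> \<longleftrightarrow>
     (\<forall>U\<in>\<U>. open_in_orthant m U) \<and>
     (\<forall>W. open_in_orthant m W \<longrightarrow> (\<exists>\<B>\<subseteq>\<U>. W = \<Union>\<B>)) \<and>
     (\<forall>U\<in>\<U>. \<forall>K. compact K \<and> K \<noteq> {} \<and> K \<subseteq> U \<longrightarrow>
        (\<exists>V\<in>\<U>. K \<subseteq> V \<and> relatively_compact_in m V U)) \<and>
     (\<forall>U. \<forall>W\<in>\<U>. open_in_orthant m U \<and> relatively_compact_in m W U \<longrightarrow>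
        (\<exists>V\<in>\<U>. relatively_compact_in m V U \<and> top_of_set (orthant m) closure_of W \<subseteq> V)) \<and>
     (\<forall>U V \<phi>. \<forall>W\<in>\<U>.
        open_in_orthant m U \<and> open_in_orthant m V \<and>
        diffeo_between (sub_lcs (Rn m)) (sub_lcs (Rn m)) U V \<phi> \<and>
        relatively_compact_in m W U \<longrightarrow> \<phi> ` W \<in> \<U>)"


section \<open>Families of function spaces suitable for global analysis\<close>

text \<open>A family is given by the topologies \<open>\<F> U\<close> of the spaces \<open>\<F>(U,\<real>)\<close>; the underlying set of
  functions is \<open>topspace (\<F> U)\<close>. Functions on \<open>U\<close> are extensional.\<close>

type_synonym fam = "vec set \<Rightarrow> (vec \<Rightarrow> real) topology"

definition fun_lcs :: "'x set \<Rightarrow> ('x \<Rightarrow> real) topology \<Rightarrow> ('x \<Rightarrow> real) lcs" where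
  "fun_lcs U T =
     \<lparr>lcs_top = T,
      lcs_add = (\<lambda>f g. restrict (\<lambda>x. f x + g x) U),
      lcs_zero = restrict (\<lambda>_. 0) U,
      lcs_scale = (\<lambda>r f. restrict (\<lambda>x. r * f x) U)\<rparr>"

definition function_spaces :: "vec set set \<Rightarrow> fam \<Rightarrow> bool" where
  "function_spaces \<U> \<F> \<longleftrightarrow>
     (\<forall>U\<in>\<U>. locally_convex_space (fun_lcs U (\<F> U)) \<and>
            integral_complete (fun_lcs U (\<F> U)) \<and>
            continuous_map (\<F> U) (mtopology_of (cfunspace (top_of_set U) euclidean_metric)) id)"

text \<open>The space \<open>\<F>(U, E)\<close> for \<open>E = span B\<close> with basis \<open>B\<close>: \<open>\<gamma>\<close> belongs to it iff its coordinate
  functions with respect to \<open>B\<close> lie in \<open>\<F>(U,\<real>)\<close>, and it carries the topology making the coordinate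
  map an isomorphism onto \<open>\<F>(U,\<real>)\<^sup>B\<close>.\<close>

definition coord_funs :: "vec set \<Rightarrow> vec set \<Rightarrow> (vec \<Rightarrow> vec) \<Rightarrow> vec \<Rightarrow> vec \<Rightarrow> real" where
  "coord_funs U B \<gamma> = (\<lambda>b\<in>B. \<lambda>x\<in>U. representation B (\<gamma> x) b)"

definition vfun_space :: "fam \<Rightarrow> vec set \<Rightarrow> vec set \<Rightarrow> (vec \<Rightarrow> vec) topology" where
  "vfun_space \<F> U B =
     pullback_topology (U \<rightarrow>\<^sub>E span B) (coord_funs U B) (product_topology (\<lambda>_. \<F> U) B)"

text \<open>The support is closed in the domain \<open>U\<close>.\<close>

definition supp_on :: "vec set \<Rightarrow> (vec \<Rightarrow> 'v::zero) \<Rightarrow> vec set" where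
  "supp_on U \<gamma> = top_of_set U closure_of {x\<in>U. \<gamma> x \<noteq> 0}"

definition extend_zero :: "vec set \<Rightarrow> vec set \<Rightarrow> (vec \<Rightarrow> vec) \<Rightarrow> vec \<Rightarrow> vec" where
  "extend_zero V U \<gamma> = (\<lambda>x\<in>U. if x \<in> V then \<gamma> x else 0)"

definition axiom_PF :: "nat \<Rightarrow> vec set set \<Rightarrow> fam \<Rightarrow> vec set \<Rightarrow> vec set \<Rightarrow> bool" where
  "axiom_PF m \<U> \<F> B C \<longleftrightarrow>
     (\<forall>U\<in>\<U>. \<forall>V\<in>\<U>. \<forall>f.
        relatively_compact_in m V U \<and>
        smooth_between (prod_lcs (sub_lcs (Rn m)) (sub_lcs (span B))) (sub_lcs (span C))
          (U \<times> span B) f \<longrightarrow>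
        continuous_map (vfun_space \<F> U B) (vfun_space \<F> V C) (\<lambda>\<gamma>. \<lambda>x\<in>V. f (x, \<gamma> x)))"

definition axiom_PB :: "nat \<Rightarrow> vec set set \<Rightarrow> fam \<Rightarrow> vec set \<Rightarrow> bool" where
  "axiom_PB m \<U> \<F> B \<longleftrightarrow>
     (\<forall>U. \<forall>V\<in>\<U>. \<forall>W\<in>\<U>. \<forall>\<Theta>.
        open_in_orthant m U \<and> relatively_compact_in m W U \<and>
        diffeo_between (sub_lcs (Rn m)) (sub_lcs (Rn m)) U V \<Theta> \<longrightarrow>
        continuous_map (vfun_space \<F> V B) (vfun_space \<F> W B) (\<lambda>\<gamma>. \<lambda>x\<in>W. \<gamma> (\<Theta> x)))"

definition axiom_GL :: "vec set set \<Rightarrow> fam \<Rightarrow> vec set \<Rightarrow> bool" where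
  "axiom_GL \<U> \<F> B \<longleftrightarrow>
     (\<forall>U\<in>\<U>. \<forall>V\<in>\<U>. V \<subseteq> U \<longrightarrow>
        (\<forall>\<gamma>\<in>topspace (vfun_space \<F> V B). compact (supp_on V \<gamma>) \<longrightarrow>
           extend_zero V U \<gamma> \<in> topspace (vfun_space \<F> U B)) \<and>
        (\<forall>K. compact K \<and> K \<subseteq> V \<longrightarrow>
           continuous_map (subtopology (vfun_space \<F> V B) {\<gamma>. supp_on V \<gamma> \<subseteq> K})
             (vfun_space \<F> U B) (extend_zero V U)))"

definition axiom_MU :: "nat \<Rightarrow> vec set set \<Rightarrow> fam \<Rightarrow> vec set \<Rightarrow> bool" where
  "axiom_MU m \<U> \<F> B \<longleftrightarrow>
     (\<forall>U\<in>\<U>. \<forall>h :: vec \<Rightarrow> real.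
        smooth_between (sub_lcs (Rn m)) (sub_lcs UNIV) U h \<and> compact (supp_on U h) \<longrightarrow>
        continuous_map (vfun_space \<F> U B) (vfun_space \<F> U B) (\<lambda>\<gamma>. \<lambda>x\<in>U. h x *\<^sub>R \<gamma> x))"

definition suitable_family :: "nat \<Rightarrow> vec set set \<Rightarrow> fam \<Rightarrow> bool" where
  "suitable_family m \<U> \<F> \<longleftrightarrow>
     function_spaces \<U> \<F> \<and>
     (\<forall>B C. finite B \<and> independent B \<and> finite C \<and> independent C \<longrightarrow>
        axiom_PF m \<U> \<F> B C \<and> axiom_PB m \<U> \<F> B \<and> axiom_GL \<U> \<F> B \<and> axiom_MU m \<U> \<F> B)"


section \<open>Manifolds\<close>

text \<open>Each chart carries its model space, so that the same record describes finite-dimensional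
  manifolds (all charts with the same model space) and manifolds of mappings.\<close>

record ('x, 'v) chart =
  cdom :: "'x set"
  cmap :: "'x \<Rightarrow> 'v"
  cmodel :: "'v lcs"

record ('x, 'v) manifold =
  mtop :: "'x topology"
  matlas :: "('x, 'v) chart set"

abbreviation mspace_of :: "('x, 'v) manifold \<Rightarrow> 'x set" where
  "mspace_of N \<equiv> topspace (mtop N)"

definition cimage :: "('x, 'v) chart \<Rightarrow> 'v set" where
  "cimage c = cmap c ` cdom c"

definition cinv :: "('x, 'v) chart \<Rightarrow> 'v \<Rightarrow> 'x" where
  "cinv c = the_inv_into (cdom c) (cmap c)"

text \<open>Charts onto relatively open subsets of \<open>X \<subseteq> E\<close>; \<open>X\<close> is \<open>E\<close> itself or \<open>[0,\<infinity>)\<^sup>m\<close>.\<close>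

definition is_chart :: "'v lcs \<Rightarrow> 'v set \<Rightarrow> 'x topology \<Rightarrow> ('x, 'v) chart \<Rightarrow> bool" where
  "is_chart E X T c \<longleftrightarrow>
     cmodel c = E \<and> openin T (cdom c) \<and> cmap c \<in> extensional (cdom c) \<and>
     openin (subtopology (lcs_top E) X) (cimage c) \<and>
     homeomorphic_map (subtopology T (cdom c)) (subtopology (lcs_top E) (cimage c)) (cmap c)"

definition smooth_transition :: "('x, 'v) chart \<Rightarrow> ('x, 'v) chart \<Rightarrow> bool" where
  "smooth_transition c d \<longleftrightarrow>
     smooth_between (cmodel c) (cmodel d) (cmap c ` (cdom c \<inter> cdom d)) (cmap d \<circ> cinv c)"

definition maximal_atlas ::
    "'v lcs \<Rightarrow> 'v set \<Rightarrow> 'x topology \<Rightarrow> ('x, 'v) chart set \<Rightarrow> ('x, 'v) chart set" where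
  "maximal_atlas E X T A =
     {c. is_chart E X T c \<and> (\<forall>d\<in>A. smooth_transition c d \<and> smooth_transition d c)}"

definition paracompact_space :: "'x topology \<Rightarrow> bool" where
  "paracompact_space T \<longleftrightarrow>
     (\<forall>\<C>. (\<forall>U\<in>\<C>. openin T U) \<and> \<Union>\<C> = topspace T \<longrightarrow>
        (\<exists>\<D>. (\<forall>V\<in>\<D>. openin T V \<and> (\<exists>U\<in>\<C>. V \<subseteq> U)) \<and> \<Union>\<D> = topspace T \<and> locally_finite_in T \<D>))"

text \<open>A fixed point of \<open>maximal_atlas\<close> is a set of pairwise compatible charts which contains every
  chart compatible with all its members.\<close>

definition modelled_manifold :: "'v lcs \<Rightarrow> 'v set \<Rightarrow> ('x, 'v) manifold \<Rightarrow> bool" where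
  "modelled_manifold E X N \<longleftrightarrow>
     Hausdorff_space (mtop N) \<and> paracompact_space (mtop N) \<and>
     (\<Union>c\<in>matlas N. cdom c) = mspace_of N \<and>
     matlas N = maximal_atlas E X (mtop N) (matlas N)"

definition corner_manifold :: "nat \<Rightarrow> ('x, vec) manifold \<Rightarrow> bool" where
  "corner_manifold m M \<longleftrightarrow> modelled_manifold (sub_lcs (Rn m)) (orthant m) M"

definition smooth_manifold :: "nat \<Rightarrow> ('x, vec) manifold \<Rightarrow> bool" where
  "smooth_manifold n N \<longleftrightarrow> modelled_manifold (sub_lcs (Rn n)) (Rn n) N"

text \<open>\<open>matlas\<close> may be any atlas defining the structure, not necessarily a maximal one.\<close>

definition smooth_map :: "('x, 'v) manifold \<Rightarrow> ('y, 'w) manifold \<Rightarrow> ('x \<Rightarrow> 'y) \<Rightarrow> bool" where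
  "smooth_map X Y f \<longleftrightarrow>
     continuous_map (mtop X) (mtop Y) f \<and>
     (\<forall>c\<in>matlas X. \<forall>d\<in>matlas Y.
        smooth_between (cmodel c) (cmodel d) (cmap c ` (cdom c \<inter> f -` cdom d))
          (cmap d \<circ> f \<circ> cinv c))"

definition diffeomorphism :: "('x, 'v) manifold \<Rightarrow> ('y, 'w) manifold \<Rightarrow> ('x \<Rightarrow> 'y) \<Rightarrow> bool" where
  "diffeomorphism X Y f \<longleftrightarrow>
     bij_betw f (mspace_of X) (mspace_of Y) \<and>
     smooth_map X Y f \<and> smooth_map Y X (the_inv_into (mspace_of X) f)"

text \<open>For open \<open>S\<close> and a maximal atlas of \<open>N\<close>.\<close>

definition open_submanifold :: "('x, 'v) manifold \<Rightarrow> 'x set \<Rightarrow> ('x, 'v) manifold" where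
  "open_submanifold N S = \<lparr>mtop = subtopology (mtop N) S, matlas = {c\<in>matlas N. cdom c \<subseteq> S}\<rparr>"

definition square_chart ::
    "nat \<Rightarrow> ('x, vec) chart \<Rightarrow> ('x, vec) chart \<Rightarrow> ('x \<times> 'x, vec) chart" where
  "square_chart n c d =
     \<lparr>cdom = cdom c \<times> cdom d,
      cmap = (\<lambda>(p, q) \<in> cdom c \<times> cdom d. vconcat n (cmap c p) (cmap d q)),
      cmodel = sub_lcs (Rn (2 * n))\<rparr>"

definition square_manifold :: "nat \<Rightarrow> ('x, vec) manifold \<Rightarrow> ('x \<times> 'x, vec) manifold" where
  "square_manifold n N =
     (let T = prod_topology (mtop N) (mtop N)
      in \<lparr>mtop = T,
          matlas = maximal_atlas (sub_lcs (Rn (2 * n))) (Rn (2 * n)) T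
                     {square_chart n c d | c d. c \<in> matlas N \<and> d \<in> matlas N}\<rparr>)"

text \<open>The topology on \<open>S\<close> for which the charts in \<open>A\<close> are homeomorphisms from open sets onto open
  subsets of their model spaces.\<close>

definition atlas_topology :: "'x set \<Rightarrow> ('x, 'v) chart set \<Rightarrow> 'x topology" where
  "atlas_topology S A =
     topology (\<lambda>W. W \<subseteq> S \<and> (\<forall>c\<in>A. openin (lcs_top (cmodel c)) (cmap c ` (W \<inter> cdom c))))"

lemma openin_atlas_topology:
  assumes "\<And>c. c \<in> A \<Longrightarrow> inj_on (cmap c) (cdom c)"
  shows "openin (atlas_topology S A) W \<longleftrightarrow>
           W \<subseteq> S \<and> (\<forall>c\<in>A. openin (lcs_top (cmodel c)) (cmap c ` (W \<inter> cdom c)))"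
proof -
  let ?P = "\<lambda>W. W \<subseteq> S \<and> (\<forall>c\<in>A. openin (lcs_top (cmodel c)) (cmap c ` (W \<inter> cdom c)))"
  have "istopology ?P"
    unfolding istopology_def
  proof (intro conjI allI impI ballI)
    fix W W' c assume W: "?P W" and W': "?P W'" and c: "c \<in> A"
    have "cmap c ` (W \<inter> W' \<inter> cdom c) = cmap c ` (W \<inter> cdom c) \<inter> cmap c ` (W' \<inter> cdom c)"
      using assms[OF c] by (auto simp: inj_on_def)
    then show "openin (lcs_top (cmodel c)) (cmap c ` (W \<inter> W' \<inter> cdom c))"
      using W W' c by auto
  next
    fix K c assume K: "\<forall>W\<in>K. ?P W" and c: "c \<in> A"
    have "cmap c ` (\<Union>K \<inter> cdom c) = (\<Union>W\<in>K. cmap c ` (W \<inter> cdom c))"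
      by auto
    then show "openin (lcs_top (cmodel c)) (cmap c ` (\<Union>K \<inter> cdom c))"
      using K c by auto
  qed auto
  then show ?thesis
    by (simp add: atlas_topology_def topology_inverse')
qed


section \<open>Tangent bundle and local additions\<close>

text \<open>A tangent vector at \<open>p\<close> is a family of vectors of \<open>\<real>\<^sup>n\<close>, one for each chart around \<open>p\<close>, related
  by the derivatives of the transition maps; the component at \<open>c\<close> of \<open>v\<close> is \<open>d(cmap c)(v)\<close>.\<close>

type_synonym 'x tvec = "'x \<times> (('x, vec) chart \<Rightarrow> vec)"

definition charts_at :: "('x, 'v) manifold \<Rightarrow> 'x \<Rightarrow> ('x, 'v) chart set" where
  "charts_at N p = {c\<in>matlas N. p \<in> cdom c}"

definition tangent_space :: "nat \<Rightarrow> ('x, vec) manifold \<Rightarrow> 'x \<Rightarrow> (('x, vec) chart \<Rightarrow> vec) set" where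
  "tangent_space n N p =
     {v \<in> charts_at N p \<rightarrow>\<^sub>E Rn n.
        \<forall>c\<in>charts_at N p. \<forall>d\<in>charts_at N p.
          has_dir_deriv (sub_lcs (Rn n)) (sub_lcs (Rn n)) (cmap d \<circ> cinv c) (cmap c p) (v c) (v d)}"

definition tangent_set :: "nat \<Rightarrow> ('x, vec) manifold \<Rightarrow> 'x tvec set" where
  "tangent_set n N = (SIGMA p : mspace_of N. tangent_space n N p)"

definition zero_vec :: "('x, vec) manifold \<Rightarrow> 'x \<Rightarrow> 'x tvec" where
  "zero_vec N p = (p, \<lambda>c\<in>charts_at N p. 0)"

definition tangent_chart ::
    "nat \<Rightarrow> ('x, vec) manifold \<Rightarrow> ('x, vec) chart \<Rightarrow> ('x tvec, vec) chart" where
  "tangent_chart n N c =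
     (let D = {(p, v) \<in> tangent_set n N. p \<in> cdom c}
      in \<lparr>cdom = D, cmap = (\<lambda>(p, v) \<in> D. vconcat n (cmap c p) (v c)),
          cmodel = sub_lcs (Rn (2 * n))\<rparr>)"

definition tangent_bundle :: "nat \<Rightarrow> ('x, vec) manifold \<Rightarrow> ('x tvec, vec) manifold" where
  "tangent_bundle n N =
     (let A = tangent_chart n N ` matlas N; T = atlas_topology (tangent_set n N) A
      in \<lparr>mtop = T, matlas = maximal_atlas (sub_lcs (Rn (2 * n))) (Rn (2 * n)) T A\<rparr>)"

definition local_addition ::
    "nat \<Rightarrow> ('x, vec) manifold \<Rightarrow> 'x tvec set \<Rightarrow> ('x tvec \<Rightarrow> 'x) \<Rightarrow> bool" where
  "local_addition n N \<Omega> \<Sigma> \<longleftrightarrow>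
     (let TN = tangent_bundle n N; \<theta> = (\<lambda>w. (fst w, \<Sigma> w))
      in openin (mtop TN) \<Omega> \<and>
         (\<forall>p\<in>mspace_of N. zero_vec N p \<in> \<Omega> \<and> \<Sigma> (zero_vec N p) = p) \<and>
         smooth_map (open_submanifold TN \<Omega>) N \<Sigma> \<and>
         openin (prod_topology (mtop N) (mtop N)) (\<theta> ` \<Omega>) \<and>
         diffeomorphism (open_submanifold TN \<Omega>)
           (open_submanifold (square_manifold n N) (\<theta> ` \<Omega>)) \<theta>)"


section \<open>Manifolds of mappings\<close>

definition mapping_set ::
    "vec set set \<Rightarrow> fam \<Rightarrow> ('x, vec) manifold \<Rightarrow> nat \<Rightarrow> ('y, vec) manifold \<Rightarrow> ('x \<Rightarrow> 'y) set" where
  "mapping_set \<U> \<F> M n N =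
     {\<gamma> \<in> mspace_of M \<rightarrow>\<^sub>E mspace_of N.
        \<forall>p\<in>mspace_of M. \<exists>c\<in>matlas M. \<exists>d\<in>matlas N.
          p \<in> cdom c \<and> cimage c \<in> \<U> \<and> \<gamma> ` cdom c \<subseteq> cdom d \<and>
          restrict (cmap d \<circ> \<gamma> \<circ> cinv c) (cimage c)
            \<in> topspace (vfun_space \<F> (cimage c) (std_basis n))}"

definition section_set ::
    "vec set set \<Rightarrow> fam \<Rightarrow> ('x, vec) manifold \<Rightarrow> nat \<Rightarrow> ('y, vec) manifold \<Rightarrow> ('x \<Rightarrow> 'y)
       \<Rightarrow> ('x \<Rightarrow> 'y tvec) set" where
  "section_set \<U> \<F> M n N \<gamma> =
     {\<sigma> \<in> mapping_set \<U> \<F> M (2 * n) (tangent_bundle n N). \<forall>x\<in>mspace_of M. fst (\<sigma> x) = \<gamma> x}"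

text \<open>The topology is initial with respect to the maps \<open>\<sigma> \<mapsto> d(cmap d) \<circ> \<sigma> \<circ> (cmap c)\<^sup>-\<^sup>1|\<^sub>W\<close>; inserting
  the whole set into the subbasis only fixes the underlying set.\<close>

definition section_topology ::
    "nat \<Rightarrow> vec set set \<Rightarrow> fam \<Rightarrow> ('x, vec) manifold \<Rightarrow> nat \<Rightarrow> ('y, vec) manifold \<Rightarrow> ('x \<Rightarrow> 'y)
       \<Rightarrow> ('x \<Rightarrow> 'y tvec) topology" where
  "section_topology m \<U> \<F> M n N \<gamma> =
     topology_generated_by
       (insert (section_set \<U> \<F> M n N \<gamma>)
          {{\<sigma> \<in> section_set \<U> \<F> M n N \<gamma>. (\<lambda>z\<in>W. snd (\<sigma> (cinv c z)) d) \<in> Q} | c d W Q.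
             c \<in> matlas M \<and> d \<in> matlas N \<and> W \<in> \<U> \<and> relatively_compact_in m W (cimage c) \<and>
             \<gamma> ` cdom c \<subseteq> cdom d \<and> openin (vfun_space \<F> W (std_basis n)) Q})"

definition section_lcs ::
    "nat \<Rightarrow> vec set set \<Rightarrow> fam \<Rightarrow> ('x, vec) manifold \<Rightarrow> nat \<Rightarrow> ('y, vec) manifold \<Rightarrow> ('x \<Rightarrow> 'y)
       \<Rightarrow> ('x \<Rightarrow> 'y tvec) lcs" where
  "section_lcs m \<U> \<F> M n N \<gamma> =
     \<lparr>lcs_top = section_topology m \<U> \<F> M n N \<gamma>,
      lcs_add = (\<lambda>\<sigma> \<tau>. \<lambda>x\<in>mspace_of M.
                   (\<gamma> x, \<lambda>c\<in>charts_at N (\<gamma> x). snd (\<sigma> x) c + snd (\<tau> x) c)),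
      lcs_zero = (\<lambda>x\<in>mspace_of M. zero_vec N (\<gamma> x)),
      lcs_scale = (\<lambda>r \<sigma>. \<lambda>x\<in>mspace_of M.
                   (\<gamma> x, \<lambda>c\<in>charts_at N (\<gamma> x). r *\<^sub>R snd (\<sigma> x) c))\<rparr>"

text \<open>The chart \<open>\<Psi>\<^sub>\<gamma>\<^sup>-\<^sup>1 : \<U>\<^sub>\<gamma> \<rightarrow> \<V>\<^sub>\<gamma>\<close>, where \<open>\<Psi>\<^sub>\<gamma>(\<sigma>) = \<Sigma> \<circ> \<sigma>\<close>.\<close>

definition mapping_chart ::
    "nat \<Rightarrow> vec set set \<Rightarrow> fam \<Rightarrow> ('x, vec) manifold \<Rightarrow> nat \<Rightarrow> ('y, vec) manifold
       \<Rightarrow> 'y tvec set \<Rightarrow> ('y tvec \<Rightarrow> 'y) \<Rightarrow> ('x \<Rightarrow> 'y) \<Rightarrow> ('x \<Rightarrow> 'y, 'x \<Rightarrow> 'y tvec) chart" where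
  "mapping_chart m \<U> \<F> M n N \<Omega> \<Sigma> \<gamma> =
     (let V = {\<sigma> \<in> section_set \<U> \<F> M n N \<gamma>. \<sigma> ` mspace_of M \<subseteq> \<Omega>};
          U = {\<xi> \<in> mapping_set \<U> \<F> M n N.
                 (\<lambda>x. (\<gamma> x, \<xi> x)) ` mspace_of M \<subseteq> (\<lambda>w. (fst w, \<Sigma> w)) ` \<Omega>}
      in \<lparr>cdom = U, cmap = restrict (the_inv_into V (compose (mspace_of M) \<Sigma>)) U,
          cmodel = section_lcs m \<U> \<F> M n N \<gamma>\<rparr>)"

definition mapping_manifold ::
    "nat \<Rightarrow> vec set set \<Rightarrow> fam \<Rightarrow> ('x, vec) manifold \<Rightarrow> nat \<Rightarrow> ('y, vec) manifold
       \<Rightarrow> 'y tvec set \<Rightarrow> ('y tvec \<Rightarrow> 'y) \<Rightarrow> ('x \<Rightarrow> 'y, 'x \<Rightarrow> 'y tvec) manifold" where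
  "mapping_manifold m \<U> \<F> M n N \<Omega> \<Sigma> =
     (let A = mapping_chart m \<U> \<F> M n N \<Omega> \<Sigma> ` mapping_set \<U> \<F> M n N
      in \<lparr>mtop = atlas_topology (mapping_set \<U> \<F> M n N) A, matlas = A\<rparr>)"

end

theory Submission
  imports Defs
begin

text \<open>In the charts given by local additions, \<open>\<gamma> \<mapsto> f \<circ> \<gamma>\<close> sends a section \<open>\<sigma>\<close> to
  the section whose value at \<open>x\<close> is the preimage of \<open>(\<eta> x, f (\<Sigma>\<^sub>1 (\<sigma> x)))\<close> under the diffeomorphism
  \<open>(\<pi>, \<Sigma>\<^sub>2)\<close>. In coordinates this is a superposition operator
  \<open>u \<mapsto> G \<circ> u\<close> with \<open>G\<close> smooth near the values of \<open>u\<close> on a compact set. After multiplying \<open>G\<close> with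
  a cut-off function, (PF) makes such operators continuous; (GL) and (MU) reduce continuity into
  \<open>\<F>(W, \<real>)\<close> to small subsets of \<open>W\<close>. By Hadamard's lemma the difference quotients of a
  superposition operator are again superposition operators, with the parameter \<open>t\<close> as an additional
  constant function. Hence the iterated directional derivatives exist and are the superposition
  operators of the iterated derivatives of \<open>G\<close> along the fibres of \<open>TN\<^sub>1\<close>, which are continuous for
  the same reason. These fibre derivatives are defined without reference to a chart, so that the
  local computations fit together.\<close>

section \<open>Smooth real-valued functions\<close>

text \<open>The obstacle is loss of domain. A superposition operator maps \<open>\<F> U\<close> only
  into \<open>\<F> V\<close> with \<open>V\<close> relatively compact in \<open>U\<close>, and
  charts of \<open>M\<close> and of the targets fit together only near a point, so no statement
  about a given \<open>W\<close> comes from one application of (PF). The local statements therefore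
  carry a parameter (\<open>lcont\<close>), and one scheme "superpose on small sets, then glue"
  serves three times: with a one-point parameter space it yields membership in
  \<open>\<F> W\<close>, with spaces of sections it yields continuity, and with a real parameter at
  0 it yields the limit of a difference quotient. The charts at \<gamma> and at \<eta> are
  unrelated; \<eta> need not be \<open>f \<circ> \<gamma>\<close>. Hence the domain of a local
  representative is cut out by one condition at every point of \<open>M\<close>, and compactness of
  \<open>M\<close> makes it open. All analysis is done for real functions on
  \<open>'k \<Rightarrow>\<^sub>0 real\<close>, whose index type \<open>'k\<close> can be chosen to
  hold several blocks of coordinates: points, tangent vectors, directions, and the parameter of a
  difference quotient.\<close>

primrec Ck :: "nat \<Rightarrow> 'a::real_normed_vector set \<Rightarrow> ('a \<Rightarrow> real) \<Rightarrow> bool" where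
  "Ck 0 Q f = continuous_on Q f"
| "Ck (Suc n) Q f = (\<exists>f'. (\<forall>x\<in>Q. (f has_derivative f' x) (at x)) \<and> (\<forall>v. Ck n Q (\<lambda>x. f' x v)))"

text \<open>\<open>Ck\<close> asks for the regularity of \<open>f' x v\<close> for each fixed
  \<open>v\<close>, not of \<open>f'\<close> as an operator-valued map. The recursion thus stays
  among real-valued functions and can be fed with partial derivatives.\<close>

definition smooth_on :: "'a::real_normed_vector set \<Rightarrow> ('a \<Rightarrow> real) \<Rightarrow> bool" where
  "smooth_on Q f \<longleftrightarrow> (\<forall>n. Ck n Q f)"

definition smooth_at :: "('a::real_normed_vector \<Rightarrow> real) \<Rightarrow> 'a \<Rightarrow> bool" where
  "smooth_at f z \<longleftrightarrow> (\<exists>Q. open Q \<and> z \<in> Q \<and> smooth_on Q f)"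

lemma Ck_Suc_imp: "Ck (Suc n) Q f \<Longrightarrow> Ck n Q f"
proof (induction n arbitrary: f)
  case 0
  then obtain f' where f': "\<And>x. x \<in> Q \<Longrightarrow> (f has_derivative f' x) (at x)"
    by auto
  show ?case
    using f' by (auto intro!: continuous_at_imp_continuous_on has_derivative_continuous)
next
  case (Suc n)
  then obtain f' where "\<forall>x\<in>Q. (f has_derivative f' x) (at x)" "\<forall>v. Ck (Suc n) Q (\<lambda>x. f' x v)"
    by (metis Ck.simps(2))
  with Suc.IH show ?case
    by (metis Ck.simps(2))
qed

lemma Ck_subset: "Ck n Q f \<Longrightarrow> Q' \<subseteq> Q \<Longrightarrow> Ck n Q' f"
proof (induction n arbitrary: f)
  case 0
  then show ?case by (auto intro: continuous_on_subset)
next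
  case (Suc n)
  then show ?case by (metis Ck.simps(2) subsetD)
qed

lemma Ck_cong:
  assumes "open Q" "\<And>x. x \<in> Q \<Longrightarrow> f x = g x" "Ck n Q f"
  shows "Ck n Q g"
proof (cases n)
  case 0
  then show ?thesis using assms by (auto cong: continuous_on_cong)
next
  case (Suc k)
  then obtain f' where f': "\<forall>x\<in>Q. (f has_derivative f' x) (at x)" "\<forall>v. Ck k Q (\<lambda>x. f' x v)"
    using assms(3) by auto
  have "(g has_derivative f' x) (at x)" if "x \<in> Q" for x
    using f'(1) that assms(1,2) by (metis has_derivative_transform_within_open)
  then show ?thesis using Suc f' by auto
qed

text \<open>\<open>Ck\<close> hides its derivative behind an existential quantifier, and the local
  witnesses need not come from one function. They are replaced by \<open>frechet_derivative\<close>,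
  with which each of them agrees on its open set \<open>P\<close>, before the induction hypothesis
  is applied.\<close>

lemma Ck_local:
  assumes "\<And>x. x \<in> Q \<Longrightarrow> \<exists>P. open P \<and> x \<in> P \<and> Ck n P f"
  shows "Ck n Q f"
  using assms
proof (induction n arbitrary: f)
  case 0
  then have "isCont f x" if "x \<in> Q" for x
    using that by (metis Ck.simps(1) continuous_on_eq_continuous_at)
  then show ?case by (auto intro: continuous_at_imp_continuous_on)
next
  case (Suc n)
  have der: "(f has_derivative frechet_derivative f (at x)) (at x)" if "x \<in> Q" for x
    using Suc.prems[OF that] by (metis Ck.simps(2) differentiableI frechet_derivative_works)
  have "\<exists>P. open P \<and> x \<in> P \<and> Ck n P (\<lambda>x. frechet_derivative f (at x) v)" if x: "x \<in> Q" for x v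
  proof -
    obtain P f' where P: "open P" "x \<in> P" "\<forall>x\<in>P. (f has_derivative f' x) (at x)"
      "Ck n P (\<lambda>x. f' x v)"
      using Suc.prems[OF x] by auto
    have "f' y v = frechet_derivative f (at y) v" if "y \<in> P" for y
      using P(3) that by (metis frechet_derivative_at)
    then have "Ck n P (\<lambda>x. frechet_derivative f (at x) v)"
      by (rule Ck_cong[OF P(1) _ P(4)])
    then show ?thesis using P(1,2) by (intro exI[of _ P] conjI)
  qed
  then have "Ck n Q (\<lambda>x. frechet_derivative f (at x) v)" for v
    by (rule Suc.IH)
  with der show ?case unfolding Ck.simps
    by (intro exI[of _ "\<lambda>x. frechet_derivative f (at x)"] conjI ballI allI)
qed

lemma Ck_const: "Ck n Q (\<lambda>_. c)"
  by (induction n arbitrary: c) (auto intro!: exI[of _ "\<lambda>_ _. 0"])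

lemma Ck_bounded_linear: "bounded_linear f \<Longrightarrow> Ck n Q f"
  by (cases n)
    (simp_all add: linear_continuous_on, intro exI[of _ "\<lambda>_. f"],
      simp add: Ck_const bounded_linear_imp_has_derivative)

lemma Ck_add: "Ck n Q f \<Longrightarrow> Ck n Q g \<Longrightarrow> Ck n Q (\<lambda>x. f x + g x)"
proof (induction n arbitrary: f g)
  case 0
  then show ?case by (auto intro: continuous_on_add)
next
  case (Suc n)
  then obtain f' g' where f': "\<forall>x\<in>Q. (f has_derivative f' x) (at x)" "\<forall>v. Ck n Q (\<lambda>x. f' x v)"
    and g': "\<forall>x\<in>Q. (g has_derivative g' x) (at x)" "\<forall>v. Ck n Q (\<lambda>x. g' x v)"
    by auto
  show ?case
    using Suc.IH f' g' unfolding Ck.simps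
    by (intro exI[of _ "\<lambda>x v. f' x v + g' x v"] conjI ballI allI has_derivative_add) auto
qed

lemma Ck_mult: "Ck n Q f \<Longrightarrow> Ck n Q g \<Longrightarrow> Ck n Q (\<lambda>x. f x * g x)"
proof (induction n arbitrary: f g)
  case 0
  then show ?case by (auto intro: continuous_on_mult)
next
  case (Suc n)
  then obtain f' g' where f': "\<forall>x\<in>Q. (f has_derivative f' x) (at x)" "\<forall>v. Ck n Q (\<lambda>x. f' x v)"
    and g': "\<forall>x\<in>Q. (g has_derivative g' x) (at x)" "\<forall>v. Ck n Q (\<lambda>x. g' x v)"
    by auto
  have "Ck n Q f" "Ck n Q g" using Suc.prems Ck_Suc_imp by blast+
  then show ?case
    using Suc.IH f' g' unfolding Ck.simps
    by (intro exI[of _ "\<lambda>x v. f x * g' x v + f' x v * g x"] conjI ballI allI has_derivative_mult Ck_add) auto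
qed

lemma Ck_sum: "finite I \<Longrightarrow> (\<And>i. i \<in> I \<Longrightarrow> Ck n Q (f i)) \<Longrightarrow> Ck n Q (\<lambda>x. \<Sum>i\<in>I. f i x)"
  by (induction I rule: finite_induct) (simp_all add: Ck_const Ck_add)

text \<open>The shape serves the induction: a vector-valued inner map enters only through real
  coefficients \<open>u i\<close> of fixed vectors \<open>b i\<close>. The chain rule gives a sum of
  products of \<open>u' i\<close> with functions \<open>G' (...) (b i)\<close> of the inner map, and
  the latter have the shape of the statement again.\<close>

lemma Ck_compose:
  assumes "finite I" "\<And>i. i \<in> I \<Longrightarrow> Ck n Q (u i)" "Ck n P G"
    "\<And>x. x \<in> Q \<Longrightarrow> (\<Sum>i\<in>I. u i x *\<^sub>R b i) \<in> P"
  shows "Ck n Q (\<lambda>x. G (\<Sum>i\<in>I. u i x *\<^sub>R b i))"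
  using assms(2-)
proof (induction n arbitrary: G)
  case 0
  then show ?case
    by (auto intro!: continuous_on_compose2[of P G] continuous_on_sum continuous_on_scaleR)
next
  case (Suc n)
  let ?u = "\<lambda>x. \<Sum>i\<in>I. u i x *\<^sub>R b i"
  have "\<forall>i\<in>I. \<exists>u'. (\<forall>x\<in>Q. (u i has_derivative u' x) (at x)) \<and> (\<forall>v. Ck n Q (\<lambda>x. u' x v))"
    using Suc.prems(1) by auto
  then obtain u' where u': "\<And>i x. i \<in> I \<Longrightarrow> x \<in> Q \<Longrightarrow> (u i has_derivative u' i x) (at x)"
    "\<And>i v. i \<in> I \<Longrightarrow> Ck n Q (\<lambda>x. u' i x v)"
    by metis
  obtain G' where G': "\<And>y. y \<in> P \<Longrightarrow> (G has_derivative G' y) (at y)" "\<And>v. Ck n P (\<lambda>y. G' y v)"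
    using Suc.prems(2) by auto
  let ?d = "\<lambda>x v. \<Sum>i\<in>I. u' i x v * G' (?u x) (b i)"
  have "((\<lambda>x. G (?u x)) has_derivative ?d x) (at x)" if x: "x \<in> Q" for x
  proof -
    have "(?u has_derivative (\<lambda>v. \<Sum>i\<in>I. u' i x v *\<^sub>R b i)) (at x)"
      by (intro has_derivative_sum has_derivative_scaleR_left u' x)
    then have "((\<lambda>x. G (?u x)) has_derivative (\<lambda>v. G' (?u x) (\<Sum>i\<in>I. u' i x v *\<^sub>R b i))) (at x)"
      using G'(1)[OF Suc.prems(3)[OF x]] by (rule has_derivative_compose)
    moreover have "linear (G' (?u x))"
      using G'(1)[OF Suc.prems(3)[OF x]] by (rule has_derivative_linear)
    ultimately show ?thesis
      by (simp add: linear_sum linear_cmul)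
  qed
  moreover have "Ck n Q (\<lambda>x. ?d x v)" for v
  proof (intro Ck_sum assms(1) Ck_mult u')
    fix i
    have "\<And>i. i \<in> I \<Longrightarrow> Ck n Q (u i)"
      using Suc.prems(1) by (rule Ck_Suc_imp)
    then show "Ck n Q (\<lambda>x. G' (?u x) (b i))"
      using Suc.prems(3) by (intro Suc.IH G'(2)) blast+
  qed
  ultimately show ?case unfolding Ck.simps
    by (intro exI[of _ ?d] conjI ballI allI)
qed

lemma Ck_inverse: "(\<And>x. x \<in> Q \<Longrightarrow> x \<noteq> 0) \<Longrightarrow> Ck n Q (inverse :: real \<Rightarrow> real)"
proof (induction n)
  case 0
  then show ?case unfolding Ck.simps by (intro continuous_on_inverse[OF continuous_on_id]) auto
next
  case (Suc n)
  have "(inverse has_derivative (\<lambda>v. - (inverse x * v * inverse x))) (at x)" if "x \<in> Q" for x :: real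
    using Suc.prems that by (auto intro!: has_derivative_inverse' )
  moreover have "Ck n Q (\<lambda>x. (- v) * (inverse x * inverse x))" for v
    using Suc by (intro Ck_mult Ck_const) auto
  then have "Ck n Q (\<lambda>x. - (inverse x * v * inverse x))" for v
    by (simp add: algebra_simps)
  ultimately show ?case unfolding Ck.simps
    by (intro exI[of _ "\<lambda>x v. - (inverse x * v * inverse x)"] conjI ballI allI)
qed

lemma smooth_on_const: "smooth_on Q (\<lambda>_. c)"
  by (simp add: smooth_on_def Ck_const)

lemma smooth_on_bounded_linear: "bounded_linear f \<Longrightarrow> smooth_on Q f"
  by (simp add: smooth_on_def Ck_bounded_linear)

lemma smooth_on_add: "smooth_on Q f \<Longrightarrow> smooth_on Q g \<Longrightarrow> smooth_on Q (\<lambda>x. f x + g x)"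
  by (simp add: smooth_on_def Ck_add)

lemma smooth_on_mult: "smooth_on Q f \<Longrightarrow> smooth_on Q g \<Longrightarrow> smooth_on Q (\<lambda>x. f x * g x)"
  by (simp add: smooth_on_def Ck_mult)

lemma smooth_on_subset: "smooth_on Q f \<Longrightarrow> Q' \<subseteq> Q \<Longrightarrow> smooth_on Q' f"
  unfolding smooth_on_def by (meson Ck_subset)

lemma smooth_on_cong:
  "open Q \<Longrightarrow> (\<And>x. x \<in> Q \<Longrightarrow> f x = g x) \<Longrightarrow> smooth_on Q f \<Longrightarrow> smooth_on Q g"
  unfolding smooth_on_def by (meson Ck_cong)

lemma smooth_on_sum:
  "finite I \<Longrightarrow> (\<And>i. i \<in> I \<Longrightarrow> smooth_on Q (h i)) \<Longrightarrow> smooth_on Q (\<lambda>x. \<Sum>i\<in>I. h i x)"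
  by (simp add: smooth_on_def Ck_sum)

lemma smooth_on_prod:
  "finite I \<Longrightarrow> (\<And>i. i \<in> I \<Longrightarrow> smooth_on Q (h i)) \<Longrightarrow> smooth_on Q (\<lambda>x. \<Prod>i\<in>I. h i x)"
  by (induction I rule: finite_induct) (simp_all add: smooth_on_const smooth_on_mult)

lemma smooth_on_continuous: "smooth_on Q f \<Longrightarrow> continuous_on Q f"
  unfolding smooth_on_def by (metis Ck.simps(1))

lemma smooth_on_compose:
  assumes "finite I" "\<And>i. i \<in> I \<Longrightarrow> smooth_on Q (u i)" "smooth_on P G"
    "\<And>x. x \<in> Q \<Longrightarrow> (\<Sum>i\<in>I. u i x *\<^sub>R b i) \<in> P"
  shows "smooth_on Q (\<lambda>x. G (\<Sum>i\<in>I. u i x *\<^sub>R b i))"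
  using assms Ck_compose unfolding smooth_on_def by blast

lemma smooth_on_compose_real:
  fixes G :: "real \<Rightarrow> real"
  assumes "smooth_on Q u" "smooth_on P G" "\<And>x. x \<in> Q \<Longrightarrow> u x \<in> P"
  shows "smooth_on Q (\<lambda>x. G (u x))"
  using smooth_on_compose[of "{()}" Q "\<lambda>_. u" P G "\<lambda>_. 1"] assms by simp

lemma smooth_on_local:
  assumes "\<And>z. z \<in> Q \<Longrightarrow> smooth_at f z"
  shows "smooth_on Q f"
  using assms unfolding smooth_on_def smooth_at_def by (intro allI Ck_local) blast

lemma smooth_on_imp_at: "smooth_on Q f \<Longrightarrow> open Q \<Longrightarrow> z \<in> Q \<Longrightarrow> smooth_at f z"
  by (auto simp: smooth_at_def)

lemma smooth_on_has_derivative: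
  assumes "smooth_on Q f" "z \<in> Q"
  shows "(f has_derivative frechet_derivative f (at z)) (at z)"
  using assms unfolding smooth_on_def by (metis Ck.simps(2) differentiableI frechet_derivative_works)

lemma smooth_on_frechet:
  assumes "smooth_on Q f" "open Q"
  shows "smooth_on Q (\<lambda>x. frechet_derivative f (at x) v)"
  unfolding smooth_on_def
proof
  fix n
  obtain f' where f': "\<forall>x\<in>Q. (f has_derivative f' x) (at x)" "Ck n Q (\<lambda>x. f' x v)"
    using assms(1) unfolding smooth_on_def by (metis Ck.simps(2))
  then show "Ck n Q (\<lambda>x. frechet_derivative f (at x) v)"
    by (intro Ck_cong[OF assms(2) _ f'(2)]) (metis frechet_derivative_at)
qed

lemma smooth_at_has_derivative:
  "smooth_at f z \<Longrightarrow> (f has_derivative frechet_derivative f (at z)) (at z)"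
  unfolding smooth_at_def by (auto intro: smooth_on_has_derivative)

lemma smooth_at_frechet: "smooth_at f z \<Longrightarrow> smooth_at (\<lambda>x. frechet_derivative f (at x) v) z"
  unfolding smooth_at_def by (auto intro: smooth_on_frechet)

lemma smooth_at_cong:
  assumes "smooth_at f z" "open Q" "z \<in> Q" "\<And>x. x \<in> Q \<Longrightarrow> f x = g x"
  shows "smooth_at g z"
proof -
  obtain P where "open P" "z \<in> P" "smooth_on P f" using assms(1) by (auto simp: smooth_at_def)
  then show ?thesis
    unfolding smooth_at_def
    using assms(2-) smooth_on_cong[of "P \<inter> Q" f g] smooth_on_subset[of P f "P \<inter> Q"]
    by (intro exI[of _ "P \<inter> Q"]) auto
qed

lemma smooth_at_const: "smooth_at (\<lambda>_. c) z"
  by (rule smooth_on_imp_at[OF smooth_on_const open_UNIV UNIV_I])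

lemma smooth_at_bounded_linear: "bounded_linear f \<Longrightarrow> smooth_at f z"
  by (rule smooth_on_imp_at[OF smooth_on_bounded_linear open_UNIV UNIV_I])

lemma smooth_at_common2:
  assumes "smooth_at f z" "smooth_at g z"
  shows "\<exists>Q. open Q \<and> z \<in> Q \<and> smooth_on Q f \<and> smooth_on Q g"
proof -
  obtain P R where "open P" "z \<in> P" "smooth_on P f" "open R" "z \<in> R" "smooth_on R g"
    using assms unfolding smooth_at_def by blast
  then show ?thesis
    using smooth_on_subset[of P f "P \<inter> R"] smooth_on_subset[of R g "P \<inter> R"]
    by (intro exI[of _ "P \<inter> R"]) auto
qed

lemma smooth_at_add:
  assumes "smooth_at f z" "smooth_at g z"
  shows "smooth_at (\<lambda>x. f x + g x) z"
proof -
  obtain Q where Q: "open Q" "z \<in> Q" "smooth_on Q f" "smooth_on Q g"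
    using smooth_at_common2[OF assms] by auto
  show ?thesis
    using smooth_on_imp_at[OF smooth_on_add[OF Q(3,4)] Q(1,2)] .
qed

lemma smooth_at_mult:
  assumes "smooth_at f z" "smooth_at g z"
  shows "smooth_at (\<lambda>x. f x * g x) z"
proof -
  obtain Q where Q: "open Q" "z \<in> Q" "smooth_on Q f" "smooth_on Q g"
    using smooth_at_common2[OF assms] by auto
  show ?thesis
    using smooth_on_imp_at[OF smooth_on_mult[OF Q(3,4)] Q(1,2)] .
qed

lemma smooth_at_sum:
  "finite I \<Longrightarrow> (\<And>i. i \<in> I \<Longrightarrow> smooth_at (h i) z) \<Longrightarrow> smooth_at (\<lambda>x. \<Sum>i\<in>I. h i x) z"
  by (induction I rule: finite_induct) (simp_all add: smooth_at_const smooth_at_add)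

lemma smooth_at_common:
  assumes "finite I" "\<And>i. i \<in> I \<Longrightarrow> smooth_at (u i) z"
  shows "\<exists>Q. open Q \<and> z \<in> Q \<and> (\<forall>i\<in>I. smooth_on Q (u i))"
proof -
  have "\<forall>i\<in>I. \<exists>Q. open Q \<and> z \<in> Q \<and> smooth_on Q (u i)"
    using assms(2) by (auto simp: smooth_at_def)
  then obtain Q where Q: "\<And>i. i \<in> I \<Longrightarrow> open (Q i) \<and> z \<in> Q i \<and> smooth_on (Q i) (u i)" by metis
  have "smooth_on (\<Inter>i\<in>I. Q i) (u i)" if "i \<in> I" for i
    using Q[OF that] that by (blast intro: smooth_on_subset)
  then show ?thesis
    using Q assms(1) by (intro exI[of _ "\<Inter>i\<in>I. Q i"]) auto
qed

lemma smooth_at_compose: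
  assumes "finite I" "\<And>i. i \<in> I \<Longrightarrow> smooth_at (u i) z" "smooth_at G (\<Sum>i\<in>I. u i z *\<^sub>R b i)"
  shows "smooth_at (\<lambda>x. G (\<Sum>i\<in>I. u i x *\<^sub>R b i)) z"
proof -
  let ?u = "\<lambda>x. \<Sum>i\<in>I. u i x *\<^sub>R b i"
  obtain Q where Q: "open Q" "z \<in> Q" "\<And>i. i \<in> I \<Longrightarrow> smooth_on Q (u i)"
    using smooth_at_common[of I u z] assms(1,2) by auto
  obtain P where P: "open P" "?u z \<in> P" "smooth_on P G"
    using assms(3) by (auto simp: smooth_at_def)
  have "continuous_on Q ?u"
    using Q(3) by (intro continuous_on_sum continuous_on_scaleR smooth_on_continuous continuous_on_const)
  then have "open (Q \<inter> ?u -` P)" using Q(1) P(1) by (simp add: continuous_open_preimage)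
  moreover have "smooth_on (Q \<inter> ?u -` P) (\<lambda>x. G (?u x))"
  proof (rule smooth_on_compose[OF assms(1) _ P(3)])
    show "smooth_on (Q \<inter> ?u -` P) (u i)" if "i \<in> I" for i
      using Q(3)[OF that] by (rule smooth_on_subset) auto
  qed auto
  ultimately show ?thesis using Q(2) P(2) by (auto simp: smooth_at_def)
qed

section \<open>Bump functions on the real line\<close>

definition bump_exp :: "real \<Rightarrow> real" where
  "bump_exp x = (if x > 0 then exp (- (1 / x)) else 0)"

lemma poly_inverse_exp_tendsto_0:
  "((\<lambda>x::real. poly p (1 / x) * exp (- (1 / x))) \<longlongrightarrow> 0) (at_right 0)"
proof -
  have lim: "((\<lambda>y. poly p y * exp (- y)) \<longlongrightarrow> 0) at_top"
  proof -
    have mono: "((\<lambda>y::real. c * (y ^ k / exp y)) \<longlongrightarrow> 0) at_top" for c k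
      by (rule tendsto_mult_right_zero[OF tendsto_power_div_exp_0])
    have "((\<lambda>y. \<Sum>i\<le>degree p. coeff p i * (y ^ i / exp y)) \<longlongrightarrow> (\<Sum>i\<le>degree p. 0)) at_top"
      by (intro tendsto_sum mono)
    then show ?thesis
      by (simp add: poly_altdef sum_distrib_right exp_minus field_simps sum_divide_distrib)
  qed
  have "filterlim (\<lambda>x::real. 1 / x) at_top (at_right 0)"
    using filterlim_inverse_at_top_right by (simp add: inverse_eq_divide)
  from filterlim_compose[OF lim this] show ?thesis by simp
qed

text \<open>The functions p(1/x) exp(-1/x) with \<open>p\<close> an arbitrary polynomial are closed
  under differentiation, so the induction on \<open>n\<close> runs with \<open>p\<close> arbitrary;
  \<open>bump_exp\<close> is the case p = 1.\<close>

lemma Ck_poly_bump: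
  "Ck n UNIV (\<lambda>x::real. if x > 0 then poly p (1 / x) * exp (- (1 / x)) else 0)"
proof (induction n arbitrary: p)
  have der: "\<exists>q. \<forall>x. ((\<lambda>x::real. if x > 0 then poly p (1 / x) * exp (- (1 / x)) else 0)
      has_real_derivative (if x > 0 then poly q (1 / x) * exp (- (1 / x)) else 0)) (at x)" for p
  proof (intro exI allI)
    let ?f = "\<lambda>x::real. if x > 0 then poly p (1 / x) * exp (- (1 / x)) else 0"
    \<comment> \<open>With y = 1/x one has dy/dx = -y^2, so the derivative of p(y) exp(-y) is y^2
      (p(y) - p'(y)) exp(-y).\<close>
    let ?q = "monom 1 2 * (p - pderiv p)"
    fix x :: real
    consider "x > 0" | "x < 0" | "x = 0" by linarith
    then show "(?f has_real_derivative (if x > 0 then poly ?q (1 / x) * exp (- (1 / x)) else 0)) (at x)"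
    proof cases
      case 1
      have "((\<lambda>x. poly p (1 / x) * exp (- (1 / x))) has_real_derivative
          poly ?q (1 / x) * exp (- (1 / x))) (at x)"
        using 1 by (auto intro!: derivative_eq_intros DERIV_chain2[OF poly_DERIV]
            simp: poly_monom field_simps power2_eq_square)
      then show ?thesis
        using 1 by (subst if_P) (auto intro: has_field_derivative_transform_within_open[of _ _ _ "{0<..}"])
    next
      case 2
      have "((\<lambda>x. 0) has_real_derivative 0) (at x)" by simp
      then show ?thesis
        using 2 has_field_derivative_transform_within_open[of "\<lambda>_. 0" 0 x "{..<0}" ?f] by auto
    next
      case 3
      \<comment> \<open>At 0 the difference quotient is (1/h) p(1/h) exp(-1/h), which is the limit
        already known, for the polynomial y p(y), that is \<open>pCons 0 p\<close>.\<close>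
      have "((\<lambda>h. ?f h / h) \<longlongrightarrow> 0) (at_right 0)"
        using poly_inverse_exp_tendsto_0[of "pCons 0 p"]
        by (rule Lim_transform_eventually)
          (auto simp: eventually_at_right_field intro!: exI[of _ 1])
      moreover have "((\<lambda>h. ?f h / h) \<longlongrightarrow> 0) (at_left 0)"
        by (rule Lim_transform_eventually[of "\<lambda>_. 0"])
          (auto simp: eventually_at_left_field intro!: exI[of _ "-1"])
      ultimately have "((\<lambda>h. ?f h / h) \<longlongrightarrow> 0) (at 0)"
        by (simp add: filterlim_split_at)
      then show ?thesis using 3 by (simp add: DERIV_def cong: if_cong)
    qed
  qed
  {
    case 0
    obtain q where "\<forall>x. ((\<lambda>x::real. if x > 0 then poly p (1 / x) * exp (- (1 / x)) else 0)
      has_real_derivative (if x > 0 then poly q (1 / x) * exp (- (1 / x)) else 0)) (at x)"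
      using der by blast
    then show ?case
      by (auto intro!: continuous_at_imp_continuous_on DERIV_isCont)
  next
    case (Suc n)
    obtain q where q: "\<forall>x. ((\<lambda>x::real. if x > 0 then poly p (1 / x) * exp (- (1 / x)) else 0)
      has_real_derivative (if x > 0 then poly q (1 / x) * exp (- (1 / x)) else 0)) (at x)"
      using der by blast
    have "Ck n UNIV (\<lambda>x. (if x > 0 then poly q (1 / x) * exp (- (1 / x)) else 0) * v)" for v
      by (intro Ck_mult Suc Ck_const)
    with q show ?case
      unfolding Ck.simps has_field_derivative_def
      by (intro exI[of _ "\<lambda>x v. (if x > 0 then poly q (1 / x) * exp (- (1 / x)) else 0) * v"]) auto
  }
qed

lemma smooth_on_bump_exp: "smooth_on UNIV bump_exp"
  unfolding smooth_on_def bump_exp_def[abs_def] using Ck_poly_bump[of _ 1] by (simp cong: if_cong)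

lemma bump_exp_nonneg: "bump_exp x \<ge> 0" and bump_exp_pos_iff: "bump_exp x > 0 \<longleftrightarrow> x > 0"
  by (auto simp: bump_exp_def)

lemma smooth_bump_real:
  obtains \<beta> :: "real \<Rightarrow> real" where "smooth_on UNIV \<beta>"
    "\<And>x. \<bar>x\<bar> \<le> 1 \<Longrightarrow> \<beta> x = 1" "\<And>x. \<bar>x\<bar> \<ge> 2 \<Longrightarrow> \<beta> x = 0"
proof
  \<comment> \<open>A transition function of the square: 1 up to 1, and 0 from 4 on. The denominator
    is positive because 4 - x and x - 1 are never both non-positive. Inserting \<open>x * x\<close>
    makes the result even without the non-smooth absolute value.\<close>
  let ?s = "\<lambda>x. bump_exp (4 - x) * inverse (bump_exp (4 - x) + bump_exp (x - 1))"
  have pos: "bump_exp (4 - x) + bump_exp (x - 1) > 0" for x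
    using bump_exp_nonneg[of "4 - x"] bump_exp_nonneg[of "x - 1"] bump_exp_pos_iff[of "4 - x"]
      bump_exp_pos_iff[of "x - 1"] by linarith
  have sq: "smooth_on UNIV (\<lambda>x::real. x * x)"
    by (intro smooth_on_mult smooth_on_bounded_linear bounded_linear_ident)
  have "smooth_on UNIV (\<lambda>x::real. 4 + (-1) * x)" "smooth_on UNIV (\<lambda>x::real. x + (-1))"
    by (intro smooth_on_add smooth_on_mult smooth_on_const smooth_on_bounded_linear bounded_linear_ident)+
  then have b: "smooth_on UNIV (\<lambda>x. bump_exp (4 - x))" "smooth_on UNIV (\<lambda>x. bump_exp (x - 1))"
    using smooth_on_compose_real[OF _ smooth_on_bump_exp] by fastforce+
  have "smooth_on {x::real. x \<noteq> 0} inverse"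
    by (auto simp: smooth_on_def intro: Ck_inverse)
  then have "smooth_on UNIV (\<lambda>x. inverse (bump_exp (4 - x) + bump_exp (x - 1)))"
    by (rule smooth_on_compose_real[OF smooth_on_add[OF b]]) (use pos in \<open>simp add: less_imp_neq[symmetric]\<close>)
  then have s: "smooth_on UNIV ?s"
    by (rule smooth_on_mult[OF b(1)])
  show "smooth_on UNIV (\<lambda>x. ?s (x * x))"
    using smooth_on_compose_real[OF sq s] by simp
  show "?s (x * x) = 1" if "\<bar>x\<bar> \<le> 1" for x
  proof -
    have "x * x \<le> 1" using that using mult_mono[of "\<bar>x\<bar>" 1 "\<bar>x\<bar>" 1] by simp
    then have "bump_exp (x * x - 1) = 0" "bump_exp (4 - x * x) > 0" by (auto simp: bump_exp_def)
    then show ?thesis by simp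
  qed
  show "?s (x * x) = 0" if "\<bar>x\<bar> \<ge> 2" for x
  proof -
    have "x * x \<ge> 4" using mult_mono[of 2 "\<bar>x\<bar>" 2 "\<bar>x\<bar>"] that by simp
    then show ?thesis by (simp add: bump_exp_def)
  qed
qed

section \<open>Calculus in finitely many coordinates\<close>

abbreviation unit_vec :: "'k \<Rightarrow> ('k \<Rightarrow>\<^sub>0 real)" where
  "unit_vec i \<equiv> Poly_Mapping.single i 1"

text \<open>A real tuple indexed by \<open>I\<close> as a point of one normed space that contains
  the coordinate spaces of all finite index sets. A function of the coordinates in \<open>I\<close>
  is realised as a function \<open>f\<close> on the whole space with
  \<open>f (proj I z) = f z\<close>, so that open sets and full derivatives are available.\<close>

definition tup :: "'k set \<Rightarrow> ('k \<Rightarrow> real) \<Rightarrow> ('k \<Rightarrow>\<^sub>0 real)" where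
  "tup I r = (\<Sum>i\<in>I. r i *\<^sub>R unit_vec i)"

abbreviation proj :: "'k set \<Rightarrow> ('k \<Rightarrow>\<^sub>0 real) \<Rightarrow> ('k \<Rightarrow>\<^sub>0 real)" where
  "proj I z \<equiv> tup I (Poly_Mapping.lookup z)"

lemma lookup_scaleR [simp]:
  fixes x :: "'k \<Rightarrow>\<^sub>0 real"
  shows "Poly_Mapping.lookup (r *\<^sub>R x) i = r * Poly_Mapping.lookup x i"
proof -
  have "finite {i. r * Poly_Mapping.lookup x i \<noteq> 0}"
    by (rule finite_subset[OF _ finite_keys[of x]]) (auto simp: in_keys_iff)
  then show ?thesis
    by (simp add: scaleR_poly_mapping_def)
qed

lemma lookup_tup: "finite I \<Longrightarrow> Poly_Mapping.lookup (tup I r) i = (if i \<in> I then r i else 0)"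
  by (simp add: tup_def lookup_sum lookup_single when_def if_distrib[of "(*) _"] cong: if_cong)

lemma tup_cong: "(\<And>i. i \<in> I \<Longrightarrow> r i = s i) \<Longrightarrow> tup I r = tup I s"
  unfolding tup_def by (auto intro: sum.cong)

lemma tup_add: "tup I r + tup I s = tup I (\<lambda>i. r i + s i)"
  by (simp add: tup_def sum.distrib scaleR_add_left)

lemma tup_scaleR: "c *\<^sub>R tup I r = tup I (\<lambda>i. c * r i)"
  by (simp add: tup_def scaleR_sum_right)

lemma proj_tup: "finite I \<Longrightarrow> proj I (tup I r) = tup I r"
  by (rule tup_cong) (simp add: lookup_tup)

lemma proj_unit: "finite I \<Longrightarrow> i \<in> I \<Longrightarrow> proj I (unit_vec i) = unit_vec i"
  by (rule poly_mapping_eqI) (auto simp: lookup_tup lookup_single when_def)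

lemma proj_add: "proj I (x + y) = proj I x + proj I y"
  unfolding tup_add by (rule tup_cong) (simp add: lookup_add)

lemma proj_scaleR: "proj I (c *\<^sub>R x) = c *\<^sub>R proj I x"
  unfolding tup_scaleR by (rule tup_cong) simp

text \<open>The norm of a finitely supported function is the sum of the absolute values of its
  entries, and zero entries may be added to or dropped from that sum.\<close>

lemma sum_abs_lookup_le_norm:
  fixes x :: "'k \<Rightarrow>\<^sub>0 real"
  assumes "finite J"
  shows "(\<Sum>i\<in>J. \<bar>Poly_Mapping.lookup x i\<bar>) \<le> norm x"
proof -
  have "(\<Sum>i\<in>J. \<bar>Poly_Mapping.lookup x i\<bar>) \<le> (\<Sum>i\<in>J \<union> Poly_Mapping.keys x. \<bar>Poly_Mapping.lookup x i\<bar>)"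
    using assms by (intro sum_mono2) auto
  also have "\<dots> = (\<Sum>i\<in>Poly_Mapping.keys x. \<bar>Poly_Mapping.lookup x i\<bar>)"
    using assms by (intro sum.mono_neutral_right) (auto simp: in_keys_iff)
  also have "\<dots> = norm x"
    by (simp add: norm_poly_mapping_def dist_poly_mapping_def)
  finally show ?thesis .
qed

lemma norm_tup_le: "norm (tup I r) \<le> (\<Sum>i\<in>I. \<bar>r i\<bar>)"
proof -
  have "norm (unit_vec i) = 1" for i :: 'a
    by (simp add: norm_poly_mapping_def dist_poly_mapping_def)
  then show ?thesis
    unfolding tup_def by (intro order_trans[OF norm_sum]) simp
qed

lemma bounded_linear_lookup: "bounded_linear (\<lambda>x::'k \<Rightarrow>\<^sub>0 real. Poly_Mapping.lookup x i)"
proof (rule bounded_linear_intro[of _ 1])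
  show "norm (Poly_Mapping.lookup x i) \<le> norm x * 1" for x :: "'k \<Rightarrow>\<^sub>0 real"
    using sum_abs_lookup_le_norm[of "{i}" x] by simp
qed (auto simp: lookup_add)

lemma continuous_on_lookup [continuous_intros]:
  fixes f :: "'a::topological_space \<Rightarrow> 'k \<Rightarrow>\<^sub>0 real"
  shows "continuous_on S f \<Longrightarrow> continuous_on S (\<lambda>x. Poly_Mapping.lookup (f x) i)"
  by (rule bounded_linear.continuous_on[OF bounded_linear_lookup])

lemma continuous_on_tup:
  "(\<And>i. i \<in> I \<Longrightarrow> continuous_on S (u i)) \<Longrightarrow> continuous_on S (\<lambda>x. tup I (\<lambda>i. u i x))"
  unfolding tup_def by (intro continuous_on_sum continuous_on_scaleR continuous_on_const) auto

lemma continuous_on_proj: "continuous_on S (proj I)"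
  by (intro continuous_on_tup continuous_on_lookup continuous_on_id)

lemma smooth_at_lookup: "smooth_at (\<lambda>z::'k \<Rightarrow>\<^sub>0 real. Poly_Mapping.lookup z i) z"
  by (rule smooth_at_bounded_linear[OF bounded_linear_lookup])

lemma smooth_on_lookup: "smooth_on Q (\<lambda>z::'k \<Rightarrow>\<^sub>0 real. Poly_Mapping.lookup z i)"
  by (rule smooth_on_bounded_linear[OF bounded_linear_lookup])

lemma smooth_at_compose_tup:
  assumes "finite I" "\<And>i. i \<in> I \<Longrightarrow> smooth_at (u i) z" "smooth_at G (tup I (\<lambda>i. u i z))"
  shows "smooth_at (\<lambda>x. G (tup I (\<lambda>i. u i x))) z"
  using smooth_at_compose[of I u z G unit_vec] assms unfolding tup_def by auto

lemma smooth_on_compose_tup: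
  assumes "finite I" "\<And>i. i \<in> I \<Longrightarrow> smooth_on Q (u i)" "smooth_on P G"
    "\<And>x. x \<in> Q \<Longrightarrow> tup I (\<lambda>i. u i x) \<in> P"
  shows "smooth_on Q (\<lambda>x. G (tup I (\<lambda>i. u i x)))"
  using smooth_on_compose[of I Q u P G unit_vec] assms unfolding tup_def by auto

lemma open_contains_box:
  fixes Q :: "('k \<Rightarrow>\<^sub>0 real) set"
  assumes "finite I" "open Q" "z \<in> Q" "proj I z = z"
  obtains r where "r > 0"
    "\<And>w. (\<And>i. i \<in> I \<Longrightarrow> \<bar>Poly_Mapping.lookup w i - Poly_Mapping.lookup z i\<bar> < r) \<Longrightarrow> proj I w \<in> Q"
proof -
  obtain e where e: "e > 0" "ball z e \<subseteq> Q"
    using assms(2,3) open_contains_ball by blast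
  show ?thesis
  \<comment> \<open>One more than \<open>card I\<close>: the bounds for the coordinates then add up
    to strictly less than \<open>e\<close>, and an empty \<open>I\<close> causes no division by
    0.\<close>
  proof (rule that[of "e / (card I + 1)"])
    show "e / (card I + 1) > 0" using e by simp
    fix w
    assume w: "\<And>i. i \<in> I \<Longrightarrow> \<bar>Poly_Mapping.lookup w i - Poly_Mapping.lookup z i\<bar> < e / (card I + 1)"
    have "proj I w - z = tup I (\<lambda>i. Poly_Mapping.lookup w i - Poly_Mapping.lookup z i)"
      by (subst assms(4)[symmetric]) (simp add: tup_def scaleR_left_diff_distrib sum_subtractf)
    then have "norm (proj I w - z) \<le> (\<Sum>i\<in>I. \<bar>Poly_Mapping.lookup w i - Poly_Mapping.lookup z i\<bar>)"
      by (metis norm_tup_le)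
    also have "\<dots> \<le> (\<Sum>i\<in>I. e / (card I + 1))"
      using w by (intro sum_mono) (auto intro: less_imp_le)
    also have "\<dots> < e"
      using e(1) by (simp add: field_simps)
    finally show "proj I w \<in> Q"
      using e(2) by (auto simp: dist_norm norm_minus_commute)
  qed
qed

text \<open>The point \<open>z + proj I w\<close> is reached from \<open>z\<close> by changing one
  coordinate at a time. By the mean value theorem each change costs at most \<open>e\<close> times
  the size of that coordinate, and these errors add up to \<open>e\<close> times the l1-norm.
  Changes in coordinates outside \<open>I\<close> are invisible to \<open>f\<close>.\<close>

lemma has_derivative_of_partials:
  fixes f :: "('k \<Rightarrow>\<^sub>0 real) \<Rightarrow> real"
  assumes "finite I" "open Q" "z \<in> Q" and proj: "\<And>z. f (proj I z) = f z"
    and der: "\<And>i z. i \<in> I \<Longrightarrow> z \<in> Q \<Longrightarrow> ((\<lambda>r. f (z + r *\<^sub>R unit_vec i)) has_real_derivative g i z) (at 0)"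
    and cont: "\<And>i. i \<in> I \<Longrightarrow> continuous_on Q (g i)"
  shows "(f has_derivative (\<lambda>w. \<Sum>i\<in>I. Poly_Mapping.lookup w i * g i z)) (at z)"
  unfolding has_derivative_at_alt
proof (intro conjI allI impI)
  show "bounded_linear (\<lambda>w. \<Sum>i\<in>I. Poly_Mapping.lookup w i * g i z)"
    by (intro bounded_linear_sum bounded_linear_mult_const bounded_linear_lookup)
  fix e :: real assume e: "e > 0"
  have "\<exists>d>0. ball z d \<subseteq> Q \<and> (\<forall>i\<in>I. \<forall>y\<in>ball z d. \<bar>g i y - g i z\<bar> \<le> e)"
  proof -
    have "\<forall>i\<in>I. \<forall>\<^sub>F y in nhds z. \<bar>g i y - g i z\<bar> < e"
    proof
      fix i assume "i \<in> I"
      then have "isCont (g i) z"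
        using cont assms(2,3) continuous_on_eq_continuous_at by blast
      then have "(g i \<longlongrightarrow> g i z) (nhds z)"
        by (simp add: isCont_def tendsto_at_iff_tendsto_nhds)
      then show "\<forall>\<^sub>F y in nhds z. \<bar>g i y - g i z\<bar> < e"
        using e by (auto simp: tendsto_iff dist_real_def)
    qed
    then have "\<forall>\<^sub>F y in nhds z. y \<in> Q \<and> (\<forall>i\<in>I. \<bar>g i y - g i z\<bar> < e)"
      using assms(1-3) by (intro eventually_conj eventually_ball_finite eventually_nhds_in_open)
    then obtain d where "d > 0" "\<And>y. dist y z < d \<Longrightarrow> y \<in> Q \<and> (\<forall>i\<in>I. \<bar>g i y - g i z\<bar> < e)"
      unfolding eventually_nhds_metric by auto
    then show ?thesis
      by (intro exI[of _ d]) (auto simp: dist_commute intro: less_imp_le)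
  qed
  then obtain d where d: "d > 0" "ball z d \<subseteq> Q"
    "\<And>i y. i \<in> I \<Longrightarrow> y \<in> ball z d \<Longrightarrow> \<bar>g i y - g i z\<bar> \<le> e"
    by auto
  have key: "\<bar>f (z + proj J w) - f z - (\<Sum>i\<in>J. Poly_Mapping.lookup w i * g i z)\<bar>
      \<le> e * (\<Sum>i\<in>J. \<bar>Poly_Mapping.lookup w i\<bar>)"
    if J: "J \<subseteq> I" "norm w < d" for J w
    using finite_subset[OF J(1) assms(1)] J
  proof (induction J rule: finite_induct)
    case empty
    then show ?case by (simp add: tup_def)
  next
    case (insert i J)
    let ?a = "Poly_Mapping.lookup w i" and ?y = "z + proj J w"
    let ?S = "{- \<bar>?a\<bar>..\<bar>?a\<bar>}"
    \<comment> \<open>The symmetric interval \<open>?S\<close> covers both signs of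
      \<open>?a\<close>. Replacing the entry at \<open>i\<close> by some \<open>r\<close> in it
      keeps the vector entrywise below \<open>w\<close> in absolute value, hence inside the ball on
      which the partial derivatives are \<open>e\<close>-close to their values at
      \<open>z\<close>.\<close>
    have in_ball: "?y + r *\<^sub>R unit_vec i \<in> ball z d" if "r \<in> ?S" for r
    proof -
      have "proj J w + r *\<^sub>R unit_vec i = tup (insert i J) (\<lambda>l. if l = i then r else Poly_Mapping.lookup w l)"
        using insert.hyps unfolding tup_def by (simp add: add.commute) (rule sum.cong, auto)
      then have "norm (proj J w + r *\<^sub>R unit_vec i) \<le> (\<Sum>l\<in>insert i J. \<bar>if l = i then r else Poly_Mapping.lookup w l\<bar>)"
        by (metis norm_tup_le)
      also have "\<dots> \<le> (\<Sum>l\<in>insert i J. \<bar>Poly_Mapping.lookup w l\<bar>)"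
        using that by (intro sum_mono) auto
      also have "\<dots> \<le> norm w"
        using insert.hyps by (intro sum_abs_lookup_le_norm) auto
      finally have "norm (proj J w + r *\<^sub>R unit_vec i) < d"
        using insert.prems(2) by simp
      moreover have "z - (?y + r *\<^sub>R unit_vec i) = - (proj J w + r *\<^sub>R unit_vec i)"
        by simp
      ultimately show ?thesis
        unfolding mem_ball dist_norm by (metis norm_minus_cancel)
    qed
    have i: "i \<in> I" using insert.prems by auto
    let ?\<phi> = "\<lambda>r. f (?y + r *\<^sub>R unit_vec i) - r * g i z"
    have d\<phi>: "(?\<phi> has_real_derivative g i (?y + r *\<^sub>R unit_vec i) - g i z) (at r within ?S)"
      if "r \<in> ?S" for r
    proof -
      have "((\<lambda>h. f ((?y + r *\<^sub>R unit_vec i) + h *\<^sub>R unit_vec i)) has_real_derivative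
          g i (?y + r *\<^sub>R unit_vec i)) (at 0)"
        using der[OF i] in_ball[OF that] d(2) by blast
      then have "((\<lambda>h. f (?y + (h + r) *\<^sub>R unit_vec i)) has_real_derivative
          g i (?y + r *\<^sub>R unit_vec i)) (at 0)"
        by (simp add: algebra_simps)
      then have "((\<lambda>r. f (?y + r *\<^sub>R unit_vec i)) has_real_derivative
          g i (?y + r *\<^sub>R unit_vec i)) (at (0 + r))"
        by (subst DERIV_shift) simp
      then have "((\<lambda>r. f (?y + r *\<^sub>R unit_vec i)) has_real_derivative
          g i (?y + r *\<^sub>R unit_vec i)) (at r within ?S)"
        by (simp add: has_field_derivative_at_within)
      then show ?thesis
        by (auto intro!: derivative_eq_intros)
    qed
    have "norm (?\<phi> ?a - ?\<phi> 0) \<le> e * norm (?a - 0)"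
    proof (rule field_differentiable_bound[OF _ d\<phi>])
      show "convex ?S" by (rule convex_real_interval)
      show "norm (g i (?y + r *\<^sub>R unit_vec i) - g i z) \<le> e" if "r \<in> ?S" for r
        using d(3)[OF i in_ball[OF that]] by simp
    qed auto
    moreover have "?y + ?a *\<^sub>R unit_vec i = z + proj (insert i J) w"
      using insert.hyps by (simp add: tup_def algebra_simps)
    ultimately have "\<bar>f (z + proj (insert i J) w) - f ?y - ?a * g i z\<bar> \<le> e * \<bar>?a\<bar>"
      by simp
    moreover have "\<bar>f ?y - f z - (\<Sum>i\<in>J. Poly_Mapping.lookup w i * g i z)\<bar>
      \<le> e * (\<Sum>i\<in>J. \<bar>Poly_Mapping.lookup w i\<bar>)"
      using insert.prems by (intro insert.IH) auto
    ultimately show ?case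
      using insert.hyps by (simp add: algebra_simps)
  qed
  have "norm (f y - f z - (\<Sum>i\<in>I. Poly_Mapping.lookup (y - z) i * g i z)) \<le> e * norm (y - z)"
    if "norm (y - z) < d" for y
  proof -
    have "f (z + proj I (y - z)) = f y"
      using proj[of y] proj[of "z + proj I (y - z)"]
      by (metis add_diff_cancel_left' assms(1) diff_add_cancel proj_add proj_tup)
    then have "\<bar>f y - f z - (\<Sum>i\<in>I. Poly_Mapping.lookup (y - z) i * g i z)\<bar>
        \<le> e * (\<Sum>i\<in>I. \<bar>Poly_Mapping.lookup (y - z) i\<bar>)"
      using key[of I "y - z"] that by simp
    also have "\<dots> \<le> e * norm (y - z)"
      using e by (intro mult_left_mono sum_abs_lookup_le_norm assms(1)) auto
    finally show ?thesis by simp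
  qed
  then show "\<exists>d>0. \<forall>y. norm (y - z) < d \<longrightarrow>
      norm (f y - f z - (\<Sum>i\<in>I. Poly_Mapping.lookup (y - z) i * g i z)) \<le> e * norm (y - z)"
    using d(1) by blast
qed

definition pd :: "'k \<Rightarrow> (('k \<Rightarrow>\<^sub>0 real) \<Rightarrow> real) \<Rightarrow> ('k \<Rightarrow>\<^sub>0 real) \<Rightarrow> real" where
  "pd i f z = frechet_derivative f (at z) (unit_vec i)"

lemma smooth_on_pd: "smooth_on Q f \<Longrightarrow> open Q \<Longrightarrow> smooth_on Q (pd i f)"
  using smooth_on_frechet[of Q f] by (simp add: pd_def[abs_def])

lemma smooth_at_pd: "smooth_at f z \<Longrightarrow> smooth_at (pd i f) z"
  using smooth_at_frechet[of f z] by (simp add: pd_def[abs_def])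

lemma frechet_tup:
  assumes "smooth_at f z"
  shows "frechet_derivative f (at z) (tup I r) = (\<Sum>i\<in>I. r i * pd i f z)"
  using has_derivative_linear[OF smooth_at_has_derivative[OF assms]]
  by (simp add: tup_def linear_sum linear_cmul pd_def)

lemma has_real_derivative_line:
  assumes "(f has_derivative f') (at (z + r *\<^sub>R w))"
  shows "((\<lambda>t. f (z + t *\<^sub>R w)) has_real_derivative f' w) (at r)"
proof -
  have "((\<lambda>t. z + t *\<^sub>R w) has_derivative (\<lambda>t. t *\<^sub>R w)) (at r)"
    by (auto intro!: derivative_eq_intros)
  from has_derivative_compose[OF this assms] show ?thesis
    by (simp add: has_field_derivative_def linear_cmul[OF has_derivative_linear[OF assms]] mult_commute_abs)
qed

lemma smooth_at_line:
  "smooth_at f z \<Longrightarrow> ((\<lambda>t. f (z + t *\<^sub>R tup I r)) has_real_derivative (\<Sum>i\<in>I. r i * pd i f z)) (at 0)"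
  using has_real_derivative_line[of f "frechet_derivative f (at z)" z 0 "tup I r"]
    smooth_at_has_derivative[of f z]
  by (simp add: frechet_tup)

text \<open>The chain rule for \<open>f \<circ> proj I = f\<close>, since \<open>proj I\<close>
  fixes the unit vector of \<open>i\<close>.\<close>

lemma pd_proj:
  assumes "smooth_on UNIV f" "finite I" "\<And>z. f (proj I z) = f z" "i \<in> I"
  shows "pd i f (proj I z) = pd i f z"
proof -
  have "(proj I has_derivative proj I) (at z)"
    unfolding tup_def by (intro bounded_linear_imp_has_derivative bounded_linear_sum
        bounded_linear_scaleR_const bounded_linear_lookup)
  moreover have "(f has_derivative frechet_derivative f (at (proj I z))) (at (proj I z))"
    by (intro smooth_on_has_derivative[OF assms(1)]) simp
  ultimately have "((\<lambda>z. f (proj I z)) has_derivative (\<lambda>w. frechet_derivative f (at (proj I z)) (proj I w))) (at z)"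
    by (rule has_derivative_compose)
  then have "frechet_derivative f (at z) = (\<lambda>w. frechet_derivative f (at (proj I z)) (proj I w))"
    using frechet_derivative_at[symmetric] assms(3) by simp
  then show ?thesis
    using assms(2,4) by (simp add: pd_def proj_unit)
qed

section \<open>Hadamard's lemma, by integration along one coordinate\<close>

definition scale_coord :: "'k \<Rightarrow> real \<Rightarrow> ('k \<Rightarrow>\<^sub>0 real) \<Rightarrow> ('k \<Rightarrow>\<^sub>0 real)" where
  "scale_coord k s z = z + ((s - 1) * Poly_Mapping.lookup z k) *\<^sub>R unit_vec k"

text \<open>The power \<open>s ^ m\<close> makes the family closed under partial derivatives: the
  one in the coordinate \<open>k\<close> produces a further factor \<open>s\<close>, the others
  none. Hadamard's lemma itself uses m = 0.\<close>

definition coord_integral :: "'k \<Rightarrow> nat \<Rightarrow> (('k \<Rightarrow>\<^sub>0 real) \<Rightarrow> real) \<Rightarrow> ('k \<Rightarrow>\<^sub>0 real) \<Rightarrow> real" where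
  "coord_integral k m h z = integral (cbox 0 1) (\<lambda>s. s ^ m * h (scale_coord k s z))"

lemma scale_coord_unit:
  "scale_coord k s (z + r *\<^sub>R unit_vec i) = scale_coord k s z + r *\<^sub>R ((if i = k then s else 1) *\<^sub>R unit_vec i)"
  by (simp add: scale_coord_def lookup_add lookup_single algebra_simps)

lemma scale_coord_proj:
  "finite I \<Longrightarrow> k \<in> I \<Longrightarrow> scale_coord k s (proj I z) = proj I (scale_coord k s z)"
  by (rule poly_mapping_eqI) (auto simp: scale_coord_def lookup_add lookup_tup lookup_single when_def)

lemma continuous_on_scale_coord:
  "continuous_on UNIV h \<Longrightarrow> continuous_on A a \<Longrightarrow> continuous_on A b \<Longrightarrow>
    continuous_on A (\<lambda>p. h (scale_coord k (a p) (b p)) :: real)"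
  by (rule continuous_on_compose2[of UNIV h])
    (auto simp: scale_coord_def intro!: continuous_intros)

lemma continuous_on_coord_integral:
  assumes "continuous_on UNIV h"
  shows "continuous_on UNIV (coord_integral k m h)"
proof -
  have "continuous_on (UNIV \<times> cbox 0 1) (\<lambda>(z, s::real). s ^ m * h (scale_coord k s z))"
    unfolding case_prod_unfold
    by (intro continuous_on_mult continuous_on_scale_coord[OF assms] continuous_intros)
  from integral_continuous_on_param[OF this] show ?thesis
    by (simp add: coord_integral_def[abs_def])
qed

text \<open>Differentiation under the integral sign: the partial derivative at \<open>i\<close> is
  the coordinate integral of \<open>pd i h\<close>, with exponent \<open>Suc m\<close> if i = k and
  \<open>m\<close> otherwise. Hence the induction on \<open>n\<close> runs with \<open>m\<close> and
  \<open>h\<close> arbitrary.\<close>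

lemma Ck_coord_integral:
  assumes "finite I" "k \<in> I"
  shows "smooth_on UNIV h \<Longrightarrow> (\<And>z. h (proj I z) = h z) \<Longrightarrow> Ck n UNIV (coord_integral k m h)"
proof (induction n arbitrary: m h)
  case 0
  then show ?case by (simp add: continuous_on_coord_integral smooth_on_continuous)
next
  case (Suc n)
  let ?m = "\<lambda>i. if i = k then Suc m else m"
  have sm: "smooth_on UNIV (pd i h)" for i
    by (intro smooth_on_pd Suc.prems) simp
  note cont = smooth_on_continuous[OF sm] smooth_on_continuous[OF Suc.prems(1)]
  have der: "((\<lambda>r. coord_integral k m h (z + r *\<^sub>R unit_vec i)) has_real_derivative
      coord_integral k (?m i) (pd i h) z) (at 0)" if "i \<in> I" for i z
  proof -
    let ?c = "\<lambda>s. if i = k then s else 1 :: real"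
    let ?fx = "\<lambda>r s. s ^ m * (?c s * pd i h (scale_coord k s (z + r *\<^sub>R unit_vec i)))"
    have "((\<lambda>r. integral (cbox 0 1) (\<lambda>s. s ^ m * h (scale_coord k s (z + r *\<^sub>R unit_vec i))))
        has_real_derivative integral (cbox 0 1) (?fx 0)) (at 0 within UNIV)"
    proof (rule leibniz_rule_field_derivative)
      fix r s :: real
      let ?w = "?c s *\<^sub>R unit_vec i"
      have d: "(h has_derivative frechet_derivative h (at (scale_coord k s z + r *\<^sub>R ?w)))
          (at (scale_coord k s z + r *\<^sub>R ?w))"
        by (intro smooth_on_has_derivative[OF Suc.prems(1)]) simp
      have "((\<lambda>r. s ^ m * h (scale_coord k s z + r *\<^sub>R ?w)) has_real_derivative
          s ^ m * frechet_derivative h (at (scale_coord k s z + r *\<^sub>R ?w)) ?w) (at r)"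
        by (intro DERIV_cmult has_real_derivative_line[OF d])
      then show "((\<lambda>r. s ^ m * h (scale_coord k s (z + r *\<^sub>R unit_vec i))) has_real_derivative ?fx r s)
          (at r within UNIV)"
        unfolding scale_coord_unit pd_def linear_cmul[OF has_derivative_linear[OF d]] by simp
    next
      fix r :: real
      show "(\<lambda>s. s ^ m * h (scale_coord k s (z + r *\<^sub>R unit_vec i))) integrable_on cbox 0 1"
        by (intro integrable_continuous continuous_on_mult continuous_on_scale_coord[OF cont(2)] continuous_intros)
    next
      have "continuous_on A (\<lambda>p::real \<times> real. ?c (snd p))" for A
        by (cases "i = k") (auto intro!: continuous_intros)
      then show "continuous_on (UNIV \<times> cbox 0 1) (\<lambda>(r, s). ?fx r s)"
        unfolding case_prod_unfold
        by (intro continuous_on_mult continuous_on_scale_coord[OF cont(1)] continuous_intros)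
    qed auto
    moreover have "integral (cbox 0 1) (?fx 0) = coord_integral k (?m i) (pd i h) z"
      unfolding coord_integral_def by (rule integral_cong) auto
    ultimately show ?thesis
      unfolding coord_integral_def by simp
  qed
  have "(coord_integral k m h has_derivative
      (\<lambda>w. \<Sum>i\<in>I. Poly_Mapping.lookup w i * coord_integral k (?m i) (pd i h) z)) (at z)" for z
  proof (rule has_derivative_of_partials[OF assms(1) open_UNIV UNIV_I _ der])
    show "coord_integral k m h (proj I z) = coord_integral k m h z" for z
      unfolding coord_integral_def using assms Suc.prems(2) by (simp add: scale_coord_proj)
    show "continuous_on UNIV (coord_integral k (?m i) (pd i h))" for i
      by (intro continuous_on_coord_integral cont)
  qed
  moreover have "Ck n UNIV (\<lambda>z. \<Sum>i\<in>I. Poly_Mapping.lookup w i * coord_integral k (?m i) (pd i h) z)" for w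
    using pd_proj[OF Suc.prems(1) assms(1) Suc.prems(2)]
    by (intro Ck_sum Ck_mult Ck_const assms Suc.IH sm) auto
  ultimately show ?case
    unfolding Ck.simps
    by (intro exI[of _ "\<lambda>z w. \<Sum>i\<in>I. Poly_Mapping.lookup w i * coord_integral k (?m i) (pd i h) z"]) auto
qed

text \<open>\<open>q z\<close> is the integral over \<open>s\<close> of the partial derivative
  \<open>pd k h\<close> along the segment from \<open>scale_coord k 0 z\<close> to \<open>z\<close>;
  \<open>h\<close> is smooth on the whole space, so no segment can leave its domain. The last
  property fixes \<open>q\<close> where the coordinate \<open>k\<close> is 0 and the equation before
  it says nothing.\<close>

lemma hadamard_division:
  assumes "finite I" "k \<in> I" "smooth_on UNIV h" "\<And>z. h (proj I z) = h z"
  obtains q where "smooth_on UNIV q"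
    "\<And>z. h z - h (scale_coord k 0 z) = Poly_Mapping.lookup z k * q z"
    "\<And>z. Poly_Mapping.lookup z k = 0 \<Longrightarrow> q z = pd k h z"
proof (rule that[of "coord_integral k 0 (pd k h)"])
  have sm: "smooth_on UNIV (pd k h)"
    by (intro smooth_on_pd assms) simp
  show "smooth_on UNIV (coord_integral k 0 (pd k h))"
    unfolding smooth_on_def
    using Ck_coord_integral[OF assms(1,2) sm] pd_proj[OF assms(3,1,4,2)] by blast
  show "coord_integral k 0 (pd k h) z = pd k h z" if "Poly_Mapping.lookup z k = 0" for z
    using that by (simp add: coord_integral_def scale_coord_def)
  show "h z - h (scale_coord k 0 z) = Poly_Mapping.lookup z k * coord_integral k 0 (pd k h) z" for z
  proof -
    let ?a = "Poly_Mapping.lookup z k"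
    have eq: "scale_coord k s z = (z - ?a *\<^sub>R unit_vec k) + s *\<^sub>R (?a *\<^sub>R unit_vec k)" for s
      by (simp add: scale_coord_def algebra_simps)
    have "((\<lambda>s. h (scale_coord k s z)) has_real_derivative ?a * pd k h (scale_coord k s z)) (at s)" for s
    proof -
      have d: "(h has_derivative frechet_derivative h (at (scale_coord k s z))) (at (scale_coord k s z))"
        by (intro smooth_on_has_derivative[OF assms(3)]) simp
      then have "((\<lambda>s. h (scale_coord k s z)) has_real_derivative
          frechet_derivative h (at (scale_coord k s z)) (?a *\<^sub>R unit_vec k)) (at s)"
        unfolding eq by (rule has_real_derivative_line)
      then show ?thesis
        by (simp add: linear_cmul[OF has_derivative_linear[OF d]] pd_def)
    qed
    then have "((\<lambda>s. ?a * pd k h (scale_coord k s z)) has_integral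
        h (scale_coord k 1 z) - h (scale_coord k 0 z)) {0..1}"
      by (intro fundamental_theorem_of_calculus)
        (auto simp flip: has_real_derivative_iff_has_vector_derivative intro: has_field_derivative_at_within)
    then have "integral {0..1} (\<lambda>s. ?a * pd k h (scale_coord k s z)) = h (scale_coord k 1 z) - h (scale_coord k 0 z)"
      by (rule integral_unique)
    then show ?thesis
      by (simp add: coord_integral_def scale_coord_def[of k 1])
  qed
qed

text \<open>(PF) accepts only functions defined on a full product of \<open>U\<close> with a vector
  space, so a \<open>G\<close> that is smooth near a compact set is replaced by a global
  \<open>H\<close> that agrees with it near that set and still depends on the coordinates in
  \<open>I\<close> alone.\<close>

lemma smooth_cutoff:
  fixes G :: "('k \<Rightarrow>\<^sub>0 real) \<Rightarrow> real"
  assumes "finite I" "compact K" "K \<subseteq> Q" "open Q" "smooth_on Q G" "\<And>z. z \<in> K \<Longrightarrow> proj I z = z"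
  obtains H P where "smooth_on UNIV H" "\<And>z. H (proj I z) = H z" "open P" "K \<subseteq> P"
    "\<And>z. z \<in> P \<Longrightarrow> proj I z = z \<Longrightarrow> z \<in> Q \<and> H z = G z"
proof -
  obtain \<beta> :: "real \<Rightarrow> real" where \<beta>: "smooth_on UNIV \<beta>"
    "\<And>x. \<bar>x\<bar> \<le> 1 \<Longrightarrow> \<beta> x = 1" "\<And>x. \<bar>x\<bar> \<ge> 2 \<Longrightarrow> \<beta> x = 0"
    using smooth_bump_real by blast
  have "\<forall>z\<in>K. \<exists>r>0. \<forall>w. (\<forall>i\<in>I. \<bar>Poly_Mapping.lookup w i - Poly_Mapping.lookup z i\<bar> < r) \<longrightarrow> proj I w \<in> Q"
    using open_contains_box[OF assms(1,4)] assms(3,6) by (metis subsetD)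
  then obtain r' where r': "\<And>z. z \<in> K \<Longrightarrow> r' z > 0"
    "\<And>z w. z \<in> K \<Longrightarrow> (\<And>i. i \<in> I \<Longrightarrow> \<bar>Poly_Mapping.lookup w i - Poly_Mapping.lookup z i\<bar> < r' z) \<Longrightarrow> proj I w \<in> Q"
    by metis
  \<comment> \<open>The factor 3 leaves room: the bumps are 1 within \<open>r z\<close>, they vanish
    from \<open>2 * r z\<close> on, and the box of radius \<open>3 * r z\<close> still lies over
    \<open>Q\<close>.\<close>
  define r where "r z = r' z / 3" for z
  define box where "box z = {w. \<forall>i\<in>I. \<bar>Poly_Mapping.lookup w i - Poly_Mapping.lookup z i\<bar> < r z}" for z
  have open_box: "open (box z)" for z
  proof -
    have "box z = (\<Inter>i\<in>I. {w. \<bar>Poly_Mapping.lookup w i - Poly_Mapping.lookup z i\<bar> < r z})"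
      by (auto simp: box_def)
    then show ?thesis
      using assms(1) by (auto intro!: open_INT open_Collect_less continuous_intros)
  qed
  have "K \<subseteq> (\<Union>z\<in>K. box z)"
    using r' by (auto simp: box_def r_def)
  then obtain Z where Z: "Z \<subseteq> K" "finite Z" "K \<subseteq> (\<Union>z\<in>Z. box z)"
    using compactE_image[OF assms(2), of K box] open_box by blast
  define cut where "cut z w = (\<Prod>i\<in>I. \<beta> ((Poly_Mapping.lookup w i - Poly_Mapping.lookup z i) / r z))" for z w
  \<comment> \<open>1 as soon as one bump is 1, and 0 where all bumps are 0; unlike a normalised sum
    it involves no division.\<close>
  define X where "X w = 1 + (-1) * (\<Prod>z\<in>Z. 1 + (-1) * cut z w)" for w
  have "smooth_on UNIV (cut z)" for z
  proof -
    have "smooth_on UNIV (\<lambda>w. (Poly_Mapping.lookup w i + (- Poly_Mapping.lookup z i)) * (1 / r z))" for i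
      by (intro smooth_on_mult smooth_on_add smooth_on_const smooth_on_lookup)
    then show ?thesis
      unfolding cut_def using assms(1)
      by (intro smooth_on_prod smooth_on_compose_real[OF _ \<beta>(1)]) auto
  qed
  then have smX: "smooth_on UNIV X"
    unfolding X_def using Z(2) by (intro smooth_on_add smooth_on_mult smooth_on_const smooth_on_prod)
  have X1: "X w = 1" if w: "w \<in> (\<Union>z\<in>Z. box z)" for w
  proof -
    obtain z where z: "z \<in> Z" "w \<in> box z" using w by auto
    have "cut z w = 1"
      unfolding cut_def
    proof (intro prod.neutral ballI \<beta>(2))
      fix i assume "i \<in> I"
      moreover have "r z > 0" using z(1) Z(1) r'(1) by (auto simp: r_def)
      ultimately show "\<bar>(Poly_Mapping.lookup w i - Poly_Mapping.lookup z i) / r z\<bar> \<le> 1"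
        using z(2) by (simp add: box_def abs_divide less_imp_le)
    qed
    then show ?thesis
      using z(1) Z(2) by (auto simp: X_def intro!: prod_zero)
  qed
  \<comment> \<open>An open set on which every bump vanishes. By the choice of the radii it contains
    each point whose projection lies outside \<open>Q\<close>, so \<open>H\<close> is locally 0
    around such a point.\<close>
  define N where "N = (\<Inter>z\<in>Z. \<Union>i\<in>I. {w. 2 * r z < \<bar>Poly_Mapping.lookup w i - Poly_Mapping.lookup z i\<bar>})"
  have "open N"
    unfolding N_def using Z(2) by (intro open_INT open_UN ballI open_Collect_less continuous_intros)
  have X0: "X w = 0" if "w \<in> N" for w
  proof -
    have "cut z w = 0" if "z \<in> Z" for z
    proof -
      obtain i where i: "i \<in> I" "2 * r z < \<bar>Poly_Mapping.lookup w i - Poly_Mapping.lookup z i\<bar>"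
        using \<open>w \<in> N\<close> \<open>z \<in> Z\<close> by (auto simp: N_def)
      have "r z > 0" using that Z(1) r'(1) by (auto simp: r_def)
      then have "\<beta> ((Poly_Mapping.lookup w i - Poly_Mapping.lookup z i) / r z) = 0"
        using i(2) by (intro \<beta>(3)) (simp add: abs_divide field_simps)
      then show ?thesis
        unfolding cut_def using assms(1) i(1) by (auto intro!: prod_zero)
    qed
    then show ?thesis by (simp add: X_def)
  qed
  have outside: "w \<in> N" if "proj I w \<notin> Q" for w
  proof -
    have "\<exists>i\<in>I. 2 * r z < \<bar>Poly_Mapping.lookup w i - Poly_Mapping.lookup z i\<bar>" if "z \<in> Z" for z
    proof -
      have "z \<in> K" using that Z(1) by auto
      then obtain i where "i \<in> I" "\<not> \<bar>Poly_Mapping.lookup w i - Poly_Mapping.lookup z i\<bar> < r' z"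
        using r'(2)[of z w] \<open>proj I w \<notin> Q\<close> by blast
      moreover have "2 * r z < r' z" using r'(1)[OF \<open>z \<in> K\<close>] by (simp add: r_def)
      ultimately show ?thesis by (intro bexI[of _ i]) auto
    qed
    then show ?thesis by (auto simp: N_def)
  qed
  define H where "H w = (if proj I w \<in> Q then X w * G (proj I w) else 0)" for w
  have "smooth_at H w" for w
  proof (cases "proj I w \<in> Q")
    case True
    have o: "open (proj I -` Q)"
      using continuous_on_proj[of UNIV I] assms(4) by (metis continuous_on_open_vimage open_UNIV Int_UNIV_right)
    have "smooth_at (\<lambda>w. G (proj I w)) w"
      using smooth_on_imp_at[OF assms(5,4) True]
      by (intro smooth_at_compose_tup[of I "\<lambda>i w. Poly_Mapping.lookup w i"] assms(1) smooth_at_lookup)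
    then have "smooth_at (\<lambda>w. X w * G (proj I w)) w"
      by (rule smooth_at_mult[OF smooth_on_imp_at[OF smX open_UNIV UNIV_I]])
    then show ?thesis
      by (rule smooth_at_cong[OF _ o]) (use True in \<open>auto simp: H_def\<close>)
  next
    case False
    show ?thesis
      by (rule smooth_at_cong[OF smooth_at_const \<open>open N\<close> outside[OF False], of 0]) (simp add: H_def X0)
  qed
  then have "smooth_on UNIV H" by (intro smooth_on_local)
  moreover have "X (proj I z) = X z" for z
    unfolding X_def cut_def using assms(1) by (simp add: lookup_tup)
  then have "H (proj I z) = H z" for z
    using assms(1) by (simp add: H_def proj_tup)
  moreover have "z \<in> Q \<and> H z = G z" if "z \<in> (\<Union>z\<in>Z. box z)" "proj I z = z" for z
  proof -
    have "proj I z \<in> Q"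
    proof (rule ccontr)
      assume "proj I z \<notin> Q"
      then have "z \<in> N" by (rule outside)
      then show False using X0 X1[OF that(1)] by force
    qed
    then show ?thesis using X1[OF that(1)] that(2) by (simp add: H_def)
  qed
  ultimately show ?thesis
    using that[of H "\<Union>z\<in>Z. box z"] Z(3) open_box by blast
qed

section \<open>The subspaces \<open>Rn n\<close>, and Bastiani smoothness in coordinates\<close>

lemma Rn_iff_proj: "x \<in> Rn n \<longleftrightarrow> proj {..<n} x = x"
proof
  assume "x \<in> Rn n"
  then show "proj {..<n} x = x"
    by (intro poly_mapping_eqI) (auto simp: lookup_tup Rn_iff in_keys_iff subset_iff)
next
  assume x: "proj {..<n} x = x"
  have "Poly_Mapping.keys (proj {..<n} x) \<subseteq> {..<n}"
    by (auto simp: lookup_tup in_keys_iff split: if_splits)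
  then show "x \<in> Rn n" by (simp add: x Rn_iff)
qed

lemma tup_in_Rn: "tup {..<n} r \<in> Rn n"
  by (simp add: Rn_iff_proj proj_tup)

lemma lookup_Rn: "x \<in> Rn n \<Longrightarrow> i \<ge> n \<Longrightarrow> Poly_Mapping.lookup x i = 0"
  by (auto simp: Rn_iff in_keys_iff subset_iff)

lemma Rn_eqI:
  assumes "x \<in> Rn n" "y \<in> Rn n" "\<And>i. i < n \<Longrightarrow> Poly_Mapping.lookup x i = Poly_Mapping.lookup y i"
  shows "x = y"
proof -
  have "proj {..<n} x = proj {..<n} y" using assms(3) by (intro tup_cong) simp
  then show ?thesis using assms(1,2) by (simp add: Rn_iff_proj)
qed

lemma subspace_Rn: "subspace (Rn n)"
  by (simp add: Rn_def)

lemma unit_vec_in_Rn: "i < n \<Longrightarrow> unit_vec i \<in> Rn n"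
  by (simp add: Rn_iff)

text \<open>\<open>Rn n\<close> is a proper subspace of \<open>vec\<close>. Its open sets are
  thickened to cylinders, on which functions composed with \<open>proj\<close> have full
  derivatives.\<close>

lemma open_proj_vimage:
  assumes "openin (top_of_set (Rn n)) U"
  shows "open {z. proj {..<n} z \<in> U}"
proof -
  obtain T where T: "open T" "U = Rn n \<inter> T"
    using assms by (auto simp: openin_open)
  have "{z. proj {..<n} z \<in> U} = proj {..<n} -` T"
    by (auto simp: T(2) tup_in_Rn)
  then show ?thesis
    using continuous_on_proj[of UNIV "{..<n}"] T(1) by (metis continuous_on_open_vimage open_UNIV Int_UNIV_right)
qed

text \<open>The derivative of order \<open>j\<close> in the directions \<open>y 0\<close>, ...,
  \<open>y (j - 1)\<close>, expanded into partial derivatives, with \<open>y 0\<close> the direction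
  that is differentiated first.\<close>

fun iterD :: "'k set \<Rightarrow> nat \<Rightarrow> (('k \<Rightarrow>\<^sub>0 real) \<Rightarrow> real) \<Rightarrow> (nat \<Rightarrow> ('k \<Rightarrow>\<^sub>0 real)) \<Rightarrow> ('k \<Rightarrow>\<^sub>0 real) \<Rightarrow> real" where
  "iterD I 0 f y z = f z"
| "iterD I (Suc j) f y z = (\<Sum>i\<in>I. Poly_Mapping.lookup (y 0) i * iterD I j (pd i f) (\<lambda>l. y (Suc l)) z)"

lemma iterD_cong: "(\<And>l. l < j \<Longrightarrow> y l = y' l) \<Longrightarrow> iterD I j f y z = iterD I j f y' z"
proof (induction j arbitrary: f y y')
  case (Suc j)
  have "y 0 = y' 0" by (rule Suc.prems) simp
  moreover have "iterD I j g (\<lambda>l. y (Suc l)) z = iterD I j g (\<lambda>l. y' (Suc l)) z" for g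
    by (rule Suc.IH) (simp add: Suc.prems)
  ultimately show ?case by simp
qed simp

text \<open>\<open>iterD\<close> unfolds at the first direction, whereas a further derivative is
  taken at the last one, in slot \<open>j\<close>. The induction bridges this with \<open>f\<close>
  and \<open>y\<close> arbitrary: the new derivative passes through the constant coefficients of
  \<open>y 0\<close>.\<close>

lemma iterD_has_derivative:
  assumes "finite I" "open P" "z \<in> P" "proj I w = w"
  shows "smooth_on P f \<Longrightarrow>
    ((\<lambda>t. iterD I j f y (z + t *\<^sub>R w)) has_real_derivative iterD I (Suc j) f (y(j := w)) z) (at 0)"
proof (induction j arbitrary: f y)
  case 0
  have "((\<lambda>t. f (z + t *\<^sub>R proj I w)) has_real_derivative (\<Sum>i\<in>I. Poly_Mapping.lookup w i * pd i f z)) (at 0)"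
    by (rule smooth_at_line[OF smooth_on_imp_at[OF 0 assms(2,3)]])
  then show ?case by (simp add: assms(4))
next
  case (Suc j)
  have "((\<lambda>t. iterD I j (pd i f) (\<lambda>l. y (Suc l)) (z + t *\<^sub>R w)) has_real_derivative
      iterD I (Suc j) (pd i f) ((\<lambda>l. y (Suc l))(j := w)) z) (at 0)" for i
    by (rule Suc.IH[OF smooth_on_pd[OF Suc.prems assms(2)]])
  then have "((\<lambda>t. \<Sum>i\<in>I. Poly_Mapping.lookup (y 0) i * iterD I j (pd i f) (\<lambda>l. y (Suc l)) (z + t *\<^sub>R w))
      has_real_derivative (\<Sum>i\<in>I. Poly_Mapping.lookup (y 0) i *
        iterD I (Suc j) (pd i f) ((\<lambda>l. y (Suc l))(j := w)) z)) (at 0)"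
    by (intro DERIV_sum DERIV_cmult)
  moreover have "(\<lambda>l. y (Suc l))(j := w) = (\<lambda>l. (y(Suc j := w)) (Suc l))"
    by auto
  ultimately show ?case
    by (simp only: iterD.simps) simp
qed

lemma continuous_map_lookup:
  assumes "continuous_map X euclidean u"
  shows "continuous_map X euclideanreal (\<lambda>x. Poly_Mapping.lookup (u x) i :: real)"
proof -
  have "continuous_map euclidean euclideanreal (\<lambda>z. Poly_Mapping.lookup z i :: real)"
    by (simp add: continuous_on_lookup continuous_on_id)
  from continuous_map_compose[OF assms this] show ?thesis by (simp add: o_def)
qed

lemma continuous_map_iterD:
  assumes "finite I" "open P" "continuous_map X (top_of_set P) u"
  shows "smooth_on P f \<Longrightarrow> (\<And>l. l < j \<Longrightarrow> continuous_map X euclidean (\<lambda>x. y x l)) \<Longrightarrow>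
    continuous_map X euclideanreal (\<lambda>x. iterD I j f (y x) (u x))"
proof (induction j arbitrary: f y)
  case 0
  have "continuous_map (top_of_set P) euclideanreal f"
    using smooth_on_continuous[OF 0(1)] by auto
  from continuous_map_compose[OF assms(3) this] show ?case
    by (simp add: o_def)
next
  case (Suc j)
  have "continuous_map X euclideanreal (\<lambda>x. iterD I j (pd i f) (\<lambda>l. y x (Suc l)) (u x))" for i
    using Suc.prems(2) by (intro Suc.IH smooth_on_pd Suc.prems(1) assms(2)) auto
  moreover have "continuous_map X euclideanreal (\<lambda>x. Poly_Mapping.lookup (y x 0) i)" for i
    by (intro continuous_map_lookup Suc.prems(2)) simp
  ultimately show ?case
    by (simp add: continuous_map_sum continuous_map_real_mult assms(1))
qed

lemma continuous_map_scaleR_const: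
  fixes b :: "'b::real_normed_vector"
  assumes "continuous_map X euclideanreal g"
  shows "continuous_map X euclidean (\<lambda>x. g x *\<^sub>R b)"
proof -
  have "continuous_map euclideanreal euclidean (\<lambda>r. r *\<^sub>R b)"
    by (simp add: continuous_on_scaleR continuous_on_id)
  from continuous_map_compose[OF assms this] show ?thesis by (simp add: o_def)
qed

lemma lcs_top_sub_lcs [simp]: "lcs_top (sub_lcs S) = top_of_set S"
  and lcs_ops_sub_lcs [simp]: "lcs_add (sub_lcs S) = (+)" "lcs_scale (sub_lcs S) = (*\<^sub>R)"
  by (simp_all add: sub_lcs_def)

lemma sum_difference_quotient:
  fixes b :: "'j \<Rightarrow> 'w::real_vector"
  shows "(\<Sum>j\<in>J. ((a j - c j) / t) *\<^sub>R b j) =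
    (1 / t) *\<^sub>R ((\<Sum>j\<in>J. a j *\<^sub>R b j) + (- 1) *\<^sub>R (\<Sum>j\<in>J. c j *\<^sub>R b j))"
proof -
  have "(\<Sum>j\<in>J. a j *\<^sub>R b j) + (- 1) *\<^sub>R (\<Sum>j\<in>J. c j *\<^sub>R b j) = (\<Sum>j\<in>J. (a j - c j) *\<^sub>R b j)"
    by (simp add: sum_subtractf scaleR_left_diff_distrib)
  then show ?thesis
    by (simp add: scaleR_sum_right)
qed

text \<open>A criterion for the finite-dimensional sources that occur, products included:
  \<open>f\<close> is a finite combination of smooth functions of a coordinate map \<open>L\<close>
  which is continuous and carries lines to lines. The required iterated derivatives are
  \<open>iterD\<close> in the directions \<open>L (y l)\<close>.\<close>

lemma smooth_between_coords:
  fixes E :: "'v lcs" and L :: "'v \<Rightarrow> ('k \<Rightarrow>\<^sub>0 real)" and b :: "'j \<Rightarrow> 'w::real_normed_vector"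
  assumes "finite I" "finite J" "open P" and sm: "\<And>j. j \<in> J \<Longrightarrow> smooth_on P (G j)"
    and Lc: "continuous_map (lcs_top E) euclidean L"
    and Lp: "\<And>x. x \<in> topspace (lcs_top E) \<Longrightarrow> proj I (L x) = L x"
    and Ladd: "\<And>x y t. x \<in> topspace (lcs_top E) \<Longrightarrow> y \<in> topspace (lcs_top E) \<Longrightarrow>
      L (lcs_add E x (lcs_scale E t y)) = L x + t *\<^sub>R L y"
    and U: "U \<subseteq> topspace (lcs_top E)" "\<And>x. x \<in> U \<Longrightarrow> L x \<in> P"
    and S: "subspace S" "\<And>j. j \<in> J \<Longrightarrow> b j \<in> S"
    and eq: "\<And>x. x \<in> U \<Longrightarrow> f x = (\<Sum>j\<in>J. G j (L x) *\<^sub>R b j)"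
  shows "smooth_between E (sub_lcs S) U f"
proof -
  define d where "d n x y = (\<Sum>j\<in>J. iterD I n (G j) (\<lambda>l. L (y l)) (L x) *\<^sub>R b j)" for n x and y :: "nat \<Rightarrow> 'v"
  have dS: "d n x y \<in> S" for n x y
    unfolding d_def by (intro subspace_sum S subspace_scale)
  have cont: "continuous_map (prod_topology (subtopology (lcs_top E) U) (product_topology (\<lambda>_. lcs_top E) {..<n}))
      (lcs_top (sub_lcs S)) (\<lambda>(x, y). d n x y)" for n
    unfolding lcs_top_sub_lcs
  proof (rule continuous_map_into_subtopology)
    let ?X = "prod_topology (subtopology (lcs_top E) U) (product_topology (\<lambda>_. lcs_top E) {..<n})"
    have "continuous_map (subtopology (lcs_top E) U) (top_of_set P) L"
      using U(2) by (intro continuous_map_into_subtopology continuous_map_from_subtopology Lc) auto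
    then have u: "continuous_map ?X (top_of_set P) (\<lambda>p. L (fst p))"
      using continuous_map_compose[OF continuous_map_fst] by (fastforce simp: o_def)
    have y: "continuous_map ?X euclidean (\<lambda>p. L (snd p l))" if "l < n" for l
      using continuous_map_compose[OF continuous_map_compose[OF continuous_map_snd
            continuous_map_product_projection[of l "{..<n}"]] Lc] that
      by (fastforce simp: o_def)
    show "continuous_map ?X euclidean (\<lambda>(x, y). d n x y)"
      unfolding d_def case_prod_unfold
      by (intro continuous_map_sum continuous_map_scaleR_const assms(2)
          continuous_map_iterD[OF assms(1,3) u] sm y)
  qed (use dS in auto)
  have der: "has_dir_deriv E (sub_lcs S) (\<lambda>z. d n z (restrict y {..<n})) x (y n) (d (Suc n) x y)"
    if x: "x \<in> lcs_top E interior_of U" and y: "y \<in> {..<Suc n} \<rightarrow>\<^sub>E topspace (lcs_top E)" for n x y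
  proof -
    have xU: "x \<in> U" "x \<in> topspace (lcs_top E)"
      using x interior_of_subset[of "lcs_top E" U] U(1) by auto
    have yn: "y n \<in> topspace (lcs_top E)" using y by auto
    let ?y = "\<lambda>l. L (restrict y {..<n} l)"
    have D: "((\<lambda>t. iterD I n (G j) ?y (L x + t *\<^sub>R L (y n))) has_real_derivative
        iterD I (Suc n) (G j) (\<lambda>l. L (y l)) (L x)) (at 0)" if "j \<in> J" for j
    proof -
      have "iterD I (Suc n) (G j) (?y(n := L (y n))) (L x) = iterD I (Suc n) (G j) (\<lambda>l. L (y l)) (L x)"
        by (rule iterD_cong) auto
      then show ?thesis
        using iterD_has_derivative[OF assms(1,3) U(2)[OF xU(1)] Lp[OF yn] sm[OF that], of n ?y] by simp
    qed
    have "((\<lambda>t. \<Sum>j\<in>J. ((iterD I n (G j) ?y (L x + t *\<^sub>R L (y n)) - iterD I n (G j) ?y (L x)) / t) *\<^sub>R b j)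
        \<longlongrightarrow> d (Suc n) x y) (at 0)"
      unfolding d_def using D
      by (intro tendsto_sum tendsto_scaleR tendsto_const) (simp add: DERIV_def)
    moreover have "(\<Sum>j\<in>J. ((iterD I n (G j) ?y (L x + t *\<^sub>R L (y n)) - iterD I n (G j) ?y (L x)) / t) *\<^sub>R b j)
      = (1 / t) *\<^sub>R (d n (lcs_add E x (lcs_scale E t (y n))) (restrict y {..<n}) + (- 1) *\<^sub>R d n x (restrict y {..<n}))" for t
      unfolding d_def Ladd[OF xU(2) yn] by (rule sum_difference_quotient)
    ultimately have "((\<lambda>t. (1 / t) *\<^sub>R (d n (lcs_add E x (lcs_scale E t (y n))) (restrict y {..<n})
        + (- 1) *\<^sub>R d n x (restrict y {..<n}))) \<longlongrightarrow> d (Suc n) x y) (at 0)"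
      by (simp only:)
    then show ?thesis
      unfolding has_dir_deriv_def lcs_top_sub_lcs lcs_ops_sub_lcs limitin_subtopology limitin_canonical_iff
      by (intro conjI dS always_eventually allI subspace_scale[OF S(1)] subspace_add[OF S(1)])
  qed
  show ?thesis
    unfolding smooth_between_def
  proof (intro exI[of _ d] conjI allI ballI cont)
    show "d 0 x (\<lambda>_. undefined) = f x" if "x \<in> U" for x
      using that by (simp add: eq d_def)
  qed (rule der)
qed

lemma continuous_map_pair_const:
  "continuous_map X Y f \<Longrightarrow> c \<in> topspace Z \<Longrightarrow> continuous_map X (prod_topology Y Z) (\<lambda>x. (f x, c))"
  by (simp add: continuous_map_pairwise o_def)

text \<open>Evaluated at unit vectors, the given derivatives of order \<open>j + 1\<close> are
  continuous partial derivatives of those of order \<open>j\<close>. So each \<open>d j\<close> with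
  fixed directions is of class \<open>Ck k\<close>, by induction on \<open>k\<close> with
  \<open>j\<close> arbitrary.\<close>

lemma smooth_between_imp_smooth_at:
  fixes f :: "vec \<Rightarrow> 'k \<Rightarrow>\<^sub>0 real"
  assumes "smooth_between (sub_lcs (Rn n)) (sub_lcs S) U f" "openin (top_of_set (Rn n)) U" "x \<in> U"
  shows "smooth_at (\<lambda>z. Poly_Mapping.lookup (f (proj {..<n} z)) i) x"
proof -
  obtain d where D: "\<forall>x\<in>U. d 0 x (\<lambda>_. undefined) = f x"
    "\<forall>j. continuous_map (prod_topology (subtopology (top_of_set (Rn n)) U)
          (product_topology (\<lambda>_. top_of_set (Rn n)) {..<j})) (top_of_set S) (\<lambda>(x, y). d j x y)"
    "\<forall>j. \<forall>x \<in> top_of_set (Rn n) interior_of U. \<forall>y \<in> {..<Suc j} \<rightarrow>\<^sub>E Rn n.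
        has_dir_deriv (sub_lcs (Rn n)) (sub_lcs S) (\<lambda>z. d j z (restrict y {..<j})) x (y j) (d (Suc j) x y)"
    using assms(1) unfolding smooth_between_def lcs_top_sub_lcs topspace_euclidean_subtopology by blast
  note d0 = D(1)[rule_format] and dc = D(2)[rule_format] and dd = D(3)[rule_format]
  define Q where "Q = {z. proj {..<n} z \<in> U}"
  have Q: "open Q" unfolding Q_def by (rule open_proj_vimage[OF assms(2)])
  have UR: "U \<subseteq> Rn n" using openin_subset[OF assms(2)] by simp
  have cont: "continuous_on Q (\<lambda>z. Poly_Mapping.lookup (d j (proj {..<n} z) y) i)"
    if y: "y \<in> {..<j} \<rightarrow>\<^sub>E Rn n" for j y
  proof -
    have "continuous_map (top_of_set Q) (subtopology (top_of_set (Rn n)) U) (proj {..<n})"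
      using UR by (intro continuous_map_into_subtopology) (auto simp: Q_def continuous_on_proj tup_in_Rn)
    then have "continuous_map (top_of_set Q) (prod_topology (subtopology (top_of_set (Rn n)) U)
        (product_topology (\<lambda>_. top_of_set (Rn n)) {..<j})) (\<lambda>z. (proj {..<n} z, y))"
      using y by (intro continuous_map_pair_const) auto
    from continuous_map_compose[OF this dc[of j]]
    have "continuous_map (top_of_set Q) (top_of_set S) (\<lambda>z. d j (proj {..<n} z) y)"
      by (simp add: o_def)
    then show ?thesis
      by (auto intro!: continuous_on_lookup dest: continuous_map_into_fulltopology)
  qed
  have "Ck k Q (\<lambda>z. Poly_Mapping.lookup (d j (proj {..<n} z) y) i)"
    if y: "y \<in> {..<j} \<rightarrow>\<^sub>E Rn n" for k j y
    using y
  proof (induction k arbitrary: j y)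
    case 0
    then show ?case using cont by simp
  next
    case (Suc k)
    let ?F = "\<lambda>z. Poly_Mapping.lookup (d j (proj {..<n} z) y) i"
    \<comment> \<open>The partial derivative of \<open>?F\<close> in the coordinate
      \<open>l\<close>: the unit vector is appended as direction number \<open>j\<close>.\<close>
    let ?g = "\<lambda>l z. Poly_Mapping.lookup (d (Suc j) (proj {..<n} z) (y(j := unit_vec l))) i"
    have y': "y(j := unit_vec l) \<in> {..<Suc j} \<rightarrow>\<^sub>E Rn n" if "l \<in> {..<n}" for l
      using Suc.prems unit_vec_in_Rn[of l n] that by (auto simp: PiE_iff extensional_def)
    have der: "((\<lambda>r. ?F (z + r *\<^sub>R unit_vec l)) has_real_derivative ?g l z) (at 0)"
      if l: "l \<in> {..<n}" and z: "z \<in> Q" for l z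
    proof -
      let ?y = "y(j := unit_vec l)" and ?x = "proj {..<n} z"
      have ry: "restrict ?y {..<j} = y"
        using Suc.prems by (auto simp: PiE_iff extensional_def fun_eq_iff)
      have "?x \<in> top_of_set (Rn n) interior_of U"
        using z assms(2) by (simp add: Q_def interior_of_openin)
      from dd[OF this y'[OF l]] have
        "((\<lambda>t. (1 / t) *\<^sub>R (d j (?x + t *\<^sub>R unit_vec l) y + (- 1) *\<^sub>R d j ?x y))
          \<longlongrightarrow> d (Suc j) ?x ?y) (at 0)"
        unfolding has_dir_deriv_def lcs_top_sub_lcs lcs_ops_sub_lcs limitin_subtopology ry by simp
      from bounded_linear.tendsto[OF bounded_linear_lookup[of i] this]
      have "((\<lambda>t. (Poly_Mapping.lookup (d j (?x + t *\<^sub>R unit_vec l) y) i - Poly_Mapping.lookup (d j ?x y) i) / t)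
          \<longlongrightarrow> ?g l z) (at 0)"
        by (simp add: lookup_minus diff_divide_distrib)
      moreover have "proj {..<n} (z + t *\<^sub>R unit_vec l) = ?x + t *\<^sub>R unit_vec l" for t
        using l by (simp add: proj_add proj_scaleR proj_unit)
      ultimately show ?thesis by (simp add: DERIV_def)
    qed
    have "(?F has_derivative (\<lambda>w. \<Sum>l<n. Poly_Mapping.lookup w l * ?g l z)) (at z)" if "z \<in> Q" for z
    proof (rule has_derivative_of_partials[OF _ Q that _ der])
      show "continuous_on Q (?g l)" if "l \<in> {..<n}" for l
        by (rule cont[OF y'[OF that]])
    qed (simp_all add: proj_tup)
    moreover have "Ck k Q (\<lambda>z. \<Sum>l<n. Poly_Mapping.lookup w l * ?g l z)" for w
      by (intro Ck_sum Ck_mult Ck_const Suc.IH y') auto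
    ultimately show ?case
      unfolding Ck.simps by (intro exI[of _ "\<lambda>z w. \<Sum>l<n. Poly_Mapping.lookup w l * ?g l z"]) auto
  qed
  from this[of "\<lambda>_. undefined" 0] have "smooth_on Q (\<lambda>z. Poly_Mapping.lookup (d 0 (proj {..<n} z) (\<lambda>_. undefined)) i)"
    by (simp add: smooth_on_def)
  then have "smooth_on Q (\<lambda>z. Poly_Mapping.lookup (f (proj {..<n} z)) i)"
    by (rule smooth_on_cong[OF Q, rotated]) (simp add: Q_def d0)
  then show ?thesis
  proof (rule smooth_on_imp_at[OF _ Q])
    have "proj {..<n} x = x" using assms(3) UR Rn_iff_proj by blast
    then show "x \<in> Q" using assms(3) by (simp add: Q_def)
  qed
qed

lemma tendsto_tup:
  "(\<And>i. i \<in> I \<Longrightarrow> (f i \<longlongrightarrow> c i) F) \<Longrightarrow> ((\<lambda>t. tup I (\<lambda>i. f i t)) \<longlongrightarrow> tup I c) F"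
  unfolding tup_def by (intro tendsto_sum tendsto_scaleR tendsto_const)

text \<open>The limit exists coordinatewise and limits are unique, so the relation turns into an
  equation with the Jacobian. Eventual membership in \<open>Rn k\<close> is what a limit in the
  subspace topology demands in addition.\<close>

lemma has_dir_deriv_coords:
  assumes "x \<in> Rn n" "y \<in> Rn n" "f x \<in> Rn k" "\<forall>\<^sub>F t in at 0. f (x + t *\<^sub>R y) \<in> Rn k"
    and sm: "\<And>i. i < k \<Longrightarrow> smooth_at (\<lambda>z. Poly_Mapping.lookup (f (proj {..<n} z)) i) x"
  shows "has_dir_deriv (sub_lcs (Rn n)) (sub_lcs (Rn k)) f x y l \<longleftrightarrow>
    l = tup {..<k} (\<lambda>i. \<Sum>a<n. Poly_Mapping.lookup y a * pd a (\<lambda>z. Poly_Mapping.lookup (f (proj {..<n} z)) i) x)"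
    (is "_ \<longleftrightarrow> l = tup {..<k} ?c")
proof -
  let ?q = "\<lambda>t. (1 / t) *\<^sub>R (f (x + t *\<^sub>R y) + (- 1) *\<^sub>R f x)"
  have px: "proj {..<n} (x + t *\<^sub>R y) = x + t *\<^sub>R y" for t
    using assms(1,2) by (simp add: proj_add proj_scaleR Rn_iff_proj)
  have lim: "((\<lambda>t. Poly_Mapping.lookup (?q t) i) \<longlongrightarrow> ?c i) (at 0)" if "i < k" for i
  proof -
    have "((\<lambda>t. Poly_Mapping.lookup (f (proj {..<n} (x + t *\<^sub>R proj {..<n} y))) i) has_real_derivative ?c i) (at 0)"
      by (rule smooth_at_line[OF sm[OF that]])
    moreover have "proj {..<n} y = y" "proj {..<n} x = x" using assms(1,2) by (simp_all add: Rn_iff_proj)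
    ultimately show ?thesis
      by (simp add: DERIV_def px lookup_minus diff_divide_distrib)
  qed
  have ev: "\<forall>\<^sub>F t in at 0. ?q t \<in> Rn k"
    using assms(4) by eventually_elim
      (intro subspace_scale[OF subspace_Rn] subspace_add[OF subspace_Rn] assms(3))
  have "((\<lambda>t. tup {..<k} (\<lambda>i. Poly_Mapping.lookup (?q t) i)) \<longlongrightarrow> tup {..<k} ?c) (at 0)"
    using lim by (intro tendsto_tup) auto
  then have tends: "(?q \<longlongrightarrow> tup {..<k} ?c) (at 0)"
    by (rule Lim_transform_eventually) (use ev in eventually_elim, simp only: Rn_iff_proj)
  have "has_dir_deriv (sub_lcs (Rn n)) (sub_lcs (Rn k)) f x y l \<longleftrightarrow> l \<in> Rn k \<and> (?q \<longlongrightarrow> l) (at 0)"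
    unfolding has_dir_deriv_def lcs_top_sub_lcs lcs_ops_sub_lcs limitin_subtopology using ev by auto
  also have "\<dots> \<longleftrightarrow> l = tup {..<k} ?c"
  proof
    assume "l \<in> Rn k \<and> (?q \<longlongrightarrow> l) (at 0)"
    then show "l = tup {..<k} ?c"
      using tendsto_unique[OF trivial_limit_at _ tends] by blast
  next
    assume "l = tup {..<k} ?c"
    then show "l \<in> Rn k \<and> (?q \<longlongrightarrow> l) (at 0)"
      using tends by (simp only: tup_in_Rn simp_thms)
  qed
  finally show ?thesis .
qed

section \<open>Local continuity\<close>

text \<open>Continuity on a whole neighbourhood of \<open>x0\<close>, more than continuity at the
  point. Operators built with cut-off functions agree with the intended ones only near
  \<open>x0\<close>, and statements of this kind still paste to a
  \<open>continuous_map\<close>.\<close>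

definition lcont :: "'x topology \<Rightarrow> 'y topology \<Rightarrow> ('x \<Rightarrow> 'y) \<Rightarrow> 'x \<Rightarrow> bool" where
  "lcont X Y f x0 \<longleftrightarrow> (\<exists>N. openin X N \<and> x0 \<in> N \<and> continuous_map (subtopology X N) Y f)"

lemma lcont_imp_continuous_map:
  assumes "\<And>x. x \<in> topspace X \<Longrightarrow> lcont X Y f x"
  shows "continuous_map X Y f"
proof -
  have "\<forall>x\<in>topspace X. \<exists>N. openin X N \<and> x \<in> N \<and> continuous_map (subtopology X N) Y f"
    using assms by (simp add: lcont_def)
  then obtain N where N: "\<And>x. x \<in> topspace X \<Longrightarrow> openin X (N x) \<and> x \<in> N x \<and> continuous_map (subtopology X (N x)) Y f"
    by metis
  show ?thesis
    by (rule pasting_lemma[where I = "topspace X" and T = N and f = "\<lambda>_. f"]) (use N in auto)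
qed

lemma continuous_map_imp_lcont: "continuous_map X Y f \<Longrightarrow> x0 \<in> topspace X \<Longrightarrow> lcont X Y f x0"
  unfolding lcont_def by (intro exI[of _ "topspace X"]) simp

lemma lcont_subset:
  "openin X N \<Longrightarrow> x0 \<in> N \<Longrightarrow> continuous_map (subtopology X N) Y f \<Longrightarrow> lcont X Y f x0"
  by (auto simp: lcont_def)

lemma lcont_compose: "lcont X Y f x0 \<Longrightarrow> continuous_map Y Z g \<Longrightarrow> lcont X Z (\<lambda>x. g (f x)) x0"
  unfolding lcont_def using continuous_map_compose[of _ Y f Z g] by (auto simp: o_def)

lemma lcont_common:
  assumes "finite I" "x0 \<in> topspace X" "\<And>i. i \<in> I \<Longrightarrow> lcont X (Y i) (f i) x0"
  shows "\<exists>N. openin X N \<and> x0 \<in> N \<and> (\<forall>i\<in>I. continuous_map (subtopology X N) (Y i) (f i))"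
  using assms(1,3)
proof (induction I rule: finite_induct)
  case empty
  then show ?case using assms(2) by auto
next
  case (insert i I)
  then obtain N where N: "openin X N" "x0 \<in> N" "\<forall>i\<in>I. continuous_map (subtopology X N) (Y i) (f i)"
    by auto
  obtain N' where N': "openin X N'" "x0 \<in> N'" "continuous_map (subtopology X N') (Y i) (f i)"
    using insert.prems[of i] by (auto simp: lcont_def)
  have "continuous_map (subtopology X (N \<inter> N')) (Y i) (f i)"
    by (rule continuous_map_from_subtopology_mono[OF N'(3)]) simp
  moreover have "\<forall>i\<in>I. continuous_map (subtopology X (N \<inter> N')) (Y i) (f i)"
    using N(3) continuous_map_from_subtopology_mono[of X N] by (meson inf_le1)
  ultimately show ?case
    using N N' by (intro exI[of _ "N \<inter> N'"]) auto
qed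

lemma lcont_cong:
  assumes "lcont X Y f x0" "openin X N" "x0 \<in> N" "\<And>x. x \<in> N \<Longrightarrow> f x = g x"
  shows "lcont X Y g x0"
proof -
  obtain N' where N': "openin X N'" "x0 \<in> N'" "continuous_map (subtopology X N') Y f"
    using assms(1) by (auto simp: lcont_def)
  have "continuous_map (subtopology X (N' \<inter> N)) Y g"
    by (rule continuous_map_eq[OF continuous_map_from_subtopology_mono[OF N'(3)]]) (use assms(4) in auto)
  then show ?thesis
    using N' assms(2,3) by (intro lcont_subset[of _ "N' \<inter> N"]) auto
qed

lemma lcont_open:
  assumes "lcont X Y f x0" "openin Y T" "f x0 \<in> T"
  shows "\<exists>N. openin X N \<and> x0 \<in> N \<and> (\<forall>x\<in>N. f x \<in> T)"
proof -
  obtain N' where N': "openin X N'" "x0 \<in> N'" "continuous_map (subtopology X N') Y f"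
    using assms(1) by (auto simp: lcont_def)
  have "openin (subtopology X N') {x \<in> topspace (subtopology X N'). f x \<in> T}"
    using N'(3) assms(2) by (rule openin_continuous_map_preimage)
  then have "openin X {x \<in> topspace (subtopology X N'). f x \<in> T}"
    using N'(1) by (rule openin_trans_full)
  then show ?thesis
    using N' assms(3) openin_subset[OF N'(1)] by (intro exI[of _ "{x \<in> topspace (subtopology X N'). f x \<in> T}"]) auto
qed

lemma lcont_topspace: "lcont X Y f x0 \<Longrightarrow> f x0 \<in> topspace Y"
  unfolding lcont_def using openin_subset by (fastforce simp: continuous_map_def)

section \<open>Function spaces\<close>

lemma finite_std_basis: "finite (std_basis k)"
  by (simp add: std_basis_def)

lemma independent_std_basis: "independent (std_basis k)"
proof -
  have "inj_on unit_vec {..<k}"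
    by (rule inj_onI) (metis lookup_single_eq lookup_single_not_eq zero_neq_one)
  then have sum: "(\<Sum>v\<in>std_basis k. u v *\<^sub>R v) = tup {..<k} (\<lambda>i. u (unit_vec i))" for u
    unfolding std_basis_def tup_def by (subst sum.reindex) auto
  show ?thesis
    unfolding real_vector.dependent_finite[OF finite_std_basis]
  proof (intro notI, elim exE conjE bexE)
    fix u v assume u: "(\<Sum>v\<in>std_basis k. u v *\<^sub>R v) = 0" and v: "v \<in> std_basis k" "u v \<noteq> 0"
    obtain i where i: "i < k" "v = unit_vec i" using v(1) by (auto simp: std_basis_def)
    have "Poly_Mapping.lookup (tup {..<k} (\<lambda>i. u (unit_vec i))) i = 0"
      using u sum by (metis lookup_zero)
    then show False using i v(2) by (simp add: lookup_tup)
  qed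
qed

lemma representation_std_basis:
  assumes "v \<in> Rn k" "i < k"
  shows "representation (std_basis k) v (unit_vec i) = Poly_Mapping.lookup v i"
proof -
  have "inj_on unit_vec {..<k}"
    by (rule inj_onI) (metis lookup_single_eq lookup_single_not_eq zero_neq_one)
  then have "(\<Sum>b\<in>std_basis k. representation (std_basis k) v b *\<^sub>R b)
      = tup {..<k} (\<lambda>i. representation (std_basis k) v (unit_vec i))"
    unfolding std_basis_def tup_def by (subst sum.reindex) auto
  moreover have "(\<Sum>b\<in>std_basis k. representation (std_basis k) v b *\<^sub>R b) = v"
    using assms(1) by (intro real_vector.sum_representation_eq independent_std_basis finite_std_basis)
      (auto simp: Rn_def)
  ultimately have "v = tup {..<k} (\<lambda>i. representation (std_basis k) v (unit_vec i))" by simp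
  from arg_cong[OF this, of "\<lambda>v. Poly_Mapping.lookup v i"] show ?thesis
    using assms(2) by (simp add: lookup_tup)
qed

lemma coord_funs_std_basis:
  assumes "\<gamma> \<in> U \<rightarrow>\<^sub>E Rn k" "i < k"
  shows "coord_funs U (std_basis k) \<gamma> (unit_vec i) = (\<lambda>x\<in>U. Poly_Mapping.lookup (\<gamma> x) i)"
proof -
  have "unit_vec i \<in> std_basis k" using assms(2) by (simp add: std_basis_def)
  then have "coord_funs U (std_basis k) \<gamma> (unit_vec i) = (\<lambda>x\<in>U. representation (std_basis k) (\<gamma> x) (unit_vec i))"
    by (simp add: coord_funs_def)
  also have "\<dots> = (\<lambda>x\<in>U. Poly_Mapping.lookup (\<gamma> x) i)"
  proof (rule restrict_ext)
    fix x assume "x \<in> U"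
    then have "\<gamma> x \<in> Rn k" using assms(1) by auto
    then show "representation (std_basis k) (\<gamma> x) (unit_vec i) = Poly_Mapping.lookup (\<gamma> x) i"
      using assms(2) by (rule representation_std_basis)
  qed
  finally show ?thesis .
qed

lemma topspace_vfun_space:
  "\<gamma> \<in> topspace (vfun_space \<F> U (std_basis k)) \<longleftrightarrow>
    \<gamma> \<in> U \<rightarrow>\<^sub>E Rn k \<and> (\<forall>i<k. (\<lambda>x\<in>U. Poly_Mapping.lookup (\<gamma> x) i) \<in> topspace (\<F> U))"
proof -
  have "coord_funs U (std_basis k) \<gamma> \<in> std_basis k \<rightarrow>\<^sub>E topspace (\<F> U) \<longleftrightarrow>
      (\<forall>i<k. (\<lambda>x\<in>U. Poly_Mapping.lookup (\<gamma> x) i) \<in> topspace (\<F> U))" if "\<gamma> \<in> U \<rightarrow>\<^sub>E Rn k"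
    using coord_funs_std_basis[OF that]
    by (auto simp: PiE_iff std_basis_def coord_funs_def)
  then show ?thesis
    unfolding vfun_space_def topspace_pullback_topology by (auto simp: Rn_def)
qed

text \<open>The topology is pulled back along the coordinate functions, so continuity is tested on
  real components. This reduces the later work to the spaces \<open>\<F> U\<close> of real
  functions.\<close>

lemma continuous_map_into_vfun_space:
  "continuous_map X (vfun_space \<F> U (std_basis k)) \<Phi> \<longleftrightarrow>
    (\<forall>x\<in>topspace X. \<Phi> x \<in> U \<rightarrow>\<^sub>E Rn k) \<and>
    (\<forall>i<k. continuous_map X (\<F> U) (\<lambda>x. \<lambda>z\<in>U. Poly_Mapping.lookup (\<Phi> x z) i))"
  (is "?l \<longleftrightarrow> ?a \<and> ?b")
proof -
  have comp: "continuous_map X (product_topology (\<lambda>_. \<F> U) (std_basis k)) (coord_funs U (std_basis k) \<circ> \<Phi>) \<longleftrightarrow> ?b"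
    if a: ?a
  proof -
    have "continuous_map X (\<F> U) (\<lambda>x. coord_funs U (std_basis k) (\<Phi> x) (unit_vec i)) \<longleftrightarrow>
        continuous_map X (\<F> U) (\<lambda>x. \<lambda>z\<in>U. Poly_Mapping.lookup (\<Phi> x z) i)" if "i < k" for i
      using a coord_funs_std_basis[OF _ that, of _ U]
      by (intro iffI; elim continuous_map_eq) auto
    then show ?thesis
      by (auto simp: continuous_map_componentwise std_basis_def coord_funs_def o_def)
  qed
  show ?thesis
  proof
    assume l: ?l
    then have a: ?a
      unfolding continuous_map_def using topspace_vfun_space[of _ \<F> U k] by blast
    have "continuous_map (vfun_space \<F> U (std_basis k)) (product_topology (\<lambda>_. \<F> U) (std_basis k))
        (id \<circ> coord_funs U (std_basis k))"
      unfolding vfun_space_def by (rule continuous_map_pullback) (rule continuous_map_id)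
    from continuous_map_compose[OF l this] comp[OF a] a show "?a \<and> ?b"
      by simp
  next
    assume "?a \<and> ?b"
    then show ?l
      unfolding vfun_space_def using comp
      by (intro continuous_map_pullback') (auto simp: Rn_def)
  qed
qed

section \<open>Superposition operators on the spaces \<open>\<F> U\<close>\<close>

locale function_family =
  fixes m :: nat and \<U> :: "vec set set" and \<F> :: fam
  assumes good: "good_collection m \<U>" and suitable: "suitable_family m \<U> \<F>"
begin

abbreviation cl :: "vec set \<Rightarrow> vec set" where
  "cl V \<equiv> top_of_set (orthant m) closure_of V"

abbreviation rc :: "vec set \<Rightarrow> vec set \<Rightarrow> bool" where
  "rc \<equiv> relatively_compact_in m"

lemma orthant_subset_Rn: "orthant m \<subseteq> Rn m"
  by (auto simp: orthant_def)

lemma \<U>_open: "U \<in> \<U> \<Longrightarrow> open_in_orthant m U"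
  using good by (simp add: good_collection_def)

lemma \<U>_subset: "U \<in> \<U> \<Longrightarrow> U \<subseteq> orthant m"
  using \<U>_open openin_subset by (fastforce simp: open_in_orthant_def)

lemma \<U>_basis:
  assumes "open_in_orthant m W" "z \<in> W"
  obtains B where "B \<in> \<U>" "z \<in> B" "B \<subseteq> W"
proof -
  have "\<exists>\<B>\<subseteq>\<U>. W = \<Union>\<B>" using good assms(1) by (simp add: good_collection_def)
  then show ?thesis using assms(2) that by auto
qed

lemma \<U>_shrink:
  assumes "open_in_orthant m W" "z \<in> W"
  obtains V where "V \<in> \<U>" "z \<in> V" "rc V W"
proof -
  obtain B where B: "B \<in> \<U>" "z \<in> B" "B \<subseteq> W" using \<U>_basis[OF assms] by blast
  have "\<forall>U\<in>\<U>. \<forall>K. compact K \<and> K \<noteq> {} \<and> K \<subseteq> U \<longrightarrow> (\<exists>V\<in>\<U>. K \<subseteq> V \<and> relatively_compact_in m V U)"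
    using good by (simp add: good_collection_def)
  then have "\<exists>V\<in>\<U>. {z} \<subseteq> V \<and> relatively_compact_in m V B"
    using B by (metis compact_sing empty_subsetI insert_not_empty insert_subset)
  then show ?thesis using that B(3) by (auto simp: relatively_compact_in_def)
qed

text \<open>Each application of (PF) uses up one relatively compact inclusion; property (c) of a
  good collection divides one inclusion into two.\<close>

lemma \<U>_interpolate:
  assumes "open_in_orthant m U" "W \<in> \<U>" "rc W U"
  obtains V where "V \<in> \<U>" "rc V U" "rc W V"
proof -
  have "\<exists>V\<in>\<U>. relatively_compact_in m V U \<and> cl W \<subseteq> V"
    using good assms unfolding good_collection_def by blast
  then show ?thesis using that assms(3) by (auto simp: relatively_compact_in_def)
qed

lemma rc_mono: "rc V U \<Longrightarrow> U \<subseteq> U' \<Longrightarrow> rc V U'"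
  by (auto simp: relatively_compact_in_def)

lemma subset_cl: "V \<in> \<U> \<Longrightarrow> V \<subseteq> cl V"
  using closure_of_subset[of V "top_of_set (orthant m)"] \<U>_subset by auto

lemma rc_subset: "V \<in> \<U> \<Longrightarrow> rc V U \<Longrightarrow> V \<subseteq> U"
  using subset_cl by (auto simp: relatively_compact_in_def)

lemma rc_cl: "rc V U \<Longrightarrow> cl V \<subseteq> U"
  by (simp add: relatively_compact_in_def)

lemma lcs_fields [simp]:
  "lcs_top (fun_lcs U T) = T"
  "lcs_add (fun_lcs U T) = (\<lambda>f g. restrict (\<lambda>x. f x + g x) U)"
  "lcs_zero (fun_lcs U T) = restrict (\<lambda>_. 0) U"
  "lcs_scale (fun_lcs U T) = (\<lambda>r f. restrict (\<lambda>x. r * f x) U)"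
  by (simp_all add: fun_lcs_def)

lemma \<F>_lcs: "U \<in> \<U> \<Longrightarrow> locally_convex_space (fun_lcs U (\<F> U))"
  using suitable by (simp add: suitable_family_def function_spaces_def)

lemma \<F>_add:
  assumes "U \<in> \<U>" "continuous_map X (\<F> U) a" "continuous_map X (\<F> U) b"
  shows "continuous_map X (\<F> U) (\<lambda>x. \<lambda>z\<in>U. a x z + b x z)"
proof -
  have "continuous_map (prod_topology (\<F> U) (\<F> U)) (\<F> U) (\<lambda>(f, g). \<lambda>z\<in>U. f z + g z)"
    using \<F>_lcs[OF assms(1)] by (simp add: locally_convex_space_def)
  from continuous_map_compose[OF _ this, of X "\<lambda>x. (a x, b x)"] assms(2,3) show ?thesis
    by (simp add: continuous_map_pairwise o_def)
qed

lemma \<F>_scale: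
  assumes "U \<in> \<U>" "continuous_map X euclideanreal r" "continuous_map X (\<F> U) a"
  shows "continuous_map X (\<F> U) (\<lambda>x. \<lambda>z\<in>U. r x * a x z)"
proof -
  have "continuous_map (prod_topology euclideanreal (\<F> U)) (\<F> U) (\<lambda>(s, f). \<lambda>z\<in>U. s * f z)"
    using \<F>_lcs[OF assms(1)] by (simp add: locally_convex_space_def)
  from continuous_map_compose[OF _ this, of X "\<lambda>x. (r x, a x)"] assms(2,3) show ?thesis
    by (simp add: continuous_map_pairwise o_def)
qed

lemma \<F>_zero: "U \<in> \<U> \<Longrightarrow> (\<lambda>z\<in>U. 0) \<in> topspace (\<F> U)"
  using \<F>_lcs[of U] unfolding locally_convex_space_def vector_space_lcs_def Let_def lcs_fields by blast

lemma \<F>_sum: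
  assumes "U \<in> \<U>" "finite K" "\<And>k. k \<in> K \<Longrightarrow> continuous_map X (\<F> U) (a k)"
  shows "continuous_map X (\<F> U) (\<lambda>x. \<lambda>z\<in>U. \<Sum>k\<in>K. a k x z)"
  using assms(2,3)
proof (induction K rule: finite_induct)
  case empty
  show ?case by (simp only: sum.empty continuous_map_const \<F>_zero[OF assms(1)] simp_thms)
next
  case (insert k K)
  then have "continuous_map X (\<F> U) (\<lambda>x. \<lambda>z\<in>U. a k x z + (\<lambda>z\<in>U. \<Sum>k\<in>K. a k x z) z)"
    by (intro \<F>_add assms(1)) auto
  moreover have "(\<lambda>z\<in>U. a k x z + (\<lambda>z\<in>U. \<Sum>k\<in>K. a k x z) z) = (\<lambda>z\<in>U. \<Sum>k\<in>insert k K. a k x z)" for x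
    by (rule restrict_ext) (simp add: insert.hyps)
  ultimately show ?case by (simp only:)
qed

lemma \<F>_bounded_continuous:
  "U \<in> \<U> \<Longrightarrow> continuous_map (\<F> U) (mtopology_of (cfunspace (top_of_set U) euclidean_metric)) id"
  using suitable by (simp add: suitable_family_def function_spaces_def)

lemma \<F>_mspace:
  assumes "U \<in> \<U>" "f \<in> topspace (\<F> U)"
  shows "f \<in> mspace (cfunspace (top_of_set U) euclidean_metric)"
proof -
  have "id f \<in> topspace (mtopology_of (cfunspace (top_of_set U) euclidean_metric))"
    using \<F>_bounded_continuous[OF assms(1)] assms(2) unfolding continuous_map_def by blast
  then show ?thesis by simp
qed

lemma \<F>_continuous_on: "U \<in> \<U> \<Longrightarrow> f \<in> topspace (\<F> U) \<Longrightarrow> continuous_on U f"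
  and \<F>_extensional: "U \<in> \<U> \<Longrightarrow> f \<in> topspace (\<F> U) \<Longrightarrow> f \<in> extensional U"
  using \<F>_mspace by auto

text \<open>The inclusion into the bounded continuous functions is continuous, so the topology of
  \<open>\<F> U\<close> controls uniform distance. This is how conditions on values become open
  conditions.\<close>

lemma \<F>_sup_nbhd:
  assumes "U \<in> \<U>" "f \<in> topspace (\<F> U)" "e > 0"
  obtains N where "openin (\<F> U) N" "f \<in> N" "\<And>g x. g \<in> N \<Longrightarrow> x \<in> U \<Longrightarrow> \<bar>g x - f x\<bar> < e"
proof -
  let ?C = "cfunspace (top_of_set U) euclidean_metric :: (vec \<Rightarrow> real) metric"
  interpret C: Metric_space "mspace ?C" "mdist ?C" by (rule Metric_space_mspace_mdist)
  \<comment> \<open>Half of \<open>e\<close>, because the distance in the function space yields only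
    a non-strict pointwise bound.\<close>
  let ?N = "{g \<in> topspace (\<F> U). id g \<in> C.mball f (e / 2)}"
  have "continuous_map (\<F> U) C.mtopology id"
    using \<F>_bounded_continuous[OF assms(1)] unfolding mtopology_of_def .
  then have "openin (\<F> U) ?N"
    using C.openin_mball by (rule openin_continuous_map_preimage)
  moreover have "f \<in> ?N"
    using assms(2,3) \<F>_mspace[OF assms(1,2)] by (auto simp del: mspace_cfunspace)
  moreover have "\<bar>g x - f x\<bar> < e" if "g \<in> ?N" "x \<in> U" for g x
  proof -
    have g: "g \<in> mspace ?C" "f \<in> mspace ?C" "mdist ?C f g < e / 2"
      using that(1) by (auto simp del: mspace_cfunspace)
    have "mdist euclidean_metric (f x) (g x) \<le> e / 2"
      using mdist_cfunspace_imp_mdist_le[OF g(2,1) less_imp_le[OF g(3)]] that(2) by simp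
    then have "\<bar>g x - f x\<bar> \<le> e / 2" by (simp add: dist_real_def abs_minus_commute)
    then show ?thesis using assms(3) by linarith
  qed
  ultimately show ?thesis using that by blast
qed

lemma smooth_between_on_orthant_product:
  fixes H :: "('k \<Rightarrow>\<^sub>0 real) \<Rightarrow> real"
  assumes "smooth_on UNIV H" "finite I" "U \<in> \<U>"
  shows "smooth_between (prod_lcs (sub_lcs (Rn m)) (sub_lcs (span (std_basis k)))) (sub_lcs (span (std_basis 1)))
    (U \<times> span (std_basis k)) (\<lambda>(x, e). H (tup I (\<lambda>i. Poly_Mapping.lookup e (h i))) *\<^sub>R unit_vec 0)"
proof (rule smooth_between_coords[where I = "{..<k}" and J = "{()}" and P = UNIV
      and L = snd and b = "\<lambda>_. unit_vec 0" and G = "\<lambda>_ e. H (tup I (\<lambda>i. Poly_Mapping.lookup e (h i)))"])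
  show "smooth_on UNIV (\<lambda>e::vec. H (tup I (\<lambda>i. Poly_Mapping.lookup e (h i))))"
    by (rule smooth_on_compose_tup[OF assms(2) smooth_on_lookup assms(1)]) simp
  show "continuous_map (lcs_top (prod_lcs (sub_lcs (Rn m)) (sub_lcs (span (std_basis k))))) euclidean snd"
    using continuous_map_snd[of "top_of_set (Rn m)" "top_of_set (span (std_basis k))"]
    by (auto simp: prod_lcs_def dest: continuous_map_into_fulltopology)
  show "U \<times> span (std_basis k) \<subseteq> topspace (lcs_top (prod_lcs (sub_lcs (Rn m)) (sub_lcs (span (std_basis k)))))"
    using \<U>_subset[OF assms(3)] orthant_subset_Rn by (auto simp: prod_lcs_def)
  show "subspace (span (std_basis 1))" by (rule subspace_span)
  show "unit_vec 0 \<in> span (std_basis 1)"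
    by (auto intro!: span_base simp: std_basis_def)
qed (auto simp: prod_lcs_def Rn_def[symmetric] Rn_iff_proj)

text \<open>(PF) needs a vector-valued function with coordinates numbered by naturals; the bijection
  \<open>h\<close> transports the family \<open>u\<close> there. The function handed to (PF) ignores
  the base point and takes values in the line spanned by \<open>unit_vec 0\<close>.\<close>

lemma \<F>_superpose_global:
  fixes H :: "('k \<Rightarrow>\<^sub>0 real) \<Rightarrow> real"
  assumes "U \<in> \<U>" "V \<in> \<U>" "rc V U" "finite I" "smooth_on UNIV H"
  shows "continuous_map (product_topology (\<lambda>_. \<F> U) I) (\<F> V) (\<lambda>u. \<lambda>x\<in>V. H (tup I (\<lambda>i. u i x)))"
proof -
  obtain h where h: "bij_betw h I {..<card I}"
    using ex_bij_betw_finite_nat[OF assms(4)] by (auto simp: atLeast0LessThan)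
  define h' where "h' = the_inv_into I h"
  have h': "i < card I \<Longrightarrow> h' i \<in> I" for i
    using bij_betw_the_inv_into[OF h] by (auto simp: h'_def bij_betw_def)
  have hh: "j \<in> I \<Longrightarrow> h j < card I" "j \<in> I \<Longrightarrow> h' (h j) = j" for j
    using h by (auto simp: h'_def bij_betw_def the_inv_into_f_f)
  let ?B = "std_basis (card I)" and ?f = "\<lambda>(x::vec, e::vec). H (tup I (\<lambda>i. Poly_Mapping.lookup e (h i))) *\<^sub>R (unit_vec 0 :: vec)"
  have "axiom_PF m \<U> \<F> ?B (std_basis 1)"
    using suitable finite_std_basis independent_std_basis by (simp add: suitable_family_def)
  then have PF: "continuous_map (vfun_space \<F> U ?B) (vfun_space \<F> V (std_basis 1)) (\<lambda>\<gamma>. \<lambda>x\<in>V. ?f (x, \<gamma> x))"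
    using smooth_between_on_orthant_product[OF assms(5,4,1), of "card I" h] assms(1-3)
    unfolding axiom_PF_def by blast
  have PF': "continuous_map (vfun_space \<F> U ?B) (\<F> V)
      (\<lambda>\<gamma>. \<lambda>z\<in>V. H (tup I (\<lambda>i. Poly_Mapping.lookup (\<gamma> z) (h i))))"
    using PF unfolding continuous_map_into_vfun_space by (auto simp: lookup_single cong: restrict_cong)
  have "continuous_map (product_topology (\<lambda>_. \<F> U) I) (\<F> U)
      (\<lambda>x. \<lambda>z\<in>U. Poly_Mapping.lookup (if z \<in> U then tup {..<card I} (\<lambda>i. x (h' i) z) else undefined) i)"
    if "i < card I" for i
  proof (rule continuous_map_eq)
    show "continuous_map (product_topology (\<lambda>_. \<F> U) I) (\<F> U) (\<lambda>x. x (h' i))"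
      using h'[OF that] by (rule continuous_map_product_projection)
    fix x assume "x \<in> topspace (product_topology (\<lambda>_. \<F> U) I)"
    then have "x (h' i) \<in> topspace (\<F> U)" using h'[OF that] by auto
    then show "x (h' i) = (\<lambda>z\<in>U. Poly_Mapping.lookup (if z \<in> U then tup {..<card I} (\<lambda>i. x (h' i) z) else undefined) i)"
      using \<F>_extensional[OF assms(1)] that by (auto simp: fun_eq_iff lookup_tup extensional_def)
  qed
  then have "continuous_map (product_topology (\<lambda>_. \<F> U) I) (vfun_space \<F> U ?B)
      (\<lambda>u. \<lambda>x\<in>U. tup {..<card I} (\<lambda>i. u (h' i) x))"
    unfolding continuous_map_into_vfun_space restrict_def by (auto simp: tup_in_Rn)
  from continuous_map_compose[OF this PF'] show ?thesis
  proof (rule continuous_map_eq)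
    fix u
    have "V \<subseteq> U" using assms(2,3) by (rule rc_subset)
    then show "((\<lambda>\<gamma>. \<lambda>z\<in>V. H (tup I (\<lambda>i. Poly_Mapping.lookup (\<gamma> z) (h i)))) \<circ>
          (\<lambda>u. \<lambda>x\<in>U. tup {..<card I} (\<lambda>i. u (h' i) x))) u = (\<lambda>x\<in>V. H (tup I (\<lambda>i. u i x)))"
      using hh by (auto simp: fun_eq_iff lookup_tup intro!: arg_cong[of _ _ H] tup_cong)
  qed
qed

lemma continuous_map_into_product_restrict:
  assumes "\<And>i. i \<in> I \<Longrightarrow> continuous_map X (Y i) (\<lambda>x. f x i)"
  shows "continuous_map X (product_topology Y I) (\<lambda>x. restrict (f x) I)"
  using assms by (auto simp: continuous_map_componentwise)

lemma \<F>_superpose_lcont_global: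
  fixes H :: "('k \<Rightarrow>\<^sub>0 real) \<Rightarrow> real"
  assumes "U \<in> \<U>" "V \<in> \<U>" "rc V U" "finite I" "smooth_on UNIV H"
    "x0 \<in> topspace X" "\<And>i. i \<in> I \<Longrightarrow> lcont X (\<F> U) (\<lambda>x. u x i) x0"
  shows "lcont X (\<F> V) (\<lambda>x. \<lambda>z\<in>V. H (tup I (\<lambda>i. u x i z))) x0"
proof -
  obtain N where N: "openin X N" "x0 \<in> N" "\<forall>i\<in>I. continuous_map (subtopology X N) (\<F> U) (\<lambda>x. u x i)"
    using lcont_common[OF assms(4,6), of "\<lambda>_. \<F> U" "\<lambda>i x. u x i"] assms(7) by auto
  have "continuous_map (subtopology X N) (product_topology (\<lambda>_. \<F> U) I) (\<lambda>x. restrict (u x) I)"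
    using N(3) by (intro continuous_map_into_product_restrict) auto
  from continuous_map_compose[OF this \<F>_superpose_global[OF assms(1-5)]]
  have "continuous_map (subtopology X N) (\<F> V) (\<lambda>x. \<lambda>z\<in>V. H (tup I (\<lambda>i. u x i z)))"
    by (simp add: o_def cong: tup_cong)
  then show ?thesis using N by (intro lcont_subset)
qed

text \<open>Restriction is the superposition operator of the identity on a single coordinate, hence
  an instance of (PF).\<close>

lemma \<F>_restrict:
  assumes "U \<in> \<U>" "V \<in> \<U>" "rc V U"
  shows "continuous_map (\<F> U) (\<F> V) (\<lambda>f. restrict f V)"
proof (rule lcont_imp_continuous_map)
  fix f assume f: "f \<in> topspace (\<F> U)"
  have "lcont (\<F> U) (\<F> V) (\<lambda>f. \<lambda>z\<in>V. Poly_Mapping.lookup (tup {()} (\<lambda>i. f z)) ()) f"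
    using f by (intro \<F>_superpose_lcont_global[OF assms] smooth_on_lookup continuous_map_imp_lcont) auto
  then show "lcont (\<F> U) (\<F> V) (\<lambda>f. restrict f V) f"
    by (simp add: lookup_tup)
qed

text \<open>A constant is a superposition of no functions at all: the index set is empty.\<close>

lemma \<F>_const:
  assumes "U \<in> \<U>" "V \<in> \<U>" "rc V U"
  shows "(\<lambda>z\<in>V. c) \<in> topspace (\<F> V)"
  using continuous_map_image_subset_topspace[OF \<F>_superpose_global[OF assms, of "{}" "\<lambda>_::unit \<Rightarrow>\<^sub>0 real. c"]]
  by (auto simp: smooth_on_const)

text \<open>The values at \<open>x0\<close> over the compact set \<open>cl V\<close> form a compact
  subset of \<open>Q\<close>, which has an \<open>e\<close>-neighbourhood inside \<open>Q\<close>;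
  near \<open>x0\<close> the functions differ uniformly on \<open>U\<close> by too little to leave
  it.\<close>

lemma \<F>_tube:
  assumes "U \<in> \<U>" "V \<in> \<U>" "rc V U" "finite I" "open Q"
    "x0 \<in> topspace X" "\<And>i. i \<in> I \<Longrightarrow> lcont X (\<F> U) (\<lambda>x. u x i) x0"
    "\<And>z. z \<in> cl V \<Longrightarrow> tup I (\<lambda>i. u x0 i z) \<in> Q"
  shows "\<exists>N. openin X N \<and> x0 \<in> N \<and> (\<forall>x\<in>N. \<forall>z\<in>cl V. tup I (\<lambda>i. u x i z) \<in> Q)"
proof -
  have clU: "cl V \<subseteq> U" and comp: "compact (cl V)"
    using assms(3) by (auto simp: relatively_compact_in_def)
  let ?t = "\<lambda>x z. tup I (\<lambda>i. u x i z)"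
  have "continuous_on (cl V) (u x0 i)" if "i \<in> I" for i
    using \<F>_continuous_on[OF assms(1) lcont_topspace[OF assms(7)[OF that]]] clU continuous_on_subset by blast
  then have "compact (?t x0 ` cl V)"
    by (intro compact_continuous_image continuous_on_tup comp) auto
  then obtain e where e: "e > 0" "(\<Union>x\<in>?t x0 ` cl V. ball x e) \<subseteq> Q"
    using compact_subset_open_imp_ball_epsilon_subset[of "?t x0 ` cl V" Q] assms(5,8) by blast
  let ?e = "e / (card I + 1)"
  have e': "?e > 0" using e(1) by simp
  have "\<exists>N. openin X N \<and> x0 \<in> N \<and> (\<forall>x\<in>N. \<forall>z\<in>U. \<bar>u x i z - u x0 i z\<bar> < ?e)" if i: "i \<in> I" for i
  proof -
    obtain T where T: "openin (\<F> U) T" "u x0 i \<in> T" "\<And>g x. g \<in> T \<Longrightarrow> x \<in> U \<Longrightarrow> \<bar>g x - u x0 i x\<bar> < ?e"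
      using \<F>_sup_nbhd[OF assms(1) lcont_topspace[OF assms(7)[OF i]] e'] by blast
    show ?thesis using lcont_open[OF assms(7)[OF i] T(1,2)] T(3) by blast
  qed
  then obtain N where N: "\<And>i. i \<in> I \<Longrightarrow> openin X (N i) \<and> x0 \<in> N i \<and> (\<forall>x\<in>N i. \<forall>z\<in>U. \<bar>u x i z - u x0 i z\<bar> < ?e)"
    by metis
  have "openin X (topspace X \<inter> (\<Inter>i\<in>I. N i))"
    using N assms(4) by (intro openin_Int_Inter[of "N ` I", simplified]) auto
  moreover have "?t x z \<in> Q" if x: "x \<in> topspace X \<inter> (\<Inter>i\<in>I. N i)" and z: "z \<in> cl V" for x z
  proof -
    have "?t x0 z - ?t x z = tup I (\<lambda>i. u x0 i z - u x i z)"
      by (simp add: tup_def scaleR_left_diff_distrib sum_subtractf)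
    then have "norm (?t x0 z - ?t x z) \<le> (\<Sum>i\<in>I. \<bar>u x0 i z - u x i z\<bar>)"
      by (metis norm_tup_le)
    also have "\<dots> \<le> (\<Sum>i\<in>I. ?e)"
    proof (rule sum_mono)
      fix i assume "i \<in> I"
      then have "\<bar>u x i z - u x0 i z\<bar> < ?e" using N x z clU by blast
      then show "\<bar>u x0 i z - u x i z\<bar> \<le> ?e" by linarith
    qed
    also have "\<dots> < e" using e(1) by (simp add: field_simps)
    finally have "?t x z \<in> ball (?t x0 z) e" by (simp add: dist_norm)
    then show ?thesis using e(2) z by blast
  qed
  ultimately show ?thesis using N assms(6) by (intro exI[of _ "topspace X \<inter> (\<Inter>i\<in>I. N i)"]) auto
qed

lemma \<F>_cutoff:
  assumes "U \<in> \<U>" "V \<in> \<U>" "rc V U" "finite I" "open Q" "smooth_on Q G"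
    "\<And>i. i \<in> I \<Longrightarrow> u i \<in> topspace (\<F> U)" "\<And>z. z \<in> cl V \<Longrightarrow> tup I (\<lambda>i. u i z) \<in> Q"
  obtains H P where "smooth_on UNIV H" "\<And>z. H (proj I z) = H z" "open P"
    "\<And>z. z \<in> cl V \<Longrightarrow> tup I (\<lambda>i. u i z) \<in> P"
    "\<And>r. tup I r \<in> P \<Longrightarrow> H (tup I r) = G (tup I r)"
proof -
  have clU: "cl V \<subseteq> U" and comp: "compact (cl V)"
    using assms(3) by (auto simp: relatively_compact_in_def)
  let ?t = "\<lambda>z. tup I (\<lambda>i. u i z)"
  have "continuous_on (cl V) (u i)" if "i \<in> I" for i
    using \<F>_continuous_on[OF assms(1) assms(7)[OF that]] clU continuous_on_subset by blast
  then have K: "compact (?t ` cl V)" "?t ` cl V \<subseteq> Q"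
    using assms(8) by (auto intro!: compact_continuous_image continuous_on_tup comp)
  have Kp: "proj I z = z" if "z \<in> ?t ` cl V" for z
    using that proj_tup[OF assms(4)] by auto
  obtain H P where "smooth_on UNIV H" "\<And>z. H (proj I z) = H z" "open P" "?t ` cl V \<subseteq> P"
    "\<And>z. z \<in> P \<Longrightarrow> proj I z = z \<Longrightarrow> z \<in> Q \<and> H z = G z"
    by (rule smooth_cutoff[OF assms(4) K assms(5,6) Kp]) blast+
  then show ?thesis
    using that[of H P] proj_tup[OF assms(4)] by blast
qed

text \<open>\<open>G\<close> lives only on \<open>Q\<close>. It is exchanged for a global
  \<open>H\<close> that agrees with it at the tuples in an open set \<open>P\<close> around the
  values over \<open>cl V\<close>. For \<open>x\<close> near \<open>x0\<close> the values stay in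
  \<open>P\<close> by \<open>\<F>_tube\<close>, so the two operators coincide there.\<close>

lemma \<F>_superpose:
  assumes "U \<in> \<U>" "V \<in> \<U>" "rc V U" "finite I" "open Q" "smooth_on Q G"
    "x0 \<in> topspace X" "\<And>i. i \<in> I \<Longrightarrow> lcont X (\<F> U) (\<lambda>x. u x i) x0"
    "\<And>z. z \<in> cl V \<Longrightarrow> tup I (\<lambda>i. u x0 i z) \<in> Q"
  shows "lcont X (\<F> V) (\<lambda>x. \<lambda>z\<in>V. G (tup I (\<lambda>i. u x i z))) x0"
proof -
  obtain H P where H: "smooth_on UNIV H" "open P" "\<And>z. z \<in> cl V \<Longrightarrow> tup I (\<lambda>i. u x0 i z) \<in> P"
    "\<And>r. tup I r \<in> P \<Longrightarrow> H (tup I r) = G (tup I r)"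
    using \<F>_cutoff[OF assms(1-6), of "u x0"] lcont_topspace[OF assms(8)] assms(9) by metis
  obtain N where N: "openin X N" "x0 \<in> N" "\<And>x z. x \<in> N \<Longrightarrow> z \<in> cl V \<Longrightarrow> tup I (\<lambda>i. u x i z) \<in> P"
    using \<F>_tube[OF assms(1-4) H(2) assms(7,8) H(3)] by blast
  show ?thesis
  proof (rule lcont_cong[OF \<F>_superpose_lcont_global[OF assms(1-4) H(1) assms(7,8)] N(1,2)])
    fix x assume "x \<in> N"
    then show "(\<lambda>z\<in>V. H (tup I (\<lambda>i. u x i z))) = (\<lambda>z\<in>V. G (tup I (\<lambda>i. u x i z)))"
      using N(3) H(4) subset_cl[OF assms(2)] by (auto simp: fun_eq_iff)
  qed
qed

end

context function_family
begin

text \<open>The path is \<open>t\<close> times the constant function 1, so continuity of scalar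
  multiplication gives the claim.\<close>

lemma \<F>_constant_paths:
  assumes "U \<in> \<U>" "V \<in> \<U>" "rc V U"
  shows "continuous_map euclideanreal (\<F> V) (\<lambda>t. \<lambda>z\<in>V. t)"
proof -
  have "continuous_map euclideanreal (\<F> V) (\<lambda>_. \<lambda>z\<in>V. 1)"
    using \<F>_const[OF assms, of 1] by (simp only: continuous_map_const simp_thms)
  then have "continuous_map euclideanreal (\<F> V) (\<lambda>t. \<lambda>z\<in>V. t * (\<lambda>z\<in>V. 1) z)"
    by (rule \<F>_scale[OF assms(2) continuous_map_id[unfolded id_def]])
  moreover have "(\<lambda>z\<in>V. t * (\<lambda>z\<in>V. 1) z) = (\<lambda>z\<in>V. t)" for t :: real
    by (rule restrict_ext) simp
  ultimately show ?thesis by (simp only:)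
qed

text \<open>Dividing \<open>G(u + t w) - G(u)\<close> by \<open>t\<close> is again a superposition operator by Hadamard's lemma, with
  \<open>t\<close> as an additional (constant) function. This replaces the usual weak integral.\<close>

lemma \<F>_difference_quotient:
  fixes G :: "('k \<Rightarrow>\<^sub>0 real) \<Rightarrow> real"
  assumes U: "U \<in> \<U>" and V: "V \<in> \<U>" "rc V U" and I: "finite I" and Q: "open Q" "smooth_on Q G"
    and u: "\<And>i. i \<in> I \<Longrightarrow> u i \<in> topspace (\<F> U)" and w: "\<And>i. i \<in> I \<Longrightarrow> w i \<in> topspace (\<F> U)"
    and uQ: "\<And>z. z \<in> cl V \<Longrightarrow> tup I (\<lambda>i. u i z) \<in> Q"
  shows "lcont euclideanreal (\<F> V) (\<lambda>t. \<lambda>z\<in>V.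
      if t = 0 then \<Sum>i\<in>I. w i z * pd i G (tup I (\<lambda>i. u i z))
      else (G (tup I (\<lambda>i. u i z + t * w i z)) - G (tup I (\<lambda>i. u i z))) / t) 0"
proof -
  obtain H P where H: "smooth_on UNIV H" "\<And>z. H (proj I z) = H z" "open P"
    and uP: "\<And>z. z \<in> cl V \<Longrightarrow> tup I (\<lambda>i. u i z) \<in> P"
    and HG: "\<And>r. tup I r \<in> P \<Longrightarrow> H (tup I r) = G (tup I r)"
    using \<F>_cutoff[OF U V I Q u uQ] by metis
  \<comment> \<open>Two shrinkings are needed: from \<open>U\<close> to \<open>V'\<close> for the
    restrictions and the constant functions, from \<open>V'\<close> to \<open>V\<close> for the
    superposition with \<open>q\<close>.\<close>
  obtain V' where V': "V' \<in> \<U>" "rc V' U" "rc V V'"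
    using \<U>_interpolate[OF \<U>_open[OF U] V] by blast
  \<comment> \<open>Tags for the coordinates of one larger space: \<open>L i\<close> for
    \<open>u i\<close>, \<open>R i\<close> for \<open>w i\<close>, and \<open>None\<close> for the
    parameter \<open>t\<close>.\<close>
  define L where "L i = Some (Inl i :: 'k + 'k)" for i
  define R where "R i = Some (Inr i :: 'k + 'k)" for i
  define J where "J = insert None (L ` I \<union> R ` I)"
  have J: "finite J" "None \<in> J" "\<And>i. i \<in> I \<Longrightarrow> L i \<in> J" "\<And>i. i \<in> I \<Longrightarrow> R i \<in> J"
    using I by (auto simp: J_def)
  define h where "h \<zeta> = H (tup I (\<lambda>i. Poly_Mapping.lookup \<zeta> (L i) + Poly_Mapping.lookup \<zeta> None * Poly_Mapping.lookup \<zeta> (R i)))" for \<zeta>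
  have h: "smooth_on UNIV h"
    unfolding h_def by (rule smooth_on_compose_tup[OF I _ H(1)]) (auto intro!: smooth_on_add smooth_on_mult smooth_on_lookup)
  have hJ: "h (proj J \<zeta>) = h \<zeta>" for \<zeta>
    unfolding h_def using J by (auto intro!: arg_cong[of _ _ H] tup_cong simp: lookup_tup)
  \<comment> \<open>With \<open>h\<close> the function \<open>H (u + t w)\<close> of all
    coordinates, setting the coordinate \<open>t\<close> to 0 gives \<open>H u\<close>. Division by
    \<open>t\<close> is thus Hadamard's lemma in the coordinate \<open>None\<close>.\<close>
  obtain q where q: "smooth_on UNIV q" "\<And>\<zeta>. h \<zeta> - h (scale_coord None 0 \<zeta>) = Poly_Mapping.lookup \<zeta> None * q \<zeta>"
    "\<And>\<zeta>. Poly_Mapping.lookup \<zeta> None = 0 \<Longrightarrow> q \<zeta> = pd None h \<zeta>"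
    using hadamard_division[OF J(1,2) h hJ] by metis
  define c where "c t j = (case j of None \<Rightarrow> (\<lambda>z\<in>V'. t) | Some (Inl i) \<Rightarrow> restrict (u i) V' | Some (Inr i) \<Rightarrow> restrict (w i) V')" for t :: real and j
  have lc: "lcont euclideanreal (\<F> V') (\<lambda>t. c t j) t0" if "j \<in> J" for j t0
  proof -
    have r: "restrict (u i) V' \<in> topspace (\<F> V')" "restrict (w i) V' \<in> topspace (\<F> V')" if "i \<in> I" for i
      using continuous_map_image_subset_topspace[OF \<F>_restrict[OF U V'(1,2)]] u[OF that] w[OF that] by auto
    have "continuous_map euclideanreal (\<F> V') (\<lambda>t. c t j)"
      using that r \<F>_constant_paths[OF U V'(1,2)] by (auto simp: c_def J_def L_def R_def)
    then show ?thesis by (rule continuous_map_imp_lcont) simp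
  qed
  have lu: "lcont euclideanreal (\<F> V') (\<lambda>t. \<lambda>z\<in>V'. u i z + t * w i z) 0" if "i \<in> I" for i
  proof (rule continuous_map_imp_lcont)
    have "c 0 (L i) \<in> topspace (\<F> V')" "c 0 (R i) \<in> topspace (\<F> V')"
      using lcont_topspace[OF lc] J(3,4) that by metis+
    then have "continuous_map euclideanreal (\<F> V') (\<lambda>t. \<lambda>z\<in>V'. c 0 (L i) z + (\<lambda>z\<in>V'. t * c 0 (R i) z) z)"
      by (intro \<F>_add \<F>_scale V'(1)) auto
    moreover have "(\<lambda>z\<in>V'. c 0 (L i) z + (\<lambda>z\<in>V'. t * c 0 (R i) z) z) = (\<lambda>z\<in>V'. u i z + t * w i z)" for t
      by (rule restrict_ext) (simp add: c_def L_def R_def)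
    ultimately show "continuous_map euclideanreal (\<F> V') (\<lambda>t. \<lambda>z\<in>V'. u i z + t * w i z)"
      by (simp only:)
  qed simp
  have clV: "z \<in> V'" if "z \<in> cl V" for z
    using rc_cl[OF V'(3)] that by auto
  have tuptup: "tup I (\<lambda>i. (\<lambda>z\<in>V'. u i z + t * w i z) z) = tup I (\<lambda>i. u i z + t * w i z)" if "z \<in> cl V" for z t
    using clV[OF that] by (intro tup_cong) simp
  have "\<exists>N. openin euclideanreal N \<and> 0 \<in> N \<and> (\<forall>t\<in>N. \<forall>z\<in>cl V. tup I (\<lambda>i. (\<lambda>z\<in>V'. u i z + t * w i z) z) \<in> P)"
  proof (rule \<F>_tube[OF V'(1) V(1) V'(3) I H(3)])
    show "tup I (\<lambda>i. (\<lambda>z\<in>V'. u i z + 0 * w i z) z) \<in> P" if "z \<in> cl V" for z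
      unfolding tuptup[OF that] using uP[OF that] by simp
  qed (simp_all only: lu topspace_euclidean UNIV_I)
  then obtain N where N: "openin euclideanreal N" "0 \<in> N"
    and N': "\<forall>t\<in>N. \<forall>z\<in>cl V. tup I (\<lambda>i. (\<lambda>z\<in>V'. u i z + t * w i z) z) \<in> P"
    by blast
  have N3: "tup I (\<lambda>i. u i z + t * w i z) \<in> P" if "t \<in> N" "z \<in> cl V" for t z
    using bspec[OF bspec[OF N' that(1)] that(2)] unfolding tuptup[OF that(2)] .
  have "lcont euclideanreal (\<F> V) (\<lambda>t. \<lambda>z\<in>V. q (tup J (\<lambda>j. c t j z))) 0"
    by (rule \<F>_superpose[OF V'(1) V(1) V'(3) J(1) open_UNIV q(1)]) (auto intro: lc)
  then show ?thesis
  proof (rule lcont_cong[OF _ N(1,2)])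
    fix t assume t: "t \<in> N"
    show "(\<lambda>z\<in>V. q (tup J (\<lambda>j. c t j z))) = (\<lambda>z\<in>V.
      if t = 0 then \<Sum>i\<in>I. w i z * pd i G (tup I (\<lambda>i. u i z))
      else (G (tup I (\<lambda>i. u i z + t * w i z)) - G (tup I (\<lambda>i. u i z))) / t)"
    proof (rule restrict_ext)
      fix z assume "z \<in> V"
      then have z: "z \<in> cl V" "z \<in> V'" using subset_cl[OF V(1)] clV by auto
      let ?\<zeta> = "tup J (\<lambda>j. c t j z)" and ?u = "tup I (\<lambda>i. u i z)" and ?w = "tup I (\<lambda>i. w i z)"
      have lk: "Poly_Mapping.lookup ?\<zeta> None = t" "i \<in> I \<Longrightarrow> Poly_Mapping.lookup ?\<zeta> (L i) = u i z"
        "i \<in> I \<Longrightarrow> Poly_Mapping.lookup ?\<zeta> (R i) = w i z" for i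
        using J z by (auto simp: lookup_tup c_def L_def R_def)
      have h_line: "h (?\<zeta> + r *\<^sub>R unit_vec None) = H (?u + (t + r) *\<^sub>R ?w)" for r
        unfolding h_def tup_scaleR tup_add
        by (rule arg_cong[of _ _ H], rule tup_cong)
          (simp add: lookup_add lk lookup_single L_def[symmetric] R_def[symmetric], simp add: L_def R_def)
      show "q ?\<zeta> = (if t = 0 then \<Sum>i\<in>I. w i z * pd i G ?u
        else (G (tup I (\<lambda>i. u i z + t * w i z)) - G ?u) / t)"
      proof (cases "t = 0")
        \<comment> \<open>At t = 0 the value of \<open>q\<close> is the derivative of
          \<open>h\<close> in the coordinate \<open>t\<close>, that is, the derivative of
          \<open>H\<close> along \<open>w\<close>. On this line \<open>H\<close> and
          \<open>G\<close> agree near 0, which leaves the derivative of \<open>G\<close>.\<close>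
        case True
        have "((\<lambda>r. h (?\<zeta> + r *\<^sub>R unit_vec None)) has_real_derivative pd None h ?\<zeta>) (at 0)"
          using has_real_derivative_line[of h _ ?\<zeta> 0 "unit_vec None"] smooth_on_has_derivative[OF h, of ?\<zeta>]
          by (simp add: pd_def)
        then have "((\<lambda>r. H (?u + (t + r) *\<^sub>R ?w)) has_real_derivative pd None h ?\<zeta>) (at 0)"
          unfolding h_line .
        moreover have "q ?\<zeta> = pd None h ?\<zeta>"
          by (rule q(3)[OF trans[OF lk(1) True]])
        ultimately have 1: "((\<lambda>r. H (?u + r *\<^sub>R ?w)) has_real_derivative q ?\<zeta>) (at 0)"
          unfolding True by simp
        have 2: "((\<lambda>r. G (?u + r *\<^sub>R ?w)) has_real_derivative (\<Sum>i\<in>I. w i z * pd i G ?u)) (at 0)"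
          by (rule smooth_at_line[OF smooth_on_imp_at[OF Q(2,1) uQ[OF z(1)]]])
        have "open N" using N(1) by simp
        have eq: "H (?u + r *\<^sub>R ?w) = G (?u + r *\<^sub>R ?w)" if "r \<in> N" for r
          using HG N3[OF that z(1)] by (simp add: tup_scaleR tup_add)
        have "((\<lambda>r. G (?u + r *\<^sub>R ?w)) has_real_derivative q ?\<zeta>) (at 0)"
          by (rule has_field_derivative_transform_within_open[OF 1 \<open>open N\<close> N(2) eq])
        from DERIV_unique[OF this 2] show ?thesis using True by simp
      next
        case False
        have s: "h (scale_coord None 0 ?\<zeta>) = H ?u"
          unfolding scale_coord_def h_line lk(1) by simp
        have "h ?\<zeta> = H (?u + t *\<^sub>R ?w)" using h_line[of 0] by simp
        then have "t * q ?\<zeta> = H (?u + t *\<^sub>R ?w) - H ?u"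
          using q(2)[of ?\<zeta>] s lk(1) by simp
        moreover have "H ?u = G ?u" using HG uP[OF z(1)] by simp
        moreover have "H (?u + t *\<^sub>R ?w) = G (tup I (\<lambda>i. u i z + t * w i z))"
          using HG N3[OF t z(1)] by (simp add: tup_scaleR tup_add)
        ultimately show ?thesis using False by (simp add: field_simps)
      qed
    qed
  qed
qed

section \<open>Pullback, localization and gluing\<close>

lemma real_to_vfun:
  assumes "continuous_map X (\<F> U) a" "U \<in> \<U>"
  shows "continuous_map X (vfun_space \<F> U (std_basis 1)) (\<lambda>x. \<lambda>z\<in>U. a x z *\<^sub>R unit_vec 0)"
  unfolding continuous_map_into_vfun_space
proof (intro conjI allI impI ballI)
  show "(\<lambda>z\<in>U. a x z *\<^sub>R unit_vec 0) \<in> U \<rightarrow>\<^sub>E Rn 1" for x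
    unfolding restrict_PiE_iff
    by (intro ballI subspace_scale[OF subspace_Rn] unit_vec_in_Rn) (rule zero_less_one)
  fix i :: nat assume "i < 1"
  show "continuous_map X (\<F> U) (\<lambda>x. \<lambda>z\<in>U. Poly_Mapping.lookup ((\<lambda>z\<in>U. a x z *\<^sub>R unit_vec 0) z) i)"
  proof (rule continuous_map_eq[OF assms(1)])
    fix x assume "x \<in> topspace X"
    then have "a x \<in> extensional U"
      using \<F>_extensional[OF assms(2)] continuous_map_image_subset_topspace[OF assms(1)] by auto
    then show "a x = (\<lambda>z\<in>U. Poly_Mapping.lookup ((\<lambda>z\<in>U. a x z *\<^sub>R unit_vec 0) z) i)"
      using \<open>i < 1\<close> by (auto simp: fun_eq_iff extensional_def)
  qed
qed

text \<open>The axioms speak of \<open>vfun_space\<close>; together with \<open>real_to_vfun\<close>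
  this passes between real functions and functions into the line \<open>Rn 1\<close>.\<close>

lemma vfun_to_real:
  "continuous_map X (vfun_space \<F> U (std_basis 1)) \<Phi> \<Longrightarrow>
    continuous_map X (\<F> U) (\<lambda>x. \<lambda>z\<in>U. Poly_Mapping.lookup (\<Phi> x z) 0)"
  unfolding continuous_map_into_vfun_space by simp

lemma axioms1:
  "axiom_PB m \<U> \<F> (std_basis 1)" "axiom_GL \<U> \<F> (std_basis 1)" "axiom_MU m \<U> \<F> (std_basis 1)"
  using suitable finite_std_basis independent_std_basis unfolding suitable_family_def by blast+

lemma \<F>_pullback:
  assumes "open_in_orthant m U" "V \<in> \<U>" "W \<in> \<U>" "rc W U"
    "diffeo_between (sub_lcs (Rn m)) (sub_lcs (Rn m)) U V \<Theta>"
  shows "continuous_map (\<F> V) (\<F> W) (\<lambda>\<gamma>. \<lambda>x\<in>W. \<gamma> (\<Theta> x))"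
proof -
  have "continuous_map (vfun_space \<F> V (std_basis 1)) (vfun_space \<F> W (std_basis 1)) (\<lambda>\<gamma>. \<lambda>x\<in>W. \<gamma> (\<Theta> x))"
    using axioms1(1) assms unfolding axiom_PB_def by blast
  from vfun_to_real[OF continuous_map_compose[OF real_to_vfun[OF continuous_map_id assms(2)] this]]
  show ?thesis
  proof (rule continuous_map_eq)
    fix \<gamma>
    have "\<Theta> x \<in> V" if "x \<in> W" for x
      using that rc_subset[OF assms(3,4)] assms(5) by (auto simp: diffeo_between_def bij_betw_def)
    then show "(\<lambda>z\<in>W. Poly_Mapping.lookup (((\<lambda>\<gamma>. \<lambda>x\<in>W. \<gamma> (\<Theta> x)) \<circ> (\<lambda>x. \<lambda>z\<in>V. id x z *\<^sub>R unit_vec 0)) \<gamma> z) 0)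
        = (\<lambda>x\<in>W. \<gamma> (\<Theta> x))"
      by (intro restrict_ext) simp
  qed
qed

text \<open>By (MU), multiplication by \<open>b\<close> is continuous and moves supports into the
  compact set \<open>K\<close>; on functions supported in \<open>K\<close>, extension by 0 is
  continuous by (GL).\<close>

lemma \<F>_localize:
  assumes "V\<^sub>0 \<in> \<U>" "V \<in> \<U>" "V\<^sub>0 \<subseteq> V" "smooth_on UNIV b" "compact K" "K \<subseteq> V\<^sub>0"
    "\<And>x. x \<in> V\<^sub>0 \<Longrightarrow> b x \<noteq> 0 \<Longrightarrow> x \<in> K"
  shows "continuous_map (\<F> V\<^sub>0) (\<F> V) (\<lambda>\<gamma>. \<lambda>x\<in>V. if x \<in> V\<^sub>0 then b x * \<gamma> x else 0)"
proof -
  have supp: "supp_on V\<^sub>0 g \<subseteq> K" if "\<And>x. x \<in> V\<^sub>0 \<Longrightarrow> x \<notin> K \<Longrightarrow> g x = 0" for g :: "vec \<Rightarrow> 'z::zero"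
  proof -
    have "closedin (top_of_set V\<^sub>0) K"
      using compact_imp_closed[OF assms(5)] assms(6) by (rule closed_subset[rotated])
    then show ?thesis
      unfolding supp_on_def using that by (intro closure_of_minimal) auto
  qed
  have Vm: "V\<^sub>0 \<subseteq> Rn m" using \<U>_subset[OF assms(1)] orthant_subset_Rn by auto
  have smb: "smooth_between (sub_lcs (Rn m)) (sub_lcs UNIV) V\<^sub>0 b"
  proof (rule smooth_between_coords[where I = "{..<m}" and J = "{()}" and P = UNIV and L = id
        and G = "\<lambda>_. b" and b = "\<lambda>_. 1"])
    show "subspace (UNIV :: real set)" by (rule subspace_UNIV)
    show "continuous_map (lcs_top (sub_lcs (Rn m))) euclidean id"
      by (simp add: continuous_on_id id_def)
  qed (use assms(4) Vm in \<open>auto simp: Rn_iff_proj[symmetric]\<close>)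
  have "compact (supp_on V\<^sub>0 b)"
  proof -
    have "closedin (top_of_set V\<^sub>0) (supp_on V\<^sub>0 b)" unfolding supp_on_def by (rule closedin_closure_of)
    moreover have "compactin (top_of_set V\<^sub>0) K" using assms(5,6) by (simp add: compactin_subtopology)
    moreover have "supp_on V\<^sub>0 b \<subseteq> K" by (rule supp) (use assms(7) in blast)
    ultimately have "compactin (top_of_set V\<^sub>0) (supp_on V\<^sub>0 b)"
      by (metis closed_compactin)
    then show ?thesis by (simp add: compactin_subtopology)
  qed
  then have MU: "continuous_map (vfun_space \<F> V\<^sub>0 (std_basis 1)) (vfun_space \<F> V\<^sub>0 (std_basis 1)) (\<lambda>\<gamma>. \<lambda>x\<in>V\<^sub>0. b x *\<^sub>R \<gamma> x)"
    using axioms1(3) assms(1) smb unfolding axiom_MU_def by blast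
  have "supp_on V\<^sub>0 (\<lambda>x\<in>V\<^sub>0. b x *\<^sub>R \<gamma> x) \<subseteq> K" for \<gamma> :: "vec \<Rightarrow> vec"
    using assms(7) by (intro supp) auto
  then have MU': "continuous_map (vfun_space \<F> V\<^sub>0 (std_basis 1))
      (subtopology (vfun_space \<F> V\<^sub>0 (std_basis 1)) {\<gamma>. supp_on V\<^sub>0 \<gamma> \<subseteq> K}) (\<lambda>\<gamma>. \<lambda>x\<in>V\<^sub>0. b x *\<^sub>R \<gamma> x)"
    by (intro continuous_map_into_subtopology MU) auto
  have GL: "continuous_map (subtopology (vfun_space \<F> V\<^sub>0 (std_basis 1)) {\<gamma>. supp_on V\<^sub>0 \<gamma> \<subseteq> K})
      (vfun_space \<F> V (std_basis 1)) (extend_zero V\<^sub>0 V)"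
    using axioms1(2) assms(1-3,5,6) unfolding axiom_GL_def by blast
  from vfun_to_real[OF continuous_map_compose[OF real_to_vfun[OF continuous_map_id assms(1)]
        continuous_map_compose[OF MU' GL]]]
  show ?thesis
  proof (rule continuous_map_eq)
    fix \<gamma> :: "vec \<Rightarrow> real"
    show "(\<lambda>z\<in>V. Poly_Mapping.lookup ((extend_zero V\<^sub>0 V \<circ> (\<lambda>\<gamma>. \<lambda>x\<in>V\<^sub>0. b x *\<^sub>R \<gamma> x)
        \<circ> (\<lambda>x. \<lambda>z\<in>V\<^sub>0. id x z *\<^sub>R unit_vec 0)) \<gamma> z) 0) = (\<lambda>x\<in>V. if x \<in> V\<^sub>0 then b x * \<gamma> x else 0)"
      by (rule restrict_ext) (simp add: extend_zero_def)
  qed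
qed

lemma local_bump:
  assumes "V \<in> \<U>" "z \<in> V"
  obtains b :: "vec \<Rightarrow> real" and K P where "smooth_on UNIV b" "compact K" "K \<subseteq> V"
    "\<And>x. x \<in> orthant m \<Longrightarrow> b x \<noteq> 0 \<Longrightarrow> x \<in> K" "open P" "z \<in> P" "\<And>x. x \<in> P \<Longrightarrow> b x = 1"
proof -
  obtain \<beta> :: "real \<Rightarrow> real" where \<beta>: "smooth_on UNIV \<beta>"
    "\<And>x. \<bar>x\<bar> \<le> 1 \<Longrightarrow> \<beta> x = 1" "\<And>x. \<bar>x\<bar> \<ge> 2 \<Longrightarrow> \<beta> x = 0"
    using smooth_bump_real by blast
  obtain V' where V': "V' \<in> \<U>" "z \<in> V'" "rc V' V"
    using \<U>_shrink[OF \<U>_open[OF assms(1)] assms(2)] by blast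
  obtain T where T: "open T" "V' = orthant m \<inter> T"
    using \<U>_open[OF V'(1)] by (auto simp: open_in_orthant_def openin_open)
  have z: "z \<in> T" "proj {..<m} z = z"
    using V'(2) T(2) by (auto simp: orthant_def Rn_iff_proj)
  obtain r where r: "r > 0"
    "\<And>w. (\<And>i. i \<in> {..<m} \<Longrightarrow> \<bar>Poly_Mapping.lookup w i - Poly_Mapping.lookup z i\<bar> < r) \<Longrightarrow> proj {..<m} w \<in> T"
    using open_contains_box[OF _ T(1) z] by blast
  have ab: "\<bar>(s + (- t)) * (2 / r)\<bar> = \<bar>s - t\<bar> * (2 / r)" for s t :: real
    unfolding abs_mult using r(1) by simp
  \<comment> \<open>With the scale \<open>2 / r\<close> every factor is 1 up to distance
    \<open>r / 2\<close>, and some factor vanishes as soon as a coordinate is at distance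
    \<open>r\<close>, the radius up to which the box is known to stay in \<open>T\<close>.\<close>
  define b where "b x = (\<Prod>i<m. \<beta> ((Poly_Mapping.lookup x i + (- Poly_Mapping.lookup z i)) * (2 / r)))" for x
  have "smooth_on UNIV b"
    unfolding b_def
    by (intro smooth_on_prod smooth_on_compose_real[OF _ \<beta>(1)] smooth_on_mult smooth_on_add
        smooth_on_const smooth_on_lookup) auto
  moreover have "compact (cl V')" "cl V' \<subseteq> V" using V'(3) by (auto simp: relatively_compact_in_def)
  moreover have "x \<in> cl V'" if x: "x \<in> orthant m" "b x \<noteq> 0" for x
  proof -
    have "\<bar>Poly_Mapping.lookup x i - Poly_Mapping.lookup z i\<bar> < r" if "i < m" for i
    proof (rule ccontr)
      assume "\<not> \<bar>Poly_Mapping.lookup x i - Poly_Mapping.lookup z i\<bar> < r"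
      then have "r * (2 / r) \<le> \<bar>Poly_Mapping.lookup x i - Poly_Mapping.lookup z i\<bar> * (2 / r)"
        using r(1) by (intro mult_right_mono) auto
      then have "\<bar>(Poly_Mapping.lookup x i + (- Poly_Mapping.lookup z i)) * (2 / r)\<bar> \<ge> 2"
        unfolding ab using r(1) by simp
      then have "\<beta> ((Poly_Mapping.lookup x i + (- Poly_Mapping.lookup z i)) * (2 / r)) = 0" by (rule \<beta>(3))
      then have "b x = 0" unfolding b_def using that by (intro prod_zero) auto
      then show False using x(2) by simp
    qed
    then have "proj {..<m} x \<in> T" by (intro r(2)) auto
    then have "x \<in> V'" using x(1) T(2) by (simp add: orthant_def Rn_iff_proj)
    then show ?thesis using subset_cl[OF V'(1)] by auto
  qed
  moreover define P where "P = (\<Inter>i<m. {x::vec. \<bar>Poly_Mapping.lookup x i - Poly_Mapping.lookup z i\<bar> < r / 2})"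
  have "open P"
    unfolding P_def by (intro open_INT ballI open_Collect_less continuous_intros) auto
  moreover have "z \<in> P" using r(1) by (auto simp: P_def)
  moreover have "b x = 1" if "x \<in> P" for x
    unfolding b_def
  proof (intro prod.neutral ballI \<beta>(2))
    fix i assume "i \<in> {..<m}"
    then have "\<bar>Poly_Mapping.lookup x i - Poly_Mapping.lookup z i\<bar> < r / 2"
      using that by (auto simp: P_def)
    then have "\<bar>Poly_Mapping.lookup x i - Poly_Mapping.lookup z i\<bar> * (2 / r) \<le> (r / 2) * (2 / r)"
      using r(1) by (intro mult_right_mono) auto
    then show "\<bar>(Poly_Mapping.lookup x i + (- Poly_Mapping.lookup z i)) * (2 / r)\<bar> \<le> 1"
      unfolding ab using r(1) by simp
  qed
  ultimately show ?thesis using that by blast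
qed

text \<open>Each summand is the difference of two consecutive products.\<close>

lemma telescoping_partition:
  fixes b :: "nat \<Rightarrow> real"
  shows "(\<Sum>k<n. b k * (\<Prod>l<k. 1 + (- 1) * b l)) = 1 - (\<Prod>l<n. 1 + (- 1) * b l)"
  by (induction n) (simp_all add: algebra_simps)

text \<open>The weights \<open>b\<^sub>k \<Prod>\<^sub>l\<^sub><\<^sub>k (1 - b\<^sub>l)\<close> of bump functions add up to \<open>1\<close> wherever some \<open>b\<^sub>k\<close> is \<open>1\<close>.\<close>

lemma \<F>_glue:
  assumes W: "W \<in> \<U>" and O: "open_in_orthant m Q" "rc W Q" and x0: "x0 \<in> topspace X"
    and loc: "\<And>z. z \<in> cl W \<Longrightarrow> \<exists>V\<in>\<U>. z \<in> V \<and> V \<subseteq> Q \<and> lcont X (\<F> V) (\<lambda>x. restrict (\<Phi> x) V) x0"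
  shows "lcont X (\<F> W) (\<lambda>x. restrict (\<Phi> x) W) x0"
proof -
  \<comment> \<open>The weighted sum is formed on \<open>V\<close>, which contains
    \<open>cl W\<close>; the weights add up to 1 on \<open>cl W\<close>. The final restriction to
    \<open>W\<close> uses the inclusion of \<open>cl W\<close> in \<open>V\<close>.\<close>
  obtain V where V: "V \<in> \<U>" "rc V Q" "rc W V"
    using \<U>_interpolate[OF O(1) W O(2)] by blast
  define R where "R z v b K P \<longleftrightarrow> v \<in> \<U> \<and> v \<subseteq> V \<and> lcont X (\<F> v) (\<lambda>x. restrict (\<Phi> x) v) x0 \<and>
      smooth_on UNIV b \<and> compact K \<and> K \<subseteq> v \<and> (\<forall>x\<in>orthant m. b x \<noteq> 0 \<longrightarrow> x \<in> K) \<and>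
      open P \<and> z \<in> P \<and> (\<forall>x\<in>P. b x = (1::real))" for z v b K P
  have "\<forall>z\<in>cl W. \<exists>v b K P. R z v b K P"
  proof
    fix z assume z: "z \<in> cl W"
    then obtain V1 where V1: "V1 \<in> \<U>" "z \<in> V1" "lcont X (\<F> V1) (\<lambda>x. restrict (\<Phi> x) V1) x0"
      using loc by blast
    \<comment> \<open>The set given by the hypothesis is shrunk into \<open>V\<close>, since
      extension by 0 goes from a subset of \<open>V\<close> to \<open>V\<close>.\<close>
    have "open_in_orthant m (V1 \<inter> V)"
      using \<U>_open[OF V1(1)] \<U>_open[OF V(1)] by (auto simp: open_in_orthant_def)
    moreover have "z \<in> V1 \<inter> V" using V1(2) z rc_cl[OF V(3)] by auto
    ultimately obtain v where v: "v \<in> \<U>" "z \<in> v" "rc v (V1 \<inter> V)" by (rule \<U>_shrink)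
    have vV: "v \<subseteq> V1" "v \<subseteq> V" "rc v V1" using rc_subset[OF v(1,3)] rc_mono[OF v(3)] by auto
    have "lcont X (\<F> v) (\<lambda>x. restrict (restrict (\<Phi> x) V1) v) x0"
      by (rule lcont_compose[OF V1(3) \<F>_restrict[OF V1(1) v(1) vV(3)]])
    moreover have "restrict (restrict f V1) v = restrict f v" for f :: "vec \<Rightarrow> real"
      using vV(1) by (auto simp: fun_eq_iff)
    ultimately have l: "lcont X (\<F> v) (\<lambda>x. restrict (\<Phi> x) v) x0" by simp
    obtain b :: "vec \<Rightarrow> real" and K P where b: "smooth_on UNIV b" "compact K" "K \<subseteq> v"
      "\<And>x. x \<in> orthant m \<Longrightarrow> b x \<noteq> 0 \<Longrightarrow> x \<in> K" "open P" "z \<in> P" "\<And>x. x \<in> P \<Longrightarrow> b x = 1"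
      by (rule local_bump[OF v(1,2)]) blast
    have "R z v b K P"
      unfolding R_def using v(1) vV(2) l b by (intro conjI ballI impI)
    then show "\<exists>v b K P. R z v b K P" by blast
  qed
  then obtain v b K P where "\<And>z. z \<in> cl W \<Longrightarrow> R z (v z) (b z) (K z) (P z)"
    by metis
  note D = this[unfolded R_def]
  have "compact (cl W)" using O(2) by (simp add: relatively_compact_in_def)
  then obtain Z where Z: "Z \<subseteq> cl W" "finite Z" "cl W \<subseteq> (\<Union>z\<in>Z. P z)"
  proof (rule compactE_image)
    show "open (P z)" if "z \<in> cl W" for z using D[OF that] by blast
    show "cl W \<subseteq> (\<Union>z\<in>cl W. P z)" using D by blast
  qed
  obtain e where e: "bij_betw e {..<card Z} Z"
    using ex_bij_betw_nat_finite[OF Z(2)] by (auto simp: atLeast0LessThan)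
  have eW: "e k \<in> cl W" if "k < card Z" for k
    using e Z(1) that by (auto simp: bij_betw_def)
  define h where "h k x = b (e k) x * (\<Prod>l<k. 1 + (- 1) * b (e l) x)" for k x
  have hs: "smooth_on UNIV (h k)" if "k < card Z" for k
    unfolding h_def using D[OF eW] that
    by (intro smooth_on_mult smooth_on_prod smooth_on_add smooth_on_const) auto
  have sum1: "(\<Sum>k<card Z. h k x) = 1" if "x \<in> cl W" for x
  proof -
    obtain z where z: "z \<in> Z" "x \<in> P z" using \<open>x \<in> cl W\<close> Z(3) by auto
    obtain k where k: "k < card Z" "z = e k" using e z(1) by (auto simp: bij_betw_def)
    have "b (e k) x = 1" using D[OF eW[OF k(1)]] z(2) k(2) by auto
    then have "(\<Prod>l<card Z. 1 + (- 1) * b (e l) x) = 0" using k(1) by (intro prod_zero) auto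
    then show ?thesis unfolding h_def telescoping_partition by simp
  qed
  let ?g = "\<lambda>k x. \<lambda>y\<in>V. if y \<in> v (e k) then h k y * restrict (\<Phi> x) (v (e k)) y else 0"
  have "lcont X (\<F> V) (?g k) x0" if k: "k < card Z" for k
  proof (rule lcont_compose[where g = "\<lambda>\<gamma>. \<lambda>y\<in>V. if y \<in> v (e k) then h k y * \<gamma> y else 0" and Y = "\<F> (v (e k))"])
    note Dk = D[OF eW[OF k]]
    show "lcont X (\<F> (v (e k))) (\<lambda>x. restrict (\<Phi> x) (v (e k))) x0" using Dk by blast
    show "continuous_map (\<F> (v (e k))) (\<F> V) (\<lambda>\<gamma>. \<lambda>y\<in>V. if y \<in> v (e k) then h k y * \<gamma> y else 0)"
    proof (rule \<F>_localize[OF _ V(1) _ hs[OF k]])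
      show "y \<in> K (e k)" if "y \<in> v (e k)" "h k y \<noteq> 0" for y
        using that Dk \<U>_subset[of "v (e k)"] by (auto simp: h_def)
    qed (use Dk in blast)+
  qed
  then obtain N where N: "openin X N" "x0 \<in> N" "\<forall>k\<in>{..<card Z}. continuous_map (subtopology X N) (\<F> V) (?g k)"
    using lcont_common[of "{..<card Z}" x0 X "\<lambda>_. \<F> V" ?g] x0 by auto
  have "continuous_map (subtopology X N) (\<F> V) (\<lambda>x. \<lambda>y\<in>V. \<Sum>k<card Z. ?g k x y)"
  proof (rule \<F>_sum[OF V(1) finite_lessThan])
    show "continuous_map (subtopology X N) (\<F> V) (?g k)" if "k \<in> {..<card Z}" for k
      using N(3) that by (rule bspec)
  qed
  from continuous_map_compose[OF this \<F>_restrict[OF V(1) W V(3)]]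
  have "continuous_map (subtopology X N) (\<F> W) (\<lambda>x. restrict (\<lambda>y\<in>V. \<Sum>k<card Z. ?g k x y) W)"
    by (simp add: o_def)
  moreover have "restrict (\<lambda>y\<in>V. \<Sum>k<card Z. ?g k x y) W = restrict (\<Phi> x) W" for x
  proof (rule restrict_ext)
    fix y assume y: "y \<in> W"
    have yV: "y \<in> V" "y \<in> cl W" "y \<in> orthant m"
      using y rc_subset[OF W V(3)] subset_cl[OF W] \<U>_subset[OF W] by auto
    have "?g k x y = h k y * \<Phi> x y" if k: "k < card Z" for k
    proof (cases "y \<in> v (e k)")
      case False
      then have "b (e k) y = 0" using D[OF eW[OF k]] yV(3) by blast
      then show ?thesis using False yV(1) by (simp add: h_def)
    qed (use yV in simp)
    then have "(\<Sum>k<card Z. ?g k x y) = (\<Sum>k<card Z. h k y) * \<Phi> x y"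
      by (simp add: sum_distrib_right)
    then show "(\<lambda>y\<in>V. \<Sum>k<card Z. ?g k x y) y = \<Phi> x y"
      using sum1[OF yV(2)] yV(1) by simp
  qed
  ultimately show ?thesis using N(1,2) by (intro lcont_subset) simp_all
qed

end

section \<open>Charts\<close>

text \<open>The same derivatives serve: continuity passes to the subspace, and the interior of
  \<open>U'\<close> is contained in that of \<open>U\<close>.\<close>

lemma smooth_between_subset_cong:
  assumes "smooth_between E F U f" "U' \<subseteq> U" "\<And>x. x \<in> U' \<Longrightarrow> f x = g x"
  shows "smooth_between E F U' g"
proof -
  obtain d where D: "\<forall>x\<in>U. d 0 x (\<lambda>_. undefined) = f x"
    "\<forall>j. continuous_map (prod_topology (subtopology (lcs_top E) U)
          (product_topology (\<lambda>_. lcs_top E) {..<j})) (lcs_top F) (\<lambda>(x, y). d j x y)"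
    "\<forall>j. \<forall>x \<in> lcs_top E interior_of U. \<forall>y \<in> {..<Suc j} \<rightarrow>\<^sub>E topspace (lcs_top E).
        has_dir_deriv E F (\<lambda>z. d j z (restrict y {..<j})) x (y j) (d (Suc j) x y)"
    using assms(1) unfolding smooth_between_def by blast
  show ?thesis
    unfolding smooth_between_def
  proof (intro exI[of _ d] conjI ballI allI)
    show "d 0 x (\<lambda>_. undefined) = g x" if "x \<in> U'" for x
      using that D(1) assms(2,3) by auto
    show "continuous_map (prod_topology (subtopology (lcs_top E) U') (product_topology (\<lambda>_. lcs_top E) {..<j}))
        (lcs_top F) (\<lambda>(x, y). d j x y)" for j
    proof -
      have "prod_topology (subtopology (lcs_top E) U') (product_topology (\<lambda>_. lcs_top E) {..<j})
        = subtopology (prod_topology (subtopology (lcs_top E) U) (product_topology (\<lambda>_. lcs_top E) {..<j})) (U' \<times> UNIV)"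
        by (simp add: prod_topology_subtopology subtopology_subtopology)
          (rule arg_cong[of _ _ "subtopology _"], use assms(2) in auto)
      then show ?thesis
        using D(2) by (simp only: continuous_map_from_subtopology)
    qed
    show "has_dir_deriv E F (\<lambda>z. d j z (restrict y {..<j})) x (y j) (d (Suc j) x y)"
      if "x \<in> lcs_top E interior_of U'" "y \<in> {..<Suc j} \<rightarrow>\<^sub>E topspace (lcs_top E)" for j x y
      using D(3) that interior_of_mono[OF assms(2), of "lcs_top E"] by blast
  qed
qed

lemma smooth_between_continuous_map:
  assumes "smooth_between (sub_lcs S) (sub_lcs S') U f" "U \<subseteq> S"
  shows "continuous_map (top_of_set U) (top_of_set S') f"
proof -
  obtain d where D: "\<forall>x\<in>U. d 0 x (\<lambda>_. undefined) = f x"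
    "\<forall>j::nat. continuous_map (prod_topology (subtopology (top_of_set S) U)
          (product_topology (\<lambda>_. top_of_set S) {..<j})) (top_of_set S') (\<lambda>(x, y). d j x y)"
    using assms(1) unfolding smooth_between_def lcs_top_sub_lcs
    by blast
  have "subtopology (top_of_set S) U = top_of_set U"
    using assms(2) by (simp add: subtopology_subtopology Int_absorb1)
  then have "continuous_map (top_of_set U) (subtopology (top_of_set S) U) (\<lambda>x. x)"
    using continuous_map_id[of "top_of_set U"] by (simp add: id_def)
  then have "continuous_map (top_of_set U) (prod_topology (subtopology (top_of_set S) U)
      (product_topology (\<lambda>_. top_of_set S) {..<0::nat})) (\<lambda>x. (x, \<lambda>_. undefined))"
    by (intro continuous_map_pair_const) auto
  from continuous_map_compose[OF this D(2)[rule_format, of 0]]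
  have "continuous_map (top_of_set U) (top_of_set S') (\<lambda>x. d 0 x (\<lambda>_. undefined))"
    by (simp add: o_def)
  then show ?thesis
    by (rule continuous_map_eq) (use D(1) in auto)
qed

lemma top_of_subset: "X \<subseteq> S \<Longrightarrow> subtopology (top_of_set S) X = top_of_set X"
  by (simp add: subtopology_subtopology Int_absorb1)

lemma cinv_cmap: "inj_on (cmap c) (cdom c) \<Longrightarrow> p \<in> cdom c \<Longrightarrow> cinv c (cmap c p) = p"
  by (simp add: cinv_def the_inv_into_f_f)

lemma cmap_cinv: "inj_on (cmap c) (cdom c) \<Longrightarrow> x \<in> cimage c \<Longrightarrow> cmap c (cinv c x) = x"
  by (simp add: cinv_def cimage_def f_the_inv_into_f)

lemma cinv_in_cdom: "inj_on (cmap c) (cdom c) \<Longrightarrow> x \<in> cimage c \<Longrightarrow> cinv c x \<in> cdom c"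
  by (auto simp: cimage_def cinv_cmap)

lemma cmap_in_cimage: "p \<in> cdom c \<Longrightarrow> cmap c p \<in> cimage c"
  by (simp add: cimage_def)

locale chart_on =
  fixes n :: nat and X :: "vec set" and T :: "'x topology" and c :: "('x, vec) chart"
  assumes chart: "is_chart (sub_lcs (Rn n)) X T c" and X: "X \<subseteq> Rn n"
begin

lemma model: "cmodel c = sub_lcs (Rn n)"
  and open_dom: "openin T (cdom c)"
  and ext: "cmap c \<in> extensional (cdom c)"
  and open_image: "openin (top_of_set X) (cimage c)"
  using chart X by (simp_all add: is_chart_def top_of_subset)

lemma image_subset: "cimage c \<subseteq> X"
  using openin_subset[OF open_image] by simp

lemma homeo: "homeomorphic_map (subtopology T (cdom c)) (top_of_set (cimage c)) (cmap c)"
  using chart X image_subset by (simp add: is_chart_def top_of_subset)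

lemma inj: "inj_on (cmap c) (cdom c)"
  using homeo openin_subset[OF open_dom]
  by (simp add: homeomorphic_eq_everything_map Int_absorb1)

lemma continuous: "continuous_map (subtopology T (cdom c)) (top_of_set (cimage c)) (cmap c)"
  using homeo by (simp add: homeomorphic_eq_everything_map)

lemma open_map_image:
  assumes "openin T W" "W \<subseteq> cdom c"
  shows "openin (top_of_set X) (cmap c ` W)"
proof -
  have "openin (subtopology T (cdom c)) W"
    using assms by (metis Int_absorb1 inf_commute openin_subtopology_Int)
  then have "openin (top_of_set (cimage c)) (cmap c ` W)"
    using homeo by (simp add: homeomorphic_eq_everything_map open_map_def)
  then show ?thesis
    using openin_trans_full[of "top_of_set X" "cimage c"] open_image image_subset by (simp add: top_of_subset)
qed

lemma cinv_continuous: "continuous_map (top_of_set (cimage c)) T (cinv c)"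
  unfolding continuous_map_def
proof (intro conjI allI impI)
  show "cinv c \<in> topspace (top_of_set (cimage c)) \<rightarrow> topspace T"
    using cinv_in_cdom[OF inj] openin_subset[OF open_dom] by auto
  fix W assume W: "openin T W"
  have "{x \<in> topspace (top_of_set (cimage c)). cinv c x \<in> W} = cmap c ` (W \<inter> cdom c)"
    using cinv_cmap[OF inj] cmap_cinv[OF inj] cinv_in_cdom[OF inj] by (force simp: cimage_def)
  moreover have "openin (top_of_set X) (cmap c ` (W \<inter> cdom c))"
    using W open_dom by (intro open_map_image) auto
  then have "openin (top_of_set (cimage c)) (cmap c ` (W \<inter> cdom c))"
    using image_subset by (metis (no_types, lifting) cimage_def image_mono inf_le2 openin_subset_trans)
  ultimately show "openin (top_of_set (cimage c)) {x \<in> topspace (top_of_set (cimage c)). cinv c x \<in> W}"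
    by simp
qed

end

text \<open>The map is cut down together with the domain, because \<open>is_chart\<close> demands an
  extensional map.\<close>

definition restrict_chart :: "('x, 'v) chart \<Rightarrow> 'x set \<Rightarrow> ('x, 'v) chart" where
  "restrict_chart c S = \<lparr>cdom = cdom c \<inter> S, cmap = restrict (cmap c) (cdom c \<inter> S), cmodel = cmodel c\<rparr>"

lemma restrict_chart_simps [simp]:
  "cdom (restrict_chart c S) = cdom c \<inter> S"
  "p \<in> cdom c \<Longrightarrow> p \<in> S \<Longrightarrow> cmap (restrict_chart c S) p = cmap c p"
  "cmodel (restrict_chart c S) = cmodel c"
  by (simp_all add: restrict_chart_def)

lemma cimage_restrict_chart: "cimage (restrict_chart c S) = cmap c ` (cdom c \<inter> S)"
  by (simp add: cimage_def restrict_chart_def)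

lemma cinv_restrict_chart:
  assumes "inj_on (cmap c) (cdom c)" "x \<in> cmap c ` (cdom c \<inter> S)"
  shows "cinv (restrict_chart c S) x = cinv c x"
proof -
  obtain p where p: "p \<in> cdom c" "p \<in> S" "x = cmap c p" using assms(2) by auto
  have "inj_on (cmap (restrict_chart c S)) (cdom (restrict_chart c S))"
    using assms(1) by (auto simp: inj_on_def)
  from cinv_cmap[OF this, of p] cinv_cmap[OF assms(1) p(1)] show ?thesis
    using p by simp
qed

text \<open>Restricting to an open set changes neither the values nor the inverse on what remains,
  so compatibility with every member of \<open>A\<close> is inherited.\<close>

lemma restrict_chart_in_maximal_atlas:
  assumes c: "c \<in> maximal_atlas (sub_lcs (Rn n)) X T A" and S: "openin T S" and X: "X \<subseteq> Rn n"
    and A: "\<And>d. d \<in> A \<Longrightarrow> inj_on (cmap d) (cdom d)"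
  shows "restrict_chart c S \<in> maximal_atlas (sub_lcs (Rn n)) X T A"
proof -
  interpret chart_on n X T c
    using c X by unfold_locales (simp_all add: maximal_atlas_def)
  let ?r = "restrict_chart c S"
  have open_r: "openin T (cdom c \<inter> S)" using open_dom S by (rule openin_Int)
  have img: "openin (top_of_set X) (cimage ?r)"
    unfolding cimage_restrict_chart by (intro open_map_image open_r) auto
  have imgX: "cimage ?r \<subseteq> X" using openin_subset[OF img] by simp
  have "homeomorphic_map (subtopology (subtopology T (cdom c)) S) (subtopology (top_of_set (cimage c)) (cimage ?r)) (cmap c)"
    using openin_subset[OF open_dom]
    by (intro homeomorphic_map_subtopologies[OF homeo]) (auto simp: cimage_restrict_chart cimage_def)
  moreover have "cimage ?r \<subseteq> cimage c" by (auto simp: cimage_restrict_chart cimage_def)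
  ultimately have "homeomorphic_map (subtopology T (cdom c \<inter> S)) (top_of_set (cimage ?r)) (cmap c)"
    by (simp only: top_of_subset) (simp only: subtopology_subtopology[of T])
  then have h: "homeomorphic_map (subtopology T (cdom ?r)) (top_of_set (cimage ?r)) (cmap ?r)"
    unfolding restrict_chart_simps(1) by (rule homeomorphic_map_eq) auto
  have "is_chart (sub_lcs (Rn n)) X T ?r"
    unfolding is_chart_def
    using model open_r img h imgX X
    by (simp add: top_of_subset) (simp add: restrict_chart_def)
  moreover have "smooth_transition ?r d \<and> smooth_transition d ?r" if d: "d \<in> A" for d
  proof -
    have cd: "smooth_transition c d" "smooth_transition d c" using c d by (auto simp: maximal_atlas_def)
    have "smooth_between (cmodel ?r) (cmodel d) (cmap ?r ` (cdom ?r \<inter> cdom d)) (cmap d \<circ> cinv ?r)"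
    proof (rule smooth_between_subset_cong)
      show "smooth_between (cmodel ?r) (cmodel d) (cmap c ` (cdom c \<inter> cdom d)) (cmap d \<circ> cinv c)"
        using cd(1) by (simp add: smooth_transition_def)
      show "cmap ?r ` (cdom ?r \<inter> cdom d) \<subseteq> cmap c ` (cdom c \<inter> cdom d)" by auto
      fix x assume "x \<in> cmap ?r ` (cdom ?r \<inter> cdom d)"
      then have "x \<in> cmap c ` (cdom c \<inter> S)" by auto
      then show "(cmap d \<circ> cinv c) x = (cmap d \<circ> cinv ?r) x"
        by (simp add: cinv_restrict_chart[OF inj])
    qed
    moreover have "smooth_between (cmodel d) (cmodel ?r) (cmap d ` (cdom d \<inter> cdom ?r)) (cmap ?r \<circ> cinv d)"
    proof (rule smooth_between_subset_cong)
      show "smooth_between (cmodel d) (cmodel ?r) (cmap d ` (cdom d \<inter> cdom c)) (cmap c \<circ> cinv d)"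
        using cd(2) by (simp add: smooth_transition_def)
      show "cmap d ` (cdom d \<inter> cdom ?r) \<subseteq> cmap d ` (cdom d \<inter> cdom c)" by auto
      fix x assume "x \<in> cmap d ` (cdom d \<inter> cdom ?r)"
      then show "(cmap c \<circ> cinv d) x = (cmap ?r \<circ> cinv d) x"
        by (auto simp: cinv_cmap[OF A[OF d]])
    qed
    ultimately have "smooth_transition ?r d \<and> smooth_transition d ?r"
      unfolding smooth_transition_def by blast
    then show ?thesis .
  qed
  ultimately show ?thesis by (simp add: maximal_atlas_def)
qed

text \<open>Smoothness at \<open>z\<close> of a map from coordinate space into a manifold, seen in
  the chart \<open>c\<close>. That a whole neighbourhood of \<open>z\<close> is mapped into
  \<open>cdom c\<close> is part of the notion, so such maps can be chained without tracking the
  domains of local representatives.\<close>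

definition chart_smooth :: "('x, vec) chart \<Rightarrow> (('k \<Rightarrow>\<^sub>0 real) \<Rightarrow> 'x) \<Rightarrow> ('k \<Rightarrow>\<^sub>0 real) \<Rightarrow> bool" where
  "chart_smooth c g z \<longleftrightarrow> (\<exists>Q. open Q \<and> z \<in> Q \<and> g ` Q \<subseteq> cdom c) \<and>
     (\<forall>i. smooth_at (\<lambda>w. Poly_Mapping.lookup (cmap c (g w)) i) z)"

lemma chart_smooth_in_cdom: "chart_smooth c g z \<Longrightarrow> g z \<in> cdom c"
  by (auto simp: chart_smooth_def)

lemma tup_preimage_nbhd:
  assumes "\<And>i. i < n \<Longrightarrow> smooth_at (u i) z" "openin (top_of_set (Rn n)) U" "tup {..<n} (\<lambda>i. u i z) \<in> U"
  obtains Q where "open Q" "z \<in> Q" "\<And>w. w \<in> Q \<Longrightarrow> tup {..<n} (\<lambda>i. u i w) \<in> U"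
proof -
  obtain Q1 where Q1: "open Q1" "z \<in> Q1" "\<forall>i\<in>{..<n}. smooth_on Q1 (u i)"
    using smooth_at_common[of "{..<n}" u z] assms(1) by auto
  let ?V = "{y. proj {..<n} y \<in> U}" and ?u = "\<lambda>w. tup {..<n} (\<lambda>i. u i w)"
  have "continuous_on Q1 ?u"
    using Q1(3) by (intro continuous_on_tup smooth_on_continuous) auto
  then have "open (Q1 \<inter> ?u -` ?V)"
    using Q1(1) open_proj_vimage[OF assms(2)] by (rule continuous_open_preimage)
  then show ?thesis
  proof (rule that)
    show "z \<in> Q1 \<inter> ?u -` ?V" using Q1(2) assms(3) by (simp add: proj_tup)
    show "?u w \<in> U" if "w \<in> Q1 \<inter> ?u -` ?V" for w
      using that by (simp add: proj_tup)
  qed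
qed

text \<open>Read in \<open>c\<close>, the map \<open>f\<close> is a smooth function of the
  coordinates of \<open>g\<close>, and the chain rule applies; since \<open>S\<close> is open,
  \<open>g w\<close> stays in \<open>S\<close> for \<open>w\<close> near \<open>z\<close>.\<close>

lemma chart_smooth_compose:
  assumes c: "chart_on n (Rn n) T c" and S: "openin T S" "S \<subseteq> cdom c" "f ` S \<subseteq> cdom d"
    and sb: "smooth_between (sub_lcs (Rn n)) (sub_lcs Y) (cmap c ` S) (cmap d \<circ> f \<circ> cinv c)"
    and g: "chart_smooth c g z" "g z \<in> S"
  shows "chart_smooth d (\<lambda>w. f (g w)) z"
proof -
  interpret chart_on n "Rn n" T c by (rule c)
  let ?u = "\<lambda>i w. Poly_Mapping.lookup (cmap c (g w)) i" and ?O = "cmap c ` S"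
  have O: "openin (top_of_set (Rn n)) ?O" by (rule open_map_image[OF S(1,2)])
  obtain Q where Q: "open Q" "z \<in> Q" "g ` Q \<subseteq> cdom c" and su: "\<And>i. smooth_at (?u i) z"
    using g(1) by (auto simp: chart_smooth_def)
  have tu: "tup {..<n} (\<lambda>i. ?u i w) = cmap c (g w)" if "w \<in> Q" for w
    using Q(3) that cmap_in_cimage[of "g w" c] image_subset by (auto simp: Rn_iff_proj subset_iff)
  have "tup {..<n} (\<lambda>i. ?u i z) \<in> ?O" using tu[OF Q(2)] g(2) by simp
  then obtain Q1 where Q1: "open Q1" "z \<in> Q1" "\<And>w. w \<in> Q1 \<Longrightarrow> tup {..<n} (\<lambda>i. ?u i w) \<in> ?O"
    using tup_preimage_nbhd[of n ?u z ?O] su O by blast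
  have gS: "g w \<in> S" if "w \<in> Q \<inter> Q1" for w
  proof -
    have "cmap c (g w) \<in> ?O" using Q1(3)[of w] tu[of w] that by simp
    then obtain p where "p \<in> S" "cmap c (g w) = cmap c p" by auto
    then show ?thesis
      using inj_onD[OF inj, of "g w" p] Q(3) S(2) that by auto
  qed
  show ?thesis
    unfolding chart_smooth_def
  proof (intro conjI allI)
    show "\<exists>Q. open Q \<and> z \<in> Q \<and> (\<lambda>w. f (g w)) ` Q \<subseteq> cdom d"
      using Q Q1 gS S(3) by (intro exI[of _ "Q \<inter> Q1"]) auto
    fix i
    let ?F = "\<lambda>y. Poly_Mapping.lookup ((cmap d \<circ> f \<circ> cinv c) (proj {..<n} y)) i"
    have "smooth_at ?F (cmap c (g z))"
      using g(2) by (intro smooth_between_imp_smooth_at[OF sb O]) auto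
    then have "smooth_at (\<lambda>w. ?F (tup {..<n} (\<lambda>i. ?u i w))) z"
      by (intro smooth_at_compose_tup[OF finite_lessThan su]) (simp only: tu[OF Q(2)])
    then show "smooth_at (\<lambda>w. Poly_Mapping.lookup (cmap d (f (g w))) i) z"
    proof (rule smooth_at_cong[of _ _ "Q \<inter> Q1"])
      fix w assume w: "w \<in> Q \<inter> Q1"
      then have "cinv c (cmap c (g w)) = g w" using Q(3) by (intro cinv_cmap[OF inj]) auto
      then show "?F (tup {..<n} (\<lambda>i. ?u i w)) = Poly_Mapping.lookup (cmap d (f (g w))) i"
        using w by (simp add: proj_tup tu)
    qed (use Q Q1 in auto)
  qed
qed

lemma chart_smooth_cinv:
  assumes c: "chart_on n (Rn n) T c"
    and u: "\<And>i. i < n \<Longrightarrow> smooth_at (u i) z" "tup {..<n} (\<lambda>i. u i z) \<in> cimage c"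
  shows "chart_smooth c (\<lambda>w. cinv c (tup {..<n} (\<lambda>i. u i w))) z"
proof -
  interpret chart_on n "Rn n" T c by (rule c)
  obtain Q where Q: "open Q" "z \<in> Q" "\<And>w. w \<in> Q \<Longrightarrow> tup {..<n} (\<lambda>i. u i w) \<in> cimage c"
    using tup_preimage_nbhd[OF u(1) open_image u(2)] by blast
  show ?thesis
    unfolding chart_smooth_def
  proof (intro conjI allI)
    show "\<exists>Q. open Q \<and> z \<in> Q \<and> (\<lambda>w. cinv c (tup {..<n} (\<lambda>i. u i w))) ` Q \<subseteq> cdom c"
      using Q cinv_in_cdom[OF inj] by blast
    fix i
    have "smooth_at (\<lambda>w. if i < n then u i w else 0) z"
      using u(1) by (cases "i < n") (auto simp: smooth_at_const)
    then show "smooth_at (\<lambda>w. Poly_Mapping.lookup (cmap c (cinv c (tup {..<n} (\<lambda>i. u i w)))) i) z"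
      by (rule smooth_at_cong[OF _ Q(1,2)]) (use Q(3) in \<open>simp add: cmap_cinv[OF inj] lookup_tup\<close>)
  qed
qed

lemma chart_smooth_transition:
  assumes c: "chart_on n (Rn n) T c" and d: "chart_on n (Rn n) T d" and cd: "smooth_transition c d"
    and g: "chart_smooth c g z" "g z \<in> cdom d"
  shows "chart_smooth d g z"
proof -
  interpret c: chart_on n "Rn n" T c by (rule c)
  interpret d: chart_on n "Rn n" T d by (rule d)
  have "smooth_between (sub_lcs (Rn n)) (sub_lcs (Rn n)) (cmap c ` (cdom c \<inter> cdom d)) (cmap d \<circ> id \<circ> cinv c)"
    using cd by (simp add: smooth_transition_def c.model d.model)
  from chart_smooth_compose[OF c _ _ _ this g(1)] show ?thesis
    using chart_smooth_in_cdom[OF g(1)] g(2) c.open_dom d.open_dom by auto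
qed

lemma chart_smooth_restrict:
  assumes c: "chart_on n (Rn n) T c" and S: "openin T S"
  shows "chart_smooth (restrict_chart c S) g z \<longleftrightarrow> chart_smooth c g z \<and> g z \<in> S"
proof
  assume r: "chart_smooth (restrict_chart c S) g z"
  then obtain Q where Q: "open Q" "z \<in> Q" "g ` Q \<subseteq> cdom c \<inter> S" by (auto simp: chart_smooth_def)
  have "smooth_at (\<lambda>w. Poly_Mapping.lookup (cmap c (g w)) i) z" for i
    by (rule smooth_at_cong[of "\<lambda>w. Poly_Mapping.lookup (cmap (restrict_chart c S) (g w)) i" _ Q])
      (use r Q in \<open>auto simp: chart_smooth_def restrict_chart_def\<close>)
  then show "chart_smooth c g z \<and> g z \<in> S"
    using Q by (auto simp: chart_smooth_def)
next
  interpret chart_on n "Rn n" T c by (rule c)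
  assume g: "chart_smooth c g z \<and> g z \<in> S"
  have op: "openin T (cdom c \<inter> S)" using open_dom S by (rule openin_Int)
  have "cmap c ` (cdom c \<inter> S) \<subseteq> Rn n" using image_subset by (auto simp: cimage_def)
  then have "smooth_between (sub_lcs (Rn n)) (sub_lcs (Rn n)) (cmap c ` (cdom c \<inter> S)) (cmap (restrict_chart c S) \<circ> id \<circ> cinv c)"
    by (intro smooth_between_coords[where I = "{..<n}" and J = "{..<n}" and P = UNIV and L = id
          and G = "\<lambda>i y. Poly_Mapping.lookup y i" and b = unit_vec])
      (auto simp: smooth_on_lookup continuous_on_id id_def Rn_iff_proj[symmetric] subspace_Rn unit_vec_in_Rn
        cinv_cmap[OF inj] tup_def[symmetric], simp add: Rn_iff_proj subset_iff)
  from chart_smooth_compose[OF c op _ _ this] g show "chart_smooth (restrict_chart c S) g z"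
    using chart_smooth_in_cdom[of c g z] by auto
qed

section \<open>Tangent bundle\<close>

text \<open>The second half of a vector of \<open>Rn (2 * n)\<close>, numbered from 0 again; with
  \<open>proj {..<n}\<close> it undoes \<open>vconcat n\<close>.\<close>

definition hi :: "nat \<Rightarrow> vec \<Rightarrow> vec" where
  "hi n z = tup {..<n} (\<lambda>i. Poly_Mapping.lookup z (n + i))"

lemma hi_in_Rn: "hi n z \<in> Rn n"
  by (simp add: hi_def tup_in_Rn)

lemma vconcat_eq_tup:
  assumes "x \<in> Rn n"
  shows "vconcat n x y = tup {..<2 * n} (\<lambda>i. if i < n then Poly_Mapping.lookup x i else Poly_Mapping.lookup y (i - n))"
proof (rule poly_mapping_eqI)
  fix k
  have "(\<Sum>i<n. if n + i = k then Poly_Mapping.lookup y i else 0) = (if n \<le> k \<and> k < 2 * n then Poly_Mapping.lookup y (k - n) else 0)"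
  proof (cases "n \<le> k")
    case True
    then have "(\<Sum>i<n. if n + i = k then Poly_Mapping.lookup y i else 0) = (\<Sum>i<n. if i = k - n then Poly_Mapping.lookup y i else 0)"
      by (intro sum.cong) auto
    also have "\<dots> = (if k - n < n then Poly_Mapping.lookup y (k - n) else 0)" by simp
    finally show ?thesis using True by auto
  qed (auto intro!: sum.neutral)
  then show "Poly_Mapping.lookup (vconcat n x y) k =
      Poly_Mapping.lookup (tup {..<2 * n} (\<lambda>i. if i < n then Poly_Mapping.lookup x i else Poly_Mapping.lookup y (i - n))) k"
    using lookup_Rn[OF assms, of k]
    by (auto simp: vconcat_def lookup_add lookup_sum lookup_single when_def lookup_tup)
qed

lemma lookup_vconcat:
  "x \<in> Rn n \<Longrightarrow> Poly_Mapping.lookup (vconcat n x y) i =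
    (if i < n then Poly_Mapping.lookup x i else if i < 2 * n then Poly_Mapping.lookup y (i - n) else 0)"
  by (simp add: vconcat_eq_tup lookup_tup)

lemma vconcat_in_Rn: "x \<in> Rn n \<Longrightarrow> vconcat n x y \<in> Rn (2 * n)"
  by (simp add: vconcat_eq_tup tup_in_Rn)

lemma proj_vconcat: "x \<in> Rn n \<Longrightarrow> proj {..<n} (vconcat n x y) = x"
  by (rule Rn_eqI[of _ n]) (simp_all add: tup_in_Rn lookup_tup lookup_vconcat)

lemma hi_vconcat: "x \<in> Rn n \<Longrightarrow> y \<in> Rn n \<Longrightarrow> hi n (vconcat n x y) = y"
  by (rule Rn_eqI[OF hi_in_Rn]) (simp_all add: hi_def lookup_tup lookup_vconcat)

lemma vconcat_proj_hi: "z \<in> Rn (2 * n) \<Longrightarrow> vconcat n (proj {..<n} z) (hi n z) = z"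
  by (rule Rn_eqI[of _ "2 * n"])
    (auto simp: vconcat_in_Rn tup_in_Rn lookup_tup lookup_vconcat hi_def)

lemma continuous_map_tup:
  "(\<And>i. i \<in> I \<Longrightarrow> continuous_map X euclideanreal (\<lambda>x. u x i)) \<Longrightarrow> finite I \<Longrightarrow>
    continuous_map X euclidean (\<lambda>x. tup I (u x))"
  unfolding tup_def
  by (rule continuous_map_sum[where f = "\<lambda>x i. u x i *\<^sub>R unit_vec i"]) (auto intro: continuous_map_scaleR_const)

lemma smooth_at_hi: "smooth_at G (hi n z) \<Longrightarrow> smooth_at (\<lambda>w. G (hi n w)) z"
  unfolding hi_def by (intro smooth_at_compose_tup[where u = "\<lambda>i w. Poly_Mapping.lookup w (n + i)"])
    (auto intro: smooth_at_lookup)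

lemma smooth_at_proj: "finite I \<Longrightarrow> smooth_at G (proj I z) \<Longrightarrow> smooth_at (\<lambda>w. G (proj I w)) z"
  by (intro smooth_at_compose_tup[where u = "\<lambda>i w. Poly_Mapping.lookup w i"]) (auto intro: smooth_at_lookup)

lemma smooth_between_Rn:
  assumes U: "openin (top_of_set (Rn k)) U"
    and sm: "\<And>i z. i < l \<Longrightarrow> z \<in> U \<Longrightarrow> smooth_at (G i) z"
    and eq: "\<And>z i. z \<in> U \<Longrightarrow> i < l \<Longrightarrow> Poly_Mapping.lookup (f z) i = G i z"
    and f: "\<And>z. z \<in> U \<Longrightarrow> f z \<in> Rn l"
  shows "smooth_between (sub_lcs (Rn k)) (sub_lcs (Rn l)) U f"
proof (rule smooth_between_coords[where I = "{..<k}" and J = "{..<l}" and L = id and b = unit_vec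
      and P = "{z. proj {..<k} z \<in> U}" and G = "\<lambda>i z. G i (proj {..<k} z)"])
  have UR: "U \<subseteq> Rn k" using openin_subset[OF U] by simp
  show "open {z. proj {..<k} z \<in> U}" by (rule open_proj_vimage[OF U])
  show "smooth_on {z. proj {..<k} z \<in> U} (\<lambda>z. G j (proj {..<k} z))" if "j \<in> {..<l}" for j
    using that sm by (intro smooth_on_local smooth_at_proj) auto
  show "id x \<in> {z. proj {..<k} z \<in> U}" if "x \<in> U" for x
    using that UR by (auto simp: Rn_iff_proj subset_iff)
  show "continuous_map (lcs_top (sub_lcs (Rn k))) euclidean id"
    by (simp add: continuous_on_id id_def)
  show "f x = (\<Sum>j<l. G j (proj {..<k} (id x)) *\<^sub>R unit_vec j)" if "x \<in> U" for x
  proof -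
    have "f x = proj {..<l} (f x)" using f[OF that] by (simp add: Rn_iff_proj)
    also have "\<dots> = tup {..<l} (\<lambda>j. G j (proj {..<k} x))"
      using that UR eq by (intro tup_cong) (auto simp: Rn_iff_proj subset_iff)
    finally show ?thesis by (simp add: tup_def)
  qed
qed (use openin_subset[OF U] in \<open>auto simp: subspace_Rn unit_vec_in_Rn Rn_iff_proj[symmetric]\<close>)

text \<open>The topology tests openness in all charts of \<open>A\<close> at once. As overlaps are
  open and transitions continuous, a subset of \<open>cdom c\<close> is already tested by
  \<open>c\<close> alone, which makes \<open>c\<close> a homeomorphism.\<close>

lemma atlas_topology_chart:
  assumes A: "\<And>c. c \<in> A \<Longrightarrow> cmodel c = sub_lcs (Rn k)" "\<And>c. c \<in> A \<Longrightarrow> inj_on (cmap c) (cdom c)"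
      "\<And>c. c \<in> A \<Longrightarrow> cmap c \<in> extensional (cdom c)" "\<And>c. c \<in> A \<Longrightarrow> cdom c \<subseteq> S"
    and ov: "\<And>c d. c \<in> A \<Longrightarrow> d \<in> A \<Longrightarrow> openin (top_of_set (Rn k)) (cmap c ` (cdom c \<inter> cdom d))"
    and tr: "\<And>c d. c \<in> A \<Longrightarrow> d \<in> A \<Longrightarrow> smooth_transition c d"
    and c: "c \<in> A"
  shows "is_chart (sub_lcs (Rn k)) (Rn k) (atlas_topology S A) c"
proof -
  let ?T = "atlas_topology S A"
  have opT: "openin ?T W \<longleftrightarrow> W \<subseteq> S \<and> (\<forall>c\<in>A. openin (top_of_set (Rn k)) (cmap c ` (W \<inter> cdom c)))" for W
    using openin_atlas_topology[OF A(2), of A S W] A(1) by auto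
  have open_dom: "openin ?T (cdom c)"
    using A(4)[OF c] ov[OF _ c] by (auto simp: opT Int_commute)
  then have dom: "cdom c \<subseteq> topspace ?T" by (rule openin_subset)
  have img: "openin (top_of_set (Rn k)) (cimage c)" using ov[OF c c] by (simp add: cimage_def)
  then have imgR: "cimage c \<subseteq> Rn k" using openin_subset by fastforce
  have "homeomorphic_map (subtopology ?T (cdom c)) (top_of_set (cimage c)) (cmap c)"
  proof (rule bijective_open_imp_homeomorphic_map)
    show "open_map (subtopology ?T (cdom c)) (top_of_set (cimage c)) (cmap c)"
      unfolding open_map_def
    proof (intro allI impI)
      fix W assume "openin (subtopology ?T (cdom c)) W"
      then have W: "openin ?T W" "W \<subseteq> cdom c"
        using open_dom openin_trans_full openin_subset[of "subtopology ?T (cdom c)" W] by auto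
      then have "openin (top_of_set (Rn k)) (cmap c ` W)"
        using opT c by (metis Int_absorb2)
      then show "openin (top_of_set (cimage c)) (cmap c ` W)"
        by (rule openin_subset_trans) (use W imgR in \<open>auto simp: cimage_def\<close>)
    qed
    show "continuous_map (subtopology ?T (cdom c)) (top_of_set (cimage c)) (cmap c)"
      unfolding continuous_map_def
    proof (intro conjI allI impI)
      show "cmap c \<in> topspace (subtopology ?T (cdom c)) \<rightarrow> topspace (top_of_set (cimage c))"
        by (auto simp: cimage_def)
      fix V assume "openin (top_of_set (cimage c)) V"
      then have V: "openin (top_of_set (Rn k)) V"
        by (rule openin_trans[OF _ img])
      let ?W = "{p \<in> cdom c. cmap c p \<in> V}"
      have "openin (top_of_set (Rn k)) (cmap d ` (?W \<inter> cdom d))" if d: "d \<in> A" for d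
      proof -
        let ?O = "cmap d ` (cdom d \<inter> cdom c)"
        have O: "openin (top_of_set (Rn k)) ?O" by (rule ov[OF d c])
        have "continuous_map (top_of_set ?O) (top_of_set (Rn k)) (cmap c \<circ> cinv d)"
          using tr[OF d c] openin_subset[OF O] A(1)[OF c] A(1)[OF d]
          by (intro smooth_between_continuous_map) (auto simp: smooth_transition_def)
        then have "openin (top_of_set ?O) {y \<in> topspace (top_of_set ?O). (cmap c \<circ> cinv d) y \<in> V}"
          using V by (rule openin_continuous_map_preimage)
        then have "openin (top_of_set (Rn k)) {y \<in> topspace (top_of_set ?O). (cmap c \<circ> cinv d) y \<in> V}"
          by (rule openin_trans[OF _ O])
        moreover have "{y \<in> topspace (top_of_set ?O). (cmap c \<circ> cinv d) y \<in> V} = cmap d ` (?W \<inter> cdom d)"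
          using cinv_cmap[OF A(2)[OF d]] by auto
        ultimately show ?thesis by simp
      qed
      then have "openin ?T ?W" using A(4)[OF c] by (auto simp: opT)
      then have "openin (subtopology ?T (cdom c)) (?W \<inter> cdom c)"
        by (rule openin_subtopology_Int)
      moreover have "?W \<inter> cdom c = ?W" by auto
      ultimately have "openin (subtopology ?T (cdom c)) ?W" by simp
      moreover have "{p \<in> topspace (subtopology ?T (cdom c)). cmap c p \<in> V} = ?W"
        using dom by auto
      ultimately show "openin (subtopology ?T (cdom c)) {p \<in> topspace (subtopology ?T (cdom c)). cmap c p \<in> V}"
        by simp
    qed
    show "cmap c ` topspace (subtopology ?T (cdom c)) = topspace (top_of_set (cimage c))"
      using dom by (auto simp: cimage_def)
    show "inj_on (cmap c) (topspace (subtopology ?T (cdom c)))"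
      using A(2)[OF c] by (rule inj_on_subset) auto
  qed
  then show ?thesis
    unfolding is_chart_def using A(1,3)[OF c] open_dom img imgR by (simp add: top_of_subset)
qed

section \<open>Jacobians of transition maps, and tangent vectors\<close>

definition trans_coord :: "nat \<Rightarrow> ('x, vec) chart \<Rightarrow> ('x, vec) chart \<Rightarrow> nat \<Rightarrow> vec \<Rightarrow> real" where
  "trans_coord n c d i z = Poly_Mapping.lookup ((cmap d \<circ> cinv c) (proj {..<n} z)) i"

text \<open>The Jacobian matrix at \<open>x\<close> of the change of charts from \<open>c\<close> to
  \<open>d\<close>, applied to \<open>y\<close>.\<close>

definition trans_deriv :: "nat \<Rightarrow> ('x, vec) chart \<Rightarrow> ('x, vec) chart \<Rightarrow> vec \<Rightarrow> vec \<Rightarrow> vec" where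
  "trans_deriv n c d x y = tup {..<n} (\<lambda>i. \<Sum>a<n. Poly_Mapping.lookup y a * pd a (trans_coord n c d i) x)"

lemma trans_deriv_in_Rn: "trans_deriv n c d x y \<in> Rn n"
  by (simp add: trans_deriv_def tup_in_Rn)

lemma trans_deriv_add: "trans_deriv n c d x (y + z) = trans_deriv n c d x y + trans_deriv n c d x z"
  by (simp add: trans_deriv_def tup_add lookup_add distrib_right sum.distrib)

lemma trans_deriv_scale: "trans_deriv n c d x (r *\<^sub>R y) = r *\<^sub>R trans_deriv n c d x y"
  by (simp add: trans_deriv_def tup_scaleR sum_distrib_left mult.assoc)

locale smooth_mfd =
  fixes n :: nat and N :: "('x, vec) manifold"
  assumes smooth_manifold: "smooth_manifold n N"
begin

lemma atlas_eq: "matlas N = maximal_atlas (sub_lcs (Rn n)) (Rn n) (mtop N) (matlas N)"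
  and cover: "(\<Union>c\<in>matlas N. cdom c) = mspace_of N"
  using smooth_manifold by (simp_all add: smooth_manifold_def modelled_manifold_def)

lemma chart_on: "c \<in> matlas N \<Longrightarrow> chart_on n (Rn n) (mtop N) c"
  using atlas_eq by unfold_locales (auto simp: maximal_atlas_def)

lemma transition: "c \<in> matlas N \<Longrightarrow> d \<in> matlas N \<Longrightarrow> smooth_transition c d"
  using atlas_eq by (auto simp: maximal_atlas_def)

lemma chart_at: assumes "p \<in> mspace_of N" obtains c where "c \<in> matlas N" "p \<in> cdom c"
  using cover assms that by blast

lemma dom_subset: "c \<in> matlas N \<Longrightarrow> cdom c \<subseteq> mspace_of N"
  using cover by blast

lemma cmap_in_Rn: "c \<in> matlas N \<Longrightarrow> p \<in> cdom c \<Longrightarrow> cmap c p \<in> Rn n"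
  by (rule subsetD[OF chart_on.image_subset[OF chart_on] cmap_in_cimage])

lemmas inj = chart_on.inj[OF chart_on]

lemma trans_between:
  assumes "c \<in> matlas N" "d \<in> matlas N"
  shows "smooth_between (sub_lcs (Rn n)) (sub_lcs (Rn n)) (cmap c ` (cdom c \<inter> cdom d)) (cmap d \<circ> cinv c)"
  using transition[OF assms] chart_on.model[OF chart_on] assms by (simp add: smooth_transition_def)

lemma overlap_open:
  assumes "c \<in> matlas N" "openin (mtop N) W"
  shows "openin (top_of_set (Rn n)) (cmap c ` (cdom c \<inter> W))"
  using chart_on.open_dom[OF chart_on] assms by (intro chart_on.open_map_image[OF chart_on]) auto

lemma dom_open: "c \<in> matlas N \<Longrightarrow> openin (mtop N) (cdom c)"
  by (rule chart_on.open_dom[OF chart_on])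

lemma trans_coord_smooth:
  assumes "c \<in> matlas N" "d \<in> matlas N" "p \<in> cdom c" "p \<in> cdom d"
  shows "smooth_at (trans_coord n c d i) (cmap c p)"
  unfolding trans_coord_def[abs_def]
  using smooth_between_imp_smooth_at[OF trans_between[OF assms(1,2)] overlap_open[OF assms(1) dom_open[OF assms(2)]], of "cmap c p" i]
    assms(3,4) by auto

lemma trans_coord_eq:
  assumes "c \<in> matlas N" "p \<in> cdom c" "proj {..<n} z = cmap c p"
  shows "trans_coord n c d i z = Poly_Mapping.lookup (cmap d p) i"
  using assms by (simp add: trans_coord_def cinv_cmap[OF inj])

text \<open>This turns the limits in the definition of \<open>tangent_space\<close> into linear
  equations between components.\<close>

lemma has_dir_deriv_transition:
  assumes c: "c \<in> matlas N" "p \<in> cdom c" and d: "d \<in> matlas N" "p \<in> cdom d" and y: "y \<in> Rn n"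
  shows "has_dir_deriv (sub_lcs (Rn n)) (sub_lcs (Rn n)) (cmap d \<circ> cinv c) (cmap c p) y l \<longleftrightarrow>
    l = trans_deriv n c d (cmap c p) y"
  unfolding trans_deriv_def trans_coord_def[abs_def]
proof (rule has_dir_deriv_coords)
  let ?O = "cmap c ` (cdom c \<inter> cdom d)"
  obtain S where S: "open S" "?O = Rn n \<inter> S"
    using overlap_open[OF c(1) dom_open[OF d(1)]] by (auto simp: openin_open)
  have OR: "(cmap d \<circ> cinv c) x \<in> Rn n" if "x \<in> ?O" for x
    using that cinv_cmap[OF inj[OF c(1)]] cmap_in_Rn[OF d(1)] by auto
  show cR: "cmap c p \<in> Rn n" by (rule cmap_in_Rn[OF c])
  show "(cmap d \<circ> cinv c) (cmap c p) \<in> Rn n" using c d by (intro OR) auto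
  have "((\<lambda>t. cmap c p + t *\<^sub>R y) \<longlongrightarrow> cmap c p + 0 *\<^sub>R y) (at 0)"
    by (intro tendsto_intros)
  moreover have "cmap c p \<in> S" using S(2) c d by auto
  ultimately have "\<forall>\<^sub>F t in at 0. cmap c p + t *\<^sub>R y \<in> S"
    using S(1) topological_tendstoD by force
  then show "\<forall>\<^sub>F t in at 0. (cmap d \<circ> cinv c) (cmap c p + t *\<^sub>R y) \<in> Rn n"
  proof eventually_elim
    case (elim t)
    have "cmap c p + t *\<^sub>R y \<in> Rn n"
      by (intro subspace_add[OF subspace_Rn] subspace_scale[OF subspace_Rn] cR y)
    then show ?case using elim S(2) by (intro OR) simp
  qed
  show "smooth_at (\<lambda>z. Poly_Mapping.lookup ((cmap d \<circ> cinv c) (proj {..<n} z)) i) (cmap c p)" for i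
    using trans_coord_smooth[OF c(1) d(1) c(2) d(2), of i] by (simp add: trans_coord_def[abs_def])
qed (rule y)

lemma trans_deriv_self:
  assumes "c \<in> matlas N" "p \<in> cdom c" "y \<in> Rn n"
  shows "trans_deriv n c c (cmap c p) y = y"
proof (rule Rn_eqI[OF trans_deriv_in_Rn assms(3)])
  fix i assume i: "i < n"
  let ?V = "{z. proj {..<n} z \<in> cimage c}" and ?x = "cmap c p"
  have V: "open ?V" by (rule open_proj_vimage[OF chart_on.open_image[OF chart_on[OF assms(1)]]])
  have px: "proj {..<n} ?x = ?x" using cmap_in_Rn[OF assms(1,2)] by (simp add: Rn_iff_proj)
  have xV: "?x \<in> ?V" using px assms(2) by (simp add: cmap_in_cimage)
  have "trans_coord n c c i z = Poly_Mapping.lookup z i" if "z \<in> ?V" for z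
    using that i cmap_cinv[OF inj[OF assms(1)]] by (simp add: trans_coord_def lookup_tup)
  then have "((\<lambda>z. Poly_Mapping.lookup z i) has_derivative frechet_derivative (trans_coord n c c i) (at ?x)) (at ?x)"
    using has_derivative_transform_within_open[OF smooth_at_has_derivative[OF
          trans_coord_smooth[OF assms(1,1,2,2), of i]] V xV] by simp
  moreover have "((\<lambda>z. Poly_Mapping.lookup z i) has_derivative (\<lambda>w. Poly_Mapping.lookup w i)) (at ?x)"
    by (rule bounded_linear_imp_has_derivative[OF bounded_linear_lookup])
  ultimately have "frechet_derivative (trans_coord n c c i) (at ?x) = (\<lambda>w. Poly_Mapping.lookup w i)"
    by (rule has_derivative_unique)
  then have pd: "pd a (trans_coord n c c i) ?x = (if a = i then 1 else 0)" for a
    by (simp add: pd_def lookup_single when_def)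
  have "Poly_Mapping.lookup (trans_deriv n c c ?x y) i = (\<Sum>a<n. Poly_Mapping.lookup y a * (if a = i then 1 else 0))"
    by (simp only: trans_deriv_def lookup_tup[OF finite_lessThan] pd lessThan_iff i if_True)
  also have "\<dots> = (\<Sum>a<n. if a = i then Poly_Mapping.lookup y a else 0)"
    by (rule sum.cong) auto
  also have "\<dots> = Poly_Mapping.lookup y i" using i by simp
  finally show "Poly_Mapping.lookup (trans_deriv n c c ?x y) i = Poly_Mapping.lookup y i" .
qed

text \<open>The chain rule for the transition from \<open>c\<close> to \<open>e\<close> factored
  through \<open>d\<close>. It makes a vector prescribed in one chart consistent in all
  charts.\<close>

lemma trans_deriv_cocycle:
  assumes c: "c \<in> matlas N" "p \<in> cdom c" and d: "d \<in> matlas N" "p \<in> cdom d"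
    and e: "e \<in> matlas N" "p \<in> cdom e"
  shows "trans_deriv n d e (cmap d p) (trans_deriv n c d (cmap c p) y) = trans_deriv n c e (cmap c p) y"
proof (rule Rn_eqI[OF trans_deriv_in_Rn trans_deriv_in_Rn])
  fix i assume i: "i < n"
  let ?x = "cmap c p" and ?u = "trans_coord n c d" and ?g = "trans_coord n d e i"
  let ?w = "tup {..<n} (Poly_Mapping.lookup y)"
  let ?V = "{z. proj {..<n} z \<in> cmap c ` (cdom c \<inter> cdom d)}"
  have V: "open ?V" by (rule open_proj_vimage[OF overlap_open[OF c(1) dom_open[OF d(1)]]])
  have px: "proj {..<n} ?x = ?x" using cmap_in_Rn[OF c] by (simp add: Rn_iff_proj)
  have xV: "?x \<in> ?V" using px c d by auto
  have tu: "tup {..<n} (\<lambda>j. ?u j z) = cmap d q" if "q \<in> cdom c" "q \<in> cdom d" "proj {..<n} z = cmap c q" for z q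
    using cmap_in_Rn[OF d(1) that(2)] trans_coord_eq[OF c(1) that(1,3)] by (simp add: Rn_iff_proj)
  have su: "smooth_at (?u j) ?x" for j by (rule trans_coord_smooth[OF c(1) d(1) c(2) d(2)])
  have sg: "smooth_at ?g (cmap d p)" by (rule trans_coord_smooth[OF d(1) e(1) d(2) e(2)])
  have "((\<lambda>z. tup {..<n} (\<lambda>j. ?u j z)) has_derivative (\<lambda>w. tup {..<n} (\<lambda>j. frechet_derivative (?u j) (at ?x) w))) (at ?x)"
    unfolding tup_def by (intro has_derivative_sum has_derivative_scaleR_left smooth_at_has_derivative su)
  moreover have "(?g has_derivative frechet_derivative ?g (at (cmap d p))) (at (tup {..<n} (\<lambda>j. ?u j ?x)))"
    using smooth_at_has_derivative[OF sg] tu[OF c(2) d(2) px] by simp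
  ultimately have "((\<lambda>z. ?g (tup {..<n} (\<lambda>j. ?u j z))) has_derivative
      (\<lambda>w. frechet_derivative ?g (at (cmap d p)) (tup {..<n} (\<lambda>j. frechet_derivative (?u j) (at ?x) w)))) (at ?x)"
    by (rule has_derivative_compose)
  then have "(trans_coord n c e i has_derivative
      (\<lambda>w. frechet_derivative ?g (at (cmap d p)) (tup {..<n} (\<lambda>j. frechet_derivative (?u j) (at ?x) w)))) (at ?x)"
  proof (rule has_derivative_transform_within_open[OF _ V xV])
    fix z assume "z \<in> ?V"
    then obtain q where q: "q \<in> cdom c" "q \<in> cdom d" "proj {..<n} z = cmap c q" by auto
    have "proj {..<n} (cmap d q) = cmap d q" using cmap_in_Rn[OF d(1) q(2)] by (simp add: Rn_iff_proj)
    then show "?g (tup {..<n} (\<lambda>j. ?u j z)) = trans_coord n c e i z"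
      by (simp only: tu[OF q] trans_coord_eq[OF d(1) q(2)] trans_coord_eq[OF c(1) q(1,3)])
  qed
  then have "frechet_derivative (trans_coord n c e i) (at ?x) ?w =
      frechet_derivative ?g (at (cmap d p)) (tup {..<n} (\<lambda>j. frechet_derivative (?u j) (at ?x) ?w))"
    by (simp flip: frechet_derivative_at)
  then have "(\<Sum>a<n. Poly_Mapping.lookup y a * pd a (trans_coord n c e i) ?x) =
      (\<Sum>j<n. (\<Sum>a<n. Poly_Mapping.lookup y a * pd a (?u j) ?x) * pd j ?g (cmap d p))"
    unfolding frechet_tup[OF trans_coord_smooth[OF c(1) e(1) c(2) e(2)]] frechet_tup[OF su] frechet_tup[OF sg] .
  then show "Poly_Mapping.lookup (trans_deriv n d e (cmap d p) (trans_deriv n c d ?x y)) i =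
      Poly_Mapping.lookup (trans_deriv n c e ?x y) i"
    using i by (simp add: trans_deriv_def lookup_tup)
qed

text \<open>The inverse of evaluation at \<open>c\<close>: for \<open>y\<close> in
  \<open>Rn n\<close>, the tangent vector at \<open>p\<close> whose component in the chart
  \<open>c\<close> is \<open>y\<close>.\<close>

definition tvec_of :: "('x, vec) chart \<Rightarrow> 'x \<Rightarrow> vec \<Rightarrow> ('x, vec) chart \<Rightarrow> vec" where
  "tvec_of c p y = (\<lambda>d\<in>charts_at N p. trans_deriv n c d (cmap c p) y)"

lemma tangent_space_iff:
  "v \<in> tangent_space n N p \<longleftrightarrow> v \<in> charts_at N p \<rightarrow>\<^sub>E Rn n \<and>
    (\<forall>c\<in>charts_at N p. \<forall>d\<in>charts_at N p. v d = trans_deriv n c d (cmap c p) (v c))"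
  unfolding tangent_space_def mem_Collect_eq
proof (rule conj_cong[OF refl], intro ball_cong[OF refl])
  fix c d assume v: "v \<in> charts_at N p \<rightarrow>\<^sub>E Rn n" and c: "c \<in> charts_at N p" and d: "d \<in> charts_at N p"
  show "has_dir_deriv (sub_lcs (Rn n)) (sub_lcs (Rn n)) (cmap d \<circ> cinv c) (cmap c p) (v c) (v d) \<longleftrightarrow>
      v d = trans_deriv n c d (cmap c p) (v c)"
    by (rule has_dir_deriv_transition) (use c d PiE_mem[OF v c] in \<open>simp_all add: charts_at_def\<close>)
qed

lemma tvec_of_in: "c \<in> charts_at N p \<Longrightarrow> tvec_of c p y \<in> tangent_space n N p"
  unfolding tangent_space_iff
proof (intro conjI ballI)
  assume c: "c \<in> charts_at N p"
  show "tvec_of c p y \<in> charts_at N p \<rightarrow>\<^sub>E Rn n"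
    unfolding tvec_of_def restrict_PiE_iff by (simp add: trans_deriv_in_Rn)
  fix d e assume "d \<in> charts_at N p" "e \<in> charts_at N p"
  then show "tvec_of c p y e = trans_deriv n d e (cmap d p) (tvec_of c p y d)"
    using c by (simp add: tvec_of_def) (simp add: charts_at_def trans_deriv_cocycle)
qed

lemma tvec_of_self: "c \<in> charts_at N p \<Longrightarrow> y \<in> Rn n \<Longrightarrow> tvec_of c p y c = y"
  by (simp add: tvec_of_def charts_at_def trans_deriv_self)

lemma tangent_eq_tvec_of:
  assumes "v \<in> tangent_space n N p" "c \<in> charts_at N p"
  shows "v = tvec_of c p (v c)"
proof
  fix d
  have v: "v \<in> charts_at N p \<rightarrow>\<^sub>E Rn n" and
    eq: "d \<in> charts_at N p \<Longrightarrow> v d = trans_deriv n c d (cmap c p) (v c)"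
    using assms unfolding tangent_space_iff by blast+
  show "v d = tvec_of c p (v c) d"
    using PiE_arb[OF v, of d] eq unfolding tvec_of_def by (cases "d \<in> charts_at N p") simp_all
qed

lemma tangent_comp_in_Rn: "v \<in> tangent_space n N p \<Longrightarrow> c \<in> charts_at N p \<Longrightarrow> v c \<in> Rn n"
  unfolding tangent_space_iff by (elim conjE PiE_mem)

lemma tangent_space_combination:
  assumes "v \<in> tangent_space n N p" "w \<in> tangent_space n N p"
  shows "(\<lambda>c\<in>charts_at N p. v c + r *\<^sub>R w c) \<in> tangent_space n N p"
  unfolding tangent_space_iff
proof (intro conjI ballI)
  show "(\<lambda>c\<in>charts_at N p. v c + r *\<^sub>R w c) \<in> charts_at N p \<rightarrow>\<^sub>E Rn n"
    unfolding restrict_PiE_iff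
    by (intro ballI subspace_add[OF subspace_Rn] subspace_scale[OF subspace_Rn]
        tangent_comp_in_Rn[OF assms(1)] tangent_comp_in_Rn[OF assms(2)])
  fix c d assume cd: "c \<in> charts_at N p" "d \<in> charts_at N p"
  have "v d = trans_deriv n c d (cmap c p) (v c)" "w d = trans_deriv n c d (cmap c p) (w c)"
    using assms[unfolded tangent_space_iff, THEN conjunct2, rule_format, OF cd] by simp_all
  then show "(\<lambda>c\<in>charts_at N p. v c + r *\<^sub>R w c) d = trans_deriv n c d (cmap c p) ((\<lambda>c\<in>charts_at N p. v c + r *\<^sub>R w c) c)"
    using cd by (simp only: restrict_apply if_True trans_deriv_add trans_deriv_scale)
qed

section \<open>Charts of the tangent bundle\<close>

abbreviation tc :: "('x, vec) chart \<Rightarrow> ('x tvec, vec) chart" where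
  "tc \<equiv> tangent_chart n N"

lemma tc_simps:
  "cdom (tc c) = {w \<in> tangent_set n N. fst w \<in> cdom c}"
  "cmodel (tc c) = sub_lcs (Rn (2 * n))"
  "cmap (tc c) \<in> extensional (cdom (tc c))"
  "w \<in> cdom (tc c) \<Longrightarrow> cmap (tc c) w = vconcat n (cmap c (fst w)) (snd w c)"
  by (auto simp: tangent_chart_def Let_def split_beta)

lemma tc_dom_iff: "c \<in> matlas N \<Longrightarrow> w \<in> cdom (tc c) \<longleftrightarrow> fst w \<in> cdom c \<and> snd w \<in> tangent_space n N (fst w)"
  using dom_subset[of c] by (cases w) (auto simp: tc_simps tangent_set_def)

lemma tc_parts:
  assumes "c \<in> matlas N" "w \<in> cdom (tc c)"
  shows "proj {..<n} (cmap (tc c) w) = cmap c (fst w)" "hi n (cmap (tc c) w) = snd w c" "cmap (tc c) w \<in> Rn (2 * n)"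
    "snd w c \<in> Rn n" "c \<in> charts_at N (fst w)"
proof -
  have w: "fst w \<in> cdom c" "snd w \<in> tangent_space n N (fst w)" using assms by (simp_all add: tc_dom_iff)
  show c: "c \<in> charts_at N (fst w)" using w(1) assms(1) by (simp add: charts_at_def)
  show s: "snd w c \<in> Rn n" by (rule tangent_comp_in_Rn[OF w(2) c])
  show "proj {..<n} (cmap (tc c) w) = cmap c (fst w)" "hi n (cmap (tc c) w) = snd w c" "cmap (tc c) w \<in> Rn (2 * n)"
    using cmap_in_Rn[OF assms(1) w(1)] s tc_simps(4)[OF assms(2)]
    by (simp_all add: proj_vconcat hi_vconcat vconcat_in_Rn)
qed

definition tpoint :: "('x, vec) chart \<Rightarrow> 'x \<Rightarrow> vec \<Rightarrow> 'x tvec" where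
  "tpoint c p y = (p, tvec_of c p y)"

lemma tpoint_in: "c \<in> matlas N \<Longrightarrow> p \<in> cdom c \<Longrightarrow> tpoint c p y \<in> cdom (tc c)"
  by (simp add: tc_dom_iff tpoint_def tvec_of_in charts_at_def)

lemma tpoint_simps [simp]: "fst (tpoint c p y) = p"
  "snd (tpoint c p y) = tvec_of c p y"
  by (simp_all add: tpoint_def)

lemma tpoint_of: "c \<in> matlas N \<Longrightarrow> w \<in> cdom (tc c) \<Longrightarrow> tpoint c (fst w) (snd w c) = w"
  using tangent_eq_tvec_of[of "snd w" "fst w" c] by (simp add: tc_dom_iff charts_at_def tpoint_def)

lemma tc_inj: "c \<in> matlas N \<Longrightarrow> inj_on (cmap (tc c)) (cdom (tc c))"
proof (rule inj_onI)
  fix w w' assume c: "c \<in> matlas N" and w: "w \<in> cdom (tc c)" "w' \<in> cdom (tc c)" "cmap (tc c) w = cmap (tc c) w'"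
  have "cmap c (fst w) = cmap c (fst w')" "snd w c = snd w' c"
    using tc_parts(1,2)[OF c w(1)] tc_parts(1,2)[OF c w(2)] w(3) by simp_all
  then have "fst w = fst w'" "snd w c = snd w' c"
    using inj_onD[OF inj[OF c]] w c by (auto simp: tc_dom_iff)
  then have "tpoint c (fst w) (snd w c) = tpoint c (fst w') (snd w' c)" by (simp only:)
  then show "w = w'" by (simp only: tpoint_of[OF c w(1)] tpoint_of[OF c w(2)])
qed

lemma cmap_tc_tpoint:
  "c \<in> matlas N \<Longrightarrow> p \<in> cdom c \<Longrightarrow> y \<in> Rn n \<Longrightarrow> cmap (tc c) (tpoint c p y) = vconcat n (cmap c p) y"
  using tc_simps(4)[OF tpoint_in, of c p y] tvec_of_self[of c p y] by (simp add: charts_at_def)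

text \<open>Over each point of the base overlap every component in \<open>Rn n\<close> occurs, since
  \<open>tpoint\<close> realises it, so the image is a full cylinder.\<close>

lemma tc_overlap:
  assumes "c \<in> matlas N" "d \<in> matlas N"
  shows "cmap (tc c) ` (cdom (tc c) \<inter> cdom (tc d)) = {z \<in> Rn (2 * n). proj {..<n} z \<in> cmap c ` (cdom c \<inter> cdom d)}"
proof (intro set_eqI iffI)
  fix z assume "z \<in> cmap (tc c) ` (cdom (tc c) \<inter> cdom (tc d))"
  then obtain w where w: "w \<in> cdom (tc c)" "w \<in> cdom (tc d)" "z = cmap (tc c) w" by auto
  then show "z \<in> {z \<in> Rn (2 * n). proj {..<n} z \<in> cmap c ` (cdom c \<inter> cdom d)}"
    using tc_parts(1,3)[OF assms(1) w(1)] assms by (auto simp: tc_dom_iff)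
next
  fix z assume "z \<in> {z \<in> Rn (2 * n). proj {..<n} z \<in> cmap c ` (cdom c \<inter> cdom d)}"
  then obtain p where p: "z \<in> Rn (2 * n)" "p \<in> cdom c" "p \<in> cdom d" "proj {..<n} z = cmap c p" by auto
  let ?w = "tpoint c p (hi n z)"
  have "cmap (tc c) ?w = z"
    using cmap_tc_tpoint[OF assms(1) p(2) hi_in_Rn, of z] vconcat_proj_hi[OF p(1)] p(4) by simp
  moreover have "?w \<in> cdom (tc c)" by (rule tpoint_in[OF assms(1) p(2)])
  moreover then have "?w \<in> cdom (tc d)" using p(3) assms by (simp add: tc_dom_iff)
  ultimately show "z \<in> cmap (tc c) ` (cdom (tc c) \<inter> cdom (tc d))" by (metis IntI image_eqI)
qed

lemma tc_overlap_open:
  assumes "c \<in> matlas N" "d \<in> matlas N"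
  shows "openin (top_of_set (Rn (2 * n))) (cmap (tc c) ` (cdom (tc c) \<inter> cdom (tc d)))"
proof -
  have "open {z. proj {..<n} z \<in> cmap c ` (cdom c \<inter> cdom d)}"
    by (rule open_proj_vimage[OF overlap_open[OF assms(1) dom_open[OF assms(2)]]])
  then show ?thesis
    unfolding tc_overlap[OF assms] openin_open by (auto intro!: exI[of _ "{z. proj {..<n} z \<in> cmap c ` (cdom c \<inter> cdom d)}"])
qed

text \<open>In coordinates the pair (x, y) goes to the base transition at x together with its
  Jacobian at x applied to y. Both halves are smooth in (x, y) jointly.\<close>

lemma tc_transition:
  assumes "c \<in> matlas N" "d \<in> matlas N"
  shows "smooth_transition (tc c) (tc d)"
  unfolding smooth_transition_def tc_simps(2)
proof (rule smooth_between_Rn[OF tc_overlap_open[OF assms]])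
  let ?G = "\<lambda>i z. if i < n then trans_coord n c d i (proj {..<n} z)
    else \<Sum>a<n. Poly_Mapping.lookup z (n + a) * pd a (trans_coord n c d (i - n)) (proj {..<n} z)"
  fix i z assume z: "z \<in> cmap (tc c) ` (cdom (tc c) \<inter> cdom (tc d))" and i: "i < 2 * n"
  then obtain w where w: "w \<in> cdom (tc c)" "w \<in> cdom (tc d)" "z = cmap (tc c) w" by auto
  note pz = tc_parts[OF assms(1) w(1), folded w(3)] and pd = tc_parts[OF assms(2) w(2)]
  have p: "fst w \<in> cdom c" "fst w \<in> cdom d" using w assms by (simp_all add: tc_dom_iff)
  have s: "smooth_at (trans_coord n c d j) (proj {..<n} z)" for j
    unfolding pz(1) by (rule trans_coord_smooth[OF assms p])
  have "smooth_at (\<lambda>z. trans_coord n c d i (proj {..<n} z)) z"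
    by (rule smooth_at_proj[OF finite_lessThan s])
  moreover have "smooth_at (\<lambda>z. \<Sum>a<n. Poly_Mapping.lookup z (n + a) * pd a (trans_coord n c d (i - n)) (proj {..<n} z)) z"
    by (intro smooth_at_sum smooth_at_mult smooth_at_lookup smooth_at_proj smooth_at_pd s) auto
  ultimately show "smooth_at (?G i) z" by (cases "i < n") auto
  have cw: "cinv (tc c) z = w" unfolding w(3) by (rule cinv_cmap[OF tc_inj[OF assms(1)] w(1)])
  have "snd w \<in> tangent_space n N (fst w)" using w(1) assms(1) by (simp add: tc_dom_iff)
  then have sw: "snd w d = trans_deriv n c d (cmap c (fst w)) (snd w c)"
    using tangent_space_iff pz(5) pd(5) by blast
  have "Poly_Mapping.lookup (cmap (tc d) w) i =
      (if i < n then Poly_Mapping.lookup (cmap d (fst w)) i else Poly_Mapping.lookup (snd w d) (i - n))"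
    using i by (simp add: tc_simps(4)[OF w(2)] lookup_vconcat[OF cmap_in_Rn[OF assms(2) p(2)]])
  also have "\<dots> = ?G i z"
  proof (cases "i < n")
    case True
    have "proj {..<n} (proj {..<n} z) = cmap c (fst w)" unfolding proj_tup[OF finite_lessThan] by (rule pz(1))
    then show ?thesis using True trans_coord_eq[OF assms(1) p(1)] by simp
  next
    case False
    have "Poly_Mapping.lookup z (n + a) = Poly_Mapping.lookup (snd w c) a" if "a < n" for a
      using that arg_cong[OF pz(2), of "\<lambda>x. Poly_Mapping.lookup x a"] by (simp add: hi_def lookup_tup)
    then show ?thesis using False i pz(1) by (simp add: sw trans_deriv_def lookup_tup)
  qed
  finally show "Poly_Mapping.lookup ((cmap (tc d) \<circ> cinv (tc c)) z) i = ?G i z" by (simp add: cw)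
next
  fix z assume "z \<in> cmap (tc c) ` (cdom (tc c) \<inter> cdom (tc d))"
  then obtain w where w: "w \<in> cdom (tc c)" "w \<in> cdom (tc d)" "z = cmap (tc c) w" by auto
  have "cinv (tc c) z = w" unfolding w(3) by (rule cinv_cmap[OF tc_inj[OF assms(1)] w(1)])
  then show "(cmap (tc d) \<circ> cinv (tc c)) z \<in> Rn (2 * n)" using tc_parts(3)[OF assms(2) w(2)] by simp
qed

abbreviation TT :: "'x tvec topology" where
  "TT \<equiv> mtop (tangent_bundle n N)"

lemma TT_def: "TT = atlas_topology (tangent_set n N) (tc ` matlas N)"
  by (simp add: tangent_bundle_def Let_def)

lemma tc_is_chart: "c \<in> matlas N \<Longrightarrow> is_chart (sub_lcs (Rn (2 * n))) (Rn (2 * n)) TT (tc c)"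
  unfolding TT_def
proof (rule atlas_topology_chart)
  fix e f assume e: "e \<in> tc ` matlas N" and f: "f \<in> tc ` matlas N"
  then obtain c d where c: "e = tc c" "c \<in> matlas N" and d: "f = tc d" "d \<in> matlas N" by blast
  show "cmodel e = sub_lcs (Rn (2 * n))" "cmap e \<in> extensional (cdom e)" "inj_on (cmap e) (cdom e)"
    unfolding c(1) by (rule tc_simps(2,3) tc_inj[OF c(2)])+
  show "cdom e \<subseteq> tangent_set n N" unfolding c(1) tc_simps(1) by blast
  show "openin (top_of_set (Rn (2 * n))) (cmap e ` (cdom e \<inter> cdom f))" "smooth_transition e f"
    unfolding c(1) d(1) by (rule tc_overlap_open[OF c(2) d(2)] tc_transition[OF c(2) d(2)])+
qed simp

lemma tc_chart_on: "c \<in> matlas N \<Longrightarrow> chart_on (2 * n) (Rn (2 * n)) TT (tc c)"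
  by unfold_locales (auto simp: tc_is_chart)

lemma TN_atlas: "matlas (tangent_bundle n N) = maximal_atlas (sub_lcs (Rn (2 * n))) (Rn (2 * n)) TT (tc ` matlas N)"
  by (simp add: tangent_bundle_def Let_def)

lemma tc_in_atlas: "c \<in> matlas N \<Longrightarrow> tc c \<in> matlas (tangent_bundle n N)"
  unfolding TN_atlas maximal_atlas_def by (auto simp: tc_is_chart tc_transition)

lemma TT_topspace: "topspace TT = tangent_set n N"
proof
  have "openin (atlas_topology (tangent_set n N) (tc ` matlas N)) W \<longleftrightarrow> W \<subseteq> tangent_set n N \<and>
      (\<forall>c\<in>tc ` matlas N. openin (lcs_top (cmodel c)) (cmap c ` (W \<inter> cdom c)))" for W
    by (rule openin_atlas_topology) (auto intro: tc_inj)
  then show "topspace TT \<subseteq> tangent_set n N"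
    using openin_topspace[of TT] unfolding TT_def by blast
  show "tangent_set n N \<subseteq> topspace TT"
  proof
    fix w assume w: "w \<in> tangent_set n N"
    then have "fst w \<in> mspace_of N" by (auto simp: tangent_set_def)
    then obtain c where c: "c \<in> matlas N" "fst w \<in> cdom c" by (rule chart_at)
    then have "w \<in> cdom (tc c)" using w by (simp add: tc_simps)
    then show "w \<in> topspace TT" using openin_subset[OF chart_on.open_dom[OF tc_chart_on[OF c(1)]]] by auto
  qed
qed

lemma chart_smooth_tpoint:
  assumes "c \<in> matlas N" "chart_smooth c g z" "\<And>i. i < n \<Longrightarrow> smooth_at (v i) z"
  shows "chart_smooth (tc c) (\<lambda>w. tpoint c (g w) (tup {..<n} (\<lambda>i. v i w))) z"
proof -
  obtain Q where Q: "open Q" "z \<in> Q" "g ` Q \<subseteq> cdom c" using assms(2) by (auto simp: chart_smooth_def)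
  let ?G = "\<lambda>i w. if i < n then Poly_Mapping.lookup (cmap c (g w)) i else if i < 2 * n then v (i - n) w else 0"
  have "smooth_at (?G i) z" for i
    using assms(2,3) by (cases "i < n"; cases "i < 2 * n") (auto simp: chart_smooth_def smooth_at_const)
  moreover have "?G i w = Poly_Mapping.lookup (cmap (tc c) (tpoint c (g w) (tup {..<n} (\<lambda>i. v i w)))) i" if "w \<in> Q" for i w
    using that Q(3) assms(1)
    by (subst cmap_tc_tpoint) (auto simp: tup_in_Rn lookup_vconcat cmap_in_Rn lookup_tup)
  ultimately have "smooth_at (\<lambda>w. Poly_Mapping.lookup (cmap (tc c) (tpoint c (g w) (tup {..<n} (\<lambda>i. v i w)))) i) z" for i
    by (rule smooth_at_cong[where f = "?G i", OF _ Q(1,2)])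
  moreover have "(\<lambda>w. tpoint c (g w) (tup {..<n} (\<lambda>i. v i w))) ` Q \<subseteq> cdom (tc c)"
    using Q(3) assms(1) by (auto intro!: tpoint_in)
  ultimately show ?thesis using Q(1,2) by (auto simp: chart_smooth_def)
qed

lemma chart_smooth_tc_comp:
  assumes "c \<in> matlas N" "chart_smooth (tc c) s z" "i < n"
  shows "smooth_at (\<lambda>w. Poly_Mapping.lookup (snd (s w) c) i) z"
proof -
  obtain Q where Q: "open Q" "z \<in> Q" "s ` Q \<subseteq> cdom (tc c)" using assms(2) by (auto simp: chart_smooth_def)
  have "smooth_at (\<lambda>w. Poly_Mapping.lookup (cmap (tc c) (s w)) (n + i)) z"
    using assms(2) by (simp add: chart_smooth_def)
  then show ?thesis
  proof (rule smooth_at_cong[OF _ Q(1,2)])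
    fix w assume "w \<in> Q"
    then have "s w \<in> cdom (tc c)" using Q(3) by auto
    then show "Poly_Mapping.lookup (cmap (tc c) (s w)) (n + i) = Poly_Mapping.lookup (snd (s w) c) i"
      using assms(1,3) by (simp add: tc_simps(4) tc_dom_iff lookup_vconcat cmap_in_Rn)
  qed
qed

end

section \<open>Local additions\<close>

lemma is_chart_open_subtopology:
  assumes "is_chart (sub_lcs (Rn k)) X T (restrict_chart c S)" "openin T S"
  shows "is_chart (sub_lcs (Rn k)) X (subtopology T S) (restrict_chart c S)"
proof -
  have "subtopology (subtopology T S) (cdom (restrict_chart c S)) = subtopology T (cdom (restrict_chart c S))"
    by (simp add: subtopology_subtopology Int_commute Int_left_commute)
  moreover have "openin (subtopology T S) (cdom (restrict_chart c S))"
    using assms by (auto simp: is_chart_def openin_open_subtopology)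
  ultimately show ?thesis using assms(1) by (simp add: is_chart_def)
qed

section \<open>Product charts on \<open>N \<times> N\<close>\<close>

context smooth_mfd
begin

abbreviation sq :: "('x, vec) chart \<Rightarrow> ('x, vec) chart \<Rightarrow> ('x \<times> 'x, vec) chart" where
  "sq \<equiv> square_chart n"

abbreviation T2 :: "('x \<times> 'x) topology" where
  "T2 \<equiv> prod_topology (mtop N) (mtop N)"

lemma sq_simps:
  "cdom (sq c d) = cdom c \<times> cdom d"
  "cmodel (sq c d) = sub_lcs (Rn (2 * n))"
  "cmap (sq c d) \<in> extensional (cdom (sq c d))"
  "w \<in> cdom (sq c d) \<Longrightarrow> cmap (sq c d) w = vconcat n (cmap c (fst w)) (cmap d (snd w))"
  by (auto simp: square_chart_def)

lemma sq_parts: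
  assumes "c \<in> matlas N" "d \<in> matlas N" "w \<in> cdom (sq c d)"
  shows "proj {..<n} (cmap (sq c d) w) = cmap c (fst w)" "hi n (cmap (sq c d) w) = cmap d (snd w)"
    "cmap (sq c d) w \<in> Rn (2 * n)"
proof -
  have "cmap c (fst w) \<in> Rn n" "cmap d (snd w) \<in> Rn n"
    using assms by (auto simp: sq_simps(1) intro: cmap_in_Rn)
  then show "proj {..<n} (cmap (sq c d) w) = cmap c (fst w)" "hi n (cmap (sq c d) w) = cmap d (snd w)"
    "cmap (sq c d) w \<in> Rn (2 * n)"
    by (simp_all add: sq_simps(4)[OF assms(3)] proj_vconcat hi_vconcat vconcat_in_Rn)
qed

lemma sq_inj:
  assumes "c \<in> matlas N" "d \<in> matlas N"
  shows "inj_on (cmap (sq c d)) (cdom (sq c d))"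
proof (rule inj_onI)
  fix w w' assume w: "w \<in> cdom (sq c d)" "w' \<in> cdom (sq c d)" "cmap (sq c d) w = cmap (sq c d) w'"
  have "cmap c (fst w) = cmap c (fst w')" "cmap d (snd w) = cmap d (snd w')"
    using sq_parts(1,2)[OF assms w(1)] sq_parts(1,2)[OF assms w(2)] w(3) by simp_all
  then have "fst w = fst w'" "snd w = snd w'"
    using w(1,2) inj_onD[OF inj[OF assms(1)]] inj_onD[OF inj[OF assms(2)]] by (auto simp: sq_simps(1))
  then show "w = w'" by (rule prod_eqI)
qed

lemma sq_image_of_rect:
  assumes "c \<in> matlas N" "d \<in> matlas N" "A \<subseteq> cdom c" "B \<subseteq> cdom d"
  shows "cmap (sq c d) ` (A \<times> B) = {z \<in> Rn (2 * n). proj {..<n} z \<in> cmap c ` A \<and> hi n z \<in> cmap d ` B}"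
proof (intro set_eqI iffI)
  fix z assume "z \<in> cmap (sq c d) ` (A \<times> B)"
  then obtain w where w: "w \<in> A \<times> B" "z = cmap (sq c d) w" by auto
  then have "w \<in> cdom (sq c d)" using assms(3,4) by (auto simp: sq_simps(1))
  from sq_parts[OF assms(1,2) this] show "z \<in> {z \<in> Rn (2 * n). proj {..<n} z \<in> cmap c ` A \<and> hi n z \<in> cmap d ` B}"
    using w by auto
next
  fix z assume "z \<in> {z \<in> Rn (2 * n). proj {..<n} z \<in> cmap c ` A \<and> hi n z \<in> cmap d ` B}"
  then obtain p q where p: "z \<in> Rn (2 * n)" "p \<in> A" "proj {..<n} z = cmap c p" "q \<in> B" "hi n z = cmap d q" by auto
  have "cmap (sq c d) (p, q) = z"
    using sq_simps(4)[of "(p, q)" c d] p assms(3,4) vconcat_proj_hi[OF p(1)] by (auto simp: sq_simps(1))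
  then show "z \<in> cmap (sq c d) ` (A \<times> B)" using p by (metis SigmaI image_eqI)
qed

lemma open_hi_vimage:
  assumes "openin (top_of_set (Rn n)) U"
  shows "open {z. hi n z \<in> U}"
proof -
  obtain S where S: "open S" "U = Rn n \<inter> S" using assms by (auto simp: openin_open)
  have "{z. hi n z \<in> U} = hi n -` S" by (auto simp: S(2) hi_in_Rn)
  moreover have "continuous_on UNIV (hi n)"
    unfolding hi_def[abs_def] by (intro continuous_on_tup continuous_on_lookup continuous_on_id)
  ultimately show ?thesis using S(1) by (metis continuous_on_open_vimage open_UNIV Int_UNIV_right)
qed

lemma sq_open_rect:
  assumes "c \<in> matlas N" "d \<in> matlas N" "openin (mtop N) A" "openin (mtop N) B" "A \<subseteq> cdom c" "B \<subseteq> cdom d"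
  shows "openin (top_of_set (Rn (2 * n))) (cmap (sq c d) ` (A \<times> B))"
proof -
  have "openin (top_of_set (Rn n)) (cmap c ` A)" "openin (top_of_set (Rn n)) (cmap d ` B)"
    using chart_on.open_map_image[OF chart_on] assms by blast+
  then have "open ({z. proj {..<n} z \<in> cmap c ` A} \<inter> {z. hi n z \<in> cmap d ` B})"
    by (intro open_Int open_proj_vimage open_hi_vimage)
  moreover have "cmap (sq c d) ` (A \<times> B) = Rn (2 * n) \<inter> ({z. proj {..<n} z \<in> cmap c ` A} \<inter> {z. hi n z \<in> cmap d ` B})"
    unfolding sq_image_of_rect[OF assms(1,2,5,6)] by auto
  ultimately show ?thesis unfolding openin_open by blast
qed

lemma sq_open_map:
  assumes c: "c \<in> matlas N" and d: "d \<in> matlas N" and W: "openin T2 W" "W \<subseteq> cdom (sq c d)"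
  shows "openin (top_of_set (Rn (2 * n))) (cmap (sq c d) ` W)"
proof (subst openin_subopen, intro ballI)
  fix z assume "z \<in> cmap (sq c d) ` W"
  then obtain p q where pq: "(p, q) \<in> W" "z = cmap (sq c d) (p, q)" by auto
  then obtain A B where AB: "openin (mtop N) A" "openin (mtop N) B" "p \<in> A" "q \<in> B" "A \<times> B \<subseteq> W"
    using W(1)[unfolded openin_prod_topology_alt, rule_format, OF pq(1)] by blast
  let ?A = "A \<inter> cdom c" and ?B = "B \<inter> cdom d"
  have "(p, q) \<in> cdom (sq c d)" using pq(1) W(2) by blast
  then have "(p, q) \<in> ?A \<times> ?B" using AB(3,4) by (simp add: sq_simps(1))
  moreover have "openin (top_of_set (Rn (2 * n))) (cmap (sq c d) ` (?A \<times> ?B))"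
    using AB(1,2) dom_open[OF c] dom_open[OF d] by (intro sq_open_rect c d) auto
  ultimately show "\<exists>T. openin (top_of_set (Rn (2 * n))) T \<and> z \<in> T \<and> T \<subseteq> cmap (sq c d) ` W"
    using AB(5) pq(2) by (intro exI[of _ "cmap (sq c d) ` (?A \<times> ?B)"]) auto
qed

lemma sq_is_chart:
  assumes c: "c \<in> matlas N" and d: "d \<in> matlas N"
  shows "is_chart (sub_lcs (Rn (2 * n))) (Rn (2 * n)) T2 (sq c d)"
proof -
  have op: "openin T2 (cdom (sq c d))"
    unfolding sq_simps(1) by (simp add: openin_prod_Times_iff dom_open c d)
  have img: "openin (top_of_set (Rn (2 * n))) (cimage (sq c d))"
    unfolding cimage_def by (rule sq_open_map[OF c d op subset_refl])
  then have imgR: "cimage (sq c d) \<subseteq> Rn (2 * n)" using openin_subset by fastforce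
  have top: "topspace (subtopology T2 (cdom (sq c d))) = cdom (sq c d)"
    using openin_subset[OF op] by auto
  have "homeomorphic_map (subtopology T2 (cdom (sq c d))) (top_of_set (cimage (sq c d))) (cmap (sq c d))"
  proof (rule bijective_open_imp_homeomorphic_map)
    show "open_map (subtopology T2 (cdom (sq c d))) (top_of_set (cimage (sq c d))) (cmap (sq c d))"
      unfolding open_map_def
    proof (intro allI impI)
      fix W assume W: "openin (subtopology T2 (cdom (sq c d))) W"
      have W': "openin T2 W" "W \<subseteq> cdom (sq c d)"
        using openin_trans_full[OF W op] openin_subset[OF W] top by auto
      show "openin (top_of_set (cimage (sq c d))) (cmap (sq c d) ` W)"
        by (rule openin_subset_trans[OF sq_open_map[OF c d W']]) (use W'(2) imgR in \<open>auto simp: cimage_def\<close>)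
    qed
    have cc: "continuous_map (subtopology T2 (cdom (sq c d))) euclidean (\<lambda>w. cmap c (fst w))"
    proof -
      have "continuous_map (subtopology T2 (cdom (sq c d))) (subtopology (mtop N) (cdom c)) fst"
        by (intro continuous_map_into_subtopology continuous_map_from_subtopology continuous_map_fst) (auto simp: sq_simps(1))
      from continuous_map_compose[OF this continuous_map_into_fulltopology[OF chart_on.continuous[OF chart_on[OF c]]]]
      show ?thesis by (simp add: o_def)
    qed
    have cd: "continuous_map (subtopology T2 (cdom (sq c d))) euclidean (\<lambda>w. cmap d (snd w))"
    proof -
      have "continuous_map (subtopology T2 (cdom (sq c d))) (subtopology (mtop N) (cdom d)) snd"
        by (intro continuous_map_into_subtopology continuous_map_from_subtopology continuous_map_snd) (auto simp: sq_simps(1))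
      from continuous_map_compose[OF this continuous_map_into_fulltopology[OF chart_on.continuous[OF chart_on[OF d]]]]
      show ?thesis by (simp add: o_def)
    qed
    let ?u = "\<lambda>w i. if i < n then Poly_Mapping.lookup (cmap c (fst w)) i else Poly_Mapping.lookup (cmap d (snd w)) (i - n)"
    have "continuous_map (subtopology T2 (cdom (sq c d))) euclidean (\<lambda>w. tup {..<2 * n} (?u w))"
    proof (rule continuous_map_tup)
      fix i
      show "continuous_map (subtopology T2 (cdom (sq c d))) euclideanreal (\<lambda>w. ?u w i)"
        by (cases "i < n") (simp_all only: if_True if_False continuous_map_lookup[OF cc] continuous_map_lookup[OF cd])
    qed simp
    then have "continuous_map (subtopology T2 (cdom (sq c d))) euclidean (cmap (sq c d))"
    proof (rule continuous_map_eq)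
      fix w assume "w \<in> topspace (subtopology T2 (cdom (sq c d)))"
      then have w: "w \<in> cdom (sq c d)" by (simp only: top)
      then have "cmap c (fst w) \<in> Rn n" by (auto simp: sq_simps(1) intro: cmap_in_Rn[OF c])
      then show "tup {..<2 * n} (?u w) = cmap (sq c d) w"
        unfolding sq_simps(4)[OF w] by (rule vconcat_eq_tup[symmetric])
    qed
    then show "continuous_map (subtopology T2 (cdom (sq c d))) (top_of_set (cimage (sq c d))) (cmap (sq c d))"
      by (rule continuous_map_into_subtopology) (auto simp: cimage_def)
    show "cmap (sq c d) ` topspace (subtopology T2 (cdom (sq c d))) = topspace (top_of_set (cimage (sq c d)))"
      unfolding top by (simp add: cimage_def)
    show "inj_on (cmap (sq c d)) (topspace (subtopology T2 (cdom (sq c d))))"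
      unfolding top by (rule sq_inj[OF c d])
  qed
  then show ?thesis
    unfolding is_chart_def using sq_simps(2,3) op img imgR by (simp add: top_of_subset)
qed

lemma sq_chart_on:
  "c \<in> matlas N \<Longrightarrow> d \<in> matlas N \<Longrightarrow> chart_on (2 * n) (Rn (2 * n)) T2 (sq c d)"
  by unfold_locales (simp_all add: sq_is_chart)

lemma sq_transition:
  assumes c: "c \<in> matlas N" "d \<in> matlas N" and c': "c' \<in> matlas N" "d' \<in> matlas N"
  shows "smooth_transition (sq c d) (sq c' d')"
  unfolding smooth_transition_def sq_simps(2)
proof (rule smooth_between_Rn)
  let ?D = "cdom (sq c d) \<inter> cdom (sq c' d')"
  let ?G = "\<lambda>i z. if i < n then trans_coord n c c' i (proj {..<n} z) else trans_coord n d d' (i - n) (hi n z)"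
  have "?D = (cdom c \<inter> cdom c') \<times> (cdom d \<inter> cdom d')" by (auto simp: sq_simps(1))
  then show "openin (top_of_set (Rn (2 * n))) (cmap (sq c d) ` ?D)"
    using dom_open c c' by (auto intro!: sq_open_rect)
  fix z assume "z \<in> cmap (sq c d) ` ?D"
  then obtain w where w: "w \<in> cdom (sq c d)" "w \<in> cdom (sq c' d')" "z = cmap (sq c d) w" by auto
  note pz = sq_parts[OF c w(1), folded w(3)]
  have p: "fst w \<in> cdom c" "fst w \<in> cdom c'" "snd w \<in> cdom d" "snd w \<in> cdom d'"
    using w(1,2) by (auto simp: sq_simps(1))
  have cw: "cinv (sq c d) z = w" unfolding w(3) by (rule cinv_cmap[OF sq_inj[OF c] w(1)])
  show "(cmap (sq c' d') \<circ> cinv (sq c d)) z \<in> Rn (2 * n)"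
    using sq_parts(3)[OF c' w(2)] by (simp add: cw)
next
  let ?D = "cdom (sq c d) \<inter> cdom (sq c' d')"
  let ?G = "\<lambda>i z. if i < n then trans_coord n c c' i (proj {..<n} z) else trans_coord n d d' (i - n) (hi n z)"
  fix z i assume "z \<in> cmap (sq c d) ` ?D" and i: "i < 2 * n"
  then obtain w where w: "w \<in> cdom (sq c d)" "w \<in> cdom (sq c' d')" "z = cmap (sq c d) w" by auto
  note pz = sq_parts[OF c w(1), folded w(3)]
  have p: "fst w \<in> cdom c" "fst w \<in> cdom c'" "snd w \<in> cdom d" "snd w \<in> cdom d'"
    using w(1,2) by (auto simp: sq_simps(1))
  have cw: "cinv (sq c d) z = w" unfolding w(3) by (rule cinv_cmap[OF sq_inj[OF c] w(1)])
  have "smooth_at (\<lambda>z. trans_coord n c c' i (proj {..<n} z)) z"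
    by (rule smooth_at_proj[OF finite_lessThan]) (unfold pz(1), rule trans_coord_smooth[OF c(1) c'(1) p(1,2)])
  moreover have "smooth_at (\<lambda>z. trans_coord n d d' (i - n) (hi n z)) z"
    by (rule smooth_at_hi) (unfold pz(2), rule trans_coord_smooth[OF c(2) c'(2) p(3,4)])
  ultimately show "smooth_at (?G i) z" by (cases "i < n") simp_all
  have q: "proj {..<n} (proj {..<n} z) = cmap c (fst w)" "proj {..<n} (hi n z) = cmap d (snd w)"
    unfolding proj_tup[OF finite_lessThan] using pz(1,2) hi_in_Rn[of n z] by (simp_all only: Rn_iff_proj)
  have "Poly_Mapping.lookup (cmap (sq c' d') w) i = (if i < n then Poly_Mapping.lookup (cmap c' (fst w)) i
      else Poly_Mapping.lookup (cmap d' (snd w)) (i - n))"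
    using i by (simp add: sq_simps(4)[OF w(2)] lookup_vconcat[OF cmap_in_Rn[OF c'(1) p(2)]])
  then show "Poly_Mapping.lookup ((cmap (sq c' d') \<circ> cinv (sq c d)) z) i = ?G i z"
    using trans_coord_eq[OF c(1) p(1) q(1), of c' i] trans_coord_eq[OF c(2) p(3) q(2), of d' "i - n"]
    by (simp add: cw)
qed

abbreviation sq_atlas :: "('x \<times> 'x, vec) chart set" where
  "sq_atlas \<equiv> {sq c d |c d. c \<in> matlas N \<and> d \<in> matlas N}"

lemma sq_in_atlas: "c \<in> matlas N \<Longrightarrow> d \<in> matlas N \<Longrightarrow> sq c d \<in> maximal_atlas (sub_lcs (Rn (2 * n))) (Rn (2 * n)) T2 sq_atlas"
  unfolding maximal_atlas_def by (auto simp: sq_is_chart sq_transition)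

lemma chart_smooth_sq:
  assumes c: "c \<in> matlas N" "d \<in> matlas N" and g: "chart_smooth c g z" "chart_smooth d h z"
  shows "chart_smooth (sq c d) (\<lambda>w. (g w, h w)) z"
proof -
  obtain Q R where Q: "open Q" "z \<in> Q" "g ` Q \<subseteq> cdom c" and R: "open R" "z \<in> R" "h ` R \<subseteq> cdom d"
    using g by (auto simp: chart_smooth_def)
  let ?G = "\<lambda>i w. if i < n then Poly_Mapping.lookup (cmap c (g w)) i
    else if i < 2 * n then Poly_Mapping.lookup (cmap d (h w)) (i - n) else 0"
  have "smooth_at (?G i) z" for i
    using g by (cases "i < n"; cases "i < 2 * n") (auto simp: chart_smooth_def smooth_at_const)
  moreover have "?G i w = Poly_Mapping.lookup (cmap (sq c d) (g w, h w)) i" if "w \<in> Q \<inter> R" for i w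
  proof -
    have "(g w, h w) \<in> cdom (sq c d)" "cmap c (g w) \<in> Rn n"
      using that Q(3) R(3) by (auto simp: sq_simps(1) intro: cmap_in_Rn[OF c(1)])
    then show ?thesis by (simp add: sq_simps(4) lookup_vconcat)
  qed
  ultimately have "smooth_at (\<lambda>w. Poly_Mapping.lookup (cmap (sq c d) (g w, h w)) i) z" for i
    by (rule smooth_at_cong[where f = "?G i", OF _ open_Int[OF Q(1) R(1)] IntI[OF Q(2) R(2)]])
  moreover have "\<exists>Q. open Q \<and> z \<in> Q \<and> (\<lambda>w. (g w, h w)) ` Q \<subseteq> cdom (sq c d)"
    using Q R by (intro exI[of _ "Q \<inter> R"]) (auto simp: sq_simps(1))
  ultimately show ?thesis by (simp add: chart_smooth_def)
qed

end

text \<open>\<open>smooth_map\<close> gives smoothness on the part of \<open>cdom c\<close> that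
  \<open>f\<close> sends into \<open>cdom d\<close>; continuity of \<open>f\<close> makes this part
  open, as \<open>chart_smooth_compose\<close> requires.\<close>

lemma chart_smooth_map:
  assumes c: "chart_on n (Rn n) (mtop X) c" "c \<in> matlas X" and d: "d \<in> matlas Y" "cmodel d = sub_lcs (Rn k)"
    "openin (mtop Y) (cdom d)"
    and f: "smooth_map X Y f" and g: "chart_smooth c g z" "f (g z) \<in> cdom d"
  shows "chart_smooth d (\<lambda>w. f (g w)) z"
proof (rule chart_smooth_compose[OF c(1) _ _ _ _ g(1)])
  interpret chart_on n "Rn n" "mtop X" c by (rule c(1))
  let ?S = "cdom c \<inter> f -` cdom d"
  have "continuous_map (mtop X) (mtop Y) f" using f by (simp add: smooth_map_def)
  then have "openin (mtop X) {x \<in> topspace (mtop X). f x \<in> cdom d}"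
    using d(3) by (rule openin_continuous_map_preimage)
  then have "openin (mtop X) (cdom c \<inter> {x \<in> topspace (mtop X). f x \<in> cdom d})"
    by (rule openin_Int[OF open_dom])
  moreover have "cdom c \<inter> {x \<in> topspace (mtop X). f x \<in> cdom d} = ?S"
    using openin_subset[OF open_dom] by auto
  ultimately show "openin (mtop X) ?S" by simp
  show "smooth_between (sub_lcs (Rn n)) (sub_lcs (Rn k)) (cmap c ` ?S) (cmap d \<circ> f \<circ> cinv c)"
    using f c(2) d(1) unfolding smooth_map_def model[symmetric] d(2)[symmetric] by blast
  show "g z \<in> ?S" using g chart_smooth_in_cdom[OF g(1)] by auto
qed auto

section \<open>Smoothness of a local addition and of the inverse of \<open>\<theta>\<close>\<close>

locale local_add = smooth_mfd n N for n :: nat and N :: "('x, vec) manifold" +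
  fixes \<Omega> :: "'x tvec set" and \<Sigma> :: "'x tvec \<Rightarrow> 'x"
  assumes local_addition: "local_addition n N \<Omega> \<Sigma>"
begin

definition \<theta> :: "'x tvec \<Rightarrow> 'x \<times> 'x" where
  "\<theta> w = (fst w, \<Sigma> w)"

definition \<theta>inv :: "'x \<times> 'x \<Rightarrow> 'x tvec" where
  "\<theta>inv = the_inv_into \<Omega> \<theta>"

abbreviation \<Omega>' :: "('x \<times> 'x) set" where
  "\<Omega>' \<equiv> \<theta> ` \<Omega>"

lemma \<theta>_eq: "\<theta> = (\<lambda>w. (fst w, \<Sigma> w))"
  by (simp add: \<theta>_def[abs_def])

lemma open_\<Omega>: "openin TT \<Omega>"
  and zero_in: "p \<in> mspace_of N \<Longrightarrow> zero_vec N p \<in> \<Omega>"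
  and \<Sigma>_zero: "p \<in> mspace_of N \<Longrightarrow> \<Sigma> (zero_vec N p) = p"
  and \<Sigma>_smooth: "smooth_map (open_submanifold (tangent_bundle n N) \<Omega>) N \<Sigma>"
  and open_\<Omega>': "openin T2 \<Omega>'"
  using local_addition by (simp_all add: local_addition_def Let_def \<theta>_eq)

lemma \<Omega>_subset: "\<Omega> \<subseteq> tangent_set n N"
  using openin_subset[OF open_\<Omega>] by (simp add: TT_topspace)

lemma \<Omega>_space: "mspace_of (open_submanifold (tangent_bundle n N) \<Omega>) = \<Omega>"
  using openin_subset[OF open_\<Omega>] by (auto simp: open_submanifold_def)

lemma \<Sigma>_space:
  assumes "w \<in> \<Omega>"
  shows "\<Sigma> w \<in> mspace_of N"
proof -
  have "continuous_map (mtop (open_submanifold (tangent_bundle n N) \<Omega>)) (mtop N) \<Sigma>"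
    using \<Sigma>_smooth by (simp add: smooth_map_def)
  then show ?thesis using assms unfolding continuous_map_def \<Omega>_space by blast
qed

lemma \<theta>_inj: "inj_on \<theta> \<Omega>"
  and \<theta>inv_smooth: "smooth_map (open_submanifold (square_manifold n N) \<Omega>')
      (open_submanifold (tangent_bundle n N) \<Omega>) \<theta>inv"
  using local_addition unfolding local_addition_def diffeomorphism_def Let_def \<theta>_eq[symmetric] \<Omega>_space \<theta>inv_def
  by (simp_all add: bij_betw_def)

lemma \<theta>inv_in: "w \<in> \<Omega>' \<Longrightarrow> \<theta>inv w \<in> \<Omega>"
  unfolding \<theta>inv_def by (rule the_inv_into_into[OF \<theta>_inj]) auto

lemma \<theta>_\<theta>inv: "w \<in> \<Omega>' \<Longrightarrow> \<theta> (\<theta>inv w) = w"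
  unfolding \<theta>inv_def by (rule f_the_inv_into_f[OF \<theta>_inj])

lemma fst_\<theta>inv: "(p, q) \<in> \<Omega>' \<Longrightarrow> fst (\<theta>inv (p, q)) = p"
  and \<Sigma>_\<theta>inv: "(p, q) \<in> \<Omega>' \<Longrightarrow> \<Sigma> (\<theta>inv (p, q)) = q"
  using \<theta>_\<theta>inv[of "(p, q)"] by (simp_all add: \<theta>_def)

text \<open>\<open>open_submanifold\<close> keeps only the charts with domain inside \<Omega>. The
  tangent chart is therefore restricted first, and the restriction still belongs to the maximal
  atlas.\<close>

lemma restricted_tc:
  assumes "c \<in> matlas N"
  shows "restrict_chart (tc c) \<Omega> \<in> matlas (open_submanifold (tangent_bundle n N) \<Omega>)"
    "chart_on (2 * n) (Rn (2 * n)) (mtop (open_submanifold (tangent_bundle n N) \<Omega>)) (restrict_chart (tc c) \<Omega>)"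
proof -
  have m: "restrict_chart (tc c) \<Omega> \<in> matlas (tangent_bundle n N)"
    unfolding TN_atlas
    by (rule restrict_chart_in_maximal_atlas) (use tc_in_atlas[OF assms] open_\<Omega> TN_atlas in \<open>auto intro: tc_inj\<close>)
  then show "restrict_chart (tc c) \<Omega> \<in> matlas (open_submanifold (tangent_bundle n N) \<Omega>)"
    by (simp add: open_submanifold_def)
  have ch: "is_chart (sub_lcs (Rn (2 * n))) (Rn (2 * n)) TT (restrict_chart (tc c) \<Omega>)"
    using m unfolding TN_atlas by (simp add: maximal_atlas_def)
  show "chart_on (2 * n) (Rn (2 * n)) (mtop (open_submanifold (tangent_bundle n N) \<Omega>)) (restrict_chart (tc c) \<Omega>)"
    by unfold_locales (use is_chart_open_subtopology[OF ch open_\<Omega>] in \<open>simp_all add: open_submanifold_def\<close>)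
qed

lemma restricted_sq:
  assumes "c \<in> matlas N" "d \<in> matlas N"
  shows "restrict_chart (sq c d) \<Omega>' \<in> matlas (open_submanifold (square_manifold n N) \<Omega>')"
    "chart_on (2 * n) (Rn (2 * n)) (mtop (open_submanifold (square_manifold n N) \<Omega>')) (restrict_chart (sq c d) \<Omega>')"
proof -
  have m: "restrict_chart (sq c d) \<Omega>' \<in> maximal_atlas (sub_lcs (Rn (2 * n))) (Rn (2 * n)) T2 sq_atlas"
    by (rule restrict_chart_in_maximal_atlas) (use sq_in_atlas[OF assms] open_\<Omega>' in \<open>auto intro: sq_inj\<close>)
  then show "restrict_chart (sq c d) \<Omega>' \<in> matlas (open_submanifold (square_manifold n N) \<Omega>')"
    by (simp add: open_submanifold_def square_manifold_def Let_def)
  have ch: "is_chart (sub_lcs (Rn (2 * n))) (Rn (2 * n)) T2 (restrict_chart (sq c d) \<Omega>')"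
    using m by (simp add: maximal_atlas_def)
  show "chart_on (2 * n) (Rn (2 * n)) (mtop (open_submanifold (square_manifold n N) \<Omega>')) (restrict_chart (sq c d) \<Omega>')"
    by unfold_locales
      (use is_chart_open_subtopology[OF ch open_\<Omega>'] in \<open>simp_all add: open_submanifold_def square_manifold_def Let_def\<close>)
qed

lemma chart_smooth_\<Sigma>:
  assumes "c \<in> matlas N" "d \<in> matlas N" "chart_smooth (tc c) s z" "s z \<in> \<Omega>" "\<Sigma> (s z) \<in> cdom d"
  shows "chart_smooth d (\<lambda>w. \<Sigma> (s w)) z"
proof (rule chart_smooth_map[OF restricted_tc(2,1)[OF assms(1)] assms(2) _ _ \<Sigma>_smooth])
  show "cmodel d = sub_lcs (Rn n)" by (rule chart_on.model[OF chart_on[OF assms(2)]])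
  show "openin (mtop N) (cdom d)" by (rule dom_open[OF assms(2)])
  show "chart_smooth (restrict_chart (tc c) \<Omega>) s z"
    using assms(3,4) chart_smooth_restrict[OF tc_chart_on[OF assms(1)] open_\<Omega>] by blast
qed (rule assms)

text \<open>The base point of \<open>\<theta>inv (p, q)\<close> is \<open>p\<close>, so the result
  lies over \<open>cdom c\<close> and can be read in the tangent chart of \<open>c\<close>, whatever
  the chart \<open>d\<close> at the second point.\<close>

lemma chart_smooth_\<theta>inv:
  assumes c: "c \<in> matlas N" "d \<in> matlas N" and g: "chart_smooth c g z" "chart_smooth d h z" "(g z, h z) \<in> \<Omega>'"
  shows "chart_smooth (tc c) (\<lambda>w. \<theta>inv (g w, h w)) z"
proof -
  have s: "chart_smooth (restrict_chart (sq c d) \<Omega>') (\<lambda>w. (g w, h w)) z"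
    unfolding chart_smooth_restrict[OF sq_chart_on[OF c] open_\<Omega>']
    using chart_smooth_sq[OF c g(1,2)] g(3) by blast
  have "chart_smooth (restrict_chart (tc c) \<Omega>) (\<lambda>w. \<theta>inv (g w, h w)) z"
  proof (rule chart_smooth_map[OF restricted_sq(2,1)[OF c] restricted_tc(1)[OF c(1)] _ _ \<theta>inv_smooth s])
    show "cmodel (restrict_chart (tc c) \<Omega>) = sub_lcs (Rn (2 * n))" by (simp add: tc_simps(2))
    show "openin (mtop (open_submanifold (tangent_bundle n N) \<Omega>)) (cdom (restrict_chart (tc c) \<Omega>))"
      by (rule chart_on.open_dom[OF restricted_tc(2)[OF c(1)]])
    have "fst (\<theta>inv (g z, h z)) \<in> cdom c"
      using fst_\<theta>inv[OF g(3)] chart_smooth_in_cdom[OF g(1)] by simp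
    then show "\<theta>inv (g z, h z) \<in> cdom (restrict_chart (tc c) \<Omega>)"
      using \<theta>inv_in[OF g(3)] \<Omega>_subset by (auto simp: tc_simps(1))
  qed
  then show ?thesis
    using chart_smooth_restrict[OF tc_chart_on[OF c(1)] open_\<Omega>] by blast
qed

end

section \<open>Spaces of mappings\<close>

lemma lcont_const: "x0 \<in> topspace X \<Longrightarrow> c \<in> topspace Y \<Longrightarrow> lcont X Y (\<lambda>_. c) x0"
  by (rule continuous_map_imp_lcont) simp_all

context function_family
begin

text \<open>Membership is local continuity over a one-point parameter space.\<close>

lemma \<F>_superpose_mem:
  assumes "U \<in> \<U>" "V \<in> \<U>" "rc V U" "finite I" "open Q" "smooth_on Q G"
    "\<And>i. i \<in> I \<Longrightarrow> u i \<in> topspace (\<F> U)" "\<And>z. z \<in> cl V \<Longrightarrow> tup I (\<lambda>i. u i z) \<in> Q"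
  shows "(\<lambda>z\<in>V. G (tup I (\<lambda>i. u i z))) \<in> topspace (\<F> V)"
proof -
  have "lcont (discrete_topology {()}) (\<F> V) (\<lambda>_. \<lambda>z\<in>V. G (tup I (\<lambda>i. u i z))) ()"
    by (rule \<F>_superpose[OF assms(1-6)]) (simp_all add: assms(7,8) lcont_const)
  from lcont_topspace[OF this] show ?thesis .
qed

lemma \<F>_glue_mem:
  assumes "W \<in> \<U>" "open_in_orthant m Q" "rc W Q"
    "\<And>z. z \<in> cl W \<Longrightarrow> \<exists>V\<in>\<U>. z \<in> V \<and> V \<subseteq> Q \<and> restrict \<phi> V \<in> topspace (\<F> V)"
  shows "restrict \<phi> W \<in> topspace (\<F> W)"
proof -
  have "lcont (discrete_topology {()}) (\<F> W) (\<lambda>_. restrict \<phi> W) ()"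
  proof (rule \<F>_glue[OF assms(1-3)])
    fix z assume "z \<in> cl W"
    then obtain V where V: "V \<in> \<U>" "z \<in> V" "V \<subseteq> Q" "restrict \<phi> V \<in> topspace (\<F> V)"
      using assms(4) by blast
    have "lcont (discrete_topology {()}) (\<F> V) (\<lambda>_. restrict \<phi> V) ()"
      by (rule lcont_const) (simp_all add: V(4))
    then show "\<exists>V\<in>\<U>. z \<in> V \<and> V \<subseteq> Q \<and> lcont (discrete_topology {()}) (\<F> V) (\<lambda>_. restrict \<phi> V) ()"
      using V(1-3) by blast
  qed simp
  from lcont_topspace[OF this] show ?thesis .
qed

lemma open_in_orthant_preimage:
  assumes "W \<in> \<U>" "\<And>i. i \<in> I \<Longrightarrow> u i \<in> topspace (\<F> W)" "open Q"
  shows "open_in_orthant m {z \<in> W. tup I (\<lambda>i. u i z) \<in> Q}"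
proof -
  have "continuous_on W (\<lambda>z. tup I (\<lambda>i. u i z))"
    using \<F>_continuous_on[OF assms(1)] assms(2) by (intro continuous_on_tup) blast
  then have "openin (top_of_set W) (W \<inter> (\<lambda>z. tup I (\<lambda>i. u i z)) -` Q)"
    using assms(3) by (rule continuous_openin_preimage_gen)
  moreover have "W \<inter> (\<lambda>z. tup I (\<lambda>i. u i z)) -` Q = {z \<in> W. tup I (\<lambda>i. u i z) \<in> Q}" by auto
  ultimately show ?thesis
    using openin_trans \<U>_open[OF assms(1)] unfolding open_in_orthant_def by metis
qed

end

lemma smooth_on_transition:
  assumes "smooth_between (sub_lcs (Rn n)) (sub_lcs S) U f" "openin (top_of_set (Rn n)) U"
  shows "smooth_on {z. proj {..<n} z \<in> U} (\<lambda>z. Poly_Mapping.lookup (f (proj {..<n} z)) i)"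
proof (rule smooth_on_local)
  fix z assume "z \<in> {z. proj {..<n} z \<in> U}"
  then have "smooth_at (\<lambda>z. Poly_Mapping.lookup (f (proj {..<n} z)) i) (proj {..<n} z)"
    by (intro smooth_between_imp_smooth_at[OF assms]) simp
  from smooth_at_proj[OF finite_lessThan this]
  show "smooth_at (\<lambda>z. Poly_Mapping.lookup (f (proj {..<n} z)) i) z"
    by (simp only: proj_tup[OF finite_lessThan])
qed

section \<open>Membership in the sets of mappings on \<open>M\<close>\<close>

locale mapping_domain = function_family m \<U> \<F> for m \<U> \<F> +
  fixes M :: "('a, vec) manifold"
  assumes corner: "corner_manifold m M" and compact_M: "compact_space (mtop M)"
begin

abbreviation MS :: "'a set" where "MS \<equiv> mspace_of M"

lemma M_atlas: "matlas M = maximal_atlas (sub_lcs (Rn m)) (orthant m) (mtop M) (matlas M)"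
  and M_cover: "(\<Union>c\<in>matlas M. cdom c) = MS"
  using corner by (simp_all add: corner_manifold_def modelled_manifold_def)

lemma M_chart: "c \<in> matlas M \<Longrightarrow> chart_on m (orthant m) (mtop M) c"
  using M_atlas orthant_subset_Rn by unfold_locales (auto simp: maximal_atlas_def)

lemma M_transition: "c \<in> matlas M \<Longrightarrow> d \<in> matlas M \<Longrightarrow> smooth_transition c d"
  using M_atlas by (auto simp: maximal_atlas_def)

lemmas M_inj = chart_on.inj[OF M_chart]
lemmas M_dom_open = chart_on.open_dom[OF M_chart]

lemma M_dom_subset: "c \<in> matlas M \<Longrightarrow> cdom c \<subseteq> MS"
  using M_cover by blast

lemma M_open_image: "c \<in> matlas M \<Longrightarrow> openin (mtop M) W \<Longrightarrow> W \<subseteq> cdom c \<Longrightarrow> open_in_orthant m (cmap c ` W)"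
  unfolding open_in_orthant_def by (rule chart_on.open_map_image[OF M_chart])

lemma M_image_open: "c \<in> matlas M \<Longrightarrow> open_in_orthant m (cimage c)"
  unfolding cimage_def by (intro M_open_image M_dom_open) auto

lemma M_restrict: "c \<in> matlas M \<Longrightarrow> openin (mtop M) S \<Longrightarrow> restrict_chart c S \<in> matlas M"
  using restrict_chart_in_maximal_atlas[of c m "orthant m" "mtop M" "matlas M" S] M_atlas M_inj orthant_subset_Rn
  by auto

lemma M_preimage_open:
  assumes "c \<in> matlas M" "open_in_orthant m V" "V \<subseteq> cimage c"
  shows "openin (mtop M) {p \<in> cdom c. cmap c p \<in> V}"
proof -
  have "openin (top_of_set (cimage c)) V"
    using assms(2,3) chart_on.image_subset[OF M_chart[OF assms(1)]]
    unfolding open_in_orthant_def by (rule openin_subset_trans)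
  then have "openin (subtopology (mtop M) (cdom c)) {p \<in> topspace (subtopology (mtop M) (cdom c)). cmap c p \<in> V}"
    by (rule openin_continuous_map_preimage[OF chart_on.continuous[OF M_chart[OF assms(1)]]])
  then have "openin (mtop M) {p \<in> topspace (subtopology (mtop M) (cdom c)). cmap c p \<in> V}"
    by (rule openin_trans_full[OF _ M_dom_open[OF assms(1)]])
  moreover have "{p \<in> topspace (subtopology (mtop M) (cdom c)). cmap c p \<in> V} = {p \<in> cdom c. cmap c p \<in> V}"
    using M_dom_subset[OF assms(1)] by auto
  ultimately show ?thesis by simp
qed

text \<open>The restriction of \<open>c\<close> with image exactly \<open>V\<close>: the charts in
  \<open>mapping_set\<close> must have an image in \<open>\<U>\<close>.\<close>

definition rchart :: "('a, vec) chart \<Rightarrow> vec set \<Rightarrow> ('a, vec) chart" where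
  "rchart c V = restrict_chart c {p \<in> cdom c. cmap c p \<in> V}"

lemma rchart:
  assumes "c \<in> matlas M" "open_in_orthant m V" "V \<subseteq> cimage c"
  shows "rchart c V \<in> matlas M" "cdom (rchart c V) = {p \<in> cdom c. cmap c p \<in> V}" "cimage (rchart c V) = V"
    "x \<in> V \<Longrightarrow> cinv (rchart c V) x = cinv c x"
proof -
  show "rchart c V \<in> matlas M"
    unfolding rchart_def by (intro M_restrict M_preimage_open assms)
  show "cdom (rchart c V) = {p \<in> cdom c. cmap c p \<in> V}" by (auto simp: rchart_def)
  have img: "cmap c ` (cdom c \<inter> {p \<in> cdom c. cmap c p \<in> V}) = V"
    using assms(3) by (auto simp: cimage_def)
  then show "cimage (rchart c V) = V" by (simp add: rchart_def cimage_restrict_chart)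
  show "cinv (rchart c V) x = cinv c x" if "x \<in> V"
    unfolding rchart_def using that img by (intro cinv_restrict_chart[OF M_inj[OF assms(1)]]) simp
qed

text \<open>Isolates properties of charts shared by \<open>N\<close> and its tangent bundle, so that
  the results on \<open>mapping_set\<close> apply to maps into both.\<close>

definition target :: "nat \<Rightarrow> ('y, vec) manifold \<Rightarrow> bool" where
  "target k Y \<longleftrightarrow> (\<forall>d\<in>matlas Y. chart_on k (Rn k) (mtop Y) d) \<and> (\<forall>d\<in>matlas Y. cdom d \<subseteq> mspace_of Y)"

definition rep :: "('a, vec) chart \<Rightarrow> ('y, vec) chart \<Rightarrow> ('a \<Rightarrow> 'y) \<Rightarrow> vec set \<Rightarrow> nat \<Rightarrow> vec \<Rightarrow> real" where
  "rep c d \<gamma> W i = (\<lambda>z\<in>W. Poly_Mapping.lookup (cmap d (\<gamma> (cinv c z))) i)"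

lemma target_cmap: "target k Y \<Longrightarrow> d \<in> matlas Y \<Longrightarrow> q \<in> cdom d \<Longrightarrow> cmap d q \<in> Rn k"
  unfolding target_def by (blast intro: subsetD[OF chart_on.image_subset] cmap_in_cimage)

lemma rep_in_vfun:
  assumes "target k Y" "d \<in> matlas Y" "c \<in> matlas M" "\<gamma> ` cdom c \<subseteq> cdom d" "W \<subseteq> cimage c"
  shows "restrict (cmap d \<circ> \<gamma> \<circ> cinv c) W \<in> topspace (vfun_space \<F> W (std_basis k)) \<longleftrightarrow>
    (\<forall>i<k. rep c d \<gamma> W i \<in> topspace (\<F> W))"
proof -
  have "cmap d (\<gamma> (cinv c z)) \<in> Rn k" if "z \<in> W" for z
    using cinv_in_cdom[OF M_inj[OF assms(3)], of z] that assms(4,5)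
    by (intro target_cmap[OF assms(1,2)]) auto
  then have "restrict (cmap d \<circ> \<gamma> \<circ> cinv c) W \<in> W \<rightarrow>\<^sub>E Rn k" by auto
  moreover have "(\<lambda>x\<in>W. Poly_Mapping.lookup (restrict (cmap d \<circ> \<gamma> \<circ> cinv c) W x) i) = rep c d \<gamma> W i" for i
    unfolding rep_def by (rule restrict_ext) simp
  ultimately show ?thesis by (simp only: topspace_vfun_space simp_thms)
qed

lemma mapping_set_local:
  assumes "target k Y" "\<gamma> \<in> mapping_set \<U> \<F> M k Y" "p \<in> MS"
  obtains c d where "c \<in> matlas M" "d \<in> matlas Y" "p \<in> cdom c" "cimage c \<in> \<U>" "\<gamma> ` cdom c \<subseteq> cdom d"
    "\<And>i. i < k \<Longrightarrow> rep c d \<gamma> (cimage c) i \<in> topspace (\<F> (cimage c))"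
proof -
  obtain c d where cd: "c \<in> matlas M" "d \<in> matlas Y" "p \<in> cdom c" "cimage c \<in> \<U>" "\<gamma> ` cdom c \<subseteq> cdom d"
    "restrict (cmap d \<circ> \<gamma> \<circ> cinv c) (cimage c) \<in> topspace (vfun_space \<F> (cimage c) (std_basis k))"
    using assms(2,3) unfolding mapping_set_def by blast
  show ?thesis
    by (rule that[OF cd(1-5)]) (use cd(6) rep_in_vfun[OF assms(1) cd(2,1,5) subset_refl] in blast)
qed

lemma mapping_set_PiE: "\<gamma> \<in> mapping_set \<U> \<F> M k Y \<Longrightarrow> \<gamma> \<in> MS \<rightarrow>\<^sub>E mspace_of Y"
  by (simp add: mapping_set_def)

lemma tup_rep:
  assumes "target k Y" "d \<in> matlas Y" "c \<in> matlas M" "\<gamma> ` cdom c \<subseteq> cdom d" "z \<in> W" "W \<subseteq> cimage c"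
  shows "tup {..<k} (\<lambda>i. rep c d \<gamma> W i z) = cmap d (\<gamma> (cinv c z))"
proof -
  have "\<gamma> (cinv c z) \<in> cdom d"
    using cinv_in_cdom[OF M_inj[OF assms(3)], of z] assms(4-6) by auto
  then have "cmap d (\<gamma> (cinv c z)) \<in> Rn k" by (rule target_cmap[OF assms(1,2)])
  then show ?thesis using assms(5) by (simp add: rep_def Rn_iff_proj)
qed

lemma mapping_set_continuous:
  assumes Y: "target k Y" and \<gamma>: "\<gamma> \<in> mapping_set \<U> \<F> M k Y"
  shows "continuous_map (mtop M) (mtop Y) \<gamma>"
proof (rule lcont_imp_continuous_map)
  fix p assume "p \<in> topspace (mtop M)"
  then obtain c d where cd: "c \<in> matlas M" "d \<in> matlas Y" "p \<in> cdom c" "cimage c \<in> \<U>" "\<gamma> ` cdom c \<subseteq> cdom d"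
    "\<And>i. i < k \<Longrightarrow> rep c d \<gamma> (cimage c) i \<in> topspace (\<F> (cimage c))"
    by (rule mapping_set_local[OF Y \<gamma>]) blast
  have d: "chart_on k (Rn k) (mtop Y) d" using Y cd(2) by (simp add: target_def)
  let ?t = "\<lambda>z. tup {..<k} (\<lambda>i. rep c d \<gamma> (cimage c) i z)"
  have t: "?t z = cmap d (\<gamma> (cinv c z))" "\<gamma> (cinv c z) \<in> cdom d" if "z \<in> cimage c" for z
    using tup_rep[OF Y cd(2,1,5) that subset_refl] cinv_in_cdom[OF M_inj[OF cd(1)] that] cd(5) by auto
  have "continuous_on (cimage c) ?t"
    using \<F>_continuous_on[OF cd(4)] cd(6) by (intro continuous_on_tup) auto
  then have "continuous_map (top_of_set (cimage c)) (top_of_set (cimage d)) ?t"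
    using t by (auto intro!: cmap_in_cimage)
  from continuous_map_compose[OF continuous_map_compose[OF chart_on.continuous[OF M_chart[OF cd(1)]] this]
      chart_on.cinv_continuous[OF d]]
  have "continuous_map (subtopology (mtop M) (cdom c)) (mtop Y) (cinv d \<circ> (?t \<circ> cmap c))" .
  then have "continuous_map (subtopology (mtop M) (cdom c)) (mtop Y) \<gamma>"
  proof (rule continuous_map_eq)
    fix x assume "x \<in> topspace (subtopology (mtop M) (cdom c))"
    then have x: "x \<in> cdom c" by simp
    have "?t (cmap c x) = cmap d (\<gamma> x)"
      using t(1)[OF cmap_in_cimage[OF x]] cinv_cmap[OF M_inj[OF cd(1)] x] by simp
    then show "(cinv d \<circ> (?t \<circ> cmap c)) x = \<gamma> x"
      using cinv_cmap[OF chart_on.inj[OF d]] cd(5) x by (simp add: image_subset_iff)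
  qed
  then show "lcont (mtop M) (mtop Y) \<gamma> p"
    using cd(3) by (intro lcont_subset[OF M_dom_open[OF cd(1)]])
qed

text \<open>\<open>mapping_set\<close> provides some pair of charts around each point; here the pair
  is prescribed. The change of chart in the target is a superposition operator, the change of chart
  in \<open>M\<close> is a pullback by (PB), and the local results are glued over
  \<open>cl W\<close>.\<close>

lemma mapping_set_regular:
  assumes Y: "target k Y" and \<gamma>: "\<gamma> \<in> mapping_set \<U> \<F> M k Y"
    and c: "c \<in> matlas M" and d: "d \<in> matlas Y" "\<And>d'. d' \<in> matlas Y \<Longrightarrow> smooth_transition d' d"
    and \<gamma>c: "\<gamma> ` cdom c \<subseteq> cdom d" and W: "W \<in> \<U>" "rc W (cimage c)"
  shows "rep c d \<gamma> W i \<in> topspace (\<F> W)"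
  unfolding rep_def
proof (rule \<F>_glue_mem[OF W(1) M_image_open[OF c] W(2)])
  fix z assume "z \<in> cl W"
  then have z: "z \<in> cimage c" using rc_cl[OF W(2)] by auto
  define p where "p = cinv c z"
  have p: "p \<in> cdom c" "cmap c p = z"
    using cinv_in_cdom[OF M_inj[OF c] z] cmap_cinv[OF M_inj[OF c] z] by (simp_all add: p_def)
  then have "p \<in> MS" using M_dom_subset[OF c] by auto
  then obtain c0 d0 where cd: "c0 \<in> matlas M" "d0 \<in> matlas Y" "p \<in> cdom c0" "cimage c0 \<in> \<U>" "\<gamma> ` cdom c0 \<subseteq> cdom d0"
    "\<And>i. i < k \<Longrightarrow> rep c0 d0 \<gamma> (cimage c0) i \<in> topspace (\<F> (cimage c0))"
    by (rule mapping_set_local[OF Y \<gamma>]) blast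
  have d0: "chart_on k (Rn k) (mtop Y) d0" and dd: "chart_on k (Rn k) (mtop Y) d"
    using Y cd(2) d(1) by (simp_all add: target_def)
  let ?O = "cmap c0 ` (cdom c0 \<inter> cdom c)" and ?D = "cmap d0 ` (cdom d0 \<inter> cdom d)"
  have O: "open_in_orthant m ?O" "cmap c0 p \<in> ?O"
    using cd(1,3) p(1) M_dom_open c by (auto intro!: M_open_image)
  obtain V where V: "V \<in> \<U>" "cmap c0 p \<in> V" "rc V ?O"
    by (rule \<U>_shrink[OF O])
  have Oc: "?O \<subseteq> cimage c0" by (auto simp: cimage_def)
  have rcV: "rc V (cimage c0)" by (rule rc_mono[OF V(3) Oc])
  have VO: "V \<subseteq> ?O" by (rule rc_subset[OF V(1,3)])
  have D: "openin (top_of_set (Rn k)) ?D"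
    using chart_on.open_dom[OF d0] chart_on.open_dom[OF dd] by (intro chart_on.open_map_image[OF d0]) auto
  let ?G = "\<lambda>y. Poly_Mapping.lookup ((cmap d \<circ> cinv d0) (proj {..<k} y)) i"
  let ?t = "\<lambda>z. tup {..<k} (\<lambda>i. rep c0 d0 \<gamma> (cimage c0) i z)"
  have sb: "smooth_between (sub_lcs (Rn k)) (sub_lcs (Rn k)) ?D (cmap d \<circ> cinv d0)"
    using d(2)[OF cd(2)] chart_on.model[OF d0] chart_on.model[OF dd] by (simp add: smooth_transition_def)
  have t: "?t y = cmap d0 (\<gamma> (cinv c0 y))" "\<gamma> (cinv c0 y) \<in> cdom d0 \<inter> cdom d" if "y \<in> ?O" for y
  proof -
    have y: "y \<in> cimage c0" using that Oc by auto
    obtain x where x: "x \<in> cdom c0" "x \<in> cdom c" "y = cmap c0 x" using \<open>y \<in> ?O\<close> by auto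
    have "cinv c0 y = x" unfolding x(3) by (rule cinv_cmap[OF M_inj[OF cd(1)] x(1)])
    then show "?t y = cmap d0 (\<gamma> (cinv c0 y))" "\<gamma> (cinv c0 y) \<in> cdom d0 \<inter> cdom d"
      using tup_rep[OF Y cd(2,1,5) y subset_refl] x cd(5) \<gamma>c by auto
  qed
  have "(\<lambda>y\<in>V. ?G (?t y)) \<in> topspace (\<F> V)"
  proof (rule \<F>_superpose_mem[OF cd(4) V(1) rcV finite_lessThan open_proj_vimage[OF D] smooth_on_transition[OF sb D]])
    fix y assume "y \<in> cl V"
    then have y: "y \<in> ?O" using rc_cl[OF V(3)] by auto
    have "proj {..<k} (?t y) = cmap d0 (\<gamma> (cinv c0 y))"
      unfolding proj_tup[OF finite_lessThan] by (rule t(1)[OF y])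
    then show "?t y \<in> {z. proj {..<k} z \<in> ?D}" using t(2)[OF y] by auto
  qed (use cd(6) in auto)
  moreover have "?G (?t y) = Poly_Mapping.lookup (cmap d (\<gamma> (cinv c0 y))) i" if "y \<in> V" for y
  proof -
    have y: "y \<in> ?O" using that VO by auto
    have "cinv d0 (cmap d0 (\<gamma> (cinv c0 y))) = \<gamma> (cinv c0 y)"
      using t(2)[OF y] by (intro cinv_cmap[OF chart_on.inj[OF d0]]) auto
    moreover have "proj {..<k} (?t y) = cmap d0 (\<gamma> (cinv c0 y))"
      unfolding proj_tup[OF finite_lessThan] by (rule t(1)[OF y])
    ultimately show ?thesis by (simp only: o_apply)
  qed
  then have "(\<lambda>y\<in>V. ?G (?t y)) = (\<lambda>y\<in>V. Poly_Mapping.lookup (cmap d (\<gamma> (cinv c0 y))) i)"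
    by (rule restrict_ext)
  ultimately have g: "(\<lambda>y\<in>V. Poly_Mapping.lookup (cmap d (\<gamma> (cinv c0 y))) i) \<in> topspace (\<F> V)"
    by (simp only:)
  \<comment> \<open>The part of the overlap that \<open>c0\<close> maps into \<open>V\<close>. On it
    the change of charts \<open>?\<Theta>\<close> is a diffeomorphism onto the member
    \<open>V\<close> itself, as (PB) requires.\<close>
  let ?S = "{x \<in> cdom c \<inter> cdom c0. cmap c0 x \<in> V}" and ?\<Theta> = "cmap c0 \<circ> cinv c"
  have S: "openin (mtop M) ?S"
  proof -
    have "openin (mtop M) (cdom c \<inter> {x \<in> cdom c0. cmap c0 x \<in> V})"
      using VO Oc by (intro openin_Int M_dom_open c M_preimage_open cd(1) \<U>_open V(1)) auto
    moreover have "cdom c \<inter> {x \<in> cdom c0. cmap c0 x \<in> V} = ?S" by auto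
    ultimately show ?thesis by simp
  qed
  have U2: "open_in_orthant m (cmap c ` ?S)" by (rule M_open_image[OF c S]) auto
  have img: "?\<Theta> ` (cmap c ` ?S) = V"
  proof -
    have "?\<Theta> ` (cmap c ` ?S) = cmap c0 ` ?S"
      unfolding image_image using cinv_cmap[OF M_inj[OF c]] by (intro image_cong) auto
    also have "\<dots> = V" using VO by auto
    finally show ?thesis .
  qed
  have injT: "inj_on ?\<Theta> (cmap c ` ?S)"
  proof (rule inj_onI)
    fix a b assume "a \<in> cmap c ` ?S" "b \<in> cmap c ` ?S" and eq: "?\<Theta> a = ?\<Theta> b"
    then obtain x y where xy: "x \<in> ?S" "y \<in> ?S" "a = cmap c x" "b = cmap c y" by blast
    have "cmap c0 x = cmap c0 y" using eq xy cinv_cmap[OF M_inj[OF c]] by auto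
    then show "a = b" using inj_onD[OF M_inj[OF cd(1)], of x y] xy by auto
  qed
  have diffeo: "diffeo_between (sub_lcs (Rn m)) (sub_lcs (Rn m)) (cmap c ` ?S) V ?\<Theta>"
    unfolding diffeo_between_def
  proof (intro conjI)
    show "bij_betw ?\<Theta> (cmap c ` ?S) V" using img injT by (simp add: bij_betw_def)
    have mod: "cmodel c = sub_lcs (Rn m)" "cmodel c0 = sub_lcs (Rn m)"
      using chart_on.model[OF M_chart] c cd(1) by blast+
    show "smooth_between (sub_lcs (Rn m)) (sub_lcs (Rn m)) (cmap c ` ?S) ?\<Theta>"
      by (rule smooth_between_subset_cong[OF M_transition[OF c cd(1), unfolded smooth_transition_def mod]]) auto
    show "smooth_between (sub_lcs (Rn m)) (sub_lcs (Rn m)) V (the_inv_into (cmap c ` ?S) ?\<Theta>)"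
    proof (rule smooth_between_subset_cong[OF M_transition[OF cd(1) c, unfolded smooth_transition_def mod] VO])
      fix y assume "y \<in> V"
      then obtain x where x: "x \<in> ?S" "y = cmap c0 x" using VO by auto
      have "?\<Theta> (cmap c x) = y" using x cinv_cmap[OF M_inj[OF c]] by auto
      then have "the_inv_into (cmap c ` ?S) ?\<Theta> y = cmap c x"
        using the_inv_into_f_eq[OF injT] x(1) by blast
      moreover have "cinv c0 y = x" using x cinv_cmap[OF M_inj[OF cd(1)]] by auto
      ultimately show "(cmap c \<circ> cinv c0) y = the_inv_into (cmap c ` ?S) ?\<Theta> y" by simp
    qed
  qed
  have "z \<in> cmap c ` ?S" using p cd(3) V(2) by auto
  then obtain W0 where W0: "W0 \<in> \<U>" "z \<in> W0" "rc W0 (cmap c ` ?S)"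
    by (rule \<U>_shrink[OF U2])
  have W0S: "W0 \<subseteq> cmap c ` ?S" by (rule rc_subset[OF W0(1,3)])
  have "(\<lambda>x\<in>W0. (\<lambda>y\<in>V. Poly_Mapping.lookup (cmap d (\<gamma> (cinv c0 y))) i) (?\<Theta> x)) \<in> topspace (\<F> W0)"
    using continuous_map_image_subset_topspace[OF \<F>_pullback[OF U2 V(1) W0(1,3) diffeo]] g by blast
  moreover have "(\<lambda>x\<in>W0. (\<lambda>y\<in>V. Poly_Mapping.lookup (cmap d (\<gamma> (cinv c0 y))) i) (?\<Theta> x))
      = (\<lambda>x\<in>W0. Poly_Mapping.lookup (cmap d (\<gamma> (cinv c x))) i)"
  proof (rule restrict_ext)
    fix a assume "a \<in> W0"
    then obtain x where x: "x \<in> ?S" "a = cmap c x" using W0S by auto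
    have "cinv c a = x" "cinv c0 (cmap c0 x) = x" using x cinv_cmap[OF M_inj] c cd(1) by auto
    then show "(\<lambda>y\<in>V. Poly_Mapping.lookup (cmap d (\<gamma> (cinv c0 y))) i) (?\<Theta> a) = Poly_Mapping.lookup (cmap d (\<gamma> (cinv c a))) i"
      using x by simp
  qed
  moreover have "W0 \<subseteq> cimage c" using W0S by (auto simp: cimage_def)
  ultimately show "\<exists>V\<in>\<U>. z \<in> V \<and> V \<subseteq> cimage c \<and> (\<lambda>z\<in>V. Poly_Mapping.lookup (cmap d (\<gamma> (cinv c z))) i) \<in> topspace (\<F> V)"
    using W0(1,2) by (intro bexI[of _ W0]) simp_all
qed

text \<open>The coordinates of \<open>g\<close>, superposed on the functions \<open>u i\<close>, lie
  in \<open>\<F> V\<close> for small \<open>V\<close>, and the chart of \<open>M\<close> is cut down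
  to have image \<open>V\<close>. Pairs as indices give several blocks of coordinates.\<close>

lemma mapping_set_superpose:
  assumes Y: "target k Y" and \<rho>: "\<rho> \<in> MS \<rightarrow>\<^sub>E mspace_of Y"
    and loc: "\<And>p. p \<in> MS \<Longrightarrow> \<exists>c d W I u g. c \<in> matlas M \<and> d \<in> matlas Y \<and> p \<in> cdom c \<and> W \<in> \<U> \<and>
      cmap c p \<in> W \<and> W \<subseteq> cimage c \<and> finite (I :: (nat \<times> nat) set) \<and> (\<forall>i\<in>I. u i \<in> topspace (\<F> W)) \<and>
      chart_smooth d g (tup I (\<lambda>i. u i (cmap c p))) \<and> (\<forall>z\<in>W. \<rho> (cinv c z) = g (tup I (\<lambda>i. u i z)))"
  shows "\<rho> \<in> mapping_set \<U> \<F> M k Y"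
  unfolding mapping_set_def mem_Collect_eq
proof (intro conjI \<rho> ballI)
  fix p assume p: "p \<in> MS"
  obtain c d W I u g where c: "c \<in> matlas M" and d: "d \<in> matlas Y" and pc: "p \<in> cdom c" and W: "W \<in> \<U>"
      "cmap c p \<in> W" "W \<subseteq> cimage c" and I: "finite (I :: (nat \<times> nat) set)" and u: "\<forall>i\<in>I. u i \<in> topspace (\<F> W)"
      and g: "chart_smooth d g (tup I (\<lambda>i. u i (cmap c p)))" and eq: "\<forall>z\<in>W. \<rho> (cinv c z) = g (tup I (\<lambda>i. u i z))"
    using loc[OF p] by (elim exE conjE)
  obtain Q where Q: "open Q" "tup I (\<lambda>i. u i (cmap c p)) \<in> Q" "g ` Q \<subseteq> cdom d"
    using g by (auto simp: chart_smooth_def)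
  obtain Q1 where Q1: "open Q1" "tup I (\<lambda>i. u i (cmap c p)) \<in> Q1"
    "\<forall>i\<in>{..<k}. smooth_on Q1 (\<lambda>w. Poly_Mapping.lookup (cmap d (g w)) i)"
    using smooth_at_common[of "{..<k}" "\<lambda>i w. Poly_Mapping.lookup (cmap d (g w)) i" "tup I (\<lambda>i. u i (cmap c p))"] g
    unfolding chart_smooth_def by blast
  let ?P = "{z \<in> W. tup I (\<lambda>i. u i z) \<in> Q \<inter> Q1}"
  have P: "open_in_orthant m ?P"
    using u Q(1) Q1(1) by (intro open_in_orthant_preimage[OF W(1)]) auto
  have "cmap c p \<in> ?P" using W(2) Q(2) Q1(2) by simp
  then obtain V where V: "V \<in> \<U>" "cmap c p \<in> V" "rc V ?P" by (rule \<U>_shrink[OF P])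
  have VP: "V \<subseteq> ?P" by (rule rc_subset[OF V(1,3)])
  then have VW: "V \<subseteq> W" by auto
  then have Vc: "V \<subseteq> cimage c" using W(3) by auto
  note r = rchart[OF c \<U>_open[OF V(1)] Vc]
  have \<rho>V: "\<rho> (cinv c z) = g (tup I (\<lambda>i. u i z))" "tup I (\<lambda>i. u i z) \<in> Q" if "z \<in> V" for z
    using that VW VP eq by auto
  have sub: "\<rho> ` cdom (rchart c V) \<subseteq> cdom d"
  proof
    fix q assume "q \<in> \<rho> ` cdom (rchart c V)"
    then obtain x where x: "x \<in> cdom c" "cmap c x \<in> V" "q = \<rho> x" unfolding r(2) by auto
    then have "q = g (tup I (\<lambda>i. u i (cmap c x)))"
      using \<rho>V(1)[OF x(2)] cinv_cmap[OF M_inj[OF c] x(1)] by simp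
    then show "q \<in> cdom d" using \<rho>V(2)[OF x(2)] Q(3) by auto
  qed
  have "rep (rchart c V) d \<rho> V i \<in> topspace (\<F> V)" if "i < k" for i
  proof -
    have "(\<lambda>z\<in>V. Poly_Mapping.lookup (cmap d (g (tup I (\<lambda>i. u i z)))) i) \<in> topspace (\<F> V)"
    proof (rule \<F>_superpose_mem[OF W(1) V(1) _ I Q1(1)])
      show "rc V W" by (rule rc_mono[OF V(3)]) auto
      show "smooth_on Q1 (\<lambda>w. Poly_Mapping.lookup (cmap d (g w)) i)" using Q1(3) that by simp
      show "tup I (\<lambda>i. u i z) \<in> Q1" if "z \<in> cl V" for z using rc_cl[OF V(3)] that by auto
    qed (use u in blast)
    moreover have "rep (rchart c V) d \<rho> V i = (\<lambda>z\<in>V. Poly_Mapping.lookup (cmap d (g (tup I (\<lambda>i. u i z)))) i)"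
      unfolding rep_def by (rule restrict_ext) (simp add: r(4) \<rho>V(1))
    ultimately show ?thesis by simp
  qed
  then have "restrict (cmap d \<circ> \<rho> \<circ> cinv (rchart c V)) V \<in> topspace (vfun_space \<F> V (std_basis k))"
    using rep_in_vfun[OF Y d r(1) sub, of V] r(3) by simp
  then show "\<exists>c\<in>matlas M. \<exists>d\<in>matlas Y. p \<in> cdom c \<and> cimage c \<in> \<U> \<and> \<rho> ` cdom c \<subseteq> cdom d \<and>
      restrict (cmap d \<circ> \<rho> \<circ> cinv c) (cimage c) \<in> topspace (vfun_space \<F> (cimage c) (std_basis k))"
    using r d pc V(1,2) sub by (intro bexI[of _ "rchart c V"] bexI[of _ d]) auto
qed

end

section \<open>Spaces of sections\<close>

text \<open>Holding eventually is preserved by finite intersections and by passing to larger sets,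
  so a limit need be checked on generating sets only.\<close>

lemma limitin_topology_generated_by:
  assumes "l \<in> \<Union>B" "\<And>U. U \<in> B \<Longrightarrow> l \<in> U \<Longrightarrow> eventually (\<lambda>x. f x \<in> U) F"
  shows "limitin (topology_generated_by B) f l F"
  unfolding limitin_def topology_generated_by_topspace
proof (intro conjI allI impI assms(1))
  fix U assume "openin (topology_generated_by B) U \<and> l \<in> U"
  then have U: "generate_topology_on B U" and lU: "l \<in> U" by (auto dest: openin_topology_generated_by)
  from U lU show "eventually (\<lambda>x. f x \<in> U) F"
  proof (induction rule: generate_topology_on.induct)
    case (Int a b)
    then show ?case by (simp add: eventually_conj)
  next
    case (UN K)
    then obtain k where k: "k \<in> K" "l \<in> k" by auto
    have "eventually (\<lambda>x. f x \<in> k) F" using UN.IH k by blast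
    then show ?case by (rule eventually_mono) (use k(1) in blast)
  qed (auto intro: assms(2))
qed

locale section_space = mapping_domain m \<U> \<F> M + smooth_mfd n N
  for m \<U> \<F> and M :: "('a, vec) manifold" and n and N :: "('y, vec) manifold" +
  fixes \<gamma> :: "'a \<Rightarrow> 'y"
  assumes \<gamma>: "\<gamma> \<in> mapping_set \<U> \<F> M n N"
begin

abbreviation Sec :: "('a \<Rightarrow> 'y tvec) set" where
  "Sec \<equiv> section_set \<U> \<F> M n N \<gamma>"

abbreviation ST :: "('a \<Rightarrow> 'y tvec) topology" where
  "ST \<equiv> section_topology m \<U> \<F> M n N \<gamma>"

abbreviation E :: "('a \<Rightarrow> 'y tvec) lcs" where
  "E \<equiv> section_lcs m \<U> \<F> M n N \<gamma>"

text \<open>The index set of the initial topology. Relative compactness of \<open>W\<close> in the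
  image of \<open>c\<close> is what puts the representatives into \<open>\<F> W\<close>.\<close>

definition allowed :: "('a, vec) chart \<Rightarrow> ('y, vec) chart \<Rightarrow> vec set \<Rightarrow> bool" where
  "allowed c d W \<longleftrightarrow> c \<in> matlas M \<and> d \<in> matlas N \<and> W \<in> \<U> \<and> rc W (cimage c) \<and> \<gamma> ` cdom c \<subseteq> cdom d"

definition comp :: "('a, vec) chart \<Rightarrow> ('y, vec) chart \<Rightarrow> vec set \<Rightarrow> nat \<Rightarrow> ('a \<Rightarrow> 'y tvec) \<Rightarrow> vec \<Rightarrow> real" where
  "comp c d W i \<sigma> = (\<lambda>z\<in>W. Poly_Mapping.lookup (snd (\<sigma> (cinv c z)) d) i)"

lemma target_N: "target n N"
  unfolding target_def using chart_on dom_subset by blast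

lemma target_TN: "target (2 * n) (tangent_bundle n N)"
  unfolding target_def
proof (intro conjI ballI)
  fix d assume d: "d \<in> matlas (tangent_bundle n N)"
  show ch: "chart_on (2 * n) (Rn (2 * n)) TT d"
    using d unfolding TN_atlas by unfold_locales (simp_all add: maximal_atlas_def)
  show "cdom d \<subseteq> topspace TT" by (rule openin_subset[OF chart_on.open_dom[OF ch]])
qed

lemma TN_transition: "c \<in> matlas N \<Longrightarrow> d \<in> matlas (tangent_bundle n N) \<Longrightarrow> smooth_transition d (tc c)"
  unfolding TN_atlas by (simp add: maximal_atlas_def)

lemma \<gamma>_space: "x \<in> MS \<Longrightarrow> \<gamma> x \<in> mspace_of N"
  using mapping_set_PiE[OF \<gamma>] by auto

lemma \<gamma>_continuous: "continuous_map (mtop M) (mtop N) \<gamma>"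
  by (rule mapping_set_continuous[OF target_N \<gamma>])

lemma Sec_mem:
  assumes "\<sigma> \<in> Sec"
  shows "\<sigma> \<in> mapping_set \<U> \<F> M (2 * n) (tangent_bundle n N)" "\<sigma> \<in> extensional MS"
    "x \<in> MS \<Longrightarrow> fst (\<sigma> x) = \<gamma> x" "x \<in> MS \<Longrightarrow> \<sigma> x \<in> tangent_set n N"
    "x \<in> MS \<Longrightarrow> snd (\<sigma> x) \<in> tangent_space n N (\<gamma> x)"
proof -
  show m: "\<sigma> \<in> mapping_set \<U> \<F> M (2 * n) (tangent_bundle n N)"
    using assms by (simp add: section_set_def)
  then show "\<sigma> \<in> extensional MS" using mapping_set_PiE by (auto simp: PiE_iff)
  show f: "fst (\<sigma> x) = \<gamma> x" if "x \<in> MS" for x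
    using assms that by (simp add: section_set_def)
  show t: "\<sigma> x \<in> tangent_set n N" if "x \<in> MS" for x
    using mapping_set_PiE[OF m] that TT_topspace by auto
  show "snd (\<sigma> x) \<in> tangent_space n N (\<gamma> x)" if "x \<in> MS"
    using f[OF that] t[OF that] by (auto simp: tangent_set_def)
qed

lemma SecI:
  assumes "\<sigma> \<in> mapping_set \<U> \<F> M (2 * n) (tangent_bundle n N)" "\<And>x. x \<in> MS \<Longrightarrow> fst (\<sigma> x) = \<gamma> x"
  shows "\<sigma> \<in> Sec"
  using assms by (simp add: section_set_def)

lemma Sec_in_tc:
  assumes "\<sigma> \<in> Sec" "x \<in> MS" "d \<in> matlas N" "\<gamma> x \<in> cdom d"
  shows "\<sigma> x \<in> cdom (tc d)"
  using Sec_mem(3,4)[OF assms(1,2)] assms(4) by (simp add: tc_simps(1))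

lemma allowed_point:
  assumes "allowed c d W" "z \<in> W"
  shows "cinv c z \<in> MS" "\<gamma> (cinv c z) \<in> cdom d" "cinv c z \<in> cdom c"
proof -
  have c: "c \<in> matlas M" "\<gamma> ` cdom c \<subseteq> cdom d" using assms(1) by (simp_all add: allowed_def)
  have "z \<in> cimage c" using rc_subset[of W "cimage c"] assms by (auto simp: allowed_def)
  then show x: "cinv c z \<in> cdom c" by (rule cinv_in_cdom[OF M_inj[OF c(1)]])
  then show "cinv c z \<in> MS" "\<gamma> (cinv c z) \<in> cdom d" using M_dom_subset[OF c(1)] c(2) by auto
qed

lemma \<gamma>_rep_mem: "allowed c d W \<Longrightarrow> rep c d \<gamma> W i \<in> topspace (\<F> W)"
  by (rule mapping_set_regular[OF target_N \<gamma>]) (auto simp: allowed_def intro: transition)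

text \<open>The component is coordinate number \<open>n + i\<close> of the representative in the
  tangent chart of \<open>d\<close>, so \<open>mapping_set_regular\<close> for the tangent bundle
  applies.\<close>

lemma comp_mem:
  assumes "\<sigma> \<in> Sec" "allowed c d W" "i < n"
  shows "comp c d W i \<sigma> \<in> topspace (\<F> W)"
proof -
  have a: "c \<in> matlas M" "d \<in> matlas N" "W \<in> \<U>" "rc W (cimage c)" "\<gamma> ` cdom c \<subseteq> cdom d"
    using assms(2) by (simp_all add: allowed_def)
  have sub: "\<sigma> ` cdom c \<subseteq> cdom (tc d)"
    using Sec_in_tc[OF assms(1) _ a(2)] M_dom_subset[OF a(1)] a(5) by blast
  have "rep c (tc d) \<sigma> W (n + i) \<in> topspace (\<F> W)"
    by (rule mapping_set_regular[OF target_TN Sec_mem(1)[OF assms(1)] a(1) tc_in_atlas[OF a(2)] TN_transition[OF a(2)] sub a(3,4)])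
  moreover have "rep c (tc d) \<sigma> W (n + i) = comp c d W i \<sigma>"
    unfolding rep_def comp_def
  proof (rule restrict_ext)
    fix z assume z: "z \<in> W"
    note x = allowed_point[OF assms(2) z]
    have w: "\<sigma> (cinv c z) \<in> cdom (tc d)" by (rule Sec_in_tc[OF assms(1) x(1) a(2) x(2)])
    have "cmap d (fst (\<sigma> (cinv c z))) \<in> Rn n"
      using Sec_mem(3)[OF assms(1) x(1)] x(2) by (simp add: cmap_in_Rn[OF a(2)])
    then show "Poly_Mapping.lookup (cmap (tc d) (\<sigma> (cinv c z))) (n + i) = Poly_Mapping.lookup (snd (\<sigma> (cinv c z)) d) i"
      unfolding tc_simps(4)[OF w] using assms(3) by (simp add: lookup_vconcat)
  qed
  ultimately show ?thesis by simp
qed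

lemma Sec_comp_PiE:
  assumes "\<sigma> \<in> Sec" "allowed c d W"
  shows "(\<lambda>z\<in>W. snd (\<sigma> (cinv c z)) d) \<in> W \<rightarrow>\<^sub>E Rn n"
  unfolding restrict_PiE_iff
proof
  fix z assume z: "z \<in> W"
  note x = allowed_point[OF assms(2) z]
  have d: "d \<in> matlas N" using assms(2) by (simp add: allowed_def)
  show "snd (\<sigma> (cinv c z)) d \<in> Rn n"
    by (rule tangent_comp_in_Rn[OF Sec_mem(5)[OF assms(1) x(1)]]) (simp add: charts_at_def d x(2))
qed

lemma topspace_ST: "topspace ST = Sec"
  unfolding section_topology_def topology_generated_by_topspace by auto

lemma into_vfun_iff:
  assumes "allowed c d W" "\<And>x. x \<in> topspace X \<Longrightarrow> \<Phi> x \<in> Sec"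
  shows "continuous_map X (vfun_space \<F> W (std_basis n)) (\<lambda>x. \<lambda>z\<in>W. snd (\<Phi> x (cinv c z)) d) \<longleftrightarrow>
    (\<forall>i<n. continuous_map X (\<F> W) (\<lambda>x. comp c d W i (\<Phi> x)))"
proof -
  have "(\<lambda>z\<in>W. Poly_Mapping.lookup ((\<lambda>z\<in>W. snd (\<Phi> x (cinv c z)) d) z) i) = comp c d W i (\<Phi> x)" for x i
    unfolding comp_def by (rule restrict_ext) simp
  then show ?thesis
    unfolding continuous_map_into_vfun_space using Sec_comp_PiE[OF assms(2) assms(1)]
    by (simp only: ball_simps simp_thms) blast
qed

lemma comp_continuous:
  assumes a: "allowed c d W" and i: "i < n"
  shows "continuous_map ST (\<F> W) (comp c d W i)"
proof -
  have "continuous_map ST (vfun_space \<F> W (std_basis n)) (\<lambda>\<sigma>. \<lambda>z\<in>W. snd (\<sigma> (cinv c z)) d)"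
    unfolding continuous_map_def topspace_ST
  proof (intro conjI allI impI)
    show "(\<lambda>\<sigma>. \<lambda>z\<in>W. snd (\<sigma> (cinv c z)) d) \<in> Sec \<rightarrow> topspace (vfun_space \<F> W (std_basis n))"
    proof
      fix \<sigma> assume \<sigma>: "\<sigma> \<in> Sec"
      have "(\<lambda>z\<in>W. Poly_Mapping.lookup ((\<lambda>z\<in>W. snd (\<sigma> (cinv c z)) d) z) i) = comp c d W i \<sigma>" for i
        unfolding comp_def by (rule restrict_ext) simp
      then show "(\<lambda>z\<in>W. snd (\<sigma> (cinv c z)) d) \<in> topspace (vfun_space \<F> W (std_basis n))"
        unfolding topspace_vfun_space using Sec_comp_PiE[OF \<sigma> a] comp_mem[OF \<sigma> a] by simp
    qed
    fix Q assume "openin (vfun_space \<F> W (std_basis n)) Q"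
    then show "openin ST {\<sigma> \<in> Sec. (\<lambda>z\<in>W. snd (\<sigma> (cinv c z)) d) \<in> Q}"
      unfolding section_topology_def using a unfolding allowed_def
      by (intro topology_generated_by_Basis insertI2) blast
  qed
  then show ?thesis
    using into_vfun_iff[OF a, of ST "\<lambda>\<sigma>. \<sigma>"] topspace_ST i by simp
qed

lemma section_generators:
  assumes "U \<in> insert Sec {{\<sigma> \<in> Sec. (\<lambda>z\<in>W. snd (\<sigma> (cinv c z)) d) \<in> Q} | c d W Q.
             c \<in> matlas M \<and> d \<in> matlas N \<and> W \<in> \<U> \<and> relatively_compact_in m W (cimage c) \<and>
             \<gamma> ` cdom c \<subseteq> cdom d \<and> openin (vfun_space \<F> W (std_basis n)) Q}"
  shows "U = Sec \<or> (\<exists>c d W Q. allowed c d W \<and> openin (vfun_space \<F> W (std_basis n)) Q \<and>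
    U = {\<sigma> \<in> Sec. (\<lambda>z\<in>W. snd (\<sigma> (cinv c z)) d) \<in> Q})"
  using assms unfolding allowed_def by blast

text \<open>The universal property of the initial topology, reduced to real components.\<close>

lemma continuous_map_into_ST:
  assumes "\<And>x. x \<in> topspace X \<Longrightarrow> \<Phi> x \<in> Sec"
    "\<And>c d W i. allowed c d W \<Longrightarrow> i < n \<Longrightarrow> continuous_map X (\<F> W) (\<lambda>x. comp c d W i (\<Phi> x))"
  shows "continuous_map X ST \<Phi>"
  unfolding section_topology_def
proof (rule continuous_on_generated_topo)
  fix U assume "U \<in> insert Sec {{\<sigma> \<in> Sec. (\<lambda>z\<in>W. snd (\<sigma> (cinv c z)) d) \<in> Q} | c d W Q.
             c \<in> matlas M \<and> d \<in> matlas N \<and> W \<in> \<U> \<and> relatively_compact_in m W (cimage c) \<and>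
             \<gamma> ` cdom c \<subseteq> cdom d \<and> openin (vfun_space \<F> W (std_basis n)) Q}"
  from section_generators[OF this] show "openin X (\<Phi> -` U \<inter> topspace X)"
  proof (elim disjE exE conjE)
    assume "U = Sec"
    then have "\<Phi> -` U \<inter> topspace X = topspace X" using assms(1) by auto
    then show ?thesis by simp
  next
    fix c d W Q assume a: "allowed c d W" and Q: "openin (vfun_space \<F> W (std_basis n)) Q"
      and U: "U = {\<sigma> \<in> Sec. (\<lambda>z\<in>W. snd (\<sigma> (cinv c z)) d) \<in> Q}"
    have "continuous_map X (vfun_space \<F> W (std_basis n)) (\<lambda>x. \<lambda>z\<in>W. snd (\<Phi> x (cinv c z)) d)"
      using into_vfun_iff[OF a, of X \<Phi>] assms(1) assms(2)[OF a] by simp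
    then have "openin X {x \<in> topspace X. (\<lambda>z\<in>W. snd (\<Phi> x (cinv c z)) d) \<in> Q}"
      using Q by (rule openin_continuous_map_preimage)
    moreover have "{x \<in> topspace X. (\<lambda>z\<in>W. snd (\<Phi> x (cinv c z)) d) \<in> Q} = \<Phi> -` U \<inter> topspace X"
      using assms(1) U by auto
    ultimately show ?thesis by simp
  qed
qed (use assms(1) in auto)

text \<open>Meant for difference quotients with the claimed derivative filled in at 0: convergence
  then amounts to local continuity of the components at 0.\<close>

lemma limitin_ST:
  fixes \<Phi> :: "real \<Rightarrow> 'a \<Rightarrow> 'y tvec"
  assumes N: "open J" "0 \<in> J" "\<And>t. t \<in> J \<Longrightarrow> \<Phi> t \<in> Sec"
    "\<And>c d W i. allowed c d W \<Longrightarrow> i < n \<Longrightarrow> lcont euclideanreal (\<F> W) (\<lambda>t. comp c d W i (\<Phi> t)) 0"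
  shows "limitin ST \<Phi> (\<Phi> 0) (at 0)"
  unfolding section_topology_def
proof (rule limitin_topology_generated_by)
  have evN: "eventually (\<lambda>t. t \<in> J) (at 0)"
    using N(1,2) by (rule eventually_at_in_open')
  fix U assume "U \<in> insert Sec {{\<sigma> \<in> Sec. (\<lambda>z\<in>W. snd (\<sigma> (cinv c z)) d) \<in> Q} | c d W Q.
             c \<in> matlas M \<and> d \<in> matlas N \<and> W \<in> \<U> \<and> relatively_compact_in m W (cimage c) \<and>
             \<gamma> ` cdom c \<subseteq> cdom d \<and> openin (vfun_space \<F> W (std_basis n)) Q}" and l: "\<Phi> 0 \<in> U"
  from section_generators[OF this(1)] show "eventually (\<lambda>t. \<Phi> t \<in> U) (at 0)"
  proof (elim disjE exE conjE)
    assume "U = Sec"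
    with N(3) show ?thesis by (intro eventually_mono[OF evN]) simp
  next
    fix c d W Q assume a: "allowed c d W" and Q: "openin (vfun_space \<F> W (std_basis n)) Q"
      and U: "U = {\<sigma> \<in> Sec. (\<lambda>z\<in>W. snd (\<sigma> (cinv c z)) d) \<in> Q}"
    obtain N' where N': "openin euclideanreal N'" "0 \<in> N'"
      "\<forall>i\<in>{..<n}. continuous_map (subtopology euclideanreal N') (\<F> W) (\<lambda>t. comp c d W i (\<Phi> t))"
      using lcont_common[of "{..<n}" 0 euclideanreal "\<lambda>_. \<F> W" "\<lambda>i t. comp c d W i (\<Phi> t)"] N(4)[OF a] by auto
    let ?N = "J \<inter> N'"
    have "continuous_map (subtopology euclideanreal ?N) (\<F> W) (\<lambda>t. comp c d W i (\<Phi> t))" if "i < n" for i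
      using bspec[OF N'(3), of i] that by (auto dest: continuous_map_from_subtopology_mono[OF _ Int_lower2])
    then have "continuous_map (subtopology euclideanreal ?N) (vfun_space \<F> W (std_basis n))
        (\<lambda>t. \<lambda>z\<in>W. snd (\<Phi> t (cinv c z)) d)"
      using into_vfun_iff[OF a, of "subtopology euclideanreal ?N" \<Phi>] N(3) by simp
    then have "lcont euclideanreal (vfun_space \<F> W (std_basis n)) (\<lambda>t. \<lambda>z\<in>W. snd (\<Phi> t (cinv c z)) d) 0"
      using N(1,2) N'(1,2) by (intro lcont_subset[of _ ?N]) auto
    from lcont_open[OF this Q] obtain N3 where N3: "open N3" "0 \<in> N3"
      "\<And>t. t \<in> N3 \<Longrightarrow> (\<lambda>z\<in>W. snd (\<Phi> t (cinv c z)) d) \<in> Q"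
      using l U by auto
    have "eventually (\<lambda>t. t \<in> N3) (at 0)" using N3(1,2) by (rule eventually_at_in_open')
    then show ?thesis using evN
    proof eventually_elim
      case (elim t)
      then show ?case using N(3) N3(3) by (simp add: U)
    qed
  qed
qed (use N(2,3) in auto)

lemma local_data:
  assumes p: "p \<in> MS" and d: "d \<in> matlas N" "\<gamma> p \<in> cdom d" and S: "openin (mtop M) S" "p \<in> S"
  obtains c W where "c \<in> matlas M" "p \<in> cdom c" "cdom c \<subseteq> S" "allowed c d W" "cmap c p \<in> W"
proof -
  obtain c0 where c0: "c0 \<in> matlas M" "p \<in> cdom c0" using p M_cover by blast
  let ?S = "S \<inter> {x \<in> MS. \<gamma> x \<in> cdom d}"
  have oS: "openin (mtop M) ?S"
    by (intro openin_Int S openin_continuous_map_preimage[OF \<gamma>_continuous dom_open[OF d(1)]])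
  let ?c = "restrict_chart c0 ?S"
  have c: "?c \<in> matlas M" by (rule M_restrict[OF c0(1) oS])
  have pc: "p \<in> cdom ?c" using c0 p d(2) S(2) by simp
  obtain W where W: "W \<in> \<U>" "cmap ?c p \<in> W" "rc W (cimage ?c)"
    by (rule \<U>_shrink[OF M_image_open[OF c] cmap_in_cimage[OF pc]])
  have "\<gamma> ` cdom ?c \<subseteq> cdom d" by auto
  then have "allowed ?c d W" using c d(1) W by (simp add: allowed_def)
  then show ?thesis using that[OF c pc _ _ W(2)] by auto
qed

text \<open>\<sigma> + r \<tau>, an operation from which difference quotients can be built:
  differences are the case r = -1, and scaling is expressed by it in \<open>E_scale\<close>.\<close>

definition combo :: "real \<Rightarrow> ('a \<Rightarrow> 'y tvec) \<Rightarrow> ('a \<Rightarrow> 'y tvec) \<Rightarrow> ('a \<Rightarrow> 'y tvec)" where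
  "combo r \<sigma> \<tau> = (\<lambda>x\<in>MS. (\<gamma> x, \<lambda>c\<in>charts_at N (\<gamma> x). snd (\<sigma> x) c + r *\<^sub>R snd (\<tau> x) c))"

lemma combo_simps:
  "x \<in> MS \<Longrightarrow> fst (combo r \<sigma> \<tau> x) = \<gamma> x"
  "x \<in> MS \<Longrightarrow> c \<in> charts_at N (\<gamma> x) \<Longrightarrow> snd (combo r \<sigma> \<tau> x) c = snd (\<sigma> x) c + r *\<^sub>R snd (\<tau> x) c"
  by (simp_all add: combo_def)

lemma combo_Sec:
  assumes \<sigma>: "\<sigma> \<in> Sec" and \<tau>: "\<tau> \<in> Sec"
  shows "combo r \<sigma> \<tau> \<in> Sec"
proof (rule SecI)
  have ts: "snd (combo r \<sigma> \<tau> x) \<in> tangent_space n N (\<gamma> x)" if "x \<in> MS" for x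
    using tangent_space_combination[OF Sec_mem(5)[OF \<sigma> that] Sec_mem(5)[OF \<tau> that]] that by (simp add: combo_def)
  show "fst (combo r \<sigma> \<tau> x) = \<gamma> x" if "x \<in> MS" for x by (rule combo_simps(1)[OF that])
  show "combo r \<sigma> \<tau> \<in> mapping_set \<U> \<F> M (2 * n) (tangent_bundle n N)"
  proof (rule mapping_set_superpose[OF target_TN])
    show "combo r \<sigma> \<tau> \<in> MS \<rightarrow>\<^sub>E mspace_of (tangent_bundle n N)"
    proof (rule PiE_I)
      fix x assume x: "x \<in> MS"
      then show "combo r \<sigma> \<tau> x \<in> mspace_of (tangent_bundle n N)"
        using ts[OF x] \<gamma>_space[OF x] combo_simps(1)[OF x, of r \<sigma> \<tau>]
        unfolding TT_topspace tangent_set_def by (simp add: mem_Times_iff Sigma_def) (metis prod.collapse)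
    qed (simp add: combo_def)
    fix p assume p: "p \<in> MS"
    obtain d where d: "d \<in> matlas N" "\<gamma> p \<in> cdom d" by (rule chart_at[OF \<gamma>_space[OF p]])
    obtain c W where c: "c \<in> matlas M" "p \<in> cdom c" and a: "allowed c d W" and W: "cmap c p \<in> W"
      by (rule local_data[OF p d openin_topspace p]) blast
    \<comment> \<open>Three blocks: the coordinates of \<gamma>, the components of \<sigma>, and the
      components of \<tau>.\<close>
    define I where "I = ({..<3} :: nat set) \<times> {..<n}"
    define u where "u = (\<lambda>(b :: nat, i). if b = 0 then rep c d \<gamma> W i else if b = 1 then comp c d W i \<sigma> else comp c d W i \<tau> :: vec \<Rightarrow> real)"
    define g where "g z = tpoint d (cinv d (tup {..<n} (\<lambda>i. Poly_Mapping.lookup z (0, i))))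
      (tup {..<n} (\<lambda>i. Poly_Mapping.lookup z (1, i) + r * Poly_Mapping.lookup z (2, i)))" for z :: "(nat \<times> nat) \<Rightarrow>\<^sub>0 real"
    have I: "finite I" by (simp add: I_def)
    have um: "u i \<in> topspace (\<F> W)" if "i \<in> I" for i
      using that \<gamma>_rep_mem[OF a] comp_mem[OF \<sigma> a] comp_mem[OF \<tau> a] by (auto simp: u_def I_def)
    have Wc: "W \<in> \<U>" "W \<subseteq> cimage c" using a rc_subset[of W "cimage c"] by (auto simp: allowed_def)
    let ?Z = "\<lambda>z. tup I (\<lambda>i. u i z)"
    have x: "cinv c z \<in> MS" "\<gamma> (cinv c z) \<in> cdom d" if "z \<in> W" for z
      using allowed_point[OF a that] by simp_all
    have Z0: "tup {..<n} (\<lambda>i. Poly_Mapping.lookup (?Z z) (0, i)) = cmap d (\<gamma> (cinv c z))" if "z \<in> W" for z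
    proof -
      have "tup {..<n} (\<lambda>i. Poly_Mapping.lookup (?Z z) (0, i)) = tup {..<n} (\<lambda>i. rep c d \<gamma> W i z)"
        using I by (intro tup_cong) (simp add: lookup_tup u_def I_def)
      also have "\<dots> = cmap d (\<gamma> (cinv c z))"
        using a that Wc(2) by (intro tup_rep[OF target_N]) (auto simp: allowed_def)
      finally show ?thesis .
    qed
    have Z12: "tup {..<n} (\<lambda>i. Poly_Mapping.lookup (?Z z) (1, i) + r * Poly_Mapping.lookup (?Z z) (2, i))
        = snd (combo r \<sigma> \<tau> (cinv c z)) d" if "z \<in> W" for z
    proof -
      have dc: "d \<in> charts_at N (\<gamma> (cinv c z))" using d(1) x(2)[OF that] by (simp add: charts_at_def)
      have "snd (combo r \<sigma> \<tau> (cinv c z)) d \<in> Rn n"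
        by (rule tangent_comp_in_Rn[OF ts[OF x(1)[OF that]] dc])
      then have "snd (combo r \<sigma> \<tau> (cinv c z)) d = proj {..<n} (snd (combo r \<sigma> \<tau> (cinv c z)) d)"
        by (simp add: Rn_iff_proj)
      also have "\<dots> = tup {..<n} (\<lambda>i. Poly_Mapping.lookup (?Z z) (1, i) + r * Poly_Mapping.lookup (?Z z) (2, i))"
        using I that by (intro tup_cong)
          (simp add: combo_simps(2)[OF x(1)[OF that] dc] lookup_tup u_def I_def comp_def lookup_add)
      finally show ?thesis by simp
    qed
    have eq: "combo r \<sigma> \<tau> (cinv c z) = g (?Z z)" if z: "z \<in> W" for z
    proof -
      have dc: "d \<in> charts_at N (\<gamma> (cinv c z))" using d(1) x(2)[OF z] by (simp add: charts_at_def)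
      have "snd (combo r \<sigma> \<tau> (cinv c z)) = tvec_of d (\<gamma> (cinv c z)) (snd (combo r \<sigma> \<tau> (cinv c z)) d)"
        by (rule tangent_eq_tvec_of[OF ts[OF x(1)[OF z]] dc])
      moreover have "cinv d (cmap d (\<gamma> (cinv c z))) = \<gamma> (cinv c z)" by (rule cinv_cmap[OF inj[OF d(1)] x(2)[OF z]])
      ultimately show ?thesis
        unfolding g_def Z0[OF z] Z12[OF z]
        by (intro prod_eqI) (simp_all add: combo_simps(1)[OF x(1)[OF z]])
    qed
    have "chart_smooth (tc d) g (?Z (cmap c p))"
      unfolding g_def
    proof (rule chart_smooth_tpoint[OF d(1) chart_smooth_cinv[OF chart_on[OF d(1)]]])
      show "tup {..<n} (\<lambda>i. Poly_Mapping.lookup (?Z (cmap c p)) (0, i)) \<in> cimage d"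
        unfolding Z0[OF W] using x(2)[OF W] by (rule cmap_in_cimage)
    qed (intro smooth_at_add smooth_at_mult smooth_at_const smooth_at_lookup)+
    then show "\<exists>c d W I u g. c \<in> matlas M \<and> d \<in> matlas (tangent_bundle n N) \<and> p \<in> cdom c \<and> W \<in> \<U> \<and>
      cmap c p \<in> W \<and> W \<subseteq> cimage c \<and> finite (I :: (nat \<times> nat) set) \<and> (\<forall>i\<in>I. u i \<in> topspace (\<F> W)) \<and>
      chart_smooth d g (tup I (\<lambda>i. u i (cmap c p))) \<and> (\<forall>z\<in>W. combo r \<sigma> \<tau> (cinv c z) = g (tup I (\<lambda>i. u i z)))"
      using c tc_in_atlas[OF d(1)] Wc W I um eq
      by (intro exI[of _ c] exI[of _ "tc d"] exI[of _ W] exI[of _ I] exI[of _ u] exI[of _ g] conjI ballI)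
  qed
qed

lemma E_simps:
  "lcs_top E = ST"
  "lcs_add E = (\<lambda>\<sigma> \<tau>. \<lambda>x\<in>MS. (\<gamma> x, \<lambda>c\<in>charts_at N (\<gamma> x). snd (\<sigma> x) c + snd (\<tau> x) c))"
  "lcs_scale E = (\<lambda>r \<sigma>. \<lambda>x\<in>MS. (\<gamma> x, \<lambda>c\<in>charts_at N (\<gamma> x). r *\<^sub>R snd (\<sigma> x) c))"
  by (simp_all add: section_lcs_def)

lemma E_line: "lcs_add E \<sigma> (lcs_scale E r \<tau>) = combo r \<sigma> \<tau>"
  unfolding E_simps combo_def by (rule restrict_ext) (auto intro!: restrict_ext)

text \<open>r \<sigma> = \<sigma> + (r - 1) \<sigma>, so scalar multiples inherit what is shown for
  \<open>combo\<close>.\<close>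

lemma E_scale: "lcs_scale E r \<sigma> = combo (r - 1) \<sigma> \<sigma>"
  unfolding E_simps combo_def by (rule restrict_ext) (auto intro!: restrict_ext simp: algebra_simps)

lemma comp_combo:
  assumes "allowed c d W"
  shows "comp c d W i (combo r \<sigma> \<tau>) = (\<lambda>z\<in>W. comp c d W i \<sigma> z + r * comp c d W i \<tau> z)"
  unfolding comp_def
proof (rule restrict_ext)
  fix z assume z: "z \<in> W"
  note x = allowed_point[OF assms z]
  have "d \<in> charts_at N (\<gamma> (cinv c z))" using assms x(2) by (simp add: allowed_def charts_at_def)
  then show "Poly_Mapping.lookup (snd (combo r \<sigma> \<tau> (cinv c z)) d) i =
      (\<lambda>z\<in>W. Poly_Mapping.lookup (snd (\<sigma> (cinv c z)) d) i) z + r * (\<lambda>z\<in>W. Poly_Mapping.lookup (snd (\<tau> (cinv c z)) d) i) z"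
    using z by (simp add: combo_simps(2)[OF x(1)] lookup_add)
qed

lemma line_continuous:
  assumes "\<sigma> \<in> Sec" "\<tau> \<in> Sec"
  shows "continuous_map euclideanreal ST (\<lambda>t. combo t \<sigma> \<tau>)"
proof (rule continuous_map_into_ST)
  fix c d W i assume a: "allowed c d W" and i: "i < n"
  have W: "W \<in> \<U>" using a by (simp add: allowed_def)
  have "continuous_map euclideanreal (\<F> W) (\<lambda>t. \<lambda>z\<in>W. comp c d W i \<sigma> z + (\<lambda>z\<in>W. t * comp c d W i \<tau> z) z)"
    using comp_mem[OF assms(1) a i] comp_mem[OF assms(2) a i]
    by (intro \<F>_add[OF W] \<F>_scale[OF W] continuous_map_id[unfolded id_def]) (simp_all only: continuous_map_const simp_thms)
  moreover have "(\<lambda>z\<in>W. comp c d W i \<sigma> z + (\<lambda>z\<in>W. t * comp c d W i \<tau> z) z) = comp c d W i (combo t \<sigma> \<tau>)" for t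
    unfolding comp_combo[OF a] by (rule restrict_ext) simp
  ultimately show "continuous_map euclideanreal (\<F> W) (\<lambda>t. comp c d W i (combo t \<sigma> \<tau>))"
    by (simp only:)
qed (rule combo_Sec[OF assms])

end

section \<open>Composition in charts\<close>

locale mapping_pair = mapping_domain m \<U> \<F> M + SA: section_space m \<U> \<F> M n\<^sub>1 N\<^sub>1 \<gamma> +
  SB: section_space m \<U> \<F> M n\<^sub>2 N\<^sub>2 \<eta> + A: local_add n\<^sub>1 N\<^sub>1 \<Omega>\<^sub>1 \<Sigma>\<^sub>1 + B: local_add n\<^sub>2 N\<^sub>2 \<Omega>\<^sub>2 \<Sigma>\<^sub>2
  for m \<U> \<F> and M :: "('a, vec) manifold" and n\<^sub>1 and N\<^sub>1 :: "('b, vec) manifold" and \<gamma>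
    and n\<^sub>2 and N\<^sub>2 :: "('c, vec) manifold" and \<eta> and \<Omega>\<^sub>1 \<Sigma>\<^sub>1 \<Omega>\<^sub>2 \<Sigma>\<^sub>2 +
  fixes f :: "'b \<Rightarrow> 'c"
  assumes f: "smooth_map N\<^sub>1 N\<^sub>2 f"
begin

section \<open>The local representative over one point, its coordinates and its fibre
  derivatives\<close>

definition admissible :: "'c \<Rightarrow> 'b tvec \<Rightarrow> bool" where
  "admissible q w \<longleftrightarrow> w \<in> \<Omega>\<^sub>1 \<and> (q, f (\<Sigma>\<^sub>1 w)) \<in> B.\<Omega>'"

text \<open>The local representative over a point x, with \<open>q\<close> = \<eta> x and
  \<open>w\<close> = \<sigma> x: the tangent vector at \<open>q\<close> that
  \<open>\<Sigma>\<^sub>2\<close> sends to \<open>f (\<Sigma>\<^sub>1 w)\<close>.\<close>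

definition H :: "'c \<Rightarrow> 'b tvec \<Rightarrow> 'c tvec" where
  "H q w = B.\<theta>inv (q, f (\<Sigma>\<^sub>1 w))"

lemma H_props:
  assumes "admissible q w"
  shows "H q w \<in> \<Omega>\<^sub>2" "fst (H q w) = q" "\<Sigma>\<^sub>2 (H q w) = f (\<Sigma>\<^sub>1 w)" "snd (H q w) \<in> tangent_space n\<^sub>2 N\<^sub>2 q"
proof -
  have a: "(q, f (\<Sigma>\<^sub>1 w)) \<in> B.\<Omega>'" using assms by (simp add: admissible_def)
  show H: "H q w \<in> \<Omega>\<^sub>2" unfolding H_def by (rule B.\<theta>inv_in[OF a])
  show fst: "fst (H q w) = q" unfolding H_def by (rule B.fst_\<theta>inv[OF a])
  show "\<Sigma>\<^sub>2 (H q w) = f (\<Sigma>\<^sub>1 w)" unfolding H_def by (rule B.\<Sigma>_\<theta>inv[OF a])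
  have "H q w \<in> tangent_set n\<^sub>2 N\<^sub>2" using H B.\<Omega>_subset by blast
  then show "snd (H q w) \<in> tangent_space n\<^sub>2 N\<^sub>2 q" using fst by (auto simp: tangent_set_def)
qed

text \<open>A point of coordinate space is indexed by pairs: block 0 holds coordinates of a point of \<open>N\<^sub>1\<close>,
  block 1 those of a point of \<open>N\<^sub>2\<close>, block 2 a tangent vector at the former, and block \<open>3 + l\<close> the
  \<open>l\<close>-th direction of differentiation.\<close>

definition blk :: "nat \<Rightarrow> nat \<Rightarrow> ((nat \<times> nat) \<Rightarrow>\<^sub>0 real) \<Rightarrow> vec" where
  "blk k b z = tup {..<k} (\<lambda>i. Poly_Mapping.lookup z (b, i))"

definition pt1 :: "('b, vec) chart \<Rightarrow> ((nat \<times> nat) \<Rightarrow>\<^sub>0 real) \<Rightarrow> 'b" where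
  "pt1 c z = cinv c (blk n\<^sub>1 0 z)"

definition pt2 :: "('c, vec) chart \<Rightarrow> ((nat \<times> nat) \<Rightarrow>\<^sub>0 real) \<Rightarrow> 'c" where
  "pt2 e z = cinv e (blk n\<^sub>2 1 z)"

definition vec1 :: "('b, vec) chart \<Rightarrow> ((nat \<times> nat) \<Rightarrow>\<^sub>0 real) \<Rightarrow> 'b tvec" where
  "vec1 c z = SA.tpoint c (pt1 c z) (blk n\<^sub>1 2 z)"

definition Q :: "('b, vec) chart \<Rightarrow> ('c, vec) chart \<Rightarrow> ((nat \<times> nat) \<Rightarrow>\<^sub>0 real) set" where
  "Q c e = {z. blk n\<^sub>1 0 z \<in> cimage c \<and> blk n\<^sub>2 1 z \<in> cimage e \<and> admissible (pt2 e z) (vec1 c z)}"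

definition G :: "('b, vec) chart \<Rightarrow> ('c, vec) chart \<Rightarrow> nat \<Rightarrow> ((nat \<times> nat) \<Rightarrow>\<^sub>0 real) \<Rightarrow> real" where
  "G c e i z = Poly_Mapping.lookup (snd (H (pt2 e z) (vec1 c z)) e) i"

lemma chart_smooth_pt2:
  assumes "e \<in> matlas N\<^sub>2" "z \<in> Q c e"
  shows "chart_smooth e (pt2 e) z"
  unfolding pt2_def[abs_def] blk_def
  by (rule chart_smooth_cinv[OF SB.chart_on[OF assms(1)]])
    (use assms(2) in \<open>auto simp: Q_def blk_def intro: smooth_at_lookup\<close>)

text \<open>A chain of charts around \<open>z\<close>: the coordinates give \<open>pt1\<close>,
  \<open>pt2\<close> and \<open>vec1\<close>; then \<open>\<Sigma>\<^sub>1\<close> leads into a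
  chart \<open>d\<close>, \<open>f\<close> into a chart \<open>e'\<close>, and the inverse of
  \<open>B.\<theta>\<close> into the tangent chart of \<open>e\<close>. Each link is
  \<open>chart_smooth\<close> at \<open>z\<close>, so its domain condition persists near
  \<open>z\<close>.\<close>

lemma Q_local:
  assumes c: "c \<in> matlas N\<^sub>1" and e: "e \<in> matlas N\<^sub>2" and z: "z \<in> Q c e"
  shows "\<exists>P. open P \<and> z \<in> P \<and> P \<subseteq> Q c e" "i < n\<^sub>2 \<Longrightarrow> smooth_at (G c e i) z"
proof -
  have zc: "blk n\<^sub>1 0 z \<in> cimage c" "blk n\<^sub>2 1 z \<in> cimage e" and ad: "vec1 c z \<in> \<Omega>\<^sub>1" "(pt2 e z, f (\<Sigma>\<^sub>1 (vec1 c z))) \<in> B.\<Omega>'"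
    using z by (simp_all add: Q_def admissible_def)
  obtain P0 where P0: "open P0" "z \<in> P0" "\<And>w. w \<in> P0 \<Longrightarrow> blk n\<^sub>1 0 w \<in> cimage c"
    using tup_preimage_nbhd[OF smooth_at_lookup chart_on.open_image[OF SA.chart_on[OF c]] zc(1)[unfolded blk_def]]
    unfolding blk_def by metis
  obtain P1 where P1: "open P1" "z \<in> P1" "\<And>w. w \<in> P1 \<Longrightarrow> blk n\<^sub>2 1 w \<in> cimage e"
    using tup_preimage_nbhd[OF smooth_at_lookup chart_on.open_image[OF SB.chart_on[OF e]] zc(2)[unfolded blk_def]]
    unfolding blk_def by metis
  have s0: "chart_smooth c (pt1 c) z"
    unfolding pt1_def[abs_def] blk_def
    by (rule chart_smooth_cinv[OF SA.chart_on[OF c] smooth_at_lookup]) (use zc(1) in \<open>simp add: blk_def\<close>)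
  have s1: "chart_smooth e (pt2 e) z" by (rule chart_smooth_pt2[OF e z])
  have s2: "chart_smooth (SA.tc c) (vec1 c) z"
    unfolding vec1_def[abs_def] blk_def by (rule SA.chart_smooth_tpoint[OF c s0 smooth_at_lookup])
  have "chart_smooth (restrict_chart (SA.tc c) \<Omega>\<^sub>1) (vec1 c) z"
    using chart_smooth_restrict[OF SA.tc_chart_on[OF c] A.open_\<Omega>] s2 ad(1) by blast
  then obtain P2 where P2: "open P2" "z \<in> P2" "vec1 c ` P2 \<subseteq> cdom (restrict_chart (SA.tc c) \<Omega>\<^sub>1)"
    unfolding chart_smooth_def by blast
  have sp: "pt2 e z \<in> mspace_of N\<^sub>2 \<and> f (\<Sigma>\<^sub>1 (vec1 c z)) \<in> mspace_of N\<^sub>2"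
    using openin_subset[OF B.open_\<Omega>'] ad(2) by auto
  have "\<Sigma>\<^sub>1 (vec1 c z) \<in> mspace_of N\<^sub>1" by (rule A.\<Sigma>_space[OF ad(1)])
  then obtain d where d: "d \<in> matlas N\<^sub>1" "\<Sigma>\<^sub>1 (vec1 c z) \<in> cdom d" by (rule SA.chart_at)
  have s3: "chart_smooth d (\<lambda>w. \<Sigma>\<^sub>1 (vec1 c w)) z" by (rule A.chart_smooth_\<Sigma>[OF c d(1) s2 ad(1) d(2)])
  obtain e' where e': "e' \<in> matlas N\<^sub>2" "f (\<Sigma>\<^sub>1 (vec1 c z)) \<in> cdom e'" using SB.chart_at sp by blast
  have s4: "chart_smooth e' (\<lambda>w. f (\<Sigma>\<^sub>1 (vec1 c w))) z"
    by (rule chart_smooth_map[OF SA.chart_on[OF d(1)] d(1) e'(1) _ _ f s3 e'(2)])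
      (rule chart_on.model[OF SB.chart_on[OF e'(1)]], rule SB.dom_open[OF e'(1)])
  have "chart_smooth (restrict_chart (SB.sq e e') B.\<Omega>') (\<lambda>w. (pt2 e w, f (\<Sigma>\<^sub>1 (vec1 c w)))) z"
    unfolding chart_smooth_restrict[OF SB.sq_chart_on[OF e e'(1)] B.open_\<Omega>']
    using SB.chart_smooth_sq[OF e e'(1) s1 s4] ad(2) by blast
  then obtain P3 where P3: "open P3" "z \<in> P3"
    "(\<lambda>w. (pt2 e w, f (\<Sigma>\<^sub>1 (vec1 c w)))) ` P3 \<subseteq> cdom (restrict_chart (SB.sq e e') B.\<Omega>')"
    unfolding chart_smooth_def by blast
  have "P0 \<inter> P1 \<inter> P2 \<inter> P3 \<subseteq> Q c e"
  proof
    fix w assume w: "w \<in> P0 \<inter> P1 \<inter> P2 \<inter> P3"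
    have "vec1 c w \<in> cdom (restrict_chart (SA.tc c) \<Omega>\<^sub>1)" using P2(3) w by blast
    moreover have "(pt2 e w, f (\<Sigma>\<^sub>1 (vec1 c w))) \<in> cdom (restrict_chart (SB.sq e e') B.\<Omega>')" using P3(3) w by blast
    ultimately show "w \<in> Q c e"
      using P0(3) P1(3) w unfolding Q_def admissible_def by simp
  qed
  then show "\<exists>P. open P \<and> z \<in> P \<and> P \<subseteq> Q c e"
    using P0(1,2) P1(1,2) P2(1,2) P3(1,2) by (intro exI[of _ "P0 \<inter> P1 \<inter> P2 \<inter> P3"] conjI open_Int IntI)
  assume i: "i < n\<^sub>2"
  show "smooth_at (G c e i) z"
    unfolding G_def[abs_def] H_def
    by (rule SB.chart_smooth_tc_comp[OF e B.chart_smooth_\<theta>inv[OF e e'(1) s1 s4 ad(2)] i])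
qed

lemma open_Q:
  assumes "c \<in> matlas N\<^sub>1" "e \<in> matlas N\<^sub>2"
  shows "open (Q c e)"
  using Q_local(1)[OF assms] by (subst open_subopen) blast

text \<open>Only the coordinates of block 2, the tangent vector, are differentiated. The direction
  in block \<open>3 + j\<close> enters as a coefficient and is held fixed, which gives the iterated
  derivative along the fibre.\<close>

primrec KD :: "nat \<Rightarrow> ('b, vec) chart \<Rightarrow> ('c, vec) chart \<Rightarrow> nat \<Rightarrow> ((nat \<times> nat) \<Rightarrow>\<^sub>0 real) \<Rightarrow> real" where
  "KD 0 c e i = G c e i"
| "KD (Suc j) c e i = (\<lambda>z. \<Sum>a<n\<^sub>1. Poly_Mapping.lookup z (3 + j, a) * pd (2, a) (KD j c e i) z)"

lemma KD_smooth:
  assumes c: "c \<in> matlas N\<^sub>1" and e: "e \<in> matlas N\<^sub>2" and i: "i < n\<^sub>2"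
  shows "smooth_on (Q c e) (KD j c e i)"
proof (induction j)
  case 0
  have "smooth_on (Q c e) (G c e i)" by (rule smooth_on_local) (rule Q_local(2)[OF c e _ i])
  then show ?case by (simp only: KD.simps)
next
  case (Suc j)
  show ?case
    unfolding KD.simps
    by (intro smooth_on_sum finite_lessThan smooth_on_mult smooth_on_lookup smooth_on_pd[OF Suc open_Q[OF c e]])
qed

text \<open>Derivatives along straight lines in the tangent space at \<open>p\<close>. As
  \<open>deriv\<close> is total, a value is meaningful only where the derivative exists; the
  induction in \<open>dd_KD\<close> provides this.\<close>

primrec dd :: "nat \<Rightarrow> 'b \<Rightarrow> ((('b, vec) chart \<Rightarrow> vec) \<Rightarrow> real) \<Rightarrow> (nat \<Rightarrow> ('b, vec) chart \<Rightarrow> vec) \<Rightarrow>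
    (('b, vec) chart \<Rightarrow> vec) \<Rightarrow> real" where
  "dd 0 p K y v = K v"
| "dd (Suc j) p K y v = deriv (\<lambda>t. dd j p K y (\<lambda>c\<in>charts_at N\<^sub>1 p. v c + t *\<^sub>R y j c)) 0"

lemma dd_cong: "(\<And>l. l < j \<Longrightarrow> y l = y' l) \<Longrightarrow> dd j p K y v = dd j p K y' v"
proof (induction j arbitrary: v)
  case (Suc j)
  have "dd j p K y w = dd j p K y' w" for w by (rule Suc.IH) (simp add: Suc.prems)
  then show ?case using Suc.prems[of j] by simp
qed simp

text \<open>\<open>z\<close> lists the coordinates of the given point, parameter and vectors; blocks
  from \<open>3 + j\<close> on are left free.\<close>

definition matches :: "nat \<Rightarrow> ('b, vec) chart \<Rightarrow> ('c, vec) chart \<Rightarrow> 'b \<Rightarrow> 'c \<Rightarrow> (('b, vec) chart \<Rightarrow> vec) \<Rightarrow>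
    (nat \<Rightarrow> ('b, vec) chart \<Rightarrow> vec) \<Rightarrow> ((nat \<times> nat) \<Rightarrow>\<^sub>0 real) \<Rightarrow> bool" where
  "matches j c e p q v y z \<longleftrightarrow> blk n\<^sub>1 0 z = cmap c p \<and> blk n\<^sub>2 1 z = cmap e q \<and> blk n\<^sub>1 2 z = v c \<and>
     (\<forall>l<j. blk n\<^sub>1 (3 + l) z = y l c)"

lemma matches_points:
  assumes c: "c \<in> matlas N\<^sub>1" "p \<in> cdom c" and e: "e \<in> matlas N\<^sub>2" "q \<in> cdom e"
    and v: "v \<in> tangent_space n\<^sub>1 N\<^sub>1 p" and z: "matches j c e p q v y z"
  shows "pt1 c z = p" "pt2 e z = q" "vec1 c z = (p, v)" "z \<in> Q c e \<longleftrightarrow> admissible q (p, v)"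
proof -
  have b: "blk n\<^sub>1 0 z = cmap c p" "blk n\<^sub>2 1 z = cmap e q" "blk n\<^sub>1 2 z = v c"
    using z by (simp_all add: matches_def)
  show 1: "pt1 c z = p" unfolding pt1_def b by (rule cinv_cmap[OF SA.inj[OF c(1)] c(2)])
  show 2: "pt2 e z = q" unfolding pt2_def b by (rule cinv_cmap[OF SB.inj[OF e(1)] e(2)])
  have "v = SA.tvec_of c p (v c)"
    by (rule SA.tangent_eq_tvec_of[OF v]) (simp add: charts_at_def c)
  then show 3: "vec1 c z = (p, v)" unfolding vec1_def 1 b SA.tpoint_def by simp
  show "z \<in> Q c e \<longleftrightarrow> admissible q (p, v)"
    unfolding Q_def 2 3 mem_Collect_eq b using cmap_in_cimage[OF c(2)] cmap_in_cimage[OF e(2)] by simp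
qed

text \<open>The linear combination with coefficients \<open>L\<close> allows a change of chart in \<open>N\<^sub>2\<close>.\<close>

lemma dd_KD:
  assumes c: "c \<in> matlas N\<^sub>1" "p \<in> cdom c" and e: "e \<in> matlas N\<^sub>2" "q \<in> cdom e"
    and K: "\<And>v. v \<in> tangent_space n\<^sub>1 N\<^sub>1 p \<Longrightarrow> admissible q (p, v) \<Longrightarrow>
      K v = (\<Sum>a<n\<^sub>2. L a * Poly_Mapping.lookup (snd (H q (p, v)) e) a)"
    and y: "\<And>l. l < j \<Longrightarrow> y l \<in> tangent_space n\<^sub>1 N\<^sub>1 p"
    and v: "v \<in> tangent_space n\<^sub>1 N\<^sub>1 p" and z: "z \<in> Q c e" "matches j c e p q v y z"
  shows "dd j p K y v = (\<Sum>a<n\<^sub>2. L a * KD j c e a z)"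
  using y v z
proof (induction j arbitrary: v z)
  case 0
  note mp = matches_points[OF c e 0(2,4)]
  have "admissible q (p, v)" using 0(3) mp(4) by simp
  then show ?case by (simp add: K[OF 0(2)] G_def mp)
next
  case (Suc j)
  have cc: "c \<in> charts_at N\<^sub>1 p" using c by (simp add: charts_at_def)
  have yj: "y j \<in> tangent_space n\<^sub>1 N\<^sub>1 p" and yl: "\<And>l. l < j \<Longrightarrow> y l \<in> tangent_space n\<^sub>1 N\<^sub>1 p"
    using Suc.prems(1) by simp_all
  \<comment> \<open>The direction stored in block \<open>3 + j\<close>, moved into block 2: along
    \<open>z + t *\<^sub>R ?w\<close> only the tangent vector changes, by \<open>t\<close> times
    \<open>y j\<close>.\<close>
  let ?w = "tup ({2} \<times> {..<n\<^sub>1}) (\<lambda>(b, a). Poly_Mapping.lookup z (3 + j, a)) :: (nat \<times> nat) \<Rightarrow>\<^sub>0 real"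
  let ?v = "\<lambda>t. \<lambda>c\<in>charts_at N\<^sub>1 p. v c + t *\<^sub>R y j c"
  define T where "T = (\<lambda>t. z + t *\<^sub>R ?w) -` Q c e"
  have "continuous_on UNIV (\<lambda>t :: real. z + t *\<^sub>R ?w)" by (intro continuous_intros)
  then have T: "open T" "0 \<in> T"
    unfolding T_def using open_vimage[OF open_Q[OF c(1) e(1)]] Suc.prems(3) by auto
  have vt: "?v t \<in> tangent_space n\<^sub>1 N\<^sub>1 p" for t
    by (rule SA.tangent_space_combination[OF Suc.prems(2) yj])
  have lw: "Poly_Mapping.lookup ?w (b, i) = (if b = 2 \<and> i < n\<^sub>1 then Poly_Mapping.lookup z (3 + j, i) else 0)" for b i
    by (simp add: lookup_tup)
  have bw: "blk k b (z + t *\<^sub>R ?w) = blk k b z" if "b \<noteq> 2" for k b t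
    unfolding blk_def using that by (intro tup_cong) (simp add: lookup_add lw)
  have mt: "matches j c e p q (?v t) y (z + t *\<^sub>R ?w)" for t
  proof -
    have "blk n\<^sub>1 2 (z + t *\<^sub>R ?w) = blk n\<^sub>1 2 z + t *\<^sub>R blk n\<^sub>1 (3 + j) z"
    proof -
      have "blk n\<^sub>1 2 (z + t *\<^sub>R ?w) = tup {..<n\<^sub>1} (\<lambda>i. Poly_Mapping.lookup z (2, i) + t * Poly_Mapping.lookup z (3 + j, i))"
        unfolding blk_def by (intro tup_cong) (simp add: lookup_add lw)
      also have "\<dots> = blk n\<^sub>1 2 z + t *\<^sub>R blk n\<^sub>1 (3 + j) z"
        unfolding blk_def by (simp add: tup_add tup_scaleR)
      finally show ?thesis .
    qed
    then show ?thesis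
      using Suc.prems(4) cc unfolding matches_def by (simp add: bw)
  qed
  have eq: "dd j p K y (?v t) = (\<Sum>a<n\<^sub>2. L a * KD j c e a (z + t *\<^sub>R ?w))" if "t \<in> T" for t
    by (rule Suc.IH[OF yl vt _ mt]) (use that in \<open>simp_all add: T_def\<close>)
  have sm: "smooth_at (KD j c e a) z" if "a < n\<^sub>2" for a
    by (rule smooth_on_imp_at[OF KD_smooth[OF c(1) e(1) that] open_Q[OF c(1) e(1)] Suc.prems(3)])
  have K': "(\<Sum>i\<in>{2} \<times> {..<n\<^sub>1}. (case i of (b, a) \<Rightarrow> Poly_Mapping.lookup z (3 + j, a)) * pd i (KD j c e a) z)
      = KD (Suc j) c e a z" for a
  proof -
    have "{2} \<times> {..<n\<^sub>1} = Pair (2 :: nat) ` {..<n\<^sub>1}" by auto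
    then show ?thesis by (simp add: sum.reindex inj_on_def)
  qed
  have "((\<lambda>t. \<Sum>a<n\<^sub>2. L a * KD j c e a (z + t *\<^sub>R ?w)) has_real_derivative (\<Sum>a<n\<^sub>2. L a * KD (Suc j) c e a z)) (at 0)"
    using smooth_at_line[OF sm, of _ "{2} \<times> {..<n\<^sub>1}" "\<lambda>(b, a). Poly_Mapping.lookup z (3 + j, a)", unfolded K']
    by (intro DERIV_sum DERIV_cmult) simp
  then have "((\<lambda>t. dd j p K y (?v t)) has_real_derivative (\<Sum>a<n\<^sub>2. L a * KD (Suc j) c e a z)) (at 0)"
    by (rule has_field_derivative_transform_within_open[OF _ T]) (simp only: eq)
  then show ?case by (simp only: dd.simps DERIV_imp_deriv)
qed

text \<open>Each chart \<open>e\<close> differentiates its own component; that the results fit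
  together to one tangent vector is the content of \<open>dvec_eq\<close>.\<close>

definition dvec :: "nat \<Rightarrow> 'b \<Rightarrow> 'c \<Rightarrow> (('b, vec) chart \<Rightarrow> vec) \<Rightarrow> (nat \<Rightarrow> ('b, vec) chart \<Rightarrow> vec) \<Rightarrow> 'c tvec" where
  "dvec j p q v y = (q, \<lambda>e\<in>charts_at N\<^sub>2 q. tup {..<n\<^sub>2} (\<lambda>i.
     dd j p (\<lambda>v. Poly_Mapping.lookup (snd (H q (p, v)) e) i) y v))"

text \<open>A change of the chart at \<open>q\<close> is linear on the tangent space, with
  coefficients independent of \<open>v\<close>, so it commutes with differentiation in
  \<open>v\<close>. These Jacobian entries are the coefficients \<open>L\<close> of
  \<open>dd_KD\<close>.\<close>

lemma dvec_eq:
  assumes c: "c \<in> matlas N\<^sub>1" "p \<in> cdom c" and e: "e \<in> matlas N\<^sub>2" "q \<in> cdom e"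
    and y: "\<And>l. l < j \<Longrightarrow> y l \<in> tangent_space n\<^sub>1 N\<^sub>1 p"
    and v: "v \<in> tangent_space n\<^sub>1 N\<^sub>1 p" and z: "z \<in> Q c e" "matches j c e p q v y z"
  shows "dvec j p q v y = SB.tpoint e q (tup {..<n\<^sub>2} (\<lambda>a. KD j c e a z))"
proof -
  have ec: "e \<in> charts_at N\<^sub>2 q" using e by (simp add: charts_at_def)
  have "tup {..<n\<^sub>2} (\<lambda>i. dd j p (\<lambda>v. Poly_Mapping.lookup (snd (H q (p, v)) e') i) y v)
      = trans_deriv n\<^sub>2 e e' (cmap e q) (tup {..<n\<^sub>2} (\<lambda>a. KD j c e a z))" if e': "e' \<in> charts_at N\<^sub>2 q" for e'
    unfolding trans_deriv_def
  proof (rule tup_cong)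
    fix i assume "i \<in> {..<n\<^sub>2}"
    have "dd j p (\<lambda>v. Poly_Mapping.lookup (snd (H q (p, v)) e') i) y v
        = (\<Sum>a<n\<^sub>2. pd a (trans_coord n\<^sub>2 e e' i) (cmap e q) * KD j c e a z)"
    proof (rule dd_KD[OF c e _ y v z])
      fix v assume "admissible q (p, v)"
      from conjunct2[OF SB.tangent_space_iff[THEN iffD1, OF H_props(4)[OF this]], rule_format, OF ec e']
      show "Poly_Mapping.lookup (snd (H q (p, v)) e') i =
          (\<Sum>a<n\<^sub>2. pd a (trans_coord n\<^sub>2 e e' i) (cmap e q) * Poly_Mapping.lookup (snd (H q (p, v)) e) a)"
        using \<open>i \<in> {..<n\<^sub>2}\<close> by (simp only: trans_deriv_def lookup_tup finite_lessThan if_True mult.commute)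
    qed
    also have "\<dots> = (\<Sum>a<n\<^sub>2. Poly_Mapping.lookup (tup {..<n\<^sub>2} (\<lambda>a. KD j c e a z)) a * pd a (trans_coord n\<^sub>2 e e' i) (cmap e q))"
      by (intro sum.cong refl) (simp add: lookup_tup)
    finally show "dd j p (\<lambda>v. Poly_Mapping.lookup (snd (H q (p, v)) e') i) y v =
      (\<Sum>a<n\<^sub>2. Poly_Mapping.lookup (tup {..<n\<^sub>2} (\<lambda>a. KD j c e a z)) a * pd a (trans_coord n\<^sub>2 e e' i) (cmap e q))" .
  qed
  then show ?thesis
    unfolding dvec_def SB.tpoint_def SB.tvec_of_def by (simp cong: restrict_cong)
qed

lemma dvec_0:
  assumes "admissible q (p, v)"
  shows "dvec 0 p q v y = H q (p, v)"
proof -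
  have t: "snd (H q (p, v)) \<in> charts_at N\<^sub>2 q \<rightarrow>\<^sub>E Rn n\<^sub>2"
    using H_props(4)[OF assms] SB.tangent_space_iff by blast
  have "(\<lambda>e\<in>charts_at N\<^sub>2 q. proj {..<n\<^sub>2} (snd (H q (p, v)) e)) = snd (H q (p, v))"
  proof
    fix e show "(\<lambda>e\<in>charts_at N\<^sub>2 q. proj {..<n\<^sub>2} (snd (H q (p, v)) e)) e = snd (H q (p, v)) e"
      using PiE_mem[OF t, of e] PiE_arb[OF t, of e] by (cases "e \<in> charts_at N\<^sub>2 q") (simp_all add: Rn_iff_proj)
  qed
  then show ?thesis
    unfolding dvec_def dd.simps using H_props(2)[OF assms] by (metis prod.collapse)
qed

end

section \<open>Composition on spaces of sections\<close>

context mapping_pair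
begin

definition \<D> :: "('a \<Rightarrow> 'b tvec) set" where
  "\<D> = {\<sigma> \<in> SA.Sec. \<forall>x\<in>MS. admissible (\<eta> x) (\<sigma> x)}"

definition dmap :: "nat \<Rightarrow> ('a \<Rightarrow> 'b tvec) \<Rightarrow> (nat \<Rightarrow> 'a \<Rightarrow> 'b tvec) \<Rightarrow> 'a \<Rightarrow> 'c tvec" where
  "dmap j \<sigma> \<tau> = (\<lambda>x\<in>MS. dvec j (\<gamma> x) (\<eta> x) (snd (\<sigma> x)) (\<lambda>l. snd (\<tau> l x)))"

definition IX :: "nat \<Rightarrow> (nat \<times> nat) set" where
  "IX j = (SIGMA b:{..<3 + j}. {..<if b = 1 then n\<^sub>2 else n\<^sub>1})"

definition fam :: "('a, vec) chart \<Rightarrow> ('b, vec) chart \<Rightarrow> ('c, vec) chart \<Rightarrow> vec set \<Rightarrow> ('a \<Rightarrow> 'b tvec) \<Rightarrow>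
    (nat \<Rightarrow> 'a \<Rightarrow> 'b tvec) \<Rightarrow> nat \<times> nat \<Rightarrow> vec \<Rightarrow> real" where
  "fam c c\<^sub>1 e W \<sigma> \<tau> = (\<lambda>(b, i). if b = 0 then rep c c\<^sub>1 \<gamma> W i else if b = 1 then rep c e \<eta> W i
     else if b = 2 then SA.comp c c\<^sub>1 W i \<sigma> else SA.comp c c\<^sub>1 W i (\<tau> (b - 3)))"

abbreviation coords where
  "coords J c c\<^sub>1 e W \<sigma> \<tau> z \<equiv> tup (IX J) (\<lambda>i. fam c c\<^sub>1 e W \<sigma> \<tau> i z)"

lemma finite_IX: "finite (IX j)"
  by (auto simp: IX_def)

lemma \<D>_Sec: "\<sigma> \<in> \<D> \<Longrightarrow> \<sigma> \<in> SA.Sec"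
  by (simp add: \<D>_def)

lemma fam_mem:
  assumes "SA.allowed c c\<^sub>1 W" "SB.allowed c e W" "\<sigma> \<in> SA.Sec" "\<And>l. l < J \<Longrightarrow> \<tau> l \<in> SA.Sec" "i \<in> IX J"
  shows "fam c c\<^sub>1 e W \<sigma> \<tau> i \<in> topspace (\<F> W)"
proof -
  obtain b k where i: "i = (b, k)" "b < 3 + J" "k < (if b = 1 then n\<^sub>2 else n\<^sub>1)" using assms(5) by (auto simp: IX_def)
  consider "b = 0" | "b = 1" | "b = 2" | "b \<ge> 3" by linarith
  then show ?thesis
  proof cases
    assume "b = 0" then show ?thesis using SA.\<gamma>_rep_mem[OF assms(1)] by (simp add: fam_def i)
  next
    assume "b = 1" then show ?thesis using SB.\<gamma>_rep_mem[OF assms(2)] by (simp add: fam_def i)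
  next
    assume "b = 2" then show ?thesis using SA.comp_mem[OF assms(3,1)] i by (simp add: fam_def)
  next
    assume b: "b \<ge> 3"
    then have "\<tau> (b - 3) \<in> SA.Sec" using i(2) by (intro assms(4)) simp
    then show ?thesis using SA.comp_mem[OF _ assms(1)] i b by (simp add: fam_def)
  qed
qed

lemma blk_tup:
  assumes "finite I" "\<And>i. i < k \<Longrightarrow> (b, i) \<in> I"
  shows "blk k b (tup I r) = tup {..<k} (\<lambda>i. r (b, i))"
  unfolding blk_def by (rule tup_cong) (simp add: lookup_tup assms)

lemma tup_comp:
  assumes "SA.allowed c c\<^sub>1 W" "\<sigma> \<in> SA.Sec" "z \<in> W"
  shows "tup {..<n\<^sub>1} (\<lambda>i. SA.comp c c\<^sub>1 W i \<sigma> z) = snd (\<sigma> (cinv c z)) c\<^sub>1"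
proof -
  have "snd (\<sigma> (cinv c z)) c\<^sub>1 \<in> Rn n\<^sub>1" using PiE_mem[OF SA.Sec_comp_PiE[OF assms(2,1)] assms(3)] assms(3) by simp
  then show ?thesis using assms(3) by (simp add: SA.comp_def Rn_iff_proj)
qed

text \<open>\<open>J\<close> may exceed \<open>j\<close>: for the derivative of order
  \<open>Suc j\<close>, \<open>KD j\<close> and \<open>KD (Suc j)\<close> are evaluated on the same
  coordinates, which hold one direction more than \<open>KD j\<close> reads.\<close>

lemma coords_matches:
  assumes a: "SA.allowed c c\<^sub>1 W" "SB.allowed c e W" and \<sigma>: "\<sigma> \<in> SA.Sec"
    and \<tau>: "\<And>l. l < J \<Longrightarrow> \<tau> l \<in> SA.Sec" and j: "j \<le> J" and z: "z \<in> W"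
  shows "matches j c\<^sub>1 e (\<gamma> (cinv c z)) (\<eta> (cinv c z)) (snd (\<sigma> (cinv c z))) (\<lambda>l. snd (\<tau> l (cinv c z)))
    (coords J c c\<^sub>1 e W \<sigma> \<tau> z)"
  unfolding matches_def
proof (intro conjI allI impI)
  have W: "W \<subseteq> cimage c" using a(1) rc_subset by (auto simp: SA.allowed_def)
  have cs: "c \<in> matlas M" "c\<^sub>1 \<in> matlas N\<^sub>1" "e \<in> matlas N\<^sub>2" "\<gamma> ` cdom c \<subseteq> cdom c\<^sub>1" "\<eta> ` cdom c \<subseteq> cdom e"
    using a by (simp_all add: SA.allowed_def SB.allowed_def)
  have b: "blk (if b = 1 then n\<^sub>2 else n\<^sub>1) b (coords J c c\<^sub>1 e W \<sigma> \<tau> z)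
      = tup {..<if b = 1 then n\<^sub>2 else n\<^sub>1} (\<lambda>i. fam c c\<^sub>1 e W \<sigma> \<tau> (b, i) z)" if "b < 3 + J" for b
    by (rule blk_tup[OF finite_IX]) (use that in \<open>simp add: IX_def\<close>)
  show "blk n\<^sub>1 0 (coords J c c\<^sub>1 e W \<sigma> \<tau> z) = cmap c\<^sub>1 (\<gamma> (cinv c z))"
    using b[of 0] tup_rep[OF SA.target_N cs(2,1,4) z W] by (simp add: fam_def)
  show "blk n\<^sub>2 1 (coords J c c\<^sub>1 e W \<sigma> \<tau> z) = cmap e (\<eta> (cinv c z))"
    using b[of 1] tup_rep[OF SB.target_N cs(3,1,5) z W] by (simp add: fam_def)
  show "blk n\<^sub>1 2 (coords J c c\<^sub>1 e W \<sigma> \<tau> z) = snd (\<sigma> (cinv c z)) c\<^sub>1"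
    using b[of 2] tup_comp[OF a(1) \<sigma> z] by (simp add: fam_def)
  fix l assume "l < j"
  then have l: "l < J" using j by simp
  show "blk n\<^sub>1 (3 + l) (coords J c c\<^sub>1 e W \<sigma> \<tau> z) = snd (\<tau> l (cinv c z)) c\<^sub>1"
    using b[of "3 + l"] l tup_comp[OF a(1) \<tau>[OF l] z] by (simp add: fam_def)
qed

lemma Sec_pair: "\<sigma> \<in> SA.Sec \<Longrightarrow> x \<in> MS \<Longrightarrow> (\<gamma> x, snd (\<sigma> x)) = \<sigma> x"
  using SA.Sec_mem(3)[of \<sigma> x] by (metis prod.collapse)

lemma coords_Q_iff:
  assumes a: "SA.allowed c c\<^sub>1 W" "SB.allowed c e W" and \<sigma>: "\<sigma> \<in> SA.Sec"
    and \<tau>: "\<And>l. l < J \<Longrightarrow> \<tau> l \<in> SA.Sec" and z: "z \<in> W"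
  shows "coords J c c\<^sub>1 e W \<sigma> \<tau> z \<in> Q c\<^sub>1 e \<longleftrightarrow> admissible (\<eta> (cinv c z)) (\<sigma> (cinv c z))"
proof -
  note x = SA.allowed_point[OF a(1) z] SB.allowed_point[OF a(2) z]
  have cs: "c\<^sub>1 \<in> matlas N\<^sub>1" "e \<in> matlas N\<^sub>2" using a by (simp_all add: SA.allowed_def SB.allowed_def)
  show ?thesis
    using matches_points(4)[OF cs(1) x(2) cs(2) x(5) SA.Sec_mem(5)[OF \<sigma> x(1)] coords_matches[OF a \<sigma> \<tau> le_refl z]]
    by (simp only: Sec_pair[OF \<sigma> x(1)])
qed

lemma coords_Q:
  assumes "SA.allowed c c\<^sub>1 W" "SB.allowed c e W" "\<sigma> \<in> \<D>" "\<And>l. l < J \<Longrightarrow> \<tau> l \<in> SA.Sec" "z \<in> W"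
  shows "coords J c c\<^sub>1 e W \<sigma> \<tau> z \<in> Q c\<^sub>1 e"
proof -
  have "admissible (\<eta> (cinv c z)) (\<sigma> (cinv c z))"
    using assms(3) SA.allowed_point(1)[OF assms(1,5)] by (simp add: \<D>_def)
  then show ?thesis
    by (rule coords_Q_iff[where J = J and \<tau> = \<tau>, OF assms(1,2) \<D>_Sec[OF assms(3)] assms(4,5), THEN iffD2, rotated])
qed

lemma dmap_coords:
  assumes a: "SA.allowed c c\<^sub>1 W" "SB.allowed c e W" and \<sigma>: "\<sigma> \<in> \<D>"
    and \<tau>: "\<And>l. l < J \<Longrightarrow> \<tau> l \<in> SA.Sec" and j: "j \<le> J" and z: "z \<in> W"
  shows "dmap j \<sigma> \<tau> (cinv c z) =
      SB.tpoint e (\<eta> (cinv c z)) (tup {..<n\<^sub>2} (\<lambda>a. KD j c\<^sub>1 e a (coords J c c\<^sub>1 e W \<sigma> \<tau> z)))"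
    "i < n\<^sub>2 \<Longrightarrow> SB.comp c e W i (dmap j \<sigma> \<tau>) z = KD j c\<^sub>1 e i (coords J c c\<^sub>1 e W \<sigma> \<tau> z)"
proof -
  note x = SA.allowed_point[OF a(1) z] SB.allowed_point[OF a(2) z]
  have cs: "c\<^sub>1 \<in> matlas N\<^sub>1" "e \<in> matlas N\<^sub>2" using a by (simp_all add: SA.allowed_def SB.allowed_def)
  have "snd (\<tau> l (cinv c z)) \<in> tangent_space n\<^sub>1 N\<^sub>1 (\<gamma> (cinv c z))" if "l < j" for l
    using that j by (intro SA.Sec_mem(5)[OF \<tau> x(1)]) simp
  from dvec_eq[OF cs(1) x(2) cs(2) x(5) this SA.Sec_mem(5)[OF \<D>_Sec[OF \<sigma>] x(1)] coords_Q[OF a \<sigma> \<tau> z]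
      coords_matches[OF a \<D>_Sec[OF \<sigma>] \<tau> j z]]
  show eq: "dmap j \<sigma> \<tau> (cinv c z) =
      SB.tpoint e (\<eta> (cinv c z)) (tup {..<n\<^sub>2} (\<lambda>a. KD j c\<^sub>1 e a (coords J c c\<^sub>1 e W \<sigma> \<tau> z)))"
    using x(1) by (simp add: dmap_def)
  have ec: "e \<in> charts_at N\<^sub>2 (\<eta> (cinv c z))" using cs x(5) by (simp add: charts_at_def)
  assume "i < n\<^sub>2"
  then show "SB.comp c e W i (dmap j \<sigma> \<tau>) z = KD j c\<^sub>1 e i (coords J c c\<^sub>1 e W \<sigma> \<tau> z)"
    using z by (simp add: SB.comp_def eq SB.tvec_of_self[OF ec] tup_in_Rn lookup_tup)
qed

lemma pair_data:
  assumes p: "p \<in> MS" and c\<^sub>1: "c\<^sub>1 \<in> matlas N\<^sub>1" "\<gamma> p \<in> cdom c\<^sub>1" and e: "e \<in> matlas N\<^sub>2" "\<eta> p \<in> cdom e"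
  obtains c U where "c \<in> matlas M" "p \<in> cdom c" "SA.allowed c c\<^sub>1 U" "SB.allowed c e U" "cmap c p \<in> U"
proof -
  have o: "openin (mtop M) {x \<in> MS. \<eta> x \<in> cdom e}"
    by (rule openin_continuous_map_preimage[OF SB.\<gamma>_continuous SB.dom_open[OF e(1)]])
  have p': "p \<in> {x \<in> MS. \<eta> x \<in> cdom e}" using p e(2) by simp
  obtain c U where c: "c \<in> matlas M" "p \<in> cdom c" "cdom c \<subseteq> {x \<in> MS. \<eta> x \<in> cdom e}" and a: "SA.allowed c c\<^sub>1 U"
    and U: "cmap c p \<in> U"
    by (rule SA.local_data[OF p c\<^sub>1 o p'])
  have "SB.allowed c e U" using a c(3) e(1) by (auto simp: SA.allowed_def SB.allowed_def)
  then show ?thesis by (rule that[OF c(1,2) a _ U])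
qed

text \<open>That \<open>W\<close> is allowed for the second target says nothing about charts of
  \<open>N\<^sub>1\<close>. Near a point of \<open>cl W\<close> the chart \<open>c\<close> is cut
  down until \<gamma> also stays in one chart; \<open>cinv\<close> is unchanged on \<open>U\<close>,
  so functions written with \<open>c\<close> or \<open>c'\<close> coincide there.\<close>

lemma refine:
  assumes a: "SB.allowed c e W" and z: "z \<in> cl W"
  obtains c' c\<^sub>1 U V where "c\<^sub>1 \<in> matlas N\<^sub>1" "SA.allowed c' c\<^sub>1 U" "SB.allowed c' e U" "U \<in> \<U>" "V \<in> \<U>" "z \<in> V" "rc V U"
    "V \<subseteq> cimage c" "\<And>w. w \<in> U \<Longrightarrow> cinv c' w = cinv c w"
proof -
  have c: "c \<in> matlas M" "e \<in> matlas N\<^sub>2" "\<eta> ` cdom c \<subseteq> cdom e" "rc W (cimage c)" using a by (simp_all add: SB.allowed_def)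
  have zc: "z \<in> cimage c" using rc_cl[OF c(4)] z by blast
  define x where "x = cinv c z"
  have x: "x \<in> cdom c" "cmap c x = z" unfolding x_def using M_inj[OF c(1)] zc by (simp_all add: cinv_in_cdom cmap_cinv)
  have xM: "x \<in> MS" using x(1) M_dom_subset[OF c(1)] by blast
  obtain c\<^sub>1 where c\<^sub>1: "c\<^sub>1 \<in> matlas N\<^sub>1" "\<gamma> x \<in> cdom c\<^sub>1" by (rule SA.chart_at[OF SA.\<gamma>_space[OF xM]])
  define S where "S = {x \<in> MS. \<gamma> x \<in> cdom c\<^sub>1}"
  have o: "openin (mtop M) S"
    unfolding S_def by (rule openin_continuous_map_preimage[OF SA.\<gamma>_continuous SA.dom_open[OF c\<^sub>1(1)]])
  let ?c = "restrict_chart c S"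
  have c': "?c \<in> matlas M" by (rule M_restrict[OF c(1) o])
  have "z \<in> cimage ?c" using cmap_in_cimage[of x ?c] x xM c\<^sub>1(2) by (simp add: S_def)
  then obtain U where U: "U \<in> \<U>" "z \<in> U" "rc U (cimage ?c)" by (rule \<U>_shrink[OF M_image_open[OF c']])
  obtain V where V: "V \<in> \<U>" "z \<in> V" "rc V U" by (rule \<U>_shrink[OF \<U>_open[OF U(1)] U(2)])
  have Uc: "U \<subseteq> cimage ?c" by (rule rc_subset[OF U(1,3)])
  have "cimage ?c \<subseteq> cimage c" unfolding cimage_restrict_chart by (auto simp: cimage_def)
  then have Vc: "V \<subseteq> cimage c" using rc_subset[OF V(1,3)] Uc by blast
  have inv: "cinv ?c w = cinv c w" if w: "w \<in> U" for w
  proof -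
    obtain y where y: "y \<in> cdom ?c" "w = cmap ?c y" using w Uc unfolding cimage_def by blast
    then have "cinv ?c w = y" "cinv c w = y"
      using cinv_cmap[OF M_inj[OF c'] y(1)] cinv_cmap[OF M_inj[OF c(1)], of y] by simp_all
    then show ?thesis by simp
  qed
  have "SA.allowed ?c c\<^sub>1 U" using c' c\<^sub>1(1) U by (auto simp: SA.allowed_def S_def)
  moreover have "SB.allowed ?c e U" using c' c(2,3) U by (auto simp: SB.allowed_def)
  ultimately show ?thesis by (rule that[OF c\<^sub>1(1) _ _ U(1) V Vc inv])
qed

text \<open>In coordinates the section is a tangent vector built from \<open>KD\<close>, superposed
  on the members \<open>fam\<close> of \<open>\<F> U\<close>, so
  \<open>mapping_set_superpose\<close> applies.\<close>

lemma dmap_Sec: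
  assumes \<sigma>: "\<sigma> \<in> \<D>" and \<tau>: "\<And>l. l < j \<Longrightarrow> \<tau> l \<in> SA.Sec"
  shows "dmap j \<sigma> \<tau> \<in> SB.Sec"
proof (rule SB.SecI)
  show "fst (dmap j \<sigma> \<tau> x) = \<eta> x" if "x \<in> MS" for x using that by (simp add: dmap_def dvec_def)
  have data: "\<exists>c c\<^sub>1 e U. c \<in> matlas M \<and> c\<^sub>1 \<in> matlas N\<^sub>1 \<and> e \<in> matlas N\<^sub>2 \<and> p \<in> cdom c \<and> SA.allowed c c\<^sub>1 U \<and>
      SB.allowed c e U \<and> cmap c p \<in> U \<and> \<eta> p \<in> cdom e" if p: "p \<in> MS" for p
  proof -
    obtain c\<^sub>1 where c\<^sub>1: "c\<^sub>1 \<in> matlas N\<^sub>1" "\<gamma> p \<in> cdom c\<^sub>1" by (rule SA.chart_at[OF SA.\<gamma>_space[OF p]])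
    obtain e where e: "e \<in> matlas N\<^sub>2" "\<eta> p \<in> cdom e" by (rule SB.chart_at[OF SB.\<gamma>_space[OF p]])
    from pair_data[OF p c\<^sub>1 e] show ?thesis using c\<^sub>1 e by metis
  qed
  show "dmap j \<sigma> \<tau> \<in> mapping_set \<U> \<F> M (2 * n\<^sub>2) (tangent_bundle n\<^sub>2 N\<^sub>2)"
  proof (rule mapping_set_superpose[OF SB.target_TN])
    show "dmap j \<sigma> \<tau> \<in> MS \<rightarrow>\<^sub>E mspace_of (tangent_bundle n\<^sub>2 N\<^sub>2)"
    proof (rule PiE_I)
      fix p assume p: "p \<in> MS"
      from data[OF p] obtain c c\<^sub>1 e U where c: "c \<in> matlas M" "c\<^sub>1 \<in> matlas N\<^sub>1" "e \<in> matlas N\<^sub>2" "p \<in> cdom c"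
        and a: "SA.allowed c c\<^sub>1 U" "SB.allowed c e U" and U: "cmap c p \<in> U" "\<eta> p \<in> cdom e" by blast
      have "dmap j \<sigma> \<tau> p \<in> cdom (SB.tc e)"
        using dmap_coords(1)[OF a \<sigma> \<tau> le_refl U(1)] SB.tpoint_in[OF c(3) U(2)]
        by (simp add: cinv_cmap[OF M_inj[OF c(1)] c(4)])
      then show "dmap j \<sigma> \<tau> p \<in> mspace_of (tangent_bundle n\<^sub>2 N\<^sub>2)"
        by (simp add: SB.TT_topspace SB.tc_simps(1))
    qed (simp add: dmap_def)
    fix p assume p: "p \<in> MS"
    from data[OF p] obtain c c\<^sub>1 e U where c: "c \<in> matlas M" "c\<^sub>1 \<in> matlas N\<^sub>1" "e \<in> matlas N\<^sub>2" "p \<in> cdom c"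
      and a: "SA.allowed c c\<^sub>1 U" "SB.allowed c e U" and U: "cmap c p \<in> U" "\<eta> p \<in> cdom e" by blast
    have Uc: "U \<in> \<U>" "U \<subseteq> cimage c" using a(1) rc_subset by (auto simp: SA.allowed_def)
    define u where "u = fam c c\<^sub>1 e U \<sigma> \<tau>"
    define g where "g z = SB.tpoint e (pt2 e z) (tup {..<n\<^sub>2} (\<lambda>i. KD j c\<^sub>1 e i z))" for z
    have Z: "tup (IX j) (\<lambda>i. u i z) \<in> Q c\<^sub>1 e" if "z \<in> U" for z
      unfolding u_def by (rule coords_Q[OF a \<sigma> \<tau> that])
    have um: "\<forall>i\<in>IX j. u i \<in> topspace (\<F> U)"
      unfolding u_def by (intro ballI fam_mem[OF a \<D>_Sec[OF \<sigma>] \<tau>])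
    have sm: "chart_smooth (SB.tc e) g (tup (IX j) (\<lambda>i. u i (cmap c p)))"
      unfolding g_def[abs_def]
      by (rule SB.chart_smooth_tpoint[OF c(3) chart_smooth_pt2[OF c(3) Z[OF U(1)]]])
        (rule smooth_on_imp_at[OF KD_smooth[OF c(2,3)] open_Q[OF c(2,3)] Z[OF U(1)]])
    have eq: "\<forall>z\<in>U. dmap j \<sigma> \<tau> (cinv c z) = g (tup (IX j) (\<lambda>i. u i z))"
    proof
      fix z assume z: "z \<in> U"
      note x = SA.allowed_point[OF a(1) z] SB.allowed_point[OF a(2) z]
      have "pt2 e (coords j c c\<^sub>1 e U \<sigma> \<tau> z) = \<eta> (cinv c z)"
        by (rule matches_points(2)[OF c(2) x(2) c(3) x(5) SA.Sec_mem(5)[OF \<D>_Sec[OF \<sigma>] x(1)]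
              coords_matches[OF a \<D>_Sec[OF \<sigma>] \<tau> le_refl z]])
      then show "dmap j \<sigma> \<tau> (cinv c z) = g (tup (IX j) (\<lambda>i. u i z))"
        unfolding g_def u_def
        by (simp only: dmap_coords(1)[where J = j and \<tau> = \<tau>, OF a \<sigma> \<tau> le_refl z])
    qed
    show "\<exists>c d W I u g. c \<in> matlas M \<and> d \<in> matlas (tangent_bundle n\<^sub>2 N\<^sub>2) \<and> p \<in> cdom c \<and> W \<in> \<U> \<and>
      cmap c p \<in> W \<and> W \<subseteq> cimage c \<and> finite (I :: (nat \<times> nat) set) \<and> (\<forall>i\<in>I. u i \<in> topspace (\<F> W)) \<and>
      chart_smooth d g (tup I (\<lambda>i. u i (cmap c p))) \<and> (\<forall>z\<in>W. dmap j \<sigma> \<tau> (cinv c z) = g (tup I (\<lambda>i. u i z)))"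
      by (intro exI[of _ c] exI[of _ "SB.tc e"] exI[of _ U] exI[of _ "IX j"] exI[of _ u] exI[of _ g] conjI
          c(1) SB.tc_in_atlas[OF c(3)] c(4) Uc U(1) finite_IX um sm eq)
  qed
qed

lemma fam_lcont:
  assumes a: "SA.allowed c c\<^sub>1 W" "SB.allowed c e W" and x0: "x0 \<in> topspace X"
    and s: "continuous_map X SA.ST s" and t: "\<And>l. l < j \<Longrightarrow> continuous_map X SA.ST (\<lambda>x. t x l)" and i: "i \<in> IX j"
  shows "lcont X (\<F> W) (\<lambda>x. fam c c\<^sub>1 e W (s x) (t x) i) x0"
proof -
  obtain b k where b: "i = (b, k)" "b < 3 + j" "k < (if b = 1 then n\<^sub>2 else n\<^sub>1)" using i by (auto simp: IX_def)
  consider "b = 0" | "b = 1" | "b = 2" | "b \<ge> 3" by linarith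
  then show ?thesis
  proof cases
    assume "b = 0"
    then show ?thesis using lcont_const[OF x0 SA.\<gamma>_rep_mem[OF a(1), of k]] by (simp add: fam_def b)
  next
    assume "b = 1"
    then show ?thesis using lcont_const[OF x0 SB.\<gamma>_rep_mem[OF a(2), of k]] by (simp add: fam_def b)
  next
    assume b2: "b = 2"
    then have "lcont X (\<F> W) (\<lambda>x. SA.comp c c\<^sub>1 W k (s x)) x0"
      using b by (intro lcont_compose[OF continuous_map_imp_lcont[OF s x0] SA.comp_continuous[OF a(1)]]) simp
    then show ?thesis using b2 by (simp add: fam_def b)
  next
    assume b3: "b \<ge> 3"
    then have l: "b - 3 < j" using b by simp
    have "lcont X (\<F> W) (\<lambda>x. SA.comp c c\<^sub>1 W k (t x (b - 3))) x0"
      using b b3 by (intro lcont_compose[OF continuous_map_imp_lcont[OF t[OF l] x0] SA.comp_continuous[OF a(1)]]) simp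
    then show ?thesis using b3 by (simp add: fam_def b)
  qed
qed

text \<open>Near each point of \<open>cl W\<close> a component is \<open>KD j\<close> superposed on
  \<open>fam\<close>, whose members depend continuously on the parameter;
  \<open>\<F>_superpose\<close> gives the local continuity and \<open>\<F>_glue\<close> the claim on
  \<open>W\<close>.\<close>

lemma continuous_map_dmap:
  assumes s: "continuous_map X SA.ST s" "\<And>x. x \<in> topspace X \<Longrightarrow> s x \<in> \<D>"
    and t: "\<And>l. l < j \<Longrightarrow> continuous_map X SA.ST (\<lambda>x. t x l)"
  shows "continuous_map X SB.ST (\<lambda>x. dmap j (s x) (t x))"
proof (rule SB.continuous_map_into_ST)
  have tS: "t x l \<in> SA.Sec" if "x \<in> topspace X" "l < j" for x l
    using t[OF that(2)] that(1) by (auto simp: continuous_map_def SA.topspace_ST)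
  show "dmap j (s x) (t x) \<in> SB.Sec" if "x \<in> topspace X" for x
    by (rule dmap_Sec[OF s(2)[OF that] tS[OF that]])
  fix c e W i assume a: "SB.allowed c e W" and i: "i < n\<^sub>2"
  have cW: "c \<in> matlas M" "e \<in> matlas N\<^sub>2" "W \<in> \<U>" "rc W (cimage c)" using a by (simp_all add: SB.allowed_def)
  show "continuous_map X (\<F> W) (\<lambda>x. SB.comp c e W i (dmap j (s x) (t x)))"
  proof (rule lcont_imp_continuous_map)
    fix x0 assume x0: "x0 \<in> topspace X"
    show "lcont X (\<F> W) (\<lambda>x. SB.comp c e W i (dmap j (s x) (t x))) x0"
      unfolding SB.comp_def
    proof (rule \<F>_glue[OF cW(3) M_image_open[OF cW(1)] cW(4) x0])
      fix z assume "z \<in> cl W"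
      from refine[OF a this] obtain c' c\<^sub>1 U V where c\<^sub>1: "c\<^sub>1 \<in> matlas N\<^sub>1" and al: "SA.allowed c' c\<^sub>1 U" "SB.allowed c' e U"
        and U: "U \<in> \<U>" and V: "V \<in> \<U>" "z \<in> V" "rc V U" "V \<subseteq> cimage c" and inv: "\<And>w. w \<in> U \<Longrightarrow> cinv c' w = cinv c w"
        by metis
      have VU: "V \<subseteq> U" by (rule rc_subset[OF V(1,3)])
      have "lcont X (\<F> V) (\<lambda>x. \<lambda>z\<in>V. KD j c\<^sub>1 e i (coords j c' c\<^sub>1 e U (s x) (t x) z)) x0"
      proof (rule \<F>_superpose[OF U V(1,3) finite_IX open_Q[OF c\<^sub>1 cW(2)] KD_smooth[OF c\<^sub>1 cW(2) i] x0])
        show "lcont X (\<F> U) (\<lambda>x. fam c' c\<^sub>1 e U (s x) (t x) k) x0" if "k \<in> IX j" for k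
          by (rule fam_lcont[OF al x0 s(1) t that])
        show "coords j c' c\<^sub>1 e U (s x0) (t x0) z \<in> Q c\<^sub>1 e" if "z \<in> cl V" for z
          by (rule coords_Q[OF al s(2)[OF x0] tS[OF x0]]) (use rc_cl[OF V(3)] that in auto)
      qed
      then have "lcont X (\<F> V) (\<lambda>x. restrict (\<lambda>z. Poly_Mapping.lookup (snd (dmap j (s x) (t x) (cinv c z)) e) i) V) x0"
      proof (rule lcont_cong[OF _ openin_topspace x0])
        fix x assume x: "x \<in> topspace X"
        show "(\<lambda>z\<in>V. KD j c\<^sub>1 e i (coords j c' c\<^sub>1 e U (s x) (t x) z)) =
          (\<lambda>z\<in>V. Poly_Mapping.lookup (snd (dmap j (s x) (t x) (cinv c z)) e) i)"
        proof (rule restrict_ext)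
          fix z assume "z \<in> V"
          then have z: "z \<in> U" using VU by blast
          show "KD j c\<^sub>1 e i (coords j c' c\<^sub>1 e U (s x) (t x) z) =
              Poly_Mapping.lookup (snd (dmap j (s x) (t x) (cinv c z)) e) i"
            using dmap_coords(2)[OF al s(2)[OF x] tS[OF x] le_refl z i] z by (simp add: SB.comp_def inv)
        qed
      qed
      then show "\<exists>V\<in>\<U>. z \<in> V \<and> V \<subseteq> cimage c \<and> lcont X (\<F> V)
          (\<lambda>x. restrict (\<lambda>z. Poly_Mapping.lookup (snd (dmap j (s x) (t x) (cinv c z)) e) i) V) x0"
        using V by blast
    qed
  qed
qed

text \<open>For every point of \<open>M\<close> the tube lemma yields a neighbourhood of that point
  and one of \<open>\<sigma>\<^sub>0\<close> on which admissibility holds. Finitely many of the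
  former cover the compact \<open>M\<close>, and the corresponding latter are intersected.\<close>

lemma open_\<D>: "openin SA.ST \<D>"
proof (subst openin_subopen, intro ballI)
  fix \<sigma>\<^sub>0 assume \<sigma>0: "\<sigma>\<^sub>0 \<in> \<D>"
  have \<sigma>0': "\<sigma>\<^sub>0 \<in> topspace SA.ST" using \<D>_Sec[OF \<sigma>0] by (simp add: SA.topspace_ST)
  define good where "good p O' N' \<longleftrightarrow> openin (mtop M) O' \<and> p \<in> O' \<and> openin SA.ST N' \<and> \<sigma>\<^sub>0 \<in> N' \<and>
     (\<forall>x\<in>O'. \<forall>\<sigma>\<in>N'. admissible (\<eta> x) (\<sigma> x))" for p O' N'
  have "\<exists>O' N'. good p O' N'" if p: "p \<in> MS" for p
  proof -
    obtain c\<^sub>1 where c\<^sub>1: "c\<^sub>1 \<in> matlas N\<^sub>1" "\<gamma> p \<in> cdom c\<^sub>1" by (rule SA.chart_at[OF SA.\<gamma>_space[OF p]])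
    obtain e where e: "e \<in> matlas N\<^sub>2" "\<eta> p \<in> cdom e" by (rule SB.chart_at[OF SB.\<gamma>_space[OF p]])
    obtain c U where c: "c \<in> matlas M" "p \<in> cdom c" and a: "SA.allowed c c\<^sub>1 U" "SB.allowed c e U" and Up: "cmap c p \<in> U"
      by (rule pair_data[OF p c\<^sub>1 e])
    have U: "U \<in> \<U>" "U \<subseteq> cimage c" using a(1) rc_subset by (auto simp: SA.allowed_def)
    obtain V where V: "V \<in> \<U>" "cmap c p \<in> V" "rc V U" by (rule \<U>_shrink[OF \<U>_open[OF U(1)] Up])
    have VU: "V \<subseteq> U" "V \<subseteq> cl V" "cl V \<subseteq> U" using rc_subset[OF V(1,3)] subset_cl[OF V(1)] rc_cl[OF V(3)] by simp_all
    have fl: "lcont SA.ST (\<F> U) (\<lambda>\<sigma>. fam c c\<^sub>1 e U \<sigma> undefined i) \<sigma>\<^sub>0" if "i \<in> IX 0" for i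
      by (rule fam_lcont[OF a \<sigma>0' continuous_map_id[unfolded id_def] _ that]) simp
    have "\<exists>N. openin SA.ST N \<and> \<sigma>\<^sub>0 \<in> N \<and> (\<forall>\<sigma>\<in>N. \<forall>z\<in>cl V. coords 0 c c\<^sub>1 e U \<sigma> undefined z \<in> Q c\<^sub>1 e)"
      by (rule \<F>_tube[OF U(1) V(1,3) finite_IX open_Q[OF c\<^sub>1(1) e(1)] \<sigma>0' fl])
        (auto intro!: coords_Q[OF a \<sigma>0] simp: VU(3)[THEN subsetD])
    then obtain N' where N': "openin SA.ST N'" "\<sigma>\<^sub>0 \<in> N'" "\<And>\<sigma> z. \<sigma> \<in> N' \<Longrightarrow> z \<in> cl V \<Longrightarrow> coords 0 c c\<^sub>1 e U \<sigma> undefined z \<in> Q c\<^sub>1 e"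
      by blast
    let ?O = "{x \<in> cdom c. cmap c x \<in> V}"
    have "admissible (\<eta> x) (\<sigma> x)" if x: "x \<in> ?O" and \<sigma>: "\<sigma> \<in> N'" for x \<sigma>
    proof -
      have "\<sigma> \<in> SA.Sec" using openin_subset[OF N'(1)] \<sigma> SA.topspace_ST by blast
      moreover have "cinv c (cmap c x) = x" using cinv_cmap[OF M_inj[OF c(1)]] x by blast
      moreover have "coords 0 c c\<^sub>1 e U \<sigma> undefined (cmap c x) \<in> Q c\<^sub>1 e" using N'(3)[OF \<sigma>] x VU(2) by blast
      moreover have "cmap c x \<in> U" using x VU(1) by blast
      ultimately show ?thesis using coords_Q_iff[OF a, of \<sigma> 0 undefined "cmap c x"] by simp
    qed
    then have "good p ?O N'"
      unfolding good_def using M_preimage_open[OF c(1) \<U>_open[OF V(1)]] VU(1) U(2) c(2) V(2) N'(1,2) by blast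
    then show ?thesis by blast
  qed
  then obtain O' N' where g: "\<And>p. p \<in> MS \<Longrightarrow> good p (O' p) (N' p)" by metis
  have op: "\<And>p. p \<in> MS \<Longrightarrow> openin (mtop M) (O' p)" "\<And>p. p \<in> MS \<Longrightarrow> p \<in> O' p" "\<And>p. p \<in> MS \<Longrightarrow> openin SA.ST (N' p)"
    "\<And>p. p \<in> MS \<Longrightarrow> \<sigma>\<^sub>0 \<in> N' p" "\<And>p x \<sigma>. p \<in> MS \<Longrightarrow> x \<in> O' p \<Longrightarrow> \<sigma> \<in> N' p \<Longrightarrow> admissible (\<eta> x) (\<sigma> x)"
    using g unfolding good_def by blast+
  have "MS \<subseteq> \<Union>(O' ` MS)" using op(2) by blast
  then obtain \<B> where B: "finite \<B>" "\<B> \<subseteq> O' ` MS" "MS \<subseteq> \<Union>\<B>"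
    using compact_M[unfolded compact_space_alt, rule_format, of "O' ` MS"] op(1) by blast
  then obtain P where P: "P \<subseteq> MS" "finite P" "\<B> = O' ` P" by (meson finite_subset_image)
  let ?N = "topspace SA.ST \<inter> \<Inter>(N' ` P)"
  have "openin SA.ST ?N"
  \<comment> \<open>\<open>\<Inter>\<close> of no sets is the whole type, so an empty subcover is
    treated apart.\<close>
  proof (cases "P = {}")
    case False
    have "openin SA.ST (\<Inter>(N' ` P))" by (rule openin_Inter) (use P False op(3) in auto)
    then show ?thesis by (intro openin_Int openin_topspace)
  qed simp
  moreover have "\<sigma>\<^sub>0 \<in> ?N" using \<sigma>0' op(4) P(1) by blast
  moreover have "?N \<subseteq> \<D>"
  proof
    fix \<sigma> assume \<sigma>: "\<sigma> \<in> ?N"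
    have "admissible (\<eta> x) (\<sigma> x)" if "x \<in> MS" for x
    proof -
      obtain p where "p \<in> P" "x \<in> O' p" using \<open>x \<in> MS\<close> B(3) P(3) by blast
      then show ?thesis using op(5)[of p x \<sigma>] P(1) \<sigma> by blast
    qed
    then show "\<sigma> \<in> \<D>" using \<sigma> by (simp add: \<D>_def SA.topspace_ST)
  qed
  ultimately show "\<exists>T. openin SA.ST T \<and> \<sigma>\<^sub>0 \<in> T \<and> T \<subseteq> \<D>" by blast
qed

end

lemma (in section_space) combo_0:
  assumes "\<sigma> \<in> Sec"
  shows "combo 0 \<sigma> \<tau> = \<sigma>"
proof
  fix x
  show "combo 0 \<sigma> \<tau> x = \<sigma> x"
  proof (cases "x \<in> MS")
    case True
    have "snd (\<sigma> x) \<in> extensional (charts_at N (\<gamma> x))"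
      using tangent_space_iff[THEN iffD1, OF Sec_mem(5)[OF assms True]] by (auto simp: PiE_iff)
    then have "(\<lambda>c\<in>charts_at N (\<gamma> x). snd (\<sigma> x) c + 0 *\<^sub>R snd (\<tau> x) c) = snd (\<sigma> x)"
      by (simp add: extensional_restrict)
    then show ?thesis using True Sec_mem(3)[OF assms True] by (simp add: combo_def prod_eq_iff)
  next
    case False
    then show ?thesis using Sec_mem(2)[OF assms] by (simp add: combo_def extensional_def)
  qed
qed

context mapping_pair
begin

lemma dmap_cong: "(\<And>l. l < j \<Longrightarrow> \<tau> l = \<tau>' l) \<Longrightarrow> dmap j \<sigma> \<tau> = dmap j \<sigma> \<tau>'"
  unfolding dmap_def dvec_def by (intro restrict_ext arg_cong2[where f = Pair] tup_cong refl dd_cong) simp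

text \<open>Moving \<sigma> in the direction \<tau> changes block 2 only, and affinely in
  \<open>t\<close>.\<close>

lemma fam_line:
  assumes "SA.allowed c c\<^sub>1 W" "z \<in> W"
  shows "fam c c\<^sub>1 e W \<sigma> y (b, i) z + t * (if b = 2 then SA.comp c c\<^sub>1 W i \<tau> else (\<lambda>z\<in>W. 0)) z
    = fam c c\<^sub>1 e W (SA.combo t \<sigma> \<tau>) y (b, i) z"
  using assms(2) by (simp add: fam_def SA.comp_combo[OF assms(1)])

text \<open>The difference quotient, with the claimed derivative as its value at t = 0, has locally
  continuous components at 0: near each point of \<open>cl W\<close> this is
  \<open>\<F>_difference_quotient\<close> for \<open>KD j\<close>, and the pieces are glued.\<close>

lemma dmap_has_derivative:
  assumes \<sigma>: "\<sigma> \<in> \<D>" and y: "\<And>l. l < Suc j \<Longrightarrow> y l \<in> SA.Sec"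
  shows "has_dir_deriv SA.E SB.E (\<lambda>\<sigma>. dmap j \<sigma> y) \<sigma> (y j) (dmap (Suc j) \<sigma> y)"
proof -
  let ?s = "\<lambda>t. SA.combo t \<sigma> (y j)"
  define \<kappa> where "\<kappa> t = SB.combo (- 1) (dmap j (?s t) y) (dmap j \<sigma> y)" for t
  \<comment> \<open>Division of \<open>\<kappa> t\<close> by \<open>t\<close> is written as
    \<open>combo (1 / t - 1)\<close>, in the form of \<open>E_scale\<close>.\<close>
  define \<Phi> where "\<Phi> t = (if t = 0 then dmap (Suc j) \<sigma> y else SB.combo (1 / t - 1) (\<kappa> t) (\<kappa> t))" for t
  define T where "T = {t. ?s t \<in> \<D>}"
  have \<sigma>S: "\<sigma> \<in> SA.Sec" by (rule \<D>_Sec[OF \<sigma>])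
  have yj: "y j \<in> SA.Sec" and yl: "\<And>l. l < j \<Longrightarrow> y l \<in> SA.Sec" using y by simp_all
  have s0: "?s 0 = \<sigma>" by (rule SA.combo_0[OF \<sigma>S])
  have T: "open T" "0 \<in> T"
    using openin_continuous_map_preimage[OF SA.line_continuous[OF \<sigma>S yj] open_\<D>] \<sigma>
    by (simp_all add: T_def s0)
  have dS: "dmap j (?s t) y \<in> SB.Sec" if "t \<in> T" for t
    by (rule dmap_Sec) (use that yl in \<open>simp_all add: T_def\<close>)
  have d0: "dmap j \<sigma> y \<in> SB.Sec" by (rule dmap_Sec[OF \<sigma> yl])
  have \<Phi>S: "\<Phi> t \<in> SB.Sec" if "t \<in> T" for t
    using SB.combo_Sec[OF SB.combo_Sec SB.combo_Sec] dS[OF that] d0 dmap_Sec[OF \<sigma> y] by (simp add: \<Phi>_def \<kappa>_def)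
  have "limitin SB.ST \<Phi> (\<Phi> 0) (at 0)"
  proof (rule SB.limitin_ST[OF T \<Phi>S])
    fix c e W i assume a: "SB.allowed c e W" and i: "i < n\<^sub>2"
    have cW: "c \<in> matlas M" "e \<in> matlas N\<^sub>2" "W \<in> \<U>" "rc W (cimage c)" using a by (simp_all add: SB.allowed_def)
    show "lcont euclideanreal (\<F> W) (\<lambda>t. SB.comp c e W i (\<Phi> t)) 0"
      unfolding SB.comp_def
    proof (rule \<F>_glue[OF cW(3) M_image_open[OF cW(1)] cW(4)])
      fix z assume "z \<in> cl W"
      from refine[OF a this] obtain c' c\<^sub>1 U V where c\<^sub>1: "c\<^sub>1 \<in> matlas N\<^sub>1" and al: "SA.allowed c' c\<^sub>1 U" "SB.allowed c' e U"
        and U: "U \<in> \<U>" and V: "V \<in> \<U>" "z \<in> V" "rc V U" "V \<subseteq> cimage c" and inv: "\<And>w. w \<in> U \<Longrightarrow> cinv c' w = cinv c w"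
        by metis
      have VU: "V \<subseteq> U" by (rule rc_subset[OF V(1,3)])
      \<comment> \<open>\<open>Suc j\<close> although the quotient is one of \<open>KD j\<close>:
        block \<open>3 + j\<close> carries \<open>y j\<close>, which the value
        \<open>KD (Suc j)\<close> at t = 0 reads.\<close>
      let ?I = "IX (Suc j)" and ?G = "KD j c\<^sub>1 e i"
      define u where "u = fam c' c\<^sub>1 e U \<sigma> y"
      define w where "w = (\<lambda>(b :: nat, i). if b = 2 then SA.comp c' c\<^sub>1 U i (y j) else (\<lambda>z\<in>U. 0))"
      have um: "u k \<in> topspace (\<F> U)" if "k \<in> ?I" for k
        unfolding u_def by (rule fam_mem[OF al \<sigma>S y that])
      have wm: "w k \<in> topspace (\<F> U)" if "k \<in> ?I" for k
        using that SA.comp_mem[OF yj al(1)] \<F>_zero[OF U] by (auto simp: w_def IX_def)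
      have line: "tup ?I (\<lambda>k. u k z + t * w k z) = coords (Suc j) c' c\<^sub>1 e U (?s t) y z" if "z \<in> U" for z t
      proof (rule tup_cong)
        fix k show "u k z + t * w k z = fam c' c\<^sub>1 e U (?s t) y k z"
          using fam_line[OF al(1) that, of e \<sigma> y "fst k" "snd k" t "y j"]
          by (simp add: u_def w_def case_prod_beta)
      qed
      have uQ: "tup ?I (\<lambda>k. u k z) \<in> Q c\<^sub>1 e" if "z \<in> cl V" for z
        unfolding u_def using rc_cl[OF V(3)] that by (intro coords_Q[OF al \<sigma> y]) auto
      have "lcont euclideanreal (\<F> V) (\<lambda>t. \<lambda>z\<in>V.
        if t = 0 then \<Sum>k\<in>?I. w k z * pd k ?G (tup ?I (\<lambda>k. u k z))
        else (?G (tup ?I (\<lambda>k. u k z + t * w k z)) - ?G (tup ?I (\<lambda>k. u k z))) / t) 0"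
        by (rule \<F>_difference_quotient[OF U V(1,3) finite_IX open_Q[OF c\<^sub>1 cW(2)] KD_smooth[OF c\<^sub>1 cW(2) i] um wm uQ])
      then have "lcont euclideanreal (\<F> V)
          (\<lambda>t. restrict (\<lambda>z. Poly_Mapping.lookup (snd (\<Phi> t (cinv c z)) e) i) V) 0"
      proof (rule lcont_cong)
        show "openin euclideanreal T" "0 \<in> T" using T by simp_all
        fix t assume t: "t \<in> T"
        then have st: "?s t \<in> \<D>" by (simp add: T_def)
        show "(\<lambda>z\<in>V. if t = 0 then \<Sum>k\<in>?I. w k z * pd k ?G (tup ?I (\<lambda>k. u k z))
            else (?G (tup ?I (\<lambda>k. u k z + t * w k z)) - ?G (tup ?I (\<lambda>k. u k z))) / t) =
          (\<lambda>z\<in>V. Poly_Mapping.lookup (snd (\<Phi> t (cinv c z)) e) i)"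
        proof (rule restrict_ext)
          fix z assume "z \<in> V"
          then have z: "z \<in> U" using VU by blast
          have "Poly_Mapping.lookup (snd (\<Phi> t (cinv c z)) e) i = SB.comp c' e U i (\<Phi> t) z"
            using z by (simp add: SB.comp_def inv)
          also have "\<dots> = (if t = 0 then \<Sum>k\<in>?I. w k z * pd k ?G (tup ?I (\<lambda>k. u k z))
            else (?G (tup ?I (\<lambda>k. u k z + t * w k z)) - ?G (tup ?I (\<lambda>k. u k z))) / t)"
          proof (cases "t = 0")
            case True
            let ?Z = "tup ?I (\<lambda>k. u k z)"
            have l: "Poly_Mapping.lookup ?Z (3 + j, a) = w (2, a) z" if "a < n\<^sub>1" for a
              using that by (simp add: lookup_tup finite_IX) (simp add: IX_def u_def w_def fam_def)
            have "SB.comp c' e U i (\<Phi> t) z = KD (Suc j) c\<^sub>1 e i ?Z"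
              unfolding u_def using True dmap_coords(2)[OF al \<sigma> y le_refl z i] by (simp add: \<Phi>_def)
            also have "\<dots> = (\<Sum>a<n\<^sub>1. w (2, a) z * pd (2, a) ?G ?Z)"
              unfolding KD.simps by (rule sum.cong) (simp_all only: l lessThan_iff)
            also have "\<dots> = (\<Sum>k\<in>Pair 2 ` {..<n\<^sub>1}. w k z * pd k ?G ?Z)"
              by (simp add: sum.reindex inj_on_def)
            also have "\<dots> = (\<Sum>k\<in>?I. w k z * pd k ?G ?Z)"
              using z by (intro sum.mono_neutral_left finite_IX) (auto simp: IX_def w_def split: if_splits)
            finally show ?thesis using True by simp
          next
            case False
            have "SB.comp c' e U i (\<Phi> t) z = (1 / t) * SB.comp c' e U i (\<kappa> t) z"
              using False z by (simp add: \<Phi>_def SB.comp_combo[OF al(2)] algebra_simps)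
            also have "SB.comp c' e U i (\<kappa> t) z = SB.comp c' e U i (dmap j (?s t) y) z - SB.comp c' e U i (dmap j \<sigma> y) z"
              using z by (simp add: \<kappa>_def SB.comp_combo[OF al(2)])
            also have "\<dots> = ?G (coords (Suc j) c' c\<^sub>1 e U (?s t) y z) - ?G (coords (Suc j) c' c\<^sub>1 e U \<sigma> y z)"
              using dmap_coords(2)[where J = "Suc j" and \<tau> = y and j = j, OF al st y _ z i]
                dmap_coords(2)[where J = "Suc j" and \<tau> = y and j = j, OF al \<sigma> y _ z i] by simp
            finally show ?thesis using False unfolding line[OF z] unfolding u_def by simp
          qed
          finally show "(if t = 0 then \<Sum>k\<in>?I. w k z * pd k ?G (tup ?I (\<lambda>k. u k z))
            else (?G (tup ?I (\<lambda>k. u k z + t * w k z)) - ?G (tup ?I (\<lambda>k. u k z))) / t) =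
            Poly_Mapping.lookup (snd (\<Phi> t (cinv c z)) e) i" by (rule sym)
        qed
      qed
      then show "\<exists>V\<in>\<U>. z \<in> V \<and> V \<subseteq> cimage c \<and> lcont euclideanreal (\<F> V)
          (\<lambda>t. restrict (\<lambda>z. Poly_Mapping.lookup (snd (\<Phi> t (cinv c z)) e) i) V) 0"
        using V by blast
    qed simp
  qed
  then have "limitin SB.ST \<Phi> (dmap (Suc j) \<sigma> y) (at 0)" by (simp add: \<Phi>_def)
  moreover have "eventually (\<lambda>t. \<Phi> t = SB.combo (1 / t - 1) (\<kappa> t) (\<kappa> t)) (at 0)"
    unfolding eventually_at_filter by (simp add: \<Phi>_def)
  ultimately show ?thesis
    unfolding has_dir_deriv_def SA.E_line SB.E_line SB.E_simps(1) \<kappa>_def unfolding SB.E_scale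
    by (rule limitin_transform_eventually[rotated])
qed

definition section_map :: "('a \<Rightarrow> 'b tvec) \<Rightarrow> 'a \<Rightarrow> 'c tvec" where
  "section_map \<sigma> = (\<lambda>x\<in>MS. H (\<eta> x) (\<sigma> x))"

lemma dmap_0: "\<sigma> \<in> \<D> \<Longrightarrow> dmap 0 \<sigma> \<tau> = section_map \<sigma>"
  unfolding dmap_def section_map_def
proof (rule restrict_ext)
  fix x assume "\<sigma> \<in> \<D>" "x \<in> MS"
  then have "admissible (\<eta> x) (\<gamma> x, snd (\<sigma> x))" "(\<gamma> x, snd (\<sigma> x)) = \<sigma> x"
    using Sec_pair[of \<sigma> x] by (simp_all add: \<D>_def)
  then show "dvec 0 (\<gamma> x) (\<eta> x) (snd (\<sigma> x)) (\<lambda>l. snd (\<tau> l x)) = H (\<eta> x) (\<sigma> x)"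
    using dvec_0 by metis
qed

lemma smooth_section_map: "smooth_between SA.E SB.E \<D> section_map"
  unfolding smooth_between_def SA.E_simps(1) SB.E_simps(1)
proof (intro exI[of _ dmap] conjI ballI allI)
  show "dmap 0 \<sigma> (\<lambda>_. undefined) = section_map \<sigma>" if "\<sigma> \<in> \<D>" for \<sigma> by (rule dmap_0[OF that])
  fix j :: nat
  let ?X = "prod_topology (subtopology SA.ST \<D>) (product_topology (\<lambda>_. SA.ST) {..<j})"
  show "continuous_map ?X SB.ST (\<lambda>(x, y). dmap j x y)"
    unfolding case_prod_beta
  proof (rule continuous_map_dmap)
    show "continuous_map ?X SA.ST fst"
      using continuous_map_compose[OF continuous_map_fst continuous_map_from_subtopology[OF continuous_map_id[of SA.ST]]]
      by (simp add: o_def)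
    show "fst x \<in> \<D>" if "x \<in> topspace ?X" for x
      using that unfolding topspace_prod_topology topspace_subtopology by (simp only: mem_Times_iff Int_iff)
    show "continuous_map ?X SA.ST (\<lambda>x. snd x l)" if "l < j" for l
      using continuous_map_compose[OF continuous_map_snd continuous_map_product_projection[of l "{..<j}" "\<lambda>_. SA.ST"]] that
      by (simp add: o_def)
  qed
  fix \<sigma> y assume "\<sigma> \<in> SA.ST interior_of \<D>" and y: "y \<in> {..<Suc j} \<rightarrow>\<^sub>E topspace SA.ST"
  then have \<sigma>: "\<sigma> \<in> \<D>" using interior_of_subset[of SA.ST \<D>] by blast
  have "y l \<in> SA.Sec" if "l < Suc j" for l using PiE_mem[OF y, of l] that by (simp add: SA.topspace_ST)
  from dmap_has_derivative[OF \<sigma> this]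
  show "has_dir_deriv SA.E SB.E (\<lambda>z. dmap j z (restrict y {..<j})) \<sigma> (y j) (dmap (Suc j) \<sigma> y)"
    using dmap_cong[of j "restrict y {..<j}" y] by simp
qed

end

section \<open>Manifolds of mappings\<close>

lemma (in smooth_mfd) smooth_map_id: "smooth_map N N id"
  unfolding smooth_map_def
proof (intro conjI ballI)
  fix c d assume cd: "c \<in> matlas N" "d \<in> matlas N"
  show "smooth_between (cmodel c) (cmodel d) (cmap c ` (cdom c \<inter> id -` cdom d)) (cmap d \<circ> id \<circ> cinv c)"
    using transition[OF cd] by (simp add: smooth_transition_def)
qed simp

text \<open>In a chart of \<open>Y\<close> the values of \<rho> are recovered by \<open>cinv\<close>
  from members of \<open>\<F>\<close>, and composing with \<open>h\<close> keeps the form required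
  by \<open>mapping_set_superpose\<close>. Smoothness of \<open>h\<close> is asked only along maps
  through values of \<rho>, so \<open>h\<close> may be meaningful on an open part of
  \<open>Y\<close> only, like a local addition on \<Omega>.\<close>

lemma (in mapping_domain) mapping_set_compose:
  assumes Y: "target k Y" and Z: "target k' Z" and \<rho>: "\<rho> \<in> mapping_set \<U> \<F> M k Y"
    and h: "\<And>p. p \<in> MS \<Longrightarrow> h (\<rho> p) \<in> mspace_of Z"
    and sm: "\<And>p c g z. p \<in> MS \<Longrightarrow> c \<in> matlas Y \<Longrightarrow> chart_smooth c g (z :: (nat \<times> nat) \<Rightarrow>\<^sub>0 real) \<Longrightarrow> g z = \<rho> p \<Longrightarrow>
      \<exists>d\<in>matlas Z. chart_smooth d (\<lambda>w. h (g w)) z"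
  shows "compose MS h \<rho> \<in> mapping_set \<U> \<F> M k' Z"
proof (rule mapping_set_superpose[OF Z])
  show "compose MS h \<rho> \<in> MS \<rightarrow>\<^sub>E mspace_of Z" using h by (auto simp: compose_def)
  fix p assume p: "p \<in> MS"
  obtain c d where c: "c \<in> matlas M" "d \<in> matlas Y" "p \<in> cdom c" "cimage c \<in> \<U>" "\<rho> ` cdom c \<subseteq> cdom d"
    "\<And>i. i < k \<Longrightarrow> rep c d \<rho> (cimage c) i \<in> topspace (\<F> (cimage c))"
    by (rule mapping_set_local[OF Y \<rho> p]) blast
  have ch: "chart_on k (Rn k) (mtop Y) d" using Y c(2) by (simp add: target_def)
  define I where "I = {0 :: nat} \<times> {..<k}"
  define u where "u = (\<lambda>(b :: nat, i). rep c d \<rho> (cimage c) i)"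
  define g where "g z = cinv d (tup {..<k} (\<lambda>i. Poly_Mapping.lookup z (0, i)))" for z :: "(nat \<times> nat) \<Rightarrow>\<^sub>0 real"
  have I: "finite I" by (simp add: I_def)
  have um: "\<forall>i\<in>I. u i \<in> topspace (\<F> (cimage c))" using c(6) by (auto simp: I_def u_def)
  have Z0: "tup {..<k} (\<lambda>i. Poly_Mapping.lookup (tup I (\<lambda>i. u i z)) (0, i)) = cmap d (\<rho> (cinv c z))" if z: "z \<in> cimage c" for z
  proof -
    have "tup {..<k} (\<lambda>i. Poly_Mapping.lookup (tup I (\<lambda>i. u i z)) (0, i)) = tup {..<k} (\<lambda>i. rep c d \<rho> (cimage c) i z)"
      using I by (intro tup_cong) (simp add: lookup_tup u_def I_def)
    also have "\<dots> = cmap d (\<rho> (cinv c z))" by (rule tup_rep[OF Y c(2,1,5) z order_refl])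
    finally show ?thesis .
  qed
  have x: "cinv c z \<in> MS" "\<rho> (cinv c z) \<in> cdom d" if z: "z \<in> cimage c" for z
    using cinv_in_cdom[OF M_inj[OF c(1)] z] c(5) M_dom_subset[OF c(1)] by blast+
  have eq: "g (tup I (\<lambda>i. u i z)) = \<rho> (cinv c z)" if z: "z \<in> cimage c" for z
    unfolding g_def Z0[OF z] by (rule cinv_cmap[OF chart_on.inj[OF ch] x(2)[OF z]])
  have pc: "cmap c p \<in> cimage c" by (rule cmap_in_cimage[OF c(3)])
  have "chart_smooth d g (tup I (\<lambda>i. u i (cmap c p)))"
    unfolding g_def[abs_def]
    by (rule chart_smooth_cinv[OF ch smooth_at_lookup]) (simp only: Z0[OF pc] cmap_in_cimage[OF x(2)[OF pc]])
  moreover have "g (tup I (\<lambda>i. u i (cmap c p))) = \<rho> p"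
    unfolding eq[OF pc] by (simp only: cinv_cmap[OF M_inj[OF c(1)] c(3)])
  ultimately obtain d' where d': "d' \<in> matlas Z" "chart_smooth d' (\<lambda>w. h (g w)) (tup I (\<lambda>i. u i (cmap c p)))"
    using sm[OF p c(2)] by blast
  have eq': "\<forall>z\<in>cimage c. compose MS h \<rho> (cinv c z) = h (g (tup I (\<lambda>i. u i z)))"
    by (simp add: compose_def x eq)
  show "\<exists>c d W I u g. c \<in> matlas M \<and> d \<in> matlas Z \<and> p \<in> cdom c \<and> W \<in> \<U> \<and>
      cmap c p \<in> W \<and> W \<subseteq> cimage c \<and> finite (I :: (nat \<times> nat) set) \<and> (\<forall>i\<in>I. u i \<in> topspace (\<F> W)) \<and>
      chart_smooth d g (tup I (\<lambda>i. u i (cmap c p))) \<and> (\<forall>z\<in>W. compose MS h \<rho> (cinv c z) = g (tup I (\<lambda>i. u i z)))"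
    by (intro exI[of _ c] exI[of _ d'] exI[of _ "cimage c"] exI[of _ I] exI[of _ u] exI[of _ "\<lambda>z. h (g z)"] conjI
        c(1) d' c(3,4) pc order_refl I um eq')
qed

text \<open>\<gamma> and \<xi> are read on a common chart of \<open>M\<close>, and their coordinates
  form the two blocks handed to \<open>mapping_set_superpose\<close>. The application takes the
  inverse of \<open>\<theta>\<close> for \<open>h\<close>.\<close>

lemma (in section_space) mapping_set_pair:
  assumes Z: "target k' Z" and \<xi>: "\<xi> \<in> mapping_set \<U> \<F> M n N"
    and h: "\<And>p. p \<in> MS \<Longrightarrow> h (\<gamma> p, \<xi> p) \<in> mspace_of Z"
    and sm: "\<And>p c d g g' z. p \<in> MS \<Longrightarrow> c \<in> matlas N \<Longrightarrow> d \<in> matlas N \<Longrightarrow> chart_smooth c g (z :: (nat \<times> nat) \<Rightarrow>\<^sub>0 real) \<Longrightarrow>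
      chart_smooth d g' z \<Longrightarrow> g z = \<gamma> p \<Longrightarrow> g' z = \<xi> p \<Longrightarrow> \<exists>e\<in>matlas Z. chart_smooth e (\<lambda>w. h (g w, g' w)) z"
  shows "(\<lambda>x\<in>MS. h (\<gamma> x, \<xi> x)) \<in> mapping_set \<U> \<F> M k' Z"
proof (rule mapping_set_superpose[OF Z])
  show "(\<lambda>x\<in>MS. h (\<gamma> x, \<xi> x)) \<in> MS \<rightarrow>\<^sub>E mspace_of Z" using h by auto
  fix p assume p: "p \<in> MS"
  obtain d where d: "d \<in> matlas N" "\<gamma> p \<in> cdom d" by (rule chart_at[OF \<gamma>_space[OF p]])
  have "\<xi> p \<in> mspace_of N" using mapping_set_PiE[OF \<xi>] p by auto
  then obtain e where e: "e \<in> matlas N" "\<xi> p \<in> cdom e" by (rule chart_at)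
  have o: "openin (mtop M) {x \<in> MS. \<xi> x \<in> cdom e}"
    by (rule openin_continuous_map_preimage[OF mapping_set_continuous[OF target_N \<xi>] dom_open[OF e(1)]])
  have p': "p \<in> {x \<in> MS. \<xi> x \<in> cdom e}" using p e(2) by simp
  obtain c W where c: "c \<in> matlas M" "p \<in> cdom c" "cdom c \<subseteq> {x \<in> MS. \<xi> x \<in> cdom e}" and a: "allowed c d W" and W: "cmap c p \<in> W"
    by (rule local_data[OF p d o p'])
  have Wc: "W \<in> \<U>" "rc W (cimage c)" "\<gamma> ` cdom c \<subseteq> cdom d" using a by (simp_all add: allowed_def)
  have Wi: "W \<subseteq> cimage c" by (rule rc_subset[OF Wc(1,2)])
  have \<xi>c: "\<xi> ` cdom c \<subseteq> cdom e" using c(3) by blast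
  have r\<xi>: "rep c e \<xi> W i \<in> topspace (\<F> W)" for i
    by (rule mapping_set_regular[OF target_N \<xi> c(1) e(1) transition[OF _ e(1)] \<xi>c Wc(1,2)])
  define I where "I = {..<2 :: nat} \<times> {..<n}"
  define u where "u = (\<lambda>(b :: nat, i). if b = 0 then rep c d \<gamma> W i else rep c e \<xi> W i)"
  define g where "g z = cinv d (tup {..<n} (\<lambda>i. Poly_Mapping.lookup z (0, i)))" for z :: "(nat \<times> nat) \<Rightarrow>\<^sub>0 real"
  define g' where "g' z = cinv e (tup {..<n} (\<lambda>i. Poly_Mapping.lookup z (1, i)))" for z :: "(nat \<times> nat) \<Rightarrow>\<^sub>0 real"
  have I: "finite I" by (simp add: I_def)
  have um: "\<forall>i\<in>I. u i \<in> topspace (\<F> W)" using r\<xi> \<gamma>_rep_mem[OF a] by (auto simp: I_def u_def)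
  have Z0: "tup {..<n} (\<lambda>i. Poly_Mapping.lookup (tup I (\<lambda>i. u i z)) (0, i)) = cmap d (\<gamma> (cinv c z))"
    and Z1: "tup {..<n} (\<lambda>i. Poly_Mapping.lookup (tup I (\<lambda>i. u i z)) (1, i)) = cmap e (\<xi> (cinv c z))" if z: "z \<in> W" for z
  proof -
    have "tup {..<n} (\<lambda>i. Poly_Mapping.lookup (tup I (\<lambda>i. u i z)) (0, i)) = tup {..<n} (\<lambda>i. rep c d \<gamma> W i z)"
      using I by (intro tup_cong) (simp add: lookup_tup u_def I_def)
    also have "\<dots> = cmap d (\<gamma> (cinv c z))" by (rule tup_rep[OF target_N d(1) c(1) Wc(3) z Wi])
    finally show "tup {..<n} (\<lambda>i. Poly_Mapping.lookup (tup I (\<lambda>i. u i z)) (0, i)) = cmap d (\<gamma> (cinv c z))" .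
    have "tup {..<n} (\<lambda>i. Poly_Mapping.lookup (tup I (\<lambda>i. u i z)) (1, i)) = tup {..<n} (\<lambda>i. rep c e \<xi> W i z)"
      using I by (intro tup_cong) (simp add: lookup_tup u_def I_def)
    also have "\<dots> = cmap e (\<xi> (cinv c z))" by (rule tup_rep[OF target_N e(1) c(1) \<xi>c z Wi])
    finally show "tup {..<n} (\<lambda>i. Poly_Mapping.lookup (tup I (\<lambda>i. u i z)) (1, i)) = cmap e (\<xi> (cinv c z))" .
  qed
  have x: "cinv c z \<in> MS" "\<gamma> (cinv c z) \<in> cdom d" "\<xi> (cinv c z) \<in> cdom e" if z: "z \<in> W" for z
    using allowed_point[OF a z] c(3) by blast+
  have eq: "g (tup I (\<lambda>i. u i z)) = \<gamma> (cinv c z)" "g' (tup I (\<lambda>i. u i z)) = \<xi> (cinv c z)" if z: "z \<in> W" for z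
    unfolding g_def g'_def Z0[OF z] Z1[OF z]
    by (rule cinv_cmap[OF inj[OF d(1)] x(2)[OF z]], rule cinv_cmap[OF inj[OF e(1)] x(3)[OF z]])
  have gs: "chart_smooth d g (tup I (\<lambda>i. u i (cmap c p)))"
    unfolding g_def[abs_def]
    by (rule chart_smooth_cinv[OF chart_on[OF d(1)] smooth_at_lookup]) (simp only: Z0[OF W] cmap_in_cimage[OF x(2)[OF W]])
  have gs': "chart_smooth e g' (tup I (\<lambda>i. u i (cmap c p)))"
    unfolding g'_def[abs_def]
    by (rule chart_smooth_cinv[OF chart_on[OF e(1)] smooth_at_lookup]) (simp only: Z1[OF W] cmap_in_cimage[OF x(3)[OF W]])
  have pp: "cinv c (cmap c p) = p" by (rule cinv_cmap[OF M_inj[OF c(1)] c(2)])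
  obtain d' where d': "d' \<in> matlas Z" "chart_smooth d' (\<lambda>w. h (g w, g' w)) (tup I (\<lambda>i. u i (cmap c p)))"
    using sm[OF p d(1) e(1) gs gs' eq[OF W, unfolded pp]] by blast
  have eq': "\<forall>z\<in>W. (\<lambda>x\<in>MS. h (\<gamma> x, \<xi> x)) (cinv c z) = h (g (tup I (\<lambda>i. u i z)), g' (tup I (\<lambda>i. u i z)))"
    by (simp add: x eq)
  show "\<exists>c d W I u g. c \<in> matlas M \<and> d \<in> matlas Z \<and> p \<in> cdom c \<and> W \<in> \<U> \<and>
      cmap c p \<in> W \<and> W \<subseteq> cimage c \<and> finite (I :: (nat \<times> nat) set) \<and> (\<forall>i\<in>I. u i \<in> topspace (\<F> W)) \<and>
      chart_smooth d g (tup I (\<lambda>i. u i (cmap c p))) \<and> (\<forall>z\<in>W. (\<lambda>x\<in>MS. h (\<gamma> x, \<xi> x)) (cinv c z) = g (tup I (\<lambda>i. u i z)))"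
    by (intro exI[of _ c] exI[of _ d'] exI[of _ W] exI[of _ I] exI[of _ u] exI[of _ "\<lambda>z. h (g z, g' z)"] conjI
        c(1,2) d' Wc(1) W Wi I um eq')
qed

section \<open>The charts and the topology of a manifold of mappings\<close>

locale mapping_charts = mapping_domain m \<U> \<F> M + local_add n N \<Omega> \<Sigma>
  for m \<U> \<F> and M :: "('a, vec) manifold" and n and N :: "('y, vec) manifold" and \<Omega> \<Sigma>
begin

abbreviation Map :: "('a \<Rightarrow> 'y) set" where
  "Map \<equiv> mapping_set \<U> \<F> M n N"

abbreviation mc :: "('a \<Rightarrow> 'y) \<Rightarrow> ('a \<Rightarrow> 'y, 'a \<Rightarrow> 'y tvec) chart" where
  "mc \<equiv> mapping_chart m \<U> \<F> M n N \<Omega> \<Sigma>"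

abbreviation MM :: "('a \<Rightarrow> 'y, 'a \<Rightarrow> 'y tvec) manifold" where
  "MM \<equiv> mapping_manifold m \<U> \<F> M n N \<Omega> \<Sigma>"

definition V :: "('a \<Rightarrow> 'y) \<Rightarrow> ('a \<Rightarrow> 'y tvec) set" where
  "V \<gamma> = {\<sigma> \<in> section_set \<U> \<F> M n N \<gamma>. \<sigma> ` MS \<subseteq> \<Omega>}"

lemma section_spaceI: "\<gamma> \<in> Map \<Longrightarrow> section_space m \<U> \<F> M n N \<gamma>"
  by unfold_locales

lemma cdom_mc: "cdom (mc \<gamma>) = {\<xi> \<in> Map. \<forall>x\<in>MS. (\<gamma> x, \<xi> x) \<in> \<Omega>'}"
  by (simp add: mapping_chart_def Let_def \<theta>_eq image_subset_iff)

text \<open>With \<open>lift\<close> and \<open>inj_ev\<close> this gives the bijection from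
  \<open>V \<gamma>\<close> onto \<open>cdom (mc \<gamma>)\<close>, composition with
  \<Sigma>.\<close>

lemma ev_cdom:
  assumes \<gamma>: "\<gamma> \<in> Map" and \<sigma>: "\<sigma> \<in> V \<gamma>"
  shows "compose MS \<Sigma> \<sigma> \<in> cdom (mc \<gamma>)"
proof -
  interpret section_space m \<U> \<F> M n N \<gamma> by (rule section_spaceI[OF \<gamma>])
  have \<sigma>S: "\<sigma> \<in> Sec" and \<sigma>\<Omega>: "\<And>x. x \<in> MS \<Longrightarrow> \<sigma> x \<in> \<Omega>" using \<sigma> by (auto simp: V_def)
  have "compose MS \<Sigma> \<sigma> \<in> Map"
  proof (rule mapping_set_compose[OF target_TN target_N Sec_mem(1)[OF \<sigma>S]])
    show "\<Sigma> (\<sigma> p) \<in> mspace_of N" if "p \<in> MS" for p by (rule \<Sigma>_space[OF \<sigma>\<Omega>[OF that]])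
    fix p c g and z :: "(nat \<times> nat) \<Rightarrow>\<^sub>0 real"
    assume p: "p \<in> MS" and c: "c \<in> matlas (tangent_bundle n N)" "chart_smooth c g z" and g: "g z = \<sigma> p"
    obtain d where d: "d \<in> matlas N" "\<gamma> p \<in> cdom d" by (rule chart_at[OF \<gamma>_space[OF p]])
    have cc: "chart_on (2 * n) (Rn (2 * n)) TT c" using target_TN c(1) by (simp add: target_def)
    have s: "chart_smooth (tc d) g z"
      by (rule chart_smooth_transition[OF cc tc_chart_on[OF d(1)] TN_transition[OF d(1) c(1)] c(2)])
        (simp only: g Sec_in_tc[OF \<sigma>S p d])
    obtain e where e: "e \<in> matlas N" "\<Sigma> (\<sigma> p) \<in> cdom e" by (rule chart_at[OF \<Sigma>_space[OF \<sigma>\<Omega>[OF p]]])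
    have "chart_smooth e (\<lambda>w. \<Sigma> (g w)) z"
      by (rule chart_smooth_\<Sigma>[OF d(1) e(1) s]) (simp_all only: g \<sigma>\<Omega>[OF p] e(2))
    then show "\<exists>d\<in>matlas N. chart_smooth d (\<lambda>w. \<Sigma> (g w)) z" using e(1) by blast
  qed
  moreover have "(\<gamma> x, compose MS \<Sigma> \<sigma> x) \<in> \<Omega>'" if x: "x \<in> MS" for x
    using imageI[OF \<sigma>\<Omega>[OF x], of \<theta>] Sec_mem(3)[OF \<sigma>S x] x by (simp add: \<theta>_def compose_def)
  ultimately show ?thesis by (simp add: cdom_mc)
qed

lemma lift:
  assumes \<gamma>: "\<gamma> \<in> Map" and \<xi>: "\<xi> \<in> cdom (mc \<gamma>)"
  shows "(\<lambda>x\<in>MS. \<theta>inv (\<gamma> x, \<xi> x)) \<in> V \<gamma>" "compose MS \<Sigma> (\<lambda>x\<in>MS. \<theta>inv (\<gamma> x, \<xi> x)) = \<xi>"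
proof -
  interpret section_space m \<U> \<F> M n N \<gamma> by (rule section_spaceI[OF \<gamma>])
  have \<xi>M: "\<xi> \<in> Map" and \<Omega>: "\<And>x. x \<in> MS \<Longrightarrow> (\<gamma> x, \<xi> x) \<in> \<Omega>'" using \<xi> by (auto simp: cdom_mc)
  have "(\<lambda>x\<in>MS. \<theta>inv (\<gamma> x, \<xi> x)) \<in> mapping_set \<U> \<F> M (2 * n) (tangent_bundle n N)"
  proof (rule mapping_set_pair[OF target_TN \<xi>M])
    show "\<theta>inv (\<gamma> p, \<xi> p) \<in> mspace_of (tangent_bundle n N)" if "p \<in> MS" for p
      using \<theta>inv_in[OF \<Omega>[OF that]] \<Omega>_subset by (auto simp: TT_topspace)
    fix p c d g g' and z :: "(nat \<times> nat) \<Rightarrow>\<^sub>0 real"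
    assume p: "p \<in> MS" and c: "c \<in> matlas N" "d \<in> matlas N" and g: "chart_smooth c g z" "chart_smooth d g' z"
      "g z = \<gamma> p" "g' z = \<xi> p"
    have "chart_smooth (tc c) (\<lambda>w. \<theta>inv (g w, g' w)) z"
      by (rule chart_smooth_\<theta>inv[OF c g(1,2)]) (simp only: g(3,4) \<Omega>[OF p])
    then show "\<exists>e\<in>matlas (tangent_bundle n N). chart_smooth e (\<lambda>w. \<theta>inv (g w, g' w)) z"
      using tc_in_atlas[OF c(1)] by blast
  qed
  then have "(\<lambda>x\<in>MS. \<theta>inv (\<gamma> x, \<xi> x)) \<in> Sec" by (rule SecI) (simp add: fst_\<theta>inv \<Omega>)
  then show "(\<lambda>x\<in>MS. \<theta>inv (\<gamma> x, \<xi> x)) \<in> V \<gamma>" using \<theta>inv_in[OF \<Omega>] by (auto simp: V_def)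
  show "compose MS \<Sigma> (\<lambda>x\<in>MS. \<theta>inv (\<gamma> x, \<xi> x)) = \<xi>"
  proof
    fix x show "compose MS \<Sigma> (\<lambda>x\<in>MS. \<theta>inv (\<gamma> x, \<xi> x)) x = \<xi> x"
      using \<Sigma>_\<theta>inv[OF \<Omega>, of x] PiE_arb[OF mapping_set_PiE[OF \<xi>M], of x] by (simp add: compose_def restrict_def)
  qed
qed

lemma inj_ev:
  assumes "\<gamma> \<in> Map"
  shows "inj_on (compose MS \<Sigma>) (V \<gamma>)"
proof
  interpret section_space m \<U> \<F> M n N \<gamma> by (rule section_spaceI[OF assms])
  fix \<sigma> \<tau> assume \<sigma>: "\<sigma> \<in> V \<gamma>" and \<tau>: "\<tau> \<in> V \<gamma>" and eq: "compose MS \<Sigma> \<sigma> = compose MS \<Sigma> \<tau>"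
  have S: "\<sigma> \<in> Sec" "\<tau> \<in> Sec" using \<sigma> \<tau> by (simp_all add: V_def)
  show "\<sigma> = \<tau>"
  proof (rule extensionalityI[OF Sec_mem(2)[OF S(1)] Sec_mem(2)[OF S(2)]])
    fix x assume x: "x \<in> MS"
    have "\<theta> (\<sigma> x) = \<theta> (\<tau> x)"
      using fun_cong[OF eq, of x] x Sec_mem(3)[OF S(1) x] Sec_mem(3)[OF S(2) x] by (simp add: compose_def \<theta>_def)
    moreover have "\<sigma> x \<in> \<Omega>" "\<tau> x \<in> \<Omega>" using \<sigma> \<tau> x by (auto simp: V_def)
    ultimately show "\<sigma> x = \<tau> x" by (rule inj_onD[OF \<theta>_inj])
  qed
qed

lemma cmap_mc_eq: "cmap (mc \<gamma>) = restrict (the_inv_into (V \<gamma>) (compose MS \<Sigma>)) (cdom (mc \<gamma>))"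
  by (simp add: mapping_chart_def Let_def V_def)

lemma cmap_mc:
  assumes "\<gamma> \<in> Map" "\<xi> \<in> cdom (mc \<gamma>)"
  shows "cmap (mc \<gamma>) \<xi> = (\<lambda>x\<in>MS. \<theta>inv (\<gamma> x, \<xi> x))"
  unfolding cmap_mc_eq using the_inv_into_f_eq[OF inj_ev[OF assms(1)] lift(2,1)[OF assms]] assms(2) by simp

lemma cmap_ev:
  assumes "\<gamma> \<in> Map" "\<sigma> \<in> V \<gamma>"
  shows "cmap (mc \<gamma>) (compose MS \<Sigma> \<sigma>) = \<sigma>"
  unfolding cmap_mc_eq using the_inv_into_f_f[OF inj_ev[OF assms(1)] assms(2)] ev_cdom[OF assms] by simp

lemma inj_mc:
  assumes "\<gamma> \<in> Map"
  shows "inj_on (cmap (mc \<gamma>)) (cdom (mc \<gamma>))"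
  by (rule inj_on_inverseI[where g = "compose MS \<Sigma>"]) (simp only: cmap_mc[OF assms] lift(2)[OF assms])

text \<open>The atlas topology tests openness on these images; the right-hand side avoids the
  inverse of composition with \<Sigma>.\<close>

lemma image_mc:
  assumes "\<gamma> \<in> Map"
  shows "cmap (mc \<gamma>) ` (cdom (mc \<gamma>) \<inter> W) = {\<sigma> \<in> V \<gamma>. compose MS \<Sigma> \<sigma> \<in> W}"
proof (intro equalityI subsetI)
  fix \<sigma> assume "\<sigma> \<in> cmap (mc \<gamma>) ` (cdom (mc \<gamma>) \<inter> W)"
  then obtain \<xi> where \<xi>: "\<xi> \<in> cdom (mc \<gamma>)" "\<xi> \<in> W" "\<sigma> = cmap (mc \<gamma>) \<xi>" by blast
  then show "\<sigma> \<in> {\<sigma> \<in> V \<gamma>. compose MS \<Sigma> \<sigma> \<in> W}"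
    using lift[OF assms \<xi>(1)] by (simp add: cmap_mc[OF assms])
next
  fix \<sigma> assume "\<sigma> \<in> {\<sigma> \<in> V \<gamma>. compose MS \<Sigma> \<sigma> \<in> W}"
  then have "\<sigma> = cmap (mc \<gamma>) (compose MS \<Sigma> \<sigma>)" "compose MS \<Sigma> \<sigma> \<in> cdom (mc \<gamma>) \<inter> W"
    using cmap_ev[OF assms] ev_cdom[OF assms] by auto
  then show "\<sigma> \<in> cmap (mc \<gamma>) ` (cdom (mc \<gamma>) \<inter> W)" by (rule image_eqI)
qed

lemma cinv_mc:
  assumes "\<gamma> \<in> Map" "\<sigma> \<in> V \<gamma>"
  shows "cinv (mc \<gamma>) \<sigma> = compose MS \<Sigma> \<sigma>"
  using cinv_cmap[OF inj_mc[OF assms(1)] ev_cdom[OF assms]] by (simp only: cmap_ev[OF assms])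

lemma cmodel_mc: "cmodel (mc \<gamma>) = section_lcs m \<U> \<F> M n N \<gamma>"
  by (simp add: mapping_chart_def Let_def)

text \<open>The case \<open>f = id\<close>, \<eta> = \<gamma> of \<open>mapping_pair\<close>: for a
  section \<sigma> over \<gamma>, admissibility of its value at x says only that this value lies in
  \<Omega>, so \<D> becomes \<open>V \<gamma>\<close>.\<close>

lemma open_V:
  assumes "\<gamma> \<in> Map"
  shows "openin (section_topology m \<U> \<F> M n N \<gamma>) (V \<gamma>)"
proof -
  interpret section_space m \<U> \<F> M n N \<gamma> by (rule section_spaceI[OF assms])
  interpret P: mapping_pair m \<U> \<F> M n N \<gamma> n N \<gamma> \<Omega> \<Sigma> \<Omega> \<Sigma> id
    by unfold_locales (rule smooth_map_id)
  have "(\<gamma> x, \<Sigma> (\<sigma> x)) \<in> \<Omega>'" if "\<sigma> \<in> Sec" "x \<in> MS" "\<sigma> x \<in> \<Omega>" for \<sigma> x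
    using imageI[OF that(3), of \<theta>] Sec_mem(3)[OF that(1,2)] by (simp add: \<theta>_def)
  then have "P.\<D> = V \<gamma>" unfolding P.\<D>_def P.admissible_def V_def by auto
  then show ?thesis using P.open_\<D> by simp
qed

lemma openin_MM:
  "openin (mtop MM) W \<longleftrightarrow> W \<subseteq> Map \<and>
    (\<forall>\<gamma>\<in>Map. openin (section_topology m \<U> \<F> M n N \<gamma>) {\<sigma> \<in> V \<gamma>. compose MS \<Sigma> \<sigma> \<in> W})"
proof -
  have "openin (mtop MM) W \<longleftrightarrow> W \<subseteq> Map \<and> (\<forall>c\<in>mc ` Map. openin (lcs_top (cmodel c)) (cmap c ` (W \<inter> cdom c)))"
    unfolding mapping_manifold_def Let_def manifold.simps
    by (rule openin_atlas_topology) (auto intro: inj_mc)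
  also have "\<dots> \<longleftrightarrow> W \<subseteq> Map \<and>
    (\<forall>\<gamma>\<in>Map. openin (section_topology m \<U> \<F> M n N \<gamma>) {\<sigma> \<in> V \<gamma>. compose MS \<Sigma> \<sigma> \<in> W})"
    by (simp add: image_mc[symmetric] Int_commute cmodel_mc section_lcs_def)
  finally show ?thesis .
qed

lemma topspace_MM: "topspace (mtop MM) = Map"
proof -
  have "{\<sigma> \<in> V \<gamma>. compose MS \<Sigma> \<sigma> \<in> Map} = V \<gamma>" if "\<gamma> \<in> Map" for \<gamma>
    using ev_cdom[OF that] by (auto simp: cdom_mc)
  then have "openin (mtop MM) Map" unfolding openin_MM using open_V by simp
  then show ?thesis using openin_MM openin_subset[of "mtop MM" Map] openin_topspace[of "mtop MM"] by blast
qed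

lemma matlas_MM: "matlas MM = mc ` Map"
  by (simp add: mapping_manifold_def Let_def)

text \<open>The pair \<open>(\<gamma> x, \<gamma> x)\<close> is the image under
  \<open>\<theta>\<close> of the zero vector at \<gamma> x.\<close>

lemma self_mem: "\<gamma> \<in> Map \<Longrightarrow> \<gamma> \<in> cdom (mc \<gamma>)"
  unfolding cdom_mc
proof (intro CollectI conjI ballI)
  fix x assume "\<gamma> \<in> Map" "x \<in> MS"
  then have "\<gamma> x \<in> mspace_of N" using mapping_set_PiE by (auto simp: PiE_iff)
  then show "(\<gamma> x, \<gamma> x) \<in> \<Omega>'"
    using imageI[OF zero_in, of "\<gamma> x" \<theta>] \<Sigma>_zero[of "\<gamma> x"] by (simp add: \<theta>_def zero_vec_def)
qed

end

section \<open>The composition map in charts\<close>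

locale mapping_composition = C1: mapping_charts m \<U> \<F> M n\<^sub>1 N\<^sub>1 \<Omega>\<^sub>1 \<Sigma>\<^sub>1 + C2: mapping_charts m \<U> \<F> M n\<^sub>2 N\<^sub>2 \<Omega>\<^sub>2 \<Sigma>\<^sub>2
  for m \<U> \<F> and M :: "('a, vec) manifold" and n\<^sub>1 and N\<^sub>1 :: "('b, vec) manifold" and \<Omega>\<^sub>1 \<Sigma>\<^sub>1
    and n\<^sub>2 and N\<^sub>2 :: "('c, vec) manifold" and \<Omega>\<^sub>2 \<Sigma>\<^sub>2 +
  fixes f :: "'b \<Rightarrow> 'c"
  assumes f: "smooth_map N\<^sub>1 N\<^sub>2 f"
begin

abbreviation F :: "('a \<Rightarrow> 'b) \<Rightarrow> 'a \<Rightarrow> 'c" where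
  "F \<equiv> compose (mspace_of M) f"

lemma F_Map:
  assumes \<gamma>: "\<gamma> \<in> C1.Map"
  shows "F \<gamma> \<in> C2.Map"
proof (rule C1.mapping_set_compose[OF _ _ \<gamma>])
  show "C1.target n\<^sub>1 N\<^sub>1" by (rule section_space.target_N[OF C1.section_spaceI[OF \<gamma>]])
  show t: "C1.target n\<^sub>2 N\<^sub>2" unfolding C1.target_def using C2.chart_on C2.dom_subset by blast
  show sp: "f (\<gamma> p) \<in> mspace_of N\<^sub>2" if "p \<in> mspace_of M" for p
    using C1.mapping_set_PiE[OF \<gamma>] that f by (auto simp: smooth_map_def continuous_map_def)
  fix p c g and z :: "(nat \<times> nat) \<Rightarrow>\<^sub>0 real"
  assume p: "p \<in> mspace_of M" and c: "c \<in> matlas N\<^sub>1" "chart_smooth c g z" and g: "g z = \<gamma> p"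
  obtain d where d: "d \<in> matlas N\<^sub>2" "f (\<gamma> p) \<in> cdom d" by (rule C2.chart_at[OF sp[OF p]])
  have "chart_smooth d (\<lambda>w. f (g w)) z"
    by (rule chart_smooth_map[OF C1.chart_on[OF c(1)] c(1) d(1) chart_on.model[OF C2.chart_on[OF d(1)]]
          C2.dom_open[OF d(1)] f c(2)]) (simp only: g d(2))
  then show "\<exists>d\<in>matlas N\<^sub>2. chart_smooth d (\<lambda>w. f (g w)) z" using d(1) by blast
qed

text \<open>For arbitrary \<gamma> and \<eta>, \<open>D\<close> is the set \<D> of
  \<open>mapping_pair\<close> and \<Phi> agrees on it with \<open>section_map\<close>, so the
  results on spaces of sections carry over.\<close>

lemma local_representative:
  assumes \<gamma>: "\<gamma> \<in> C1.Map" and \<eta>: "\<eta> \<in> C2.Map"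
  defines "D \<equiv> {\<sigma> \<in> C1.V \<gamma>. F (compose (mspace_of M) \<Sigma>\<^sub>1 \<sigma>) \<in> cdom (C2.mc \<eta>)}"
    and "\<Phi> \<equiv> \<lambda>\<sigma>. cmap (C2.mc \<eta>) (F (compose (mspace_of M) \<Sigma>\<^sub>1 \<sigma>))"
  shows "openin (section_topology m \<U> \<F> M n\<^sub>1 N\<^sub>1 \<gamma>) D"
    "smooth_between (section_lcs m \<U> \<F> M n\<^sub>1 N\<^sub>1 \<gamma>) (section_lcs m \<U> \<F> M n\<^sub>2 N\<^sub>2 \<eta>) D \<Phi>"
    "continuous_map (subtopology (section_topology m \<U> \<F> M n\<^sub>1 N\<^sub>1 \<gamma>) D) (section_topology m \<U> \<F> M n\<^sub>2 N\<^sub>2 \<eta>) \<Phi>"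
proof -
  interpret SA: section_space m \<U> \<F> M n\<^sub>1 N\<^sub>1 \<gamma> by (rule C1.section_spaceI[OF \<gamma>])
  interpret SB: section_space m \<U> \<F> M n\<^sub>2 N\<^sub>2 \<eta> by (rule C2.section_spaceI[OF \<eta>])
  interpret P: mapping_pair m \<U> \<F> M n\<^sub>1 N\<^sub>1 \<gamma> n\<^sub>2 N\<^sub>2 \<eta> \<Omega>\<^sub>1 \<Sigma>\<^sub>1 \<Omega>\<^sub>2 \<Sigma>\<^sub>2 f
    by unfold_locales (rule f)
  have D: "D = P.\<D>"
  proof -
    have "F (compose (mspace_of M) \<Sigma>\<^sub>1 \<sigma>) \<in> C2.Map" if "\<sigma> \<in> C1.V \<gamma>" for \<sigma>
      using F_Map C1.ev_cdom[OF \<gamma> that] by (simp add: C1.cdom_mc)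
    then show ?thesis
      unfolding D_def P.\<D>_def P.admissible_def C2.cdom_mc by (auto simp: C1.V_def compose_def)
  qed
  have \<Phi>: "\<Phi> \<sigma> = P.section_map \<sigma>" if "\<sigma> \<in> D" for \<sigma>
  proof -
    have "F (compose (mspace_of M) \<Sigma>\<^sub>1 \<sigma>) \<in> cdom (C2.mc \<eta>)" using that by (simp add: D_def)
    from C2.cmap_mc[OF \<eta> this] show ?thesis
      unfolding \<Phi>_def P.section_map_def P.H_def by (simp add: compose_def cong: restrict_cong)
  qed
  show "openin SA.ST D" unfolding D by (rule P.open_\<D>)
  show "smooth_between SA.E SB.E D \<Phi>"
    by (rule smooth_between_subset_cong[OF P.smooth_section_map]) (simp_all add: \<Phi> D)
  have "continuous_map (subtopology SA.ST D) SB.ST (\<lambda>\<sigma>. P.dmap 0 \<sigma> undefined)"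
  proof (rule P.continuous_map_dmap)
    show "continuous_map (subtopology SA.ST D) SA.ST (\<lambda>\<sigma>. \<sigma>)"
      using continuous_map_from_subtopology[OF continuous_map_id[of SA.ST]] by (simp add: id_def)
  qed (simp_all add: D)
  then show "continuous_map (subtopology SA.ST D) SB.ST \<Phi>"
    by (rule continuous_map_eq) (simp add: P.dmap_0 \<Phi> flip: D)
qed

lemma F_continuous: "continuous_map (mtop C1.MM) (mtop C2.MM) F"
  unfolding continuous_map_def C1.topspace_MM C2.topspace_MM
proof (intro conjI allI impI)
  show "F \<in> C1.Map \<rightarrow> C2.Map" using F_Map by blast
  fix W assume "openin (mtop C2.MM) W"
  then have W: "\<And>\<eta>. \<eta> \<in> C2.Map \<Longrightarrow>
      openin (section_topology m \<U> \<F> M n\<^sub>2 N\<^sub>2 \<eta>) {\<sigma> \<in> C2.V \<eta>. compose (mspace_of M) \<Sigma>\<^sub>2 \<sigma> \<in> W}"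
    by (simp add: C2.openin_MM)
  let ?P = "{\<gamma> \<in> C1.Map. F \<gamma> \<in> W}"
  show "openin (mtop C1.MM) ?P"
    unfolding C1.openin_MM
  proof (intro conjI ballI)
    fix \<gamma> assume \<gamma>: "\<gamma> \<in> C1.Map"
    let ?ST = "section_topology m \<U> \<F> M n\<^sub>1 N\<^sub>1 \<gamma>" and ?ev = "compose (mspace_of M) \<Sigma>\<^sub>1"
    show "openin ?ST {\<sigma> \<in> C1.V \<gamma>. ?ev \<sigma> \<in> ?P}"
    proof (subst openin_subopen, intro ballI)
      fix \<sigma> assume "\<sigma> \<in> {\<sigma> \<in> C1.V \<gamma>. ?ev \<sigma> \<in> ?P}"
      then have \<sigma>: "\<sigma> \<in> C1.V \<gamma>" "F (?ev \<sigma>) \<in> W" "F (?ev \<sigma>) \<in> C2.Map" using F_Map by auto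
      \<comment> \<open>The target chart is the one at the image of the point considered, so that
        this point lies in the domain \<open>?D\<close> of the local representative.\<close>
      define \<eta> where "\<eta> = F (?ev \<sigma>)"
      have \<eta>: "\<eta> \<in> C2.Map" by (simp only: \<eta>_def \<sigma>(3))
      let ?D = "{\<sigma> \<in> C1.V \<gamma>. F (?ev \<sigma>) \<in> cdom (C2.mc \<eta>)}" and ?\<Phi> = "\<lambda>\<sigma>. cmap (C2.mc \<eta>) (F (?ev \<sigma>))"
      let ?T = "{\<sigma> \<in> topspace (subtopology ?ST ?D). ?\<Phi> \<sigma> \<in> {\<sigma> \<in> C2.V \<eta>. compose (mspace_of M) \<Sigma>\<^sub>2 \<sigma> \<in> W}}"
      have "openin (subtopology ?ST ?D) ?T"
        by (rule openin_continuous_map_preimage[OF local_representative(3)[OF \<gamma> \<eta>] W[OF \<eta>]])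
      then have o: "openin ?ST ?T" by (rule openin_trans_full[OF _ local_representative(1)[OF \<gamma> \<eta>]])
      have T: "?T = {\<sigma> \<in> ?D. F (?ev \<sigma>) \<in> W}"
        using C2.lift[OF \<eta>] C2.cmap_mc[OF \<eta>] openin_subset[OF local_representative(1)[OF \<gamma> \<eta>]] by auto
      show "\<exists>T. openin ?ST T \<and> \<sigma> \<in> T \<and> T \<subseteq> {\<sigma> \<in> C1.V \<gamma>. ?ev \<sigma> \<in> ?P}"
      proof (rule exI[of _ ?T], intro conjI o)
        show "\<sigma> \<in> ?T" unfolding T using \<sigma>(1,2) C2.self_mem[OF \<eta>] by (simp add: \<eta>_def)
        show "?T \<subseteq> {\<sigma> \<in> C1.V \<gamma>. ?ev \<sigma> \<in> ?P}"
          unfolding T using C1.ev_cdom[OF \<gamma>] by (auto simp: C1.cdom_mc)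
      qed
    qed
  qed blast
qed

lemma F_smooth: "smooth_map C1.MM C2.MM F"
  unfolding smooth_map_def C1.matlas_MM C2.matlas_MM
proof (intro conjI ballI F_continuous)
  fix c d assume "c \<in> C1.mc ` C1.Map" "d \<in> C2.mc ` C2.Map"
  then obtain \<gamma> \<eta> where \<gamma>: "\<gamma> \<in> C1.Map" "c = C1.mc \<gamma>" and \<eta>: "\<eta> \<in> C2.Map" "d = C2.mc \<eta>" by blast
  have D: "cmap c ` (cdom c \<inter> F -` cdom d) = {\<sigma> \<in> C1.V \<gamma>. F (compose (mspace_of M) \<Sigma>\<^sub>1 \<sigma>) \<in> cdom d}"
    unfolding \<gamma>(2) C1.image_mc[OF \<gamma>(1)] by simp
  show "smooth_between (cmodel c) (cmodel d) (cmap c ` (cdom c \<inter> F -` cdom d)) (cmap d \<circ> F \<circ> cinv c)"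
    unfolding D unfolding \<gamma>(2) \<eta>(2) C1.cmodel_mc C2.cmodel_mc
    by (rule smooth_between_subset_cong[OF local_representative(2)[OF \<gamma>(1) \<eta>(1)] order_refl])
      (simp add: C1.cinv_mc[OF \<gamma>(1)])
qed

end

theorem proposition4p7:
  fixes m n\<^sub>1 n\<^sub>2 :: nat
    and \<U> :: "vec set set"
    and \<F> :: "vec set \<Rightarrow> (vec \<Rightarrow> real) topology"
    and M :: "('a, vec) manifold"
    and N\<^sub>1 :: "('b, vec) manifold"
    and N\<^sub>2 :: "('c, vec) manifold"
    and \<Omega>\<^sub>1 :: "'b tvec set" and \<Sigma>\<^sub>1 :: "'b tvec \<Rightarrow> 'b"
    and \<Omega>\<^sub>2 :: "'c tvec set" and \<Sigma>\<^sub>2 :: "'c tvec \<Rightarrow> 'c"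
    and f :: "'b \<Rightarrow> 'c"
  assumes "good_collection m \<U>"
    and "suitable_family m \<U> \<F>"
    and "corner_manifold m M" and "compact_space (mtop M)"
    and "smooth_manifold n\<^sub>1 N\<^sub>1" and "local_addition n\<^sub>1 N\<^sub>1 \<Omega>\<^sub>1 \<Sigma>\<^sub>1"
    and "smooth_manifold n\<^sub>2 N\<^sub>2" and "local_addition n\<^sub>2 N\<^sub>2 \<Omega>\<^sub>2 \<Sigma>\<^sub>2"
    and "smooth_map N\<^sub>1 N\<^sub>2 f"
  shows "smooth_map (mapping_manifold m \<U> \<F> M n\<^sub>1 N\<^sub>1 \<Omega>\<^sub>1 \<Sigma>\<^sub>1)
                    (mapping_manifold m \<U> \<F> M n\<^sub>2 N\<^sub>2 \<Omega>\<^sub>2 \<Sigma>\<^sub>2)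
                    (\<lambda>\<gamma>. compose (mspace_of M) f \<gamma>)"
proof -
  interpret mapping_composition m \<U> \<F> M n\<^sub>1 N\<^sub>1 \<Omega>\<^sub>1 \<Sigma>\<^sub>1 n\<^sub>2 N\<^sub>2 \<Omega>\<^sub>2 \<Sigma>\<^sub>2 f
    by unfold_locales (rule assms)+
  show ?thesis by (rule F_smooth)
qed

end
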